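(* Let $\tfrac12<\alpha<1$. There exist a small constant $\eta_*>0$ and a constant $C>0$, depending only on $\alpha$, such that the following holds. Suppose that $f_0:\mathbb{R}^3\times\mathbb{R}^3\to[0,\infty)$ satisfies $$\|\langle x\rangle f_0\|_{W^{1,1}_{x,v}(\mathbb{R}^6)\cap W^{1,\infty}_{x,v}(\mathbb{R}^6)}+\|\langle x\rangle f_0\|_{W^{1,1}_x(\mathbb{R}^3;W^{1,\infty}_v(\mathbb{R}^3))\cap W^{1,1}_v(\mathbb{R}^3;W^{1,\infty}_x(\mathbb{R}^3))}\le\eta_*,$$ and let $f\in C([0,\infty);W^{1,1}_{x,v}(\mathbb{R}^6)\cap W^{1,\infty}_{x,v}(\mathbb{R}^6))$ be the global solution of the Vlasov--Riesz system with initial data $f_0$ such that $$\sup_{t\ge0}\Big(\langle t\rangle^{1+\alpha}\|\mathbf{E}_f(t)\|_{L^\infty_x}+\langle t\rangle^{2+\alpha}\|\nabla\mathbf{E}_f(t)\|_{L^\infty_x}+\langle t\rangle^{3}\|\nabla^2\mathbf{E}_f(t)\|_{L^\infty_x}\Big)\le C\eta_*.$$ Then there exists $f^+\in L^1_{x,v}(\mathbb{R}^6)\cap L^\infty_{x,v}(\mathbb{R}^6)$ such that for all $t\ge1$, $$\big\|f\big(t,\Phi^{\mathrm{ref}}(t)(x,v)\big)-f^+(x,v)\big\|_{L^\infty_{x,v}(\mathbb{R}^6)}\le C\,\frac{\eta_*^2}{t^{2\alpha-1}}.$$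
   Context: Notation: $\langle y\rangle=(1+|y|^2)^{1/2}$. For $k\in\mathbb{N}_0$, $r\in[1,\infty]$, $\|u\|_{W^{k,r}}=\sum_{|m|\le k}\|\nabla^m u\|_{L^r}$. The mixed norm is $$\|f\|_{W^{k,r}_x(\mathbb{R}^3;W^{k',r'}_v(\mathbb{R}^3))}=\sum_{|m|\le k,\,|m'|\le k'}\|\nabla_x^m\nabla_v^{m'}f\|_{L^r_x(\mathbb{R}^3;L^{r'}_v(\mathbb{R}^3))},$$ and $W^{k,r}_v(\mathbb{R}^3;W^{k',r'}_x(\mathbb{R}^3))$ is defined by interchanging the roles of $x$ and $v$. The norm of an intersection of spaces is the sum of the norms. Vlasov--Riesz system: fix $\lambda\in\{1,-1\}$ and $w(x)=\lambda|x|^{-\alpha}$ on $\mathbb{R}^3$. For $f=f(t,x,v):[0,\infty)\times\mathbb{R}^3\times\mathbb{R}^3\to[0,\infty)$, the system is $$\partial_tf+v\cdot\nabla_xf+\mathbf{E}_f\cdot\nabla_vf=0,\qquad f(0)=f_0,$$ $$\mathbf{E}_f(t,x)=-\int_{\mathbb{R}^3}\nabla w(x-y)\rho_f(t,y)\,dy,\qquad \rho_f(t,x)=\int_{\mathbb{R}^3}f(t,x,v)\,dv.$$ Solutions are understood in the weak sense; equivalently $f(t)=\Phi(t)_\#f_0=f_0\circ\Phi(t)^{-1}$, where $\Phi(t)(x,v)=(\mathcal{X}(t,0,x,v),\mathcal{V}(t,0,x,v))$ is the forward characteristic flow: $\partial_t\mathcal{X}=\mathcal{V}$, $\partial_t\mathcal{V}=\mathbf{E}_f(t,\mathcal{X})$,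 $(\mathcal{X},\mathcal{V})|_{t=0}=(x,v)$. Momentum limit: $\mathcal{V}^+(x,v)=\lim_{t\to\infty}\mathcal{V}(t,0,x,v)=v+\int_0^\infty\mathbf{E}_f(\tau,\mathcal{X}(\tau,0,x,v))\,d\tau$. Velocity correction: $$\mathbf{A}_\infty(v)=-\iint_{\mathbb{R}^6}\nabla w\big(v-\mathcal{V}^+(\tilde x,\tilde v)\big)f_0(\tilde x,\tilde v)\,d\tilde x\,d\tilde v.$$ Reference flow: $$\Phi^{\mathrm{ref}}(t)(x,v)=\Big(x+tv-\frac{t^{1-\alpha}-1}{1-\alpha}\mathbf{A}_\infty(v),\,v\Big).$$ *)

theory Defs
  imports "HOL-Probability.Essential_Supremum" "HOL-Library.Multiset"
begin

definition japanese_bracket :: "'a::real_normed_vector \<Rightarrow> real" where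
  "japanese_bracket y = sqrt (1 + (norm y)\<^sup>2)"

definition grad :: "('a::euclidean_space \<Rightarrow> real) \<Rightarrow> 'a \<Rightarrow> 'a" where
  "grad f x = (\<Sum>b\<in>Basis. frechet_derivative f (at x) b *\<^sub>R b)"

section \<open>Test functions and weak derivatives\<close>

fun partials :: "'a::euclidean_space list \<Rightarrow> ('a \<Rightarrow> real) \<Rightarrow> 'a \<Rightarrow> real" where
  "partials [] \<phi> = \<phi>"
| "partials (b # bs) \<phi> = (\<lambda>x. frechet_derivative (partials bs \<phi>) (at x) b)"

text \<open>A function is of class \<open>C\<^sup>\<infinity>\<close> iff all its iterated partial derivatives are
  (Frechet) differentiable.\<close>

definition smooth :: "('a::euclidean_space \<Rightarrow> real) \<Rightarrow> bool" where
  "smooth \<phi> \<longleftrightarrow> (\<forall>bs. set bs \<subseteq> Basis \<longrightarrow> partials bs \<phi> differentiable_on UNIV)"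

definition test_functions :: "'a::euclidean_space set \<Rightarrow> ('a \<Rightarrow> real) set" where
  "test_functions \<Omega> = {\<phi>. smooth \<phi> \<and> compact (closure {x. \<phi> x \<noteq> 0}) \<and> closure {x. \<phi> x \<noteq> 0} \<subseteq> \<Omega>}"

definition locally_integrable ::
    "('a::euclidean_space \<Rightarrow> 'b::{banach, second_countable_topology}) \<Rightarrow> bool" where
  "locally_integrable u \<longleftrightarrow> (\<forall>K. compact K \<longrightarrow> set_integrable lebesgue K u)"

text \<open>Multi-indices are multisets of standard basis vectors, \<open>|m|\<close> being the size of the multiset.
  Below, \<open>bs\<close> runs through the orderings of \<open>m\<close>; by Schwarz' theorem they all give the same
  derivative of a test function.\<close>

definition has_weak_derivative ::
    "'a::euclidean_space multiset \<Rightarrow> ('a \<Rightarrow> 'b::euclidean_space) \<Rightarrow> ('a \<Rightarrow> 'b) \<Rightarrow> bool" where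
  "has_weak_derivative m u g \<longleftrightarrow> locally_integrable u \<and> locally_integrable g \<and>
     (\<forall>\<phi>\<in>test_functions UNIV. \<forall>bs. mset bs = m \<longrightarrow>
        (LINT x|lebesgue. partials bs \<phi> x *\<^sub>R u x)
          = (-1) ^ size m *\<^sub>R (LINT x|lebesgue. \<phi> x *\<^sub>R g x))"

definition multi_indices :: "nat \<Rightarrow> 'a::euclidean_space multiset set" where
  "multi_indices k = {m. set_mset m \<subseteq> Basis \<and> size m \<le> k}"

lemma finite_multi_indices: "finite (multi_indices k :: 'a::euclidean_space multiset set)"
proof -
  have "(multi_indices k :: 'a multiset set) \<subseteq> (\<Union>n\<le>k. multisets_of_size Basis n)"
    by (auto simp: multi_indices_def multisets_of_size_def)
  then show ?thesis
    by (rule finite_subset) auto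
qed

section \<open>Lebesgue and Sobolev norms\<close>

text \<open>Norms take values in \<open>[0,\<infinity>]\<close>. The functionals below are applied to the pointwise
  absolute value of a function, and are \<open>\<infinity>\<close> on non-measurable functions
  (for \<^const>\<open>esssup\<close> this is part of the library definition).\<close>

definition L1 :: "'a measure \<Rightarrow> ('a \<Rightarrow> ennreal) \<Rightarrow> ennreal" where
  "L1 M g = (if g \<in> borel_measurable M then (\<integral>\<^sup>+ x. g x \<partial>M) else \<infinity>)"

definition Linf :: "'a measure \<Rightarrow> ('a \<Rightarrow> ennreal) \<Rightarrow> ennreal" where
  "Linf M g = esssup M g"

text \<open>\<open>L\<^sup>1_x(L\<^sup>\<infinity>_v)\<close> and \<open>L\<^sup>1_v(L\<^sup>\<infinity>_x)\<close>\<close>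

definition L1x_Linfv :: "('a::euclidean_space \<times> 'b::euclidean_space \<Rightarrow> ennreal) \<Rightarrow> ennreal" where
  "L1x_Linfv g = L1 lebesgue (\<lambda>x. Linf lebesgue (\<lambda>v. g (x, v)))"

definition L1v_Linfx :: "('a::euclidean_space \<times> 'b::euclidean_space \<Rightarrow> ennreal) \<Rightarrow> ennreal" where
  "L1v_Linfx g = L1 lebesgue (\<lambda>v. Linf lebesgue (\<lambda>x. g (x, v)))"

text \<open>The norm of the \<open>m\<close>-th weak derivative. The weak derivative is unique up to null sets, so the
  infimum is over at most one value; it is \<open>\<infinity>\<close> if there is no weak derivative.\<close>

definition weak_derivative_norm ::
    "(('a \<Rightarrow> ennreal) \<Rightarrow> ennreal) \<Rightarrow> 'a::euclidean_space multiset \<Rightarrow> ('a \<Rightarrow> 'b::euclidean_space) \<Rightarrow> ennreal" where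
  "weak_derivative_norm N m u = (INF g\<in>{g. has_weak_derivative m u g}. N (\<lambda>x. ennreal (norm (g x))))"

definition sobolev_norm ::
    "(('a \<Rightarrow> ennreal) \<Rightarrow> ennreal) \<Rightarrow> nat \<Rightarrow> ('a::euclidean_space \<Rightarrow> 'b::euclidean_space) \<Rightarrow> ennreal" where
  "sobolev_norm N k u = (\<Sum>m\<in>multi_indices k. weak_derivative_norm N m u)"

text \<open>Here \<open>k\<close> bounds the order of differentiation in the first variable \<open>x\<close> and \<open>k'\<close> that in the second
  variable \<open>v\<close>; for both equal to 1 this includes the second derivatives
  taken once in \<open>x\<close> and once in \<open>v\<close>. Which variable is integrated first is determined by \<open>N\<close>.\<close>

definition mixed_sobolev_norm ::
    "(('a \<times> 'b \<Rightarrow> ennreal) \<Rightarrow> ennreal) \<Rightarrow> nat \<Rightarrow> nat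
      \<Rightarrow> ('a::euclidean_space \<times> 'b::euclidean_space \<Rightarrow> real) \<Rightarrow> ennreal" where
  "mixed_sobolev_norm N k k' u =
     (\<Sum>m\<in>multi_indices k. \<Sum>m'\<in>multi_indices k'.
        weak_derivative_norm N (image_mset (\<lambda>b. (b, 0)) m + image_mset (\<lambda>b. (0, b)) m') u)"

text \<open>\<open>\<parallel>\<nabla>\<^sup>k u\<parallel>\<close> in \<open>L\<^sup>\<infinity>\<close>, summed over all derivatives of order exactly \<open>k\<close>\<close>

definition nabla_Linf_norm :: "nat \<Rightarrow> ('a::euclidean_space \<Rightarrow> 'b::euclidean_space) \<Rightarrow> ennreal" where
  "nabla_Linf_norm k u =
     (\<Sum>m | set_mset m \<subseteq> Basis \<and> size m = k. weak_derivative_norm (Linf lebesgue) m u)"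

definition W11_W1inf_norm :: "('a::euclidean_space \<Rightarrow> real) \<Rightarrow> ennreal" where
  "W11_W1inf_norm u = sobolev_norm (L1 lebesgue) 1 u + sobolev_norm (Linf lebesgue) 1 u"

definition mixed_W11_W1inf_norm :: "('a::euclidean_space \<times> 'b::euclidean_space \<Rightarrow> real) \<Rightarrow> ennreal" where
  "mixed_W11_W1inf_norm u = mixed_sobolev_norm L1x_Linfv 1 1 u + mixed_sobolev_norm L1v_Linfx 1 1 u"

section \<open>The Vlasov--Riesz system\<close>

type_synonym phase = "(real^3) \<times> (real^3)"

text \<open>The gradient of the potential has no meaning at the origin; the integrals below
  meet this point only on null sets.\<close>

definition riesz_potential :: "real \<Rightarrow> real \<Rightarrow> real^3 \<Rightarrow> real" where
  "riesz_potential lam \<alpha> x = lam * norm x powr (- \<alpha>)"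

definition spatial_density :: "(real \<Rightarrow> phase \<Rightarrow> real) \<Rightarrow> real \<Rightarrow> real^3 \<Rightarrow> real" where
  "spatial_density f t x = (LINT v|lebesgue. f t (x, v))"

definition force_field ::
    "real \<Rightarrow> real \<Rightarrow> (real \<Rightarrow> phase \<Rightarrow> real) \<Rightarrow> real \<Rightarrow> real^3 \<Rightarrow> real^3" where
  "force_field lam \<alpha> f t x =
     - (LINT y|lebesgue. spatial_density f t y *\<^sub>R grad (riesz_potential lam \<alpha>) (x - y))"

text \<open>Weak solutions in \<open>C([0,\<infinity>); W\<^sup>1\<^sup>,\<^sup>1 \<inter> W\<^sup>1\<^sup>,\<^sup>\<infinity>)\<close>. The differential of the test function in
  direction \<open>(1, v, E)\<close> is \<open>\<partial>\<^sub>t \<phi> + v \<cdot> \<nabla>\<^sub>x \<phi> + E \<cdot> \<nabla>\<^sub>v \<phi>\<close>. Note that \<open>E\<close> does not depend on \<open>v\<close>, so the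
  transport term is in divergence form.\<close>

definition vlasov_riesz_solution ::
    "real \<Rightarrow> real \<Rightarrow> (phase \<Rightarrow> real) \<Rightarrow> (real \<Rightarrow> phase \<Rightarrow> real) \<Rightarrow> bool" where
  "vlasov_riesz_solution lam \<alpha> f\<^sub>0 f \<longleftrightarrow>
     (\<forall>t\<ge>0. \<forall>z. 0 \<le> f t z) \<and>
     (\<forall>t\<ge>0. W11_W1inf_norm (f t) < \<infinity>) \<and>
     (\<forall>t\<ge>0. ((\<lambda>s. W11_W1inf_norm (\<lambda>z. f s z - f t z)) \<longlongrightarrow> 0) (at t within {0..})) \<and>
     (AE z in lebesgue. f 0 z = f\<^sub>0 z) \<and>
     (\<forall>\<phi>\<in>test_functions ({0<..} \<times> UNIV).
        (LINT t|lebesgue. LINT z|lebesgue. f t z *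
           frechet_derivative \<phi> (at (t, z)) (1, snd z, force_field lam \<alpha> f t (fst z))) = 0)"

definition characteristic_flow ::
    "(real \<Rightarrow> real^3 \<Rightarrow> real^3) \<Rightarrow> (real \<Rightarrow> phase \<Rightarrow> phase) \<Rightarrow> bool" where
  "characteristic_flow E \<Phi> \<longleftrightarrow> (\<forall>z. \<Phi> 0 z = z \<and>
     (\<forall>t\<ge>0. ((\<lambda>s. \<Phi> s z) has_vector_derivative (snd (\<Phi> t z), E t (fst (\<Phi> t z)))) (at t within {0..})))"

definition momentum_limit :: "(real \<Rightarrow> phase \<Rightarrow> phase) \<Rightarrow> phase \<Rightarrow> real^3" where
  "momentum_limit \<Phi> z = Lim at_top (\<lambda>t. snd (\<Phi> t z))"

definition velocity_correction ::
    "real \<Rightarrow> real \<Rightarrow> (phase \<Rightarrow> real) \<Rightarrow> (real \<Rightarrow> phase \<Rightarrow> phase) \<Rightarrow> real^3 \<Rightarrow> real^3" where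
  "velocity_correction lam \<alpha> f\<^sub>0 \<Phi> v =
     - (LINT z|lebesgue. f\<^sub>0 z *\<^sub>R grad (riesz_potential lam \<alpha>) (v - momentum_limit \<Phi> z))"

definition reference_flow :: "real \<Rightarrow> (real^3 \<Rightarrow> real^3) \<Rightarrow> real \<Rightarrow> phase \<Rightarrow> phase" where
  "reference_flow \<alpha> A t = (\<lambda>(x, v). (x + t *\<^sub>R v - ((t powr (1 - \<alpha>) - 1) / (1 - \<alpha>)) *\<^sub>R A v, v))"

end

theory Submission
  imports Defs "HOL-Analysis.Ball_Volume"
begin

text \<open>A bounded gradient of the Riesz force controls \<open>\<integral> \<rho>(y) \<bar>x - y\<bar>\<^sup>-\<^sup>\<alpha>\<^sup>-\<^sup>2 dy\<close>, because the kernel has positive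
  divergence for \<open>\<alpha> < 1\<close>. Hence the force is continuous and Lipschitz, the characteristic flow is a
  measure preserving homeomorphism, and a commutator estimate shows that the Lipschitz representative
  of the weak solution is constant along it. The decay of the force makes \<open>v \<mapsto> X(t)\<close> and
  \<open>v \<mapsto> V\<^sup>+\<close> expanding, so the force at time \<open>t\<close> is an integral of the kernel against a bounded density,
  and by homogeneity it equals \<open>t\<^sup>-\<^sup>1\<^sup>-\<^sup>\<alpha> A\<^sub>\<infinity>\<close> near \<open>t v\<close> up to \<open>O(\<eta> t\<^sup>-\<^sup>1\<^sup>-\<^sup>2\<^sup>\<alpha>)\<close>, with a loss of
  one weight \<open>\<langle>x\<rangle>\<close>. Along the reference flow \<open>x - t v\<close> is corrected exactly by the integral of this leading
  term; the remainder integrates to \<open>O(\<eta> t\<^sup>1\<^sup>-\<^sup>2\<^sup>\<alpha>)\<close>, and backward stability of the flow transfers it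
  to the initial positions, where \<open>\<langle>x\<rangle> f\<^sub>0\<close> is Lipschitz with constant \<open>O(\<eta>)\<close>.\<close>

section \<open>Smooth cutoff functions\<close>

text \<open>The same constant \<open>C\<close> bounds the assumed decay of the force and the final
  error, so the rate must come out with constants free of \<open>C\<close>. Two small parameters are
  therefore kept apart. The first, a multiple of \<open>C * \<eta>\<close>, only controls the
  geometry of the flow: expansion in velocity, distance to free motion, backward stability. Once
  these hold, the decay of the force is derived again with constants that depend on \<alpha> alone;
  they determine \<open>C\<close>, and \<open>\<eta>\<close> is chosen last. The square of
  \<open>\<eta>\<close> has two sources: the displacement of the initial position is linear in the
  force, and the initial density has a Lipschitz constant of order \<open>\<eta>\<close>. The
  condition \<alpha> > 1/2 makes s^(-2\<alpha>), the speed of the corrected position, integrable at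
  infinity; \<alpha> < 1 makes |x|^(-\<alpha>-2), the size of the kernel's gradient, locally
  integrable in dimension three. The data are classes modulo null sets with weak derivatives, while
  the argument follows single trajectories. Hence continuous representatives of the density and of
  the force have to be found before the dynamics can start.\<close>

definition exp_cutoff :: "real poly \<Rightarrow> real \<Rightarrow> real" where
  "exp_cutoff P y = (if y > 0 then poly P (1 / y) * exp (- (1 / y)) else 0)"

lemma poly_times_exp_tendsto_0:
  fixes P :: "real poly" shows "((\<lambda>u. poly P u * exp (- u)) \<longlongrightarrow> 0) at_top"
proof -
  have "((\<lambda>u. \<Sum>i\<le>degree P. coeff P i * (u ^ i / exp u)) \<longlongrightarrow> (\<Sum>i\<le>degree P. coeff P i * 0)) at_top"
    by (intro tendsto_sum tendsto_mult tendsto_const tendsto_power_div_exp_0)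
  moreover have "(\<lambda>u. \<Sum>i\<le>degree P. coeff P i * (u ^ i / exp u)) = (\<lambda>u. poly P u * exp (- u))"
    by (simp add: poly_altdef sum_distrib_right exp_minus divide_inverse mult.assoc)
  ultimately show ?thesis by simp
qed

text \<open>With u = 1/y the derivative of P(u) exp(-u) is u^2 (P(u) - P'(u)) exp(-u), again of the
  same form, so one differentiation rule covers all orders. At the origin the right difference
  quotient is u P(u) exp(-u), which vanishes as u grows.\<close>

lemma DERIV_exp_cutoff:
  "(exp_cutoff P has_real_derivative exp_cutoff ([:0, 0, 1:] * (P - pderiv P)) y) (at y)"
proof -
  consider "y > 0" | "y < 0" | "y = 0" by linarith
  then show ?thesis
  proof cases
    case 1
    have "((\<lambda>y. poly P (1 / y) * exp (- (1 / y))) has_real_derivative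
        exp_cutoff ([:0, 0, 1:] * (P - pderiv P)) y) (at y)"
      using 1 unfolding exp_cutoff_def
      by (auto intro!: derivative_eq_intros DERIV_chain2[OF poly_DERIV]
          simp: field_simps power2_eq_square)
    moreover have "\<forall>\<^sub>F z in nhds y. poly P (1 / z) * exp (- (1 / z)) = exp_cutoff P z"
      using eventually_nhds_in_open[of "{0<..}" y] 1
      by (auto elim!: eventually_mono simp: exp_cutoff_def)
    ultimately show ?thesis
      by (subst DERIV_cong_ev[OF refl _ refl, symmetric]) auto
  next
    case 2
    have "\<forall>\<^sub>F z in nhds y. 0 = exp_cutoff P z"
      using eventually_nhds_in_open[of "{..<0}" y] 2
      by (auto elim!: eventually_mono simp: exp_cutoff_def)
    moreover have "((\<lambda>_. 0) has_real_derivative exp_cutoff ([:0, 0, 1:] * (P - pderiv P)) y) (at y)"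
      using 2 by (simp add: exp_cutoff_def)
    ultimately show ?thesis
      by (subst DERIV_cong_ev[OF refl _ refl, symmetric]) auto
  next
    case 3
    have "((\<lambda>u. poly ([:0, 1:] * P) u * exp (- u)) \<longlongrightarrow> 0) at_top"
      by (rule poly_times_exp_tendsto_0)
    from filterlim_compose[OF this filterlim_inverse_at_top_right]
    have "((\<lambda>h. poly ([:0, 1:] * P) (inverse h) * exp (- inverse h)) \<longlongrightarrow> 0) (at_right 0)" .
    moreover have "\<forall>\<^sub>F h in at_right 0. poly ([:0, 1:] * P) (inverse h) * exp (- inverse h)
        = (exp_cutoff P (0 + h) - exp_cutoff P 0) / h"
      using eventually_at_right_less[of "0::real"]
      by eventually_elim (simp add: exp_cutoff_def field_simps)
    ultimately have R: "((\<lambda>h. (exp_cutoff P (0 + h) - exp_cutoff P 0) / h) \<longlongrightarrow> 0) (at_right 0)"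
      by (rule Lim_transform_eventually)
    have "\<forall>\<^sub>F h in at_left (0::real). 0 = (exp_cutoff P (0 + h) - exp_cutoff P 0) / h"
      by (auto simp: eventually_at_filter exp_cutoff_def)
    then have L: "((\<lambda>h. (exp_cutoff P (0 + h) - exp_cutoff P 0) / h) \<longlongrightarrow> 0) (at_left 0)"
      by (rule Lim_transform_eventually[OF tendsto_const])
    show ?thesis
      using filterlim_split_at_real[OF L R] 3 by (simp add: DERIV_def exp_cutoff_def)
  qed
qed

text \<open>The derivative is quantified existentially instead of being written with
  \<open>frechet_derivative\<close>: the sum, product and chain rules then provide witnesses
  directly, and closure properties follow by induction on the order.\<close>

primrec k_smooth :: "nat \<Rightarrow> ('a::euclidean_space \<Rightarrow> real) \<Rightarrow> bool" where
  "k_smooth 0 f = True"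
| "k_smooth (Suc n) f = (\<exists>D. (\<forall>x. (f has_derivative D x) (at x)) \<and> (\<forall>b\<in>Basis. k_smooth n (\<lambda>x. D x b)))"

lemma k_smooth_SucD: "k_smooth (Suc n) f \<Longrightarrow> k_smooth n f"
proof (induction n arbitrary: f)
  case (Suc n)
  then show ?case by (metis k_smooth.simps(2))
qed simp

lemma k_smooth_add: "k_smooth n f \<Longrightarrow> k_smooth n g \<Longrightarrow> k_smooth n (\<lambda>x. f x + g x)"
proof (induction n arbitrary: f g)
  case (Suc n)
  from Suc.prems obtain D where 1: "\<And>x. (f has_derivative D x) (at x)" "\<And>b. b\<in>Basis \<Longrightarrow> k_smooth n (\<lambda>x. D x b)"
    by auto
  from Suc.prems(2) obtain D' where 2: "\<And>x. (g has_derivative D' x) (at x)" "\<And>b. b\<in>Basis \<Longrightarrow> k_smooth n (\<lambda>x. D' x b)"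
    by auto
  with 1 2 show ?case
    by (auto intro!: exI[of _ "\<lambda>x h. D x h + D' x h"] has_derivative_add Suc.IH)
qed simp

lemma k_smooth_mult: "k_smooth n f \<Longrightarrow> k_smooth n g \<Longrightarrow> k_smooth n (\<lambda>x. f x * g x)"
proof (induction n arbitrary: f g)
  case (Suc n)
  from Suc.prems obtain D where 1: "\<And>x. (f has_derivative D x) (at x)" "\<And>b. b\<in>Basis \<Longrightarrow> k_smooth n (\<lambda>x. D x b)"
    by auto
  from Suc.prems(2) obtain D' where 2: "\<And>x. (g has_derivative D' x) (at x)" "\<And>b. b\<in>Basis \<Longrightarrow> k_smooth n (\<lambda>x. D' x b)"
    by auto
  have "k_smooth n f" "k_smooth n g" using Suc.prems k_smooth_SucD by blast+
  with 1 2 show ?case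
    by (auto intro!: exI[of _ "\<lambda>x h. f x * D' x h + D x h * g x"] has_derivative_mult k_smooth_add Suc.IH)
qed simp

lemma k_smooth_const: "k_smooth n (\<lambda>x. c)"
proof (induction n arbitrary: c)
  case (Suc n)
  show ?case
    using Suc[of 0] by (auto intro!: exI[of _ "\<lambda>x h. 0"])
qed simp

lemma k_smooth_prod: "(\<And>i. i \<in> I \<Longrightarrow> k_smooth n (f i)) \<Longrightarrow> k_smooth n (\<lambda>x. \<Prod>i\<in>I. f i x)"
  by (induction I rule: infinite_finite_induct) (auto intro: k_smooth_const k_smooth_mult)

lemma k_smooth_exp_cutoff: "k_smooth n (\<lambda>x. exp_cutoff P (c * (x \<bullet> b) + d))"
proof (induction n arbitrary: P)
  case (Suc n)
  let ?Q = "[:0, 0, 1:] * (P - pderiv P)"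
  have "((\<lambda>x. exp_cutoff P (c * (x \<bullet> b) + d)) has_derivative
      (\<lambda>h. c * (h \<bullet> b) * exp_cutoff ?Q (c * (x \<bullet> b) + d))) (at x)" for x
  proof -
    have "(exp_cutoff P has_derivative (\<lambda>h. h * exp_cutoff ?Q (c * (x \<bullet> b) + d))) (at (c * (x \<bullet> b) + d))"
      using DERIV_exp_cutoff[of P "c * (x \<bullet> b) + d"]
      by (simp only: has_field_derivative_def) (simp add: mult.commute[of "exp_cutoff _ _"] mult_commute_abs)
    moreover have "((\<lambda>x. c * (x \<bullet> b) + d) has_derivative (\<lambda>h. c * (h \<bullet> b))) (at x)"
      by (auto intro!: derivative_eq_intros)
    ultimately show ?thesis using has_derivative_compose by blast
  qed
  then show ?case
    by (auto intro!: exI[of _ "\<lambda>x h. c * (h \<bullet> b) * exp_cutoff ?Q (c * (x \<bullet> b) + d)"]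
        k_smooth_mult[OF k_smooth_const] simp del: mult_pCons_left intro: Suc)
qed simp

text \<open>Uniqueness of the derivative identifies the existential witness with
  \<open>frechet_derivative\<close>, which leads back to the iterated partial derivatives in
  \<open>smooth\<close>.\<close>

lemma k_smooth_partials:
  assumes "\<And>n. k_smooth n f" "set bs \<subseteq> Basis"
  shows "k_smooth n (partials bs f)"
  using assms(2)
proof (induction bs arbitrary: n)
  case (Cons b bs)
  then have "k_smooth (Suc n) (partials bs f)" by auto
  then obtain D where D: "\<And>x. (partials bs f has_derivative D x) (at x)"
    "\<And>b. b\<in>Basis \<Longrightarrow> k_smooth n (\<lambda>x. D x b)" by auto
  then have "frechet_derivative (partials bs f) (at x) = D x" for x
    by (metis frechet_derivative_at)
  then show ?case using D Cons.prems by simp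
qed (use assms in auto)

lemma smooth_if_k_smooth:
  assumes "\<And>n. k_smooth n f" shows "smooth f"
  unfolding smooth_def
proof (intro allI impI)
  fix bs :: "'a list" assume "set bs \<subseteq> Basis"
  then have "k_smooth (Suc 0) (partials bs f)" by (intro k_smooth_partials assms)
  then show "partials bs f differentiable_on UNIV"
    by (auto simp: differentiable_on_def differentiable_def)
qed

text \<open>\<open>a\<close> and \<open>c\<close> are the corners of the supporting box and
  \<open>n\<close> the steepness. One formula serves two purposes: with fixed corners and n tending
  to infinity it approaches the indicator of the open box, and with corners \<plusminus>\<delta> and
  steepness 1/\<delta> it is a mollifier that scales exactly.\<close>

definition bump :: "real \<Rightarrow> 'a \<Rightarrow> 'a \<Rightarrow> 'a::euclidean_space \<Rightarrow> real" where
  "bump n a c x = (\<Prod>b\<in>Basis. exp_cutoff 1 (n * (x \<bullet> b - a \<bullet> b)) * exp_cutoff 1 (n * (c \<bullet> b - x \<bullet> b)))"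

lemma exp_cutoff_1: "0 \<le> exp_cutoff 1 y" "exp_cutoff 1 y \<le> 1" "exp_cutoff 1 y = 0 \<longleftrightarrow> y \<le> 0"
  by (auto simp: exp_cutoff_def)

lemma smooth_bump: "smooth (bump n a c)"
proof (rule smooth_if_k_smooth)
  fix k
  have "k_smooth k (\<lambda>x. exp_cutoff 1 (n * (x \<bullet> b - a \<bullet> b)) * exp_cutoff 1 (n * (c \<bullet> b - x \<bullet> b)))" for b
    using k_smooth_mult[OF k_smooth_exp_cutoff[of k 1 n b "- n * (a \<bullet> b)"] k_smooth_exp_cutoff[of k 1 "- n" b "n * (c \<bullet> b)"]]
    by (simp add: algebra_simps)
  then show "k_smooth k (bump n a c)"
    unfolding bump_def by (intro k_smooth_prod)
qed

lemma bump_nonneg: "0 \<le> bump n a c x"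
  unfolding bump_def by (intro prod_nonneg) (auto simp: exp_cutoff_1)

lemma bump_le_1: "bump n a c x \<le> 1"
  unfolding bump_def
  by (intro prod_le_1) (auto simp: exp_cutoff_1 intro!: mult_le_one)

lemma bump_eq_0_iff: "n > 0 \<Longrightarrow> bump n a c x = 0 \<longleftrightarrow> x \<notin> box a c"
  unfolding bump_def by (auto simp: exp_cutoff_1 mem_box mult_le_0_iff not_less)

lemma bump_tendsto: "(\<lambda>n. bump (real (Suc n)) a c x) \<longlonglongrightarrow> indicator (box a c) x"
proof (cases "x \<in> box a c")
  case True
  have *: "(\<lambda>n. exp_cutoff 1 (real (Suc n) * d)) \<longlonglongrightarrow> 1" if "d > 0" for d
  proof -
    have "(\<lambda>n. exp (- (inverse (real (Suc n)) * (1 / d)))) \<longlonglongrightarrow> exp (- (0 * (1 / d)))"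
      by (intro tendsto_intros LIMSEQ_inverse_real_of_nat)
    moreover have "0 < real (Suc n) * d" for n using that by simp
    ultimately show ?thesis using that
      by (simp add: exp_cutoff_def del: of_nat_Suc) (simp add: field_simps)
  qed
  have "(\<lambda>n. bump (real (Suc n)) a c x) \<longlonglongrightarrow> (\<Prod>b\<in>(Basis::'a set). 1 * 1)"
    unfolding bump_def using True
    by (intro tendsto_prod tendsto_mult *) (auto simp: mem_box)
  then show ?thesis using True by simp
next
  case False
  then have "bump (real (Suc n)) a c x = 0" for n
    by (subst bump_eq_0_iff) auto
  then show ?thesis using False by simp
qed

lemma bump_test_function:
  assumes "n > 0" "cbox a c \<subseteq> \<Omega>"
  shows "bump n a c \<in> test_functions \<Omega>"
proof -
  have "{x. bump n a c x \<noteq> 0} \<subseteq> cbox a c"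
    using bump_eq_0_iff[OF assms(1), of a c] box_subset_cbox[of a c] by auto
  then have *: "closure {x. bump n a c x \<noteq> 0} \<subseteq> cbox a c"
    by (rule closure_minimal) (rule closed_cbox)
  then have "compact (closure {x. bump n a c x \<noteq> 0})"
    by (meson bounded_cbox bounded_subset closed_closure compact_eq_bounded_closed)
  with * assms(2) show ?thesis by (auto simp: test_functions_def smooth_bump)
qed

lemma bump_translate: "bump n a c (x - p) = bump n (a + p) (c + p) x"
  by (simp add: bump_def algebra_simps)

section \<open>Calculus of test functions\<close>

lemma partials_append: "partials (cs @ bs) \<phi> = partials cs (partials bs \<phi>)"
  by (induction cs) auto

lemma smooth_partials: "smooth \<phi> \<Longrightarrow> set bs \<subseteq> Basis \<Longrightarrow> smooth (partials bs \<phi>)"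
  unfolding smooth_def by (simp flip: partials_append)

lemma smooth_has_derivative:
  fixes \<phi> :: "'a::euclidean_space \<Rightarrow> real"
  assumes "smooth \<phi>"
  shows "(\<phi> has_derivative frechet_derivative \<phi> (at x)) (at x)"
proof -
  have "partials [] \<phi> differentiable_on UNIV" using assms unfolding smooth_def by (metis empty_set empty_subsetI)
  then show ?thesis
    by (simp add: differentiable_on_def frechet_derivative_works)
qed

lemma smooth_frechet_derivative_eq:
  fixes \<phi> :: "'a::euclidean_space \<Rightarrow> real"
  assumes "smooth \<phi>"
  shows "frechet_derivative \<phi> (at x) h = (\<Sum>b\<in>Basis. (h \<bullet> b) * partials [b] \<phi> x)"
proof -
  interpret bounded_linear "frechet_derivative \<phi> (at x)"
    using smooth_has_derivative[OF assms] has_derivative_bounded_linear by blast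
  have "frechet_derivative \<phi> (at x) (\<Sum>b\<in>Basis. (h \<bullet> b) *\<^sub>R b) = (\<Sum>b\<in>Basis. (h \<bullet> b) * partials [b] \<phi> x)"
    by (simp add: sum scaleR)
  then show ?thesis by (simp only: euclidean_representation)
qed

lemma smooth_continuous: "smooth \<phi> \<Longrightarrow> continuous_on S \<phi>"
  by (intro continuous_at_imp_continuous_on ballI has_derivative_continuous[OF smooth_has_derivative])

lemma partials_support:
  assumes "x \<notin> closure {x. \<phi> x \<noteq> 0}"
  shows "partials bs \<phi> x = 0"
  using assms
proof (induction bs arbitrary: x)
  case (Cons b bs)
  have "((\<lambda>_. 0) has_derivative (\<lambda>_. 0)) (at x)" by simp
  then have "(partials bs \<phi> has_derivative (\<lambda>_. 0)) (at x)"
    by (rule has_derivative_transform_within_open[where s = "- closure {x. \<phi> x \<noteq> 0}"]) (use Cons in auto)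
  then have "frechet_derivative (partials bs \<phi>) (at x) = (\<lambda>_. 0)"
    using frechet_derivative_at by metis
  then show ?case by simp
next
  case Nil
  then show ?case using closure_subset[of "{x. \<phi> x \<noteq> 0}"] by auto
qed

lemma partials_test_function:
  assumes "\<phi> \<in> test_functions \<Omega>" "set bs \<subseteq> Basis"
  shows "partials bs \<phi> \<in> test_functions \<Omega>"
proof -
  have "closure {x. partials bs \<phi> x \<noteq> 0} \<subseteq> closure {x. \<phi> x \<noteq> 0}"
    by (rule closure_minimal) (use partials_support in auto)
  moreover from this have "compact (closure {x. partials bs \<phi> x \<noteq> 0})"
    using assms(1) unfolding test_functions_def mem_Collect_eq
    by (metis closed_closure compact_Int_closed inf.absorb2)
  ultimately show ?thesis
    using assms smooth_partials[of \<phi> bs] unfolding test_functions_def mem_Collect_eq by blast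
qed

lemma test_function_bounded:
  assumes "\<phi> \<in> test_functions \<Omega>"
  obtains B where "B > 0" "\<And>x. \<bar>\<phi> x\<bar> \<le> B"
proof -
  let ?K = "closure {x. \<phi> x \<noteq> 0}"
  have "compact (\<phi> ` ?K)" using assms unfolding test_functions_def
    by (auto intro: compact_continuous_image smooth_continuous)
  then obtain B where B: "B > 0" "\<And>y. y \<in> \<phi> ` ?K \<Longrightarrow> norm y \<le> B"
    by (meson bounded_pos compact_imp_bounded)
  have "\<bar>\<phi> x\<bar> \<le> B" for x
    using B closure_subset[of "{x. \<phi> x \<noteq> 0}"] by (cases "\<phi> x = 0") auto
  with B(1) that show ?thesis by blast
qed

lemma test_function_support:
  assumes "\<phi> \<in> test_functions \<Omega>"
  obtains R where "R > 0" "\<And>x bs. partials bs \<phi> x \<noteq> 0 \<Longrightarrow> norm x \<le> R"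
proof -
  have "bounded (closure {x. \<phi> x \<noteq> 0})"
    using assms unfolding test_functions_def by (auto intro: compact_imp_bounded)
  then obtain R where "R > 0" "\<And>x. x \<in> closure {x. \<phi> x \<noteq> 0} \<Longrightarrow> norm x \<le> R"
    by (meson bounded_pos)
  with that show ?thesis using partials_support by metis
qed

lemma test_function_derivative_bounded:
  assumes "\<phi> \<in> test_functions \<Omega>"
  obtains L where "L > 0" "\<And>x h. \<bar>frechet_derivative \<phi> (at x) h\<bar> \<le> L * norm h"
proof -
  have "\<exists>B>0. \<forall>x. \<bar>partials [b] \<phi> x\<bar> \<le> B" if "b \<in> Basis" for b
    by (rule test_function_bounded[OF partials_test_function[OF assms, of "[b]"]]) (use that in auto)
  then obtain B where B: "\<And>b. b \<in> Basis \<Longrightarrow> B b > 0" "\<And>b x. b \<in> Basis \<Longrightarrow> \<bar>partials [b] \<phi> x\<bar> \<le> B b"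
    by metis
  have sm: "smooth \<phi>" using assms by (simp add: test_functions_def)
  have "\<bar>frechet_derivative \<phi> (at x) h\<bar> \<le> (1 + (\<Sum>b\<in>Basis. B b)) * norm h" for x h
  proof -
    have "\<bar>frechet_derivative \<phi> (at x) h\<bar> \<le> (\<Sum>b\<in>Basis. \<bar>(h \<bullet> b) * partials [b] \<phi> x\<bar>)"
      unfolding smooth_frechet_derivative_eq[OF sm] by (rule sum_abs)
    also have "\<dots> \<le> (\<Sum>b\<in>Basis. norm h * B b)"
      unfolding abs_mult using B less_imp_le
      by (intro sum_mono mult_mono) (auto simp: Basis_le_norm)
    also have "\<dots> \<le> (1 + (\<Sum>b\<in>Basis. B b)) * norm h"
      by (simp add: algebra_simps sum_distrib_left)
    finally show ?thesis .
  qed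
  moreover have "1 + (\<Sum>b\<in>Basis. B b) > 0" using sum_nonneg[of Basis B] B(1) by (smt (verit) less_imp_le)
  ultimately show ?thesis using that by blast
qed

lemma test_function_lipschitz:
  assumes "\<phi> \<in> test_functions \<Omega>"
  obtains L where "L > 0" "\<And>x y. \<bar>\<phi> x - \<phi> y\<bar> \<le> L * norm (x - y)"
proof -
  obtain L where L: "L > 0" "\<And>x h. \<bar>frechet_derivative \<phi> (at x) h\<bar> \<le> L * norm h"
    by (rule test_function_derivative_bounded[OF assms]) blast
  have sm: "smooth \<phi>" using assms by (simp add: test_functions_def)
  have "norm (\<phi> x - \<phi> y) \<le> L * norm (x - y)" for x y
  proof (rule differentiable_bound[of UNIV \<phi> "\<lambda>x. frechet_derivative \<phi> (at x)"])
    show "(\<phi> has_derivative frechet_derivative \<phi> (at x)) (at x within UNIV)" for x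
      using smooth_has_derivative[OF sm] by simp
    show "onorm (frechet_derivative \<phi> (at x)) \<le> L" for x
      by (rule onorm_le) (use L in auto)
  qed auto
  with that L(1) show ?thesis by simp
qed

lemma test_function_derivative_lipschitz:
  assumes "\<phi> \<in> test_functions \<Omega>"
  obtains L where "L > 0"
    "\<And>x y h. \<bar>frechet_derivative \<phi> (at x) h - frechet_derivative \<phi> (at y) h\<bar> \<le> L * norm (x - y) * norm h"
proof -
  have "\<exists>B>0. \<forall>x y. \<bar>partials [b] \<phi> x - partials [b] \<phi> y\<bar> \<le> B * norm (x - y)" if "b \<in> Basis" for b
    by (rule test_function_lipschitz[OF partials_test_function[OF assms, of "[b]"]]) (use that in auto)
  then obtain B where B: "\<And>b. b \<in> Basis \<Longrightarrow> B b > 0"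
    "\<And>b x y. b \<in> Basis \<Longrightarrow> \<bar>partials [b] \<phi> x - partials [b] \<phi> y\<bar> \<le> B b * norm (x - y)"
    by metis
  have sm: "smooth \<phi>" using assms by (simp add: test_functions_def)
  have "\<bar>frechet_derivative \<phi> (at x) h - frechet_derivative \<phi> (at y) h\<bar> \<le> (1 + (\<Sum>b\<in>Basis. B b)) * norm (x - y) * norm h" for x y h
  proof -
    have "frechet_derivative \<phi> (at x) h - frechet_derivative \<phi> (at y) h
        = (\<Sum>b\<in>Basis. (h \<bullet> b) * (partials [b] \<phi> x - partials [b] \<phi> y))"
      unfolding smooth_frechet_derivative_eq[OF sm] by (simp add: algebra_simps sum_subtractf)
    also have "\<bar>\<dots>\<bar> \<le> (\<Sum>b\<in>Basis. \<bar>(h \<bullet> b) * (partials [b] \<phi> x - partials [b] \<phi> y)\<bar>)"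
      by (rule sum_abs)
    also have "\<dots> \<le> (\<Sum>b\<in>Basis. norm h * (B b * norm (x - y)))"
      unfolding abs_mult using B less_imp_le
      by (intro sum_mono mult_mono) (auto simp: Basis_le_norm)
    also have "\<dots> = (\<Sum>b\<in>Basis. B b) * norm (x - y) * norm h"
      unfolding sum_distrib_right by (intro sum.cong) (simp_all add: mult_ac)
    also have "\<dots> \<le> (1 + (\<Sum>b\<in>Basis. B b)) * norm (x - y) * norm h"
      by (intro mult_right_mono) auto
    finally show ?thesis .
  qed
  moreover have "1 + (\<Sum>b\<in>Basis. B b) > 0" using sum_nonneg[of Basis B] B(1) by (smt (verit) less_imp_le)
  ultimately show ?thesis using that by blast
qed

text \<open>The mean value inequality on the ball of radius |h| around x, applied to \<phi> minus
  its linearisation at x, whose derivative there is at most L |h|. The bound is uniform in x, which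
  differentiation under the integral will require.\<close>

lemma test_function_taylor:
  assumes "\<phi> \<in> test_functions \<Omega>"
  obtains L where "L > 0"
    "\<And>x h. \<bar>\<phi> (x + h) - \<phi> x - frechet_derivative \<phi> (at x) h\<bar> \<le> L * (norm h)\<^sup>2"
proof -
  obtain L where L: "L > 0"
    "\<And>x y h. \<bar>frechet_derivative \<phi> (at x) h - frechet_derivative \<phi> (at y) h\<bar> \<le> L * norm (x - y) * norm h"
    by (rule test_function_derivative_lipschitz[OF assms]) blast
  have sm: "smooth \<phi>" using assms by (simp add: test_functions_def)
  note D = smooth_has_derivative[OF sm]
  have "\<bar>\<phi> (x + h) - \<phi> x - frechet_derivative \<phi> (at x) h\<bar> \<le> L * (norm h)\<^sup>2" for x h
  proof -
    interpret lx: bounded_linear "frechet_derivative \<phi> (at x)"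
      using D has_derivative_bounded_linear by blast
    let ?g = "\<lambda>y. \<phi> y - frechet_derivative \<phi> (at x) y"
    have "norm (?g (x + h) - ?g x) \<le> (L * norm h) * norm ((x + h) - x)"
    proof (rule differentiable_bound[of "cball x (norm h)" ?g "\<lambda>y k. frechet_derivative \<phi> (at y) k - frechet_derivative \<phi> (at x) k"])
      show "(?g has_derivative (\<lambda>k. frechet_derivative \<phi> (at y) k - frechet_derivative \<phi> (at x) k)) (at y within cball x (norm h))" for y
        using D[of y] lx.bounded_linear_axioms
        by (intro has_derivative_diff bounded_linear_imp_has_derivative) (auto intro: has_derivative_at_withinI)
      show "onorm (\<lambda>k. frechet_derivative \<phi> (at y) k - frechet_derivative \<phi> (at x) k) \<le> L * norm h"
        if "y \<in> cball x (norm h)" for y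
      proof (rule onorm_le)
        fix k
        have "norm (frechet_derivative \<phi> (at y) k - frechet_derivative \<phi> (at x) k) \<le> L * norm (y - x) * norm k"
          using L by simp
        also have "\<dots> \<le> L * norm h * norm k"
          using that L(1) by (intro mult_right_mono mult_left_mono) (auto simp: dist_norm norm_minus_commute)
        finally show "norm (frechet_derivative \<phi> (at y) k - frechet_derivative \<phi> (at x) k) \<le> L * norm h * norm k" .
      qed
    qed (auto simp: dist_norm)
    then show ?thesis by (simp add: lx.add power2_eq_square algebra_simps)
  qed
  with L(1) that show ?thesis by blast
qed

section \<open>Local integrability and differentiation of mollifications\<close>

lemma locally_integrable_measurable:
  fixes u :: "'a::euclidean_space \<Rightarrow> 'b::euclidean_space"
  assumes "locally_integrable u" shows "u \<in> borel_measurable lebesgue"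
proof (rule borel_measurable_LIMSEQ_metric)
  fix n :: nat
  show "(\<lambda>x. indicator (cball 0 (real n)) x *\<^sub>R u x) \<in> borel_measurable lebesgue"
    using assms unfolding locally_integrable_def set_integrable_def by (meson borel_measurable_integrable compact_cball)
next
  fix x :: 'a
  obtain N :: nat where "norm x \<le> N" using real_arch_simple by blast
  then have "indicator (cball 0 (real n)) x *\<^sub>R u x = u x" if "n \<ge> N" for n
    using that by (auto simp: indicator_def)
  then show "(\<lambda>n. indicator (cball 0 (real n)) x *\<^sub>R u x) \<longlonglongrightarrow> u x"
    by (intro tendsto_eventually) (auto simp: eventually_sequentially)
qed

lemma locally_integrable_mult:
  fixes u :: "'a::euclidean_space \<Rightarrow> 'b::euclidean_space"
  assumes u: "locally_integrable u" and w: "w \<in> borel_measurable lebesgue"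
    and B: "\<And>x. \<bar>w x\<bar> \<le> B" and R: "\<And>x. w x \<noteq> 0 \<Longrightarrow> norm x \<le> R"
  shows "integrable lebesgue (\<lambda>x. w x *\<^sub>R u x)"
proof (rule Bochner_Integration.integrable_bound[of _ "\<lambda>x. B * norm (indicator (cball 0 R) x *\<^sub>R u x)"])
  show "integrable lebesgue (\<lambda>x. B * norm (indicator (cball 0 R) x *\<^sub>R u x))"
    using u unfolding locally_integrable_def set_integrable_def by (intro integrable_mult_right integrable_norm) auto
  show "(\<lambda>x. w x *\<^sub>R u x) \<in> borel_measurable lebesgue"
    using w locally_integrable_measurable[OF u] by measurable
  have "norm (w x *\<^sub>R u x) \<le> norm (B * norm (indicator (cball 0 R) x *\<^sub>R u x))" for x
  proof (cases "w x = 0")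
    case False
    then have "norm x \<le> R" using R by blast
    then have "norm (w x *\<^sub>R u x) \<le> B * norm (indicator (cball 0 R) x *\<^sub>R u x)"
      using B[of x] by (auto intro!: mult_right_mono)
    then show ?thesis by (smt (verit) real_norm_def)
  qed auto
  then show "AE x in lebesgue. norm (w x *\<^sub>R u x) \<le> norm (B * norm (indicator (cball 0 R) x *\<^sub>R u x))"
    by simp
qed

lemma continuous_locally_integrable:
  fixes u :: "'a::euclidean_space \<Rightarrow> 'b::euclidean_space"
  assumes "continuous_on UNIV u"
  shows "locally_integrable u"
  unfolding locally_integrable_def
proof (intro allI impI)
  fix K :: "'a set" assume K: "compact K"
  then have "set_integrable lborel K u"
    using borel_integrable_compact[of K u] assms continuous_on_subset unfolding set_integrable_def by (metis subset_UNIV)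
  moreover have "(\<lambda>x. indicator K x *\<^sub>R u x) \<in> borel_measurable borel"
    using K assms by (intro borel_measurable_scaleR borel_measurable_indicator borel_measurable_continuous_onI) (auto intro: borel_compact)
  ultimately show "set_integrable lebesgue K u"
    unfolding set_integrable_def by (simp add: integrable_completion)
qed

lemma test_function_measurable:
  assumes "\<phi> \<in> test_functions \<Omega>" shows "\<phi> \<in> borel_measurable borel"
  using assms unfolding test_functions_def by (intro borel_measurable_continuous_onI) (auto intro: smooth_continuous)

lemma frechet_derivative_test_function_measurable:
  assumes "\<phi> \<in> test_functions \<Omega>" shows "(\<lambda>x. frechet_derivative \<phi> (at x) h) \<in> borel_measurable borel"
proof -
  have sm: "smooth \<phi>" using assms by (simp add: test_functions_def)
  have "(\<lambda>x. \<Sum>b\<in>Basis. (h \<bullet> b) * partials [b] \<phi> x) \<in> borel_measurable borel"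
    using test_function_measurable[OF partials_test_function[OF assms]]
    by (intro borel_measurable_sum borel_measurable_times borel_measurable_const) (simp del: partials.simps)
  then show ?thesis by (simp only: smooth_frechet_derivative_eq[OF sm])
qed

lemma frechet_derivative_support:
  assumes "\<phi> \<in> test_functions \<Omega>"
  obtains R where "R > 0" "\<And>x. \<phi> x \<noteq> 0 \<Longrightarrow> norm x \<le> R" "\<And>x h. frechet_derivative \<phi> (at x) h \<noteq> 0 \<Longrightarrow> norm x \<le> R"
proof -
  have sm: "smooth \<phi>" using assms by (simp add: test_functions_def)
  obtain R where R: "R > 0" "\<And>x bs. partials bs \<phi> x \<noteq> 0 \<Longrightarrow> norm x \<le> R"
    by (rule test_function_support[OF assms]) blast
  have "norm x \<le> R" if nz: "frechet_derivative \<phi> (at x) h \<noteq> 0" for x h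
  proof (rule ccontr)
    assume "\<not> norm x \<le> R"
    then have "partials [b] \<phi> x = 0" for b using R(2) by blast
    then have "frechet_derivative \<phi> (at x) h = 0"
      unfolding smooth_frechet_derivative_eq[OF sm] by (simp del: partials.simps)
    with nz show False ..
  qed
  with R(1) R(2)[of "[]"] that show ?thesis by auto
qed

text \<open>The uniform second-order Taylor error of \<phi>, multiplied by the mass of u near the
  support, is O(|h|^2). The kernel is evaluated at y - x, so differentiating in x produces the minus
  sign.\<close>

lemma mollification_has_derivative:
  fixes u :: "'a::euclidean_space \<Rightarrow> 'b::euclidean_space"
  assumes \<phi>: "\<phi> \<in> test_functions \<Omega>" and u: "locally_integrable u"
  shows "((\<lambda>x. LINT y|lebesgue. \<phi> (y - x) *\<^sub>R u y) has_derivative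
      (\<lambda>h. - (LINT y|lebesgue. frechet_derivative \<phi> (at (y - x)) h *\<^sub>R u y))) (at x)"
proof -
  have sm: "smooth \<phi>" using \<phi> by (simp add: test_functions_def)
  obtain L where L: "L > 0" "\<And>x h. \<bar>\<phi> (x + h) - \<phi> x - frechet_derivative \<phi> (at x) h\<bar> \<le> L * (norm h)\<^sup>2"
    by (rule test_function_taylor[OF \<phi>]) blast
  obtain B where B: "B > 0" "\<And>x. \<bar>\<phi> x\<bar> \<le> B" by (rule test_function_bounded[OF \<phi>]) blast
  obtain B' where B': "B' > 0" "\<And>x h. \<bar>frechet_derivative \<phi> (at x) h\<bar> \<le> B' * norm h"
    by (rule test_function_derivative_bounded[OF \<phi>]) blast
  obtain R where R: "R > 0" "\<And>x. \<phi> x \<noteq> 0 \<Longrightarrow> norm x \<le> R" "\<And>x h. frechet_derivative \<phi> (at x) h \<noteq> 0 \<Longrightarrow> norm x \<le> R"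
    by (rule frechet_derivative_support[OF \<phi>]) blast
  note [measurable] = test_function_measurable[OF \<phi>] frechet_derivative_test_function_measurable[OF \<phi>]
  have int1: "integrable lebesgue (\<lambda>y. \<phi> (y - x) *\<^sub>R u y)" for x
  proof (rule locally_integrable_mult[OF u _ B(2)])
    show "norm y \<le> R + norm x" if "\<phi> (y - x) \<noteq> 0" for y
      using R(2)[OF that] by norm
    show "(\<lambda>y. \<phi> (y - x)) \<in> borel_measurable lebesgue" by (rule measurable_completion) measurable
  qed
  have int2: "integrable lebesgue (\<lambda>y. frechet_derivative \<phi> (at (y - x)) h *\<^sub>R u y)" for x h
  proof (rule locally_integrable_mult[OF u _ B'(2)])
    show "norm y \<le> R + norm x" if "frechet_derivative \<phi> (at (y - x)) h \<noteq> 0" for y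
      using R(3)[OF that] by norm
    show "(\<lambda>y. frechet_derivative \<phi> (at (y - x)) h) \<in> borel_measurable lebesgue" by (rule measurable_completion) measurable
  qed
  let ?D = "\<lambda>h. - (LINT y|lebesgue. frechet_derivative \<phi> (at (y - x)) h *\<^sub>R u y)"
  have lin: "frechet_derivative \<phi> (at z) (h + k) = frechet_derivative \<phi> (at z) h + frechet_derivative \<phi> (at z) k"
    "frechet_derivative \<phi> (at z) (c *\<^sub>R h) = c * frechet_derivative \<phi> (at z) h" for z h k c
    unfolding smooth_frechet_derivative_eq[OF sm]
    by (auto simp: algebra_simps inner_add_left sum.distrib sum_distrib_left)
  \<comment> \<open>An increment |h| \<le> 1 moves the support by at most 1, so the ball of radius
    \<open>R + 1\<close> contains all integrands.\<close>
  define M where "M = (LINT y|lebesgue. norm (indicator (cball x (R + 1)) y *\<^sub>R u y))"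
  have intM: "integrable lebesgue (\<lambda>y. norm (indicator (cball x (R + 1)) y *\<^sub>R u y))"
    using u unfolding locally_integrable_def set_integrable_def by (intro integrable_norm) auto
  have est: "norm ((LINT y|lebesgue. \<phi> (y - (x + h)) *\<^sub>R u y) - (LINT y|lebesgue. \<phi> (y - x) *\<^sub>R u y) - ?D h)
      \<le> L * (norm h)\<^sup>2 * M" if h: "norm h \<le> 1" for h
  proof -
    have "(LINT y|lebesgue. \<phi> (y - (x + h)) *\<^sub>R u y) - (LINT y|lebesgue. \<phi> (y - x) *\<^sub>R u y) - ?D h
       = (LINT y|lebesgue. \<phi> (y - (x + h)) *\<^sub>R u y - \<phi> (y - x) *\<^sub>R u y + frechet_derivative \<phi> (at (y - x)) h *\<^sub>R u y)"
      using int1 int2 by (simp add: Bochner_Integration.integral_add)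
    also have "norm \<dots> \<le> (LINT y|lebesgue. L * (norm h)\<^sup>2 * norm (indicator (cball x (R + 1)) y *\<^sub>R u y))"
    proof (rule Bochner_Integration.integral_norm_bound_integral)
      show "integrable lebesgue (\<lambda>y. \<phi> (y - (x + h)) *\<^sub>R u y - \<phi> (y - x) *\<^sub>R u y + frechet_derivative \<phi> (at (y - x)) h *\<^sub>R u y)"
        using int1 int2 by auto
      show "integrable lebesgue (\<lambda>y. L * (norm h)\<^sup>2 * norm (indicator (cball x (R + 1)) y *\<^sub>R u y))"
        using intM by (rule integrable_mult_right)
      fix y
      have neg: "frechet_derivative \<phi> (at z) (- h) = - frechet_derivative \<phi> (at z) h" for z
        using lin(2)[of z "-1" h] by simp
      let ?c = "\<phi> (y - (x + h)) - \<phi> (y - x) + frechet_derivative \<phi> (at (y - x)) h"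
      have c: "\<bar>?c\<bar> \<le> L * (norm h)\<^sup>2" using L(2)[of "y - x" "- h"] by (simp add: neg algebra_simps)
      have c0: "norm (y - x) \<le> R + 1" if "?c \<noteq> 0"
      proof (rule ccontr)
        assume n: "\<not> norm (y - x) \<le> R + 1"
        then have "\<not> norm (y - (x + h)) \<le> R" using h by norm
        then have "\<phi> (y - (x + h)) = 0" using R(2) by blast
        moreover have "\<phi> (y - x) = 0" "frechet_derivative \<phi> (at (y - x)) h = 0" using R n by force+
        ultimately show False using that by simp
      qed
      have "\<phi> (y - (x + h)) *\<^sub>R u y - \<phi> (y - x) *\<^sub>R u y + frechet_derivative \<phi> (at (y - x)) h *\<^sub>R u y = ?c *\<^sub>R u y"
        by (simp add: algebra_simps)
      moreover have "norm (?c *\<^sub>R u y) \<le> L * (norm h)\<^sup>2 * norm (indicator (cball x (R + 1)) y *\<^sub>R u y)"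
      proof (cases "?c = 0")
        case True
        then show ?thesis using L(1) by (simp only: scaleR_zero_left norm_zero) simp
      next
        case False
        then have "y \<in> cball x (R + 1)" using c0 by (simp add: dist_norm norm_minus_commute)
        then show ?thesis using c by (auto intro!: mult_right_mono)
      qed
      ultimately show "norm (\<phi> (y - (x + h)) *\<^sub>R u y - \<phi> (y - x) *\<^sub>R u y + frechet_derivative \<phi> (at (y - x)) h *\<^sub>R u y)
        \<le> L * (norm h)\<^sup>2 * norm (indicator (cball x (R + 1)) y *\<^sub>R u y)"
        by simp
    qed
    also have "\<dots> = L * (norm h)\<^sup>2 * M" by (simp add: M_def)
    finally show ?thesis .
  qed
  have "bounded_linear ?D"
  proof -
    have "linear ?D"
      using int2 by (intro linearI) (simp_all add: lin scaleR_add_left flip: scaleR_scaleR)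
    then show ?thesis by (rule linear_conv_bounded_linear[THEN iffD1])
  qed
  moreover have "((\<lambda>h. norm ((LINT y|lebesgue. \<phi> (y - (x + h)) *\<^sub>R u y) - (LINT y|lebesgue. \<phi> (y - x) *\<^sub>R u y) - ?D h) / norm h) \<longlongrightarrow> 0) (at 0)"
  proof (rule Lim_null_comparison)
    have "\<forall>\<^sub>F h in at (0::'a). norm h < 1"
      by (auto simp: eventually_at dist_norm intro!: exI[of _ 1])
    then show "\<forall>\<^sub>F h in at 0. norm (norm ((LINT y|lebesgue. \<phi> (y - (x + h)) *\<^sub>R u y) - (LINT y|lebesgue. \<phi> (y - x) *\<^sub>R u y) - ?D h) / norm h)
        \<le> L * norm h * M"
    proof eventually_elim
      case (elim h)
      show ?case
      proof (cases "h = 0")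
        case False
        with est[of h] elim show ?thesis by (simp add: field_simps power2_eq_square)
      qed auto
    qed
    have "((\<lambda>h::'a. L * norm h * M) \<longlongrightarrow> L * norm (0::'a) * M) (at 0)"
      by (intro tendsto_intros)
    then show "((\<lambda>h::'a. L * norm h * M) \<longlongrightarrow> 0) (at 0)" by simp
  qed
  ultimately show ?thesis by (simp add: has_derivative_at)
qed

section \<open>Uniqueness of weak derivatives\<close>

lemma lborel_distr_reflect: "distr lborel borel (\<lambda>x. a - x) = (lborel :: 'a::euclidean_space measure)"
  using lborel_affine[of "-1" a] by (simp add: density_1)

lemma integral_lborel_reflect:
  fixes f :: "'a::euclidean_space \<Rightarrow> 'b::{banach, second_countable_topology}"
  assumes [measurable]: "f \<in> borel_measurable borel"
  shows "(LINT x|lborel. f (a - x)) = (LINT x|lborel. f x)"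
proof -
  have "(LINT x|lborel. f x) = (LINT x|distr lborel borel (\<lambda>x. a - x). f x)"
    by (simp add: lborel_distr_reflect)
  also have "\<dots> = (LINT x|lborel. f (a - x))"
    by (subst integral_distr) auto
  finally show ?thesis ..
qed

lemma integral_lborel_shift:
  fixes f :: "'a::euclidean_space \<Rightarrow> 'b::{banach, second_countable_topology}"
  assumes [measurable]: "f \<in> borel_measurable borel"
  shows "(LINT x|lborel. f (x + a)) = (LINT x|lborel. f x)"
proof -
  have "(LINT x|lborel. f x) = (LINT x|distr lborel borel ((+) a). f x)"
    by (simp add: lborel_distr_plus)
  also have "\<dots> = (LINT x|lborel. f (a + x))"
    by (subst integral_distr) auto
  finally show ?thesis by (simp add: add.commute)
qed

lemma integral_norm_bound_integral_AE:
  fixes f :: "'a \<Rightarrow> 'b::{banach, second_countable_topology}"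
  assumes "integrable M f" "integrable M g" "AE x in M. norm (f x) \<le> g x"
  shows "norm (LINT x|M. f x) \<le> (LINT x|M. g x)"
  using order_trans[OF integral_norm_bound integral_mono_AE[OF integrable_norm[OF assms(1)] assms(2,3)]] .

lemma AE_lebesgue_iff: "(AE x in lebesgue. P x) \<longleftrightarrow> (AE x in lborel. P x)"
  by (rule AE_completion_iff)

text \<open>Nonempty open sets are not null. This is the device by which relations between
  continuous functions are upgraded from almost everywhere to everywhere.\<close>

lemma AE_open_imp_empty:
  fixes S :: "'a::euclidean_space set"
  assumes "AE x in lebesgue. x \<notin> S" "open S" shows "S = {}"
proof -
  have "S \<in> null_sets lebesgue" using assms(1) by (simp add: completion.AE_iff_null_sets)
  then show ?thesis using open_not_negligible[OF assms(2)] by (auto simp: negligible_iff_null_sets)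
qed

lemma AE_continuous_eq:
  fixes f g :: "'a::euclidean_space \<Rightarrow> 'b::euclidean_space"
  assumes "AE x in lebesgue. f x = g x" "continuous_on UNIV f" "continuous_on UNIV g"
  shows "f = g"
proof -
  have "open {x. f x \<noteq> g x}" by (rule open_Collect_neq[OF assms(2,3)])
  then have "{x. f x \<noteq> g x} = {}" by (intro AE_open_imp_empty) (use assms(1) in auto)
  then show ?thesis by auto
qed

lemma AE_continuous_le:
  fixes f :: "'a::euclidean_space \<Rightarrow> 'b::euclidean_space"
  assumes "AE x in lebesgue. norm (f x) \<le> c" "continuous_on UNIV f"
  shows "norm (f x) \<le> c"
proof -
  have "open {x. c < norm (f x)}" by (rule open_Collect_less) (intro continuous_intros assms)+
  then have "{x. c < norm (f x)} = {}" by (intro AE_open_imp_empty) (use assms(1) in \<open>auto simp: not_less\<close>)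
  then show ?thesis by (metis (mono_tags, lifting) Collect_empty_eq not_less)
qed

lemma box_integral_eq_0:
  fixes u :: "'a::euclidean_space \<Rightarrow> real"
  assumes u: "locally_integrable u" and z: "\<And>\<phi>. \<phi> \<in> test_functions UNIV \<Longrightarrow> (LINT x|lebesgue. \<phi> x * u x) = 0"
  shows "(LINT x:box a c|lebesgue. u x) = 0"
proof -
  note [measurable] = locally_integrable_measurable[OF u]
  have bm: "bump (real (Suc n)) a c \<in> borel_measurable lebesgue" for n
    by (intro measurable_completion) (use test_function_measurable[OF bump_test_function[of "real (Suc n)" a c UNIV]] in auto)
  have im: "indicat_real (box a c) \<in> borel_measurable lebesgue" by (intro borel_measurable_indicator) auto
  have "(\<lambda>n. LINT x|lebesgue. bump (real (Suc n)) a c x * u x) \<longlonglongrightarrow> (LINT x|lebesgue. indicator (box a c) x * u x)"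
  proof (rule integral_dominated_convergence[where w = "\<lambda>x. norm (indicator (cbox a c) x *\<^sub>R u x)"])
    show "integrable lebesgue (\<lambda>x. norm (indicator (cbox a c) x *\<^sub>R u x))"
      using u unfolding locally_integrable_def set_integrable_def by (intro integrable_norm) auto
    show "AE x in lebesgue. (\<lambda>n. bump (real (Suc n)) a c x * u x) \<longlonglongrightarrow> indicator (box a c) x * u x"
      by (intro AE_I2 tendsto_intros bump_tendsto)
    show "AE x in lebesgue. norm (bump (real (Suc n)) a c x * u x) \<le> norm (indicator (cbox a c) x *\<^sub>R u x)" for n
    proof (rule AE_I2)
      fix x show "norm (bump (real (Suc n)) a c x * u x) \<le> norm (indicator (cbox a c) x *\<^sub>R u x)"
        using bump_nonneg[of "real (Suc n)" a c x] bump_le_1[of "real (Suc n)" a c x] bump_eq_0_iff[of "real (Suc n)" a c x] box_subset_cbox[of a c]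
        by (cases "x \<in> box a c") (auto simp: abs_mult subset_iff intro!: mult_left_le_one_le)
    qed
  qed (use bm im locally_integrable_measurable[OF u] in \<open>auto intro!: borel_measurable_times\<close>)
  moreover have "(LINT x|lebesgue. bump (real (Suc n)) a c x * u x) = 0" for n
    by (intro z bump_test_function) auto
  ultimately show ?thesis by (simp add: LIMSEQ_const_iff set_lebesgue_integral_def)
qed

text \<open>The fundamental lemma of the calculus of variations. Testing with bumps shows that u has
  zero integral over every box; boxes are stable under intersection and generate the Borel sets, so
  the integral vanishes over every bounded Borel set, in particular over the sets where u is
  positive or negative.\<close>

lemma weak_zero_real:
  fixes u :: "'a::euclidean_space \<Rightarrow> real"
  assumes u: "locally_integrable u" and z: "\<And>\<phi>. \<phi> \<in> test_functions UNIV \<Longrightarrow> (LINT x|lebesgue. \<phi> x * u x) = 0"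
  shows "AE x in lebesgue. u x = 0"
proof -
  obtain u' where u'[measurable]: "u' \<in> borel_measurable lborel" and uu': "AE x in lborel. u x = u' x"
    using completion_ex_borel_measurable_real[OF locally_integrable_measurable[OF u]] by blast
  \<comment> \<open>Intersecting with bounded boxes keeps all integrals finite, so that complements
    and countable disjoint unions can be handled by additivity.\<close>
  let ?B = "\<lambda>n::nat. box (- (real n *\<^sub>R One)) (real n *\<^sub>R One) :: 'a set"
  have si: "set_integrable lebesgue A u" if "A \<subseteq> ?B n" "A \<in> sets borel" for n A
  proof (rule set_integrable_subset)
    show "set_integrable lebesgue (cbox (- (real n *\<^sub>R One)) (real n *\<^sub>R One)) u"
      using u unfolding locally_integrable_def by auto
    show "A \<subseteq> cbox (- (real n *\<^sub>R One)) (real n *\<^sub>R One)" using that(1) box_subset_cbox by blast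
  qed (use that in auto)
  have subset_Pow_UNIV: "range (\<lambda>(a, b). box a b :: 'a set) \<subseteq> Pow UNIV" by simp
  have stable: "Int_stable (range (\<lambda>(a, b). box a b :: 'a set))"
    by (auto simp: Int_stable_def box_Int_box)
  have *: "(LINT x:A \<inter> ?B n|lebesgue. u x) = 0" if A: "A \<in> sets borel" for A n
  proof -
   have "A \<in> sigma_sets UNIV (range (\<lambda>(a, b). box a b))" using A by (simp add: borel_eq_box)
   from stable subset_Pow_UNIV this show ?thesis
   proof (induction A rule: sigma_sets_induct_disjoint)
    case (basic A)
    then show ?case using box_integral_eq_0[OF u z] by (auto simp: box_Int_box)
  next
    case empty
    then show ?case by (simp add: set_lebesgue_integral_def)
  next
    case (compl A)
    then have A: "A \<in> sets borel" by (simp add: borel_eq_box)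
    have "(LINT x:?B n|lebesgue. u x) = (LINT x:(A \<inter> ?B n) \<union> ((UNIV - A) \<inter> ?B n)|lebesgue. u x)"
      by (rule arg_cong[where f = "\<lambda>S. LINT x:S|lebesgue. u x"]) auto
    also have "\<dots> = (LINT x:(A \<inter> ?B n)|lebesgue. u x) + (LINT x:(UNIV - A) \<inter> ?B n|lebesgue. u x)"
      by (intro set_integral_Un si[of _ n]) (use A in auto)
    finally show ?case using compl box_integral_eq_0[OF u z] by simp
  next
    case (union A)
    then have A: "\<And>i. A i \<in> sets borel" by (auto simp: borel_eq_box)
    have "(LINT x:(\<Union>i. A i \<inter> ?B n)|lebesgue. u x) = (\<Sum>i. (LINT x:(A i \<inter> ?B n)|lebesgue. u x))"
    proof (rule lebesgue_integral_countable_add)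
      show "A i \<inter> ?B n \<in> sets lebesgue" for i using A by auto
      show "(A i \<inter> ?B n) \<inter> (A j \<inter> ?B n) = {}" if "i \<noteq> j" for i j
        using union(1) that by (auto simp: disjoint_family_on_def)
      show "set_integrable lebesgue (\<Union>i. A i \<inter> ?B n) u"
        by (rule si[of _ n]) (use A in auto)
    qed
    moreover have "(\<Union>i. A i \<inter> ?B n) = (\<Union>i. A i) \<inter> ?B n" by auto
    ultimately show ?case using union by simp
   qed
  qed
  \<comment> \<open>The sign \<open>s\<close> treats the positive and the negative part together.
    The set is defined through the Borel version \<open>u'\<close>, because the previous step
    concerns Borel sets.\<close>
  have part: "AE x in lborel. x \<in> ?B n \<longrightarrow> \<not> 0 < s * u' x" if "s = 1 \<or> s = -1" for n s
  proof -
    let ?A = "{x. 0 < s * u' x}"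
    have A: "?A \<in> sets borel" by measurable
    have i: "integrable lebesgue (\<lambda>x. s * (indicator (?A \<inter> ?B n) x *\<^sub>R u x))"
      using si[of "?A \<inter> ?B n" n] A unfolding set_integrable_def by (intro integrable_mult_right) auto
    have "(LINT x|lebesgue. s * (indicator (?A \<inter> ?B n) x *\<^sub>R u x)) = 0"
      using *[OF A, of n] unfolding set_lebesgue_integral_def by simp
    moreover have nn: "AE x in lebesgue. 0 \<le> s * (indicator (?A \<inter> ?B n) x *\<^sub>R u x)"
      unfolding AE_lebesgue_iff using uu' by eventually_elim (auto simp: indicator_def)
    ultimately have "AE x in lebesgue. s * (indicator (?A \<inter> ?B n) x *\<^sub>R u x) = 0"
      using integral_nonneg_eq_0_iff_AE[OF i nn] by simp
    then show ?thesis unfolding AE_lebesgue_iff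
      using uu' by eventually_elim (auto simp: indicator_def split: if_splits)
  qed
  have "AE x in lborel. \<forall>n. (x \<in> ?B n \<longrightarrow> \<not> 0 < 1 * u' x) \<and> (x \<in> ?B n \<longrightarrow> \<not> 0 < (-1) * u' x)"
    unfolding AE_all_countable by (intro allI AE_conjI part) auto
  moreover have "(\<Union>n. ?B n) = UNIV" by (rule UN_box_eq_UNIV)
  ultimately have "AE x in lborel. u' x = 0"
    by (elim eventually_mono) (metis (no_types, lifting) UNIV_I UN_iff linorder_neqE_linordered_idom mult_1 mult_minus1 neg_0_less_iff_less)
  with uu' show ?thesis unfolding AE_lebesgue_iff by eventually_elim auto
qed

lemma locally_integrable_diff:
  fixes u g :: "'a::euclidean_space \<Rightarrow> 'b::euclidean_space"
  assumes "locally_integrable u" "locally_integrable g"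
  shows "locally_integrable (\<lambda>x. u x - g x)"
  using assms unfolding locally_integrable_def by (auto intro: set_integral_diff)

lemma locally_integrable_inner:
  fixes u :: "'a::euclidean_space \<Rightarrow> 'b::euclidean_space"
  assumes "locally_integrable u"
  shows "locally_integrable (\<lambda>x. u x \<bullet> b)"
  unfolding locally_integrable_def set_integrable_def
proof (intro allI impI)
  fix K :: "'a set" assume "compact K"
  then have "integrable lebesgue (\<lambda>x. (indicator K x *\<^sub>R u x) \<bullet> b)"
    using assms unfolding locally_integrable_def set_integrable_def by (intro integrable_inner_left) auto
  then show "integrable lebesgue (\<lambda>x. indicat_real K x *\<^sub>R (u x \<bullet> b))" by simp
qed

lemma integrable_test_function_scaleR:
  fixes u :: "'a::euclidean_space \<Rightarrow> 'b::euclidean_space"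
  assumes "\<phi> \<in> test_functions \<Omega>" "locally_integrable u"
  shows "integrable lebesgue (\<lambda>x. \<phi> x *\<^sub>R u x)"
proof -
  obtain R where "R > 0" "\<And>x bs. partials bs \<phi> x \<noteq> 0 \<Longrightarrow> norm x \<le> R"
    by (rule test_function_support[OF assms(1)]) blast
  then have R: "\<And>x. \<phi> x \<noteq> 0 \<Longrightarrow> norm x \<le> R" by (metis partials.simps(1))
  obtain B where "\<And>x. \<bar>\<phi> x\<bar> \<le> B" by (rule test_function_bounded[OF assms(1)]) blast
  with R show ?thesis
    by (intro locally_integrable_mult[OF assms(2)]) (auto intro!: measurable_completion test_function_measurable[OF assms(1)])
qed

lemma weak_zero:
  fixes u :: "'a::euclidean_space \<Rightarrow> 'b::euclidean_space"
  assumes u: "locally_integrable u" and z: "\<And>\<phi>. \<phi> \<in> test_functions UNIV \<Longrightarrow> (LINT x|lebesgue. \<phi> x *\<^sub>R u x) = 0"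
  shows "AE x in lebesgue. u x = 0"
proof -
  have "AE x in lebesgue. u x \<bullet> b = 0" for b
  proof (rule weak_zero_real[OF locally_integrable_inner[OF u]])
    fix \<phi> :: "'a \<Rightarrow> real" assume \<phi>: "\<phi> \<in> test_functions UNIV"
    have "(LINT x|lebesgue. \<phi> x * (u x \<bullet> b)) = (LINT x|lebesgue. (\<phi> x *\<^sub>R u x) \<bullet> b)" by simp
    also have "\<dots> = (LINT x|lebesgue. \<phi> x *\<^sub>R u x) \<bullet> b"
      by (intro integral_inner_left integrable_test_function_scaleR[OF \<phi> u])
    finally show "(LINT x|lebesgue. \<phi> x * (u x \<bullet> b)) = 0" by (simp add: z[OF \<phi>])
  qed
  then have "AE x in lebesgue. \<forall>b\<in>Basis. u x \<bullet> b = 0"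
    by (intro AE_finite_allI) auto
  then show ?thesis by eventually_elim (simp add: euclidean_all_zero_iff)
qed

lemma weak_derivative_empty_AE:
  fixes u g :: "'a::euclidean_space \<Rightarrow> 'b::euclidean_space"
  assumes "has_weak_derivative {#} u g"
  shows "AE x in lebesgue. u x = g x"
proof -
  have u: "locally_integrable u" and g: "locally_integrable g"
    and eq: "\<And>\<phi>. \<phi> \<in> test_functions UNIV \<Longrightarrow> (LINT x|lebesgue. \<phi> x *\<^sub>R u x) = (LINT x|lebesgue. \<phi> x *\<^sub>R g x)"
    using assms unfolding has_weak_derivative_def by auto
  have "AE x in lebesgue. u x - g x = 0"
  proof (rule weak_zero[OF locally_integrable_diff[OF u g]])
    fix \<phi> :: "'a \<Rightarrow> real" assume \<phi>: "\<phi> \<in> test_functions UNIV"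
    show "(LINT x|lebesgue. \<phi> x *\<^sub>R (u x - g x)) = 0"
      using eq[OF \<phi>] integrable_test_function_scaleR[OF \<phi> u] integrable_test_function_scaleR[OF \<phi> g]
      by (simp add: scaleR_diff_right)
  qed
  then show ?thesis by eventually_elim simp
qed

text \<open>Fubini's theorem and changes of variables are carried out over \<open>lborel\<close>,
  where measurability means Borel measurability; the hypotheses speak of \<open>lebesgue\<close>.
  Passing to a Borel version, coordinate by coordinate, connects the two.\<close>

lemma lebesgue_borel_version:
  fixes u :: "'a::euclidean_space \<Rightarrow> 'b::euclidean_space"
  assumes "u \<in> borel_measurable lebesgue"
  obtains u' where "u' \<in> borel_measurable borel" "AE x in lborel. u x = u' x"
proof -
  have "\<exists>g\<in>borel_measurable lborel. AE x in lborel. u x \<bullet> b = g x" for b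
    by (intro completion_ex_borel_measurable_real borel_measurable_inner assms borel_measurable_const)
  then obtain g where g: "\<And>b. g b \<in> borel_measurable lborel" "\<And>b. AE x in lborel. u x \<bullet> b = g b x" by metis
  have "AE x in lborel. \<forall>b\<in>Basis. u x \<bullet> b = g b x" using g by (intro AE_finite_allI) auto
  then have "AE x in lborel. u x = (\<Sum>b\<in>Basis. g b x *\<^sub>R b)"
    by eventually_elim (metis (no_types, lifting) euclidean_representation sum.cong)
  moreover have "(\<lambda>x. \<Sum>b\<in>Basis. g b x *\<^sub>R b) \<in> borel_measurable borel"
    using g by simp
  ultimately show ?thesis using that by blast
qed

lemma integral_lebesgue_borel_version:
  fixes u :: "'a::euclidean_space \<Rightarrow> 'b::euclidean_space"
  assumes "u' \<in> borel_measurable borel" "AE x in lborel. u x = u' x"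
  shows "(LINT x|lebesgue. u x) = (LINT x|lborel. u' x)"
proof -
  have u': "u' \<in> borel_measurable lebesgue" using assms(1) by (intro measurable_completion) simp
  have "AE x in lebesgue. u' x = u x" unfolding AE_lebesgue_iff using assms(2) by eventually_elim simp
  then have "(LINT x|lebesgue. u x) = (LINT x|lebesgue. u' x)"
    using borel_measurable_AE[OF u'] u' by (intro integral_cong_AE) auto
  also have "\<dots> = (LINT x|lborel. u' x)" using assms(1) by (intro integral_completion) simp
  finally show ?thesis .
qed

section \<open>Mollification\<close>

text \<open>A mollifier without normalisation: its integral is carried along as
  \<open>bump_mass\<close> and divided out only where it is needed.\<close>

abbreviation cube_bump :: "real \<Rightarrow> 'a::euclidean_space \<Rightarrow> real" where
  "cube_bump \<delta> \<equiv> bump (1 / \<delta>) (- (\<delta> *\<^sub>R One)) (\<delta> *\<^sub>R One)"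

abbreviation bump_mass :: "'a::euclidean_space itself \<Rightarrow> real \<Rightarrow> real" where
  "bump_mass T \<delta> \<equiv> (LINT x|lborel. (cube_bump \<delta> :: 'a \<Rightarrow> real) x)"

lemma cube_bump_shift_test_function:
  "\<delta> > 0 \<Longrightarrow> (\<lambda>y. cube_bump \<delta> (y - x)) \<in> test_functions UNIV"
  unfolding bump_translate by (intro bump_test_function) auto

lemma cube_bump_test_function: "\<delta> > 0 \<Longrightarrow> cube_bump \<delta> \<in> test_functions UNIV"
  by (intro bump_test_function) auto

lemma cube_bump_support:
  fixes y :: "'a::euclidean_space" and \<delta> :: real
  assumes "\<delta> > 0" "cube_bump \<delta> y \<noteq> 0"
  shows "norm y \<le> DIM('a) * \<delta>"
proof -
  have "y \<in> box (- (\<delta> *\<^sub>R One)) (\<delta> *\<^sub>R One)"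
    using assms bump_eq_0_iff[of "1 / \<delta>"] by (metis zero_less_divide_1_iff)
  then have "\<bar>y \<bullet> b\<bar> \<le> \<delta>" if "b \<in> Basis" for b
    using that by (auto simp: mem_box intro: abs_leI less_imp_le)
  then have "(\<Sum>b\<in>Basis. \<bar>y \<bullet> b\<bar>) \<le> (\<Sum>b\<in>(Basis::'a set). \<delta>)" by (intro sum_mono)
  with norm_le_l1[of y] show ?thesis by simp
qed

lemma cube_bump_measurable [measurable]: "\<delta> > 0 \<Longrightarrow> cube_bump \<delta> \<in> borel_measurable borel"
  by (rule test_function_measurable[OF cube_bump_test_function])

lemma integrable_test_function: "\<phi> \<in> test_functions \<Omega> \<Longrightarrow> integrable lborel \<phi>"
proof -
  assume \<phi>: "\<phi> \<in> test_functions \<Omega>"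
  have "integrable lebesgue (\<lambda>x. \<phi> x *\<^sub>R (1::real))"
    by (rule integrable_test_function_scaleR[OF \<phi>]) (simp add: continuous_locally_integrable)
  then show ?thesis using test_function_measurable[OF \<phi>] by (simp add: integrable_completion)
qed

lemma bump_mass_pos: "\<delta> > 0 \<Longrightarrow> 0 < bump_mass TYPE('a::euclidean_space) \<delta>"
proof -
  assume d: "\<delta> > 0"
  have i: "integrable lborel (cube_bump \<delta> :: 'a \<Rightarrow> real)" by (rule integrable_test_function[OF cube_bump_test_function[OF d]])
  have "bump_mass TYPE('a) \<delta> \<noteq> 0"
  proof
    assume "bump_mass TYPE('a) \<delta> = 0"
    then have "AE x::'a in lborel. cube_bump \<delta> x = 0"
      using integral_nonneg_eq_0_iff_AE[OF i AE_I2[OF bump_nonneg]] by simp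
    then have "AE x::'a in lebesgue. x \<notin> box (- (\<delta> *\<^sub>R One)) (\<delta> *\<^sub>R One)"
      unfolding AE_lebesgue_iff by eventually_elim (use d bump_eq_0_iff[of "1 / \<delta>"] in auto)
    then have "box (- (\<delta> *\<^sub>R One)) (\<delta> *\<^sub>R One) = ({} :: 'a set)" by (intro AE_open_imp_empty open_box)
    then show False using d by (auto simp: box_eq_empty)
  qed
  moreover have "0 \<le> bump_mass TYPE('a) \<delta>" by (intro integral_nonneg_AE) (simp add: bump_nonneg)
  ultimately show ?thesis by simp
qed

text \<open>The integrand vanishes unless |x| \<le> R and |y| \<le> R + R', which gives an
  integrable majorant of product form. The identity is used both to interchange two mollifications
  and to move a mollifier from u to the test function.\<close>

lemma mollify_Fubini:
  fixes u :: "'a::euclidean_space \<Rightarrow> 'b::euclidean_space"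
  assumes \<phi>: "\<phi> \<in> test_functions \<Omega>" and \<kappa>: "\<kappa> \<in> test_functions \<Omega>'" and u: "locally_integrable u"
  shows "(LINT x|lborel. \<phi> x *\<^sub>R (LINT y|lebesgue. \<kappa> (y - x) *\<^sub>R u y))
    = (LINT y|lebesgue. (LINT x|lborel. \<phi> x * \<kappa> (y - x)) *\<^sub>R u y)"
proof -
  obtain u' where u'[measurable]: "u' \<in> borel_measurable borel" and uu': "AE x in lborel. u x = u' x"
    by (rule lebesgue_borel_version[OF locally_integrable_measurable[OF u]])
  note [measurable] = test_function_measurable[OF \<phi>] test_function_measurable[OF \<kappa>]
  obtain R where R: "R > 0" "\<And>x. \<phi> x \<noteq> 0 \<Longrightarrow> norm x \<le> R" by (rule frechet_derivative_support[OF \<phi>]) blast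
  obtain R' where R': "R' > 0" "\<And>x. \<kappa> x \<noteq> 0 \<Longrightarrow> norm x \<le> R'" by (rule frechet_derivative_support[OF \<kappa>]) blast
  obtain B where B: "B > 0" "\<And>x. \<bar>\<phi> x\<bar> \<le> B" by (rule test_function_bounded[OF \<phi>]) blast
  obtain B' where B': "B' > 0" "\<And>x. \<bar>\<kappa> x\<bar> \<le> B'" by (rule test_function_bounded[OF \<kappa>]) blast
  have [measurable]: "cball (0::'a) r \<in> sets borel" for r by (intro borel_closed closed_cball)
  have iu'_meas: "(\<lambda>y. indicat_real (cball 0 (R + R')) y *\<^sub>R u' y) \<in> borel_measurable borel"
    by (intro borel_measurable_scaleR borel_measurable_indicator u') simp
  have "integrable lebesgue (\<lambda>y. indicator (cball 0 (R + R')) y *\<^sub>R u y)"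
    using u unfolding locally_integrable_def set_integrable_def by auto
  then have "integrable lebesgue (\<lambda>y. indicator (cball 0 (R + R')) y *\<^sub>R u' y)"
  proof (rule Bochner_Integration.integrable_cong_AE_imp)
    show "(\<lambda>y. indicator (cball 0 (R + R')) y *\<^sub>R u' y) \<in> borel_measurable lebesgue"
      using iu'_meas by (intro measurable_completion) simp
    show "AE y in lebesgue. indicator (cball 0 (R + R')) y *\<^sub>R u y = indicator (cball 0 (R + R')) y *\<^sub>R u' y"
      unfolding AE_lebesgue_iff using uu' by eventually_elim simp
  qed
  then have iu': "integrable lborel (\<lambda>y. indicator (cball 0 (R + R')) y *\<^sub>R u' y)"
    using iu'_meas by (simp add: integrable_completion)
  let ?f = "\<lambda>x y. (\<phi> x * \<kappa> (y - x)) *\<^sub>R u' y"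
  have int: "integrable (lborel \<Otimes>\<^sub>M lborel) (\<lambda>(x, y). ?f x y)"
  proof (rule integrableI_bounded)
    show "(\<lambda>(x, y). ?f x y) \<in> borel_measurable (lborel \<Otimes>\<^sub>M lborel)" by measurable
    have "(\<integral>\<^sup>+ p. ennreal (norm ((\<lambda>(x, y). ?f x y) p)) \<partial>(lborel \<Otimes>\<^sub>M lborel))
      = (\<integral>\<^sup>+ x. \<integral>\<^sup>+ y. ennreal (norm (?f x y)) \<partial>lborel \<partial>lborel)"
      by (subst lborel.nn_integral_fst[symmetric]) auto
    also have "\<dots> \<le> (\<integral>\<^sup>+ x. ennreal (B * B' * indicator (cball 0 R) (x::'a)) * (\<integral>\<^sup>+ y. ennreal (norm (indicator (cball 0 (R + R')) y *\<^sub>R u' y)) \<partial>lborel) \<partial>lborel)"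
    proof (intro nn_integral_mono)
      fix x :: 'a
      have "(\<integral>\<^sup>+ y. ennreal (norm (?f x y)) \<partial>lborel)
        \<le> (\<integral>\<^sup>+ y. ennreal (B * B' * indicator (cball 0 R) (x::'a)) * ennreal (norm (indicator (cball 0 (R + R')) y *\<^sub>R u' y)) \<partial>lborel)"
      proof (intro nn_integral_mono)
        fix y :: 'a
        have "norm (?f x y) \<le> (B * B' * indicator (cball 0 R) x) * norm (indicator (cball 0 (R + R')) y *\<^sub>R u' y)"
        proof (cases "\<phi> x = 0 \<or> \<kappa> (y - x) = 0")
          case True
          then show ?thesis using B(1) B'(1) by auto
        next
          case False
          then have "norm x \<le> R" "norm (y - x) \<le> R'" using R R' by auto
          then have "norm x \<le> R" "norm y \<le> R + R'" using norm_triangle_sub[of y x] by auto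
          moreover have "\<bar>\<phi> x * \<kappa> (y - x)\<bar> \<le> B * B'"
            unfolding abs_mult using B B' by (intro mult_mono) (auto intro: less_imp_le)
          ultimately show ?thesis by (auto simp: abs_mult intro!: mult_right_mono)
        qed
        then show "ennreal (norm (?f x y)) \<le> ennreal (B * B' * indicator (cball 0 R) x) * ennreal (norm (indicator (cball 0 (R + R')) y *\<^sub>R u' y))"
          using B(1) B'(1) by (simp add: ennreal_mult[symmetric] ennreal_leI)
      qed
      also have "\<dots> = ennreal (B * B' * indicator (cball 0 R) (x::'a)) * (\<integral>\<^sup>+ y. ennreal (norm (indicator (cball 0 (R + R')) y *\<^sub>R u' y)) \<partial>lborel)"
        by (rule nn_integral_cmult) simp
      finally show "(\<integral>\<^sup>+ y. ennreal (norm (?f x y)) \<partial>lborel) \<le> \<dots>" .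
    qed
    also have "\<dots> = (\<integral>\<^sup>+ x. ennreal (B * B' * indicator (cball 0 R) (x::'a)) \<partial>lborel) * (\<integral>\<^sup>+ y. ennreal (norm (indicator (cball 0 (R + R')) y *\<^sub>R u' y)) \<partial>lborel)"
      by (rule nn_integral_multc) simp
    also have "\<dots> < \<infinity>"
    proof -
      have "(\<integral>\<^sup>+ x. ennreal (B * B' * indicator (cball 0 R) (x::'a)) \<partial>lborel) = ennreal (B * B') * emeasure lborel (cball (0::'a) R)"
        using B(1) B'(1) by (simp add: ennreal_mult ennreal_indicator nn_integral_cmult)
      moreover have "\<dots> < \<infinity>" using emeasure_lborel_cball_finite[of "0::'a" R] by (simp add: ennreal_mult_less_top)
      moreover have "(\<integral>\<^sup>+ y. ennreal (norm (indicator (cball 0 (R + R')) y *\<^sub>R u' y)) \<partial>lborel) < \<infinity>"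
        using iu' by (simp add: integrable_iff_bounded)
      ultimately show ?thesis by (simp add: ennreal_mult_less_top)
    qed
    finally show "(\<integral>\<^sup>+ p. ennreal (norm ((\<lambda>(x, y). ?f x y) p)) \<partial>(lborel \<Otimes>\<^sub>M lborel)) < \<infinity>" .
  qed
  have "(LINT x|lborel. \<phi> x *\<^sub>R (LINT y|lebesgue. \<kappa> (y - x) *\<^sub>R u y)) = (LINT x|lborel. LINT y|lborel. ?f x y)"
  proof (rule Bochner_Integration.integral_cong[OF refl])
    fix x
    have "(LINT y|lebesgue. \<kappa> (y - x) *\<^sub>R u y) = (LINT y|lborel. \<kappa> (y - x) *\<^sub>R u' y)"
      by (rule integral_lebesgue_borel_version) (use uu' in \<open>auto elim!: eventually_mono\<close>)
    then show "\<phi> x *\<^sub>R (LINT y|lebesgue. \<kappa> (y - x) *\<^sub>R u y) = (LINT y|lborel. ?f x y)"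
      by (simp flip: scaleR_scaleR)
  qed
  also have "\<dots> = (LINT y|lborel. LINT x|lborel. ?f x y)"
    by (rule lborel_pair.Fubini_integral[OF int, symmetric])
  also have "\<dots> = (LINT y|lborel. (LINT x|lborel. \<phi> x * \<kappa> (y - x)) *\<^sub>R u' y)"
  proof (rule Bochner_Integration.integral_cong[OF refl])
    fix y
    have "integrable lborel (\<lambda>x. \<phi> x * \<kappa> (y - x))"
    proof (rule Bochner_Integration.integrable_bound[of _ "\<lambda>x. B' * \<phi> x"])
      show "integrable lborel (\<lambda>x. B' * \<phi> x)" using integrable_test_function[OF \<phi>] by simp
      show "AE x in lborel. norm (\<phi> x * \<kappa> (y - x)) \<le> norm (B' * \<phi> x)"
        using B' by (auto simp: abs_mult intro!: AE_I2 mult_right_mono simp: mult.commute[of B'])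
          (metis abs_ge_zero abs_of_pos mult.commute mult_left_mono)
    qed simp
    then show "(LINT x|lborel. ?f x y) = (LINT x|lborel. \<phi> x * \<kappa> (y - x)) *\<^sub>R u' y"
      by (intro integral_scaleR_left)
  qed
  also have "\<dots> = (LINT y|lebesgue. (LINT x|lborel. \<phi> x * \<kappa> (y - x)) *\<^sub>R u y)"
    by (rule integral_lebesgue_borel_version[symmetric]) (use uu' in \<open>auto elim!: eventually_mono\<close>)
  finally show ?thesis .
qed

lemma frechet_derivative_shift:
  fixes \<phi> :: "'a::euclidean_space \<Rightarrow> real"
  assumes "smooth \<phi>"
  shows "frechet_derivative (\<lambda>y. \<phi> (y - x)) (at y) = frechet_derivative \<phi> (at (y - x))"
proof -
  have "((\<lambda>y. y - x) has_derivative (\<lambda>h. h)) (at y)" by (auto intro!: derivative_eq_intros)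
  from has_derivative_compose[OF this smooth_has_derivative[OF assms]]
  show ?thesis by (rule frechet_derivative_at[symmetric])
qed

lemma has_weak_derivative_singleton:
  assumes "has_weak_derivative {#b#} u g" "\<phi> \<in> test_functions UNIV"
  shows "(LINT y|lebesgue. frechet_derivative \<phi> (at y) b *\<^sub>R u y) = - (LINT y|lebesgue. \<phi> y *\<^sub>R g y)"
proof -
  have "\<forall>bs. mset bs = {#b#} \<longrightarrow> (LINT x|lebesgue. partials bs \<phi> x *\<^sub>R u x)
          = (-1) ^ size {#b#} *\<^sub>R (LINT x|lebesgue. \<phi> x *\<^sub>R g x)"
    using assms unfolding has_weak_derivative_def by blast
  from this[rule_format, of "[b]"] show ?thesis by simp
qed

text \<open>A translated bump is itself a test function, so each partial derivative of the
  mollification of u is the mollification of the weak derivative and inherits its bound. Summing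
  over the basis costs the factor \<open>DIM('a)\<close>.\<close>

lemma mollification_lipschitz:
  fixes u :: "'a::euclidean_space \<Rightarrow> 'b::euclidean_space" and M :: real
  assumes u: "locally_integrable u" and \<delta>: "\<delta> > 0"
    and g: "\<And>b. b \<in> Basis \<Longrightarrow> has_weak_derivative {#b#} u (g b)"
    and M: "\<And>b. b \<in> Basis \<Longrightarrow> AE x in lebesgue. norm (g b x) \<le> M"
  shows "norm ((LINT y|lebesgue. cube_bump \<delta> (y - x) *\<^sub>R u y) - (LINT y|lebesgue. cube_bump \<delta> (y - x') *\<^sub>R u y))
    \<le> bump_mass TYPE('a) \<delta> * (DIM('a) * M) * norm (x - x')"
proof -
  let ?\<kappa> = "cube_bump \<delta> :: 'a \<Rightarrow> real"
  let ?I = "bump_mass TYPE('a) \<delta>"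
  note \<kappa> = cube_bump_test_function[OF \<delta>, where 'a = 'a]
  have sm: "smooth ?\<kappa>" by (rule smooth_bump)
  let ?D = "\<lambda>x h. - (LINT y|lebesgue. frechet_derivative ?\<kappa> (at (y - x)) h *\<^sub>R u y)"
  have der: "((\<lambda>x. LINT y|lebesgue. ?\<kappa> (y - x) *\<^sub>R u y) has_derivative ?D x) (at x)" for x
    by (rule mollification_has_derivative[OF \<kappa> u])
  have Db: "norm (?D x b) \<le> ?I * M" if b: "b \<in> Basis" for x b
  proof -
    let ?\<phi> = "\<lambda>y. ?\<kappa> (y - x)"
    have \<phi>: "?\<phi> \<in> test_functions UNIV" by (rule cube_bump_shift_test_function[OF \<delta>])
    \<comment> \<open>Two signs cancel: one from differentiating with respect to the centre x, one
      from the definition of the weak derivative.\<close>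
    have "?D x b = (LINT y|lebesgue. ?\<phi> y *\<^sub>R g b y)"
      using has_weak_derivative_singleton[OF g[OF b] \<phi>] by (simp only: frechet_derivative_shift[OF sm] minus_minus)
    also have "norm \<dots> \<le> (LINT y|lebesgue. ?\<phi> y * M)"
    proof (rule integral_norm_bound_integral_AE)
      have lg: "locally_integrable (g b)" using g[OF b] by (simp add: has_weak_derivative_def)
      show "integrable lebesgue (\<lambda>y. ?\<phi> y *\<^sub>R g b y)" by (rule integrable_test_function_scaleR[OF \<phi> lg])
      show "integrable lebesgue (\<lambda>y. ?\<phi> y * M)"
        using integrable_test_function_scaleR[OF \<phi> continuous_locally_integrable[of "\<lambda>_. M"]] by simp
      show "AE y in lebesgue. norm (?\<phi> y *\<^sub>R g b y) \<le> ?\<phi> y * M"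
        using M[OF b] by eventually_elim (auto simp: bump_nonneg intro!: mult_left_mono)
    qed
    also have "\<dots> = (LINT y|lborel. ?\<phi> y * M)"
      using test_function_measurable[OF \<phi>] by (intro integral_completion) simp
    also have "\<dots> = ?I * M"
      using integral_lborel_shift[of ?\<kappa> "- x"] \<delta> by simp
    finally show ?thesis .
  qed
  have "norm ((\<lambda>x. LINT y|lebesgue. ?\<kappa> (y - x) *\<^sub>R u y) x - (\<lambda>x. LINT y|lebesgue. ?\<kappa> (y - x) *\<^sub>R u y) x') \<le> (?I * (DIM('a) * M)) * norm (x - x')"
  proof (rule differentiable_bound[of UNIV _ ?D])
    show "((\<lambda>x. LINT y|lebesgue. ?\<kappa> (y - x) *\<^sub>R u y) has_derivative ?D x) (at x within UNIV)" for x
      using der by simp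
    show "onorm (?D x) \<le> ?I * (DIM('a) * M)" for x
    proof (rule onorm_le)
      fix h
      interpret bounded_linear "?D x" using der has_derivative_bounded_linear by blast
      have "norm (?D x h) = norm (?D x (\<Sum>b\<in>Basis. (h \<bullet> b) *\<^sub>R b))" by (simp only: euclidean_representation)
      also have "\<dots> = norm (\<Sum>b\<in>Basis. (h \<bullet> b) *\<^sub>R ?D x b)" by (simp only: sum scaleR)
      also have "\<dots> \<le> (\<Sum>b\<in>Basis. \<bar>h \<bullet> b\<bar> * norm (?D x b))"
        by (rule order_trans[OF norm_sum]) (simp only: norm_scaleR order_refl)
      also have "\<dots> \<le> (\<Sum>b\<in>(Basis::'a set). norm h * (?I * M))"
        using Db by (intro sum_mono mult_mono) (auto simp: Basis_le_norm)
      also have "\<dots> = ?I * (DIM('a) * M) * norm h" by simp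
      finally show "norm (?D x h) \<le> ?I * (DIM('a) * M) * norm h" .
    qed
  qed auto
  then show ?thesis by simp
qed

section \<open>Lipschitz representatives\<close>

lemma integrable_lborel_shift:
  fixes f :: "'a::euclidean_space \<Rightarrow> 'b::{banach, second_countable_topology}"
  assumes "integrable lborel f"
  shows "integrable lborel (\<lambda>x. f (x + a))"
proof -
  have "integrable (distr lborel borel ((+) a)) f" using assms by (simp add: lborel_distr_plus)
  then show ?thesis using borel_measurable_integrable[OF assms]
    by (subst (asm) integrable_distr_eq) (auto simp: add.commute)
qed

lemma integrable_lborel_reflect:
  fixes f :: "'a::euclidean_space \<Rightarrow> 'b::{banach, second_countable_topology}"
  assumes "integrable lborel f"
  shows "integrable lborel (\<lambda>x. f (a - x))"
proof -
  have "integrable (distr lborel borel (\<lambda>x. a - x)) f" using assms by (simp add: lborel_distr_reflect)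
  then show ?thesis using borel_measurable_integrable[OF assms]
    by (subst (asm) integrable_distr_eq) auto
qed

text \<open>The normalised mollifications \<open>w n\<close> share one Lipschitz constant. Two of
  them are compared through the double mollification, which does not depend on the order and lies
  close to both; hence they form a uniformly Cauchy sequence without any appeal to almost-everywhere
  convergence. The Lipschitz limit agrees with u when tested.\<close>

lemma weak_derivative_lipschitz:
  fixes u :: "'a::euclidean_space \<Rightarrow> 'b::euclidean_space" and M :: real
  assumes u: "locally_integrable u" and M0: "0 \<le> M"
    and g: "\<And>b. b \<in> Basis \<Longrightarrow> has_weak_derivative {#b#} u (g b)"
    and M: "\<And>b. b \<in> Basis \<Longrightarrow> AE x in lebesgue. norm (g b x) \<le> M"
  obtains w where "AE x in lebesgue. u x = w x"
    "\<And>x y. norm (w x - w y) \<le> DIM('a) * M * norm (x - y)"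
proof -
  define \<delta> where "\<delta> n = 1 / real (Suc n)" for n
  have \<delta>: "\<delta> n > 0" "\<delta> n \<le> 1" for n by (auto simp: \<delta>_def)
  have \<delta>lim: "\<delta> \<longlonglongrightarrow> 0" unfolding \<delta>_def using LIMSEQ_inverse_real_of_nat by (simp add: inverse_eq_divide)
  let ?\<kappa> = "\<lambda>n. cube_bump (\<delta> n) :: 'a \<Rightarrow> real"
  define I where "I n = bump_mass TYPE('a) (\<delta> n)" for n
  have I: "I n > 0" for n unfolding I_def by (intro bump_mass_pos \<delta>)
  define U where "U n x = (LINT y|lebesgue. ?\<kappa> n (y - x) *\<^sub>R u y)" for n x
  define w where "w n x = (1 / I n) *\<^sub>R U n x" for n x
  define K where "K = DIM('a) * M"
  have K: "K \<ge> 0" using M0 by (simp add: K_def)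
  have Ulip: "norm (U n x - U n y) \<le> I n * K * norm (x - y)" for n x y
    unfolding U_def I_def K_def by (rule mollification_lipschitz[OF u \<delta>(1) g M])
  have wlip: "norm (w n x - w n y) \<le> K * norm (x - y)" for n x y
  proof -
    have "norm (w n x - w n y) = (1 / I n) * norm (U n x - U n y)"
      using I[of n] by (simp add: w_def flip: scaleR_diff_right)
    also have "\<dots> \<le> (1 / I n) * (I n * K * norm (x - y))"
      using I[of n] Ulip by (intro mult_left_mono) auto
    finally show ?thesis using I[of n] by simp
  qed
  have wcont: "continuous_on S (w n)" for n S
  proof (rule lipschitz_on_continuous_on[of K])
    show "K-lipschitz_on S (w n)" using wlip K by (auto simp: lipschitz_on_def dist_norm)
  qed
  have Ucont: "continuous_on S (U n)" for n S
  proof -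
    have "U n = (\<lambda>x. I n *\<^sub>R w n x)" using I[of n] by (auto simp: w_def)
    then show ?thesis using wcont[of S n] by (simp add: continuous_on_scaleR)
  qed
  have shiftI: "(LINT x|lborel. ?\<kappa> n (x - p)) = I n" for n p
    using integral_lborel_shift[of "?\<kappa> n" "- p"] \<delta>(1)[of n] by (simp add: I_def)
  \<comment> \<open>Mollifying the Lipschitz function \<open>U n\<close> at scale
    \<open>\<delta> m\<close> moves it by at most its Lipschitz constant times the radius of the
    support. Both sides carry the mass \<open>I m\<close> since nothing is normalised.\<close>
  have approx: "norm (I m *\<^sub>R U n p - (LINT x|lborel. ?\<kappa> m (x - p) *\<^sub>R U n x)) \<le> I m * (I n * K * (DIM('a) * \<delta> m))" for m n p
  proof -
    let ?\<phi> = "\<lambda>x. ?\<kappa> m (x - p)"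
    have \<phi>: "?\<phi> \<in> test_functions UNIV" by (rule cube_bump_shift_test_function[OF \<delta>(1)])
    have i1: "integrable lborel (\<lambda>x. ?\<phi> x *\<^sub>R U n p)" using integrable_test_function[OF \<phi>] by simp
    have i2: "integrable lborel (\<lambda>x. ?\<phi> x *\<^sub>R U n x)"
      using integrable_test_function_scaleR[OF \<phi> continuous_locally_integrable[OF Ucont]] test_function_measurable[OF \<phi>]
        borel_measurable_continuous_onI[OF Ucont[of UNIV]]
      by (subst (asm) integrable_completion) auto
    have E: "I m *\<^sub>R U n p - (LINT x|lborel. ?\<phi> x *\<^sub>R U n x) = (LINT x|lborel. ?\<phi> x *\<^sub>R U n p - ?\<phi> x *\<^sub>R U n x)"
      using i1 i2 integral_scaleR_left[OF integrable_test_function[OF \<phi>], of "U n p"] shiftI[of m p] by simp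
    have "norm (I m *\<^sub>R U n p - (LINT x|lborel. ?\<phi> x *\<^sub>R U n x)) \<le> (LINT x|lborel. ?\<phi> x * (I n * K * (DIM('a) * \<delta> m)))"
      unfolding E
    proof (rule Bochner_Integration.integral_norm_bound_integral)
      fix x
      show "norm (?\<phi> x *\<^sub>R U n p - ?\<phi> x *\<^sub>R U n x) \<le> ?\<phi> x * (I n * K * (DIM('a) * \<delta> m))"
      proof (cases "?\<phi> x = 0")
        case False
        have "norm (?\<phi> x *\<^sub>R U n p - ?\<phi> x *\<^sub>R U n x) = ?\<phi> x * norm (U n p - U n x)"
          by (simp add: bump_nonneg flip: scaleR_diff_right)
        also have "\<dots> \<le> ?\<phi> x * (I n * K * (DIM('a) * \<delta> m))"
        proof (rule mult_left_mono[OF _ bump_nonneg])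
          have "norm (U n p - U n x) \<le> I n * K * norm (p - x)" by (rule Ulip)
          also have "\<dots> \<le> I n * K * (real DIM('a) * \<delta> m)"
            using cube_bump_support[OF \<delta>(1) False] I[of n] K by (intro mult_left_mono) (auto simp: norm_minus_commute)
          finally show "norm (U n p - U n x) \<le> I n * K * (real DIM('a) * \<delta> m)" .
        qed
        finally show ?thesis .
      qed (simp only: scaleR_zero_left, simp)
    qed (use i1 i2 integrable_test_function[OF \<phi>] in auto)
    also have "\<dots> = I m * (I n * K * (DIM('a) * \<delta> m))" using shiftI[of m p] by simp
    finally show ?thesis .
  qed
  have comm: "(LINT x|lborel. ?\<kappa> m (x - p) *\<^sub>R U n x) = (LINT x|lborel. ?\<kappa> n (x - p) *\<^sub>R U m x)" for m n p
  proof -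
    have "(LINT x|lborel. ?\<kappa> m (x - p) *\<^sub>R U n x) = (LINT y|lebesgue. (LINT x|lborel. ?\<kappa> m (x - p) * ?\<kappa> n (y - x)) *\<^sub>R u y)" for m n
      unfolding U_def by (rule mollify_Fubini[OF cube_bump_shift_test_function[OF \<delta>(1)] cube_bump_test_function[OF \<delta>(1)] u])
    \<comment> \<open>The substitution of y + p - x for x exchanges the two kernels.\<close>
    moreover have "(LINT x|lborel. ?\<kappa> m (x - p) * ?\<kappa> n (y - x)) = (LINT x|lborel. ?\<kappa> n (x - p) * ?\<kappa> m (y - x))" for y
    proof -
      have [measurable]: "?\<kappa> m \<in> borel_measurable borel" "?\<kappa> n \<in> borel_measurable borel" by (intro cube_bump_measurable \<delta>)+
      show ?thesis
        using integral_lborel_reflect[of "\<lambda>x. ?\<kappa> m (x - p) * ?\<kappa> n (y - x)" "y + p"] by (simp add: mult.commute algebra_simps)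
    qed
    ultimately show ?thesis by simp
  qed
  have wdiff: "norm (w n p - w m p) \<le> K * DIM('a) * (\<delta> n + \<delta> m)" for n m p
  proof -
    have "norm (I m *\<^sub>R U n p - I n *\<^sub>R U m p) \<le> I m * (I n * K * (DIM('a) * \<delta> m)) + I n * (I m * K * (DIM('a) * \<delta> n))"
      using norm_triangle_le_diff[OF add_mono[OF approx[of m n p] approx[of n m p]]] comm[of m p n] by simp
    moreover have "I m *\<^sub>R U n p - I n *\<^sub>R U m p = (I m * I n) *\<^sub>R (w n p - w m p)"
      using I[of n] I[of m] by (simp add: w_def scaleR_diff_right)
    moreover have "norm ((I m * I n) *\<^sub>R (w n p - w m p)) = (I m * I n) * norm (w n p - w m p)"
      using I[of n] I[of m] by (simp add: abs_mult)
    ultimately have "(I m * I n) * norm (w n p - w m p) \<le> I m * (I n * K * (DIM('a) * \<delta> m)) + I n * (I m * K * (DIM('a) * \<delta> n))"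
      by metis
    also have "\<dots> = (I m * I n) * (K * DIM('a) * (\<delta> n + \<delta> m))" by (simp add: algebra_simps)
    finally have "(I m * I n) * norm (w n p - w m p) \<le> (I m * I n) * (K * DIM('a) * (\<delta> n + \<delta> m))" .
    then show ?thesis using I[of n] I[of m] by simp
  qed
  have "Cauchy (\<lambda>n. w n p)" for p
  proof (rule metric_CauchyI)
    fix e :: real assume e: "e > 0"
    have "(\<lambda>n. K * DIM('a) * (\<delta> n + \<delta> n)) \<longlonglongrightarrow> K * DIM('a) * (0 + 0)" by (intro tendsto_intros \<delta>lim)
    then obtain N where N: "\<And>n. n \<ge> N \<Longrightarrow> K * DIM('a) * (\<delta> n + \<delta> n) < e"
      using order_tendstoD(2)[of _ 0 sequentially e] e by (auto simp: eventually_sequentially)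
    have dec: "\<delta> n \<le> \<delta> N" if "n \<ge> N" for n using that by (auto simp: \<delta>_def field_simps)
    have "dist (w m p) (w n p) < e" if "m \<ge> N" "n \<ge> N" for m n
    proof -
      have "norm (w m p - w n p) \<le> K * DIM('a) * (\<delta> m + \<delta> n)" by (rule wdiff)
      also have "\<dots> \<le> K * DIM('a) * (\<delta> N + \<delta> N)" using dec that K by (intro mult_left_mono add_mono) auto
      also have "\<dots> < e" by (rule N) simp
      finally show ?thesis by (simp add: dist_norm)
    qed
    then show "\<exists>M. \<forall>m\<ge>M. \<forall>n\<ge>M. dist (w m p) (w n p) < e" by blast
  qed
  then have "\<exists>l. (\<lambda>n. w n p) \<longlonglongrightarrow> l" for p using Cauchy_convergent convergent_def by blast
  then obtain v where v: "\<And>p. (\<lambda>n. w n p) \<longlonglongrightarrow> v p" by metis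
  have vlip: "norm (v x - v y) \<le> K * norm (x - y)" for x y
    by (rule tendsto_upperbound[OF tendsto_norm[OF tendsto_diff[OF v v]]]) (use wlip in auto)
  have vcont: "continuous_on UNIV v"
  proof (rule lipschitz_on_continuous_on[of K])
    show "K-lipschitz_on UNIV v" using vlip K by (auto simp: lipschitz_on_def dist_norm)
  qed
  have wv: "norm (w n p - v p) \<le> K * DIM('a) * \<delta> n" for n p
  proof (rule tendsto_upperbound)
    show "(\<lambda>m. norm (w n p - w m p) - K * DIM('a) * \<delta> m) \<longlonglongrightarrow> norm (w n p - v p)"
      using tendsto_diff[OF tendsto_norm[OF tendsto_diff[OF tendsto_const v[of p]]] tendsto_mult[OF tendsto_const \<delta>lim], of "w n p" "K * DIM('a)"] by simp
    show "\<forall>\<^sub>F m in sequentially. norm (w n p - w m p) - K * DIM('a) * \<delta> m \<le> K * DIM('a) * \<delta> n"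
      using wdiff[of n p] by (intro always_eventually allI) (simp add: algebra_simps)
  qed simp
  have vli: "locally_integrable v" by (rule continuous_locally_integrable[OF vcont])
  have "AE x in lebesgue. u x - v x = 0"
  proof (rule weak_zero[OF locally_integrable_diff[OF u vli]])
    fix \<phi> :: "'a \<Rightarrow> real" assume \<phi>: "\<phi> \<in> test_functions UNIV"
    note [measurable] = test_function_measurable[OF \<phi>]
    obtain R where R: "R > 0" "\<And>x. \<phi> x \<noteq> 0 \<Longrightarrow> norm x \<le> R" by (rule frechet_derivative_support[OF \<phi>]) blast
    obtain L where L: "L > 0" "\<And>x y. \<bar>\<phi> x - \<phi> y\<bar> \<le> L * norm (x - y)" by (rule test_function_lipschitz[OF \<phi>]) blast
    let ?R = "R + DIM('a)"
    define A where "A = (LINT y|lebesgue. norm (indicator (cball 0 ?R) y *\<^sub>R u y))"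
    define P where "P = (LINT y|lborel. \<bar>\<phi> y\<bar>)"
    have iA: "integrable lebesgue (\<lambda>y. norm (indicator (cball 0 ?R) y *\<^sub>R u y))"
      using u unfolding locally_integrable_def set_integrable_def by (intro integrable_norm) auto
    have iu: "integrable lebesgue (\<lambda>x. \<phi> x *\<^sub>R u x)" and iv: "integrable lebesgue (\<lambda>x. \<phi> x *\<^sub>R v x)"
      by (rule integrable_test_function_scaleR[OF \<phi> u] integrable_test_function_scaleR[OF \<phi> vli])+
    \<comment> \<open>With \<psi> the mollified test function, testing \<open>w n\<close> against
      \<phi> equals testing u against \<psi>. Hence the defect splits into (\<phi> - \<psi>) u and
      \<phi> (w n - v), and each part is of order \<open>\<delta> n\<close>.\<close>
    have bound: "norm (LINT x|lebesgue. \<phi> x *\<^sub>R (u x - v x)) \<le> \<delta> n * (L * DIM('a) * A + K * DIM('a) * P)" for n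
    proof -
      define \<psi> where "\<psi> y = (1 / I n) * (LINT x|lborel. \<phi> x * ?\<kappa> n (y - x))" for y
      have [measurable]: "?\<kappa> n \<in> borel_measurable borel" by (intro cube_bump_measurable \<delta>)
      have ik: "integrable lborel (\<lambda>x. ?\<kappa> n (y - x))" for y
        by (intro integrable_lborel_reflect integrable_test_function[OF cube_bump_test_function[OF \<delta>(1)]])
      have kI: "(LINT x|lborel. ?\<kappa> n (y - x)) = I n" for y
        by (subst integral_lborel_reflect) (auto simp: I_def)
      have \<psi>\<phi>: "\<bar>\<psi> y - \<phi> y\<bar> \<le> L * (DIM('a) * \<delta> n)" for y
      proof -
        have i: "integrable lborel (\<lambda>x. \<phi> x * ?\<kappa> n (y - x))"
        proof (rule Bochner_Integration.integrable_bound[OF integrable_test_function[OF \<phi>]])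
          show "AE x in lborel. norm (\<phi> x * ?\<kappa> n (y - x)) \<le> norm (\<phi> x)"
            by (intro AE_I2) (auto simp: abs_mult bump_nonneg bump_le_1 intro!: mult_left_le)
        qed simp
        have "I n * \<psi> y - I n * \<phi> y = (LINT x|lborel. \<phi> x * ?\<kappa> n (y - x)) - (LINT x|lborel. \<phi> y * ?\<kappa> n (y - x))"
          using I[of n] kI by (simp add: \<psi>_def)
        also have "\<dots> = (LINT x|lborel. \<phi> x * ?\<kappa> n (y - x) - \<phi> y * ?\<kappa> n (y - x))"
          by (rule Bochner_Integration.integral_diff[symmetric]) (use i ik in auto)
        finally have E: "I n * \<psi> y - I n * \<phi> y = (LINT x|lborel. \<phi> x * ?\<kappa> n (y - x) - \<phi> y * ?\<kappa> n (y - x))" .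
        have "norm (I n * \<psi> y - I n * \<phi> y) \<le> (LINT x|lborel. L * (DIM('a) * \<delta> n) * ?\<kappa> n (y - x))"
          unfolding E
        proof (rule Bochner_Integration.integral_norm_bound_integral)
          fix x
          show "norm (\<phi> x * ?\<kappa> n (y - x) - \<phi> y * ?\<kappa> n (y - x)) \<le> L * (DIM('a) * \<delta> n) * ?\<kappa> n (y - x)"
          proof (cases "?\<kappa> n (y - x) = 0")
            case False
            have "norm (\<phi> x * ?\<kappa> n (y - x) - \<phi> y * ?\<kappa> n (y - x)) = \<bar>\<phi> x - \<phi> y\<bar> * ?\<kappa> n (y - x)"
              by (simp add: abs_mult bump_nonneg flip: left_diff_distrib)
            also have "\<dots> \<le> L * (DIM('a) * \<delta> n) * ?\<kappa> n (y - x)"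
            proof (rule mult_right_mono[OF _ bump_nonneg])
              have "\<bar>\<phi> x - \<phi> y\<bar> \<le> L * norm (x - y)" by (rule L(2))
              also have "\<dots> \<le> L * (DIM('a) * \<delta> n)"
                using cube_bump_support[OF \<delta>(1) False] L(1) by (intro mult_left_mono) (auto simp: norm_minus_commute)
              finally show "\<bar>\<phi> x - \<phi> y\<bar> \<le> L * (DIM('a) * \<delta> n)" .
            qed
            finally show ?thesis .
          qed (simp only: mult_zero_right diff_self norm_zero order_refl)
        qed (use i ik in auto)
        also have "\<dots> = L * (DIM('a) * \<delta> n) * I n" using kI by simp
        finally have "I n * \<bar>\<psi> y - \<phi> y\<bar> \<le> I n * (L * (DIM('a) * \<delta> n))"
          using I[of n] by (simp add: mult_ac abs_mult flip: right_diff_distrib)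
        then show ?thesis using I[of n] by simp
      qed
      have \<psi>supp: "norm y \<le> ?R" if "\<psi> y \<noteq> 0" for y
      proof (rule ccontr)
        assume c: "\<not> norm y \<le> ?R"
        have Z: "\<phi> x * ?\<kappa> n (y - x) = 0" for x
        proof (rule ccontr)
          assume "\<phi> x * ?\<kappa> n (y - x) \<noteq> 0"
          then have "norm x \<le> R" "norm (y - x) \<le> DIM('a) * \<delta> n" using R(2) cube_bump_support[OF \<delta>(1)] by auto
          moreover have "real DIM('a) * \<delta> n \<le> real DIM('a) * 1" using \<delta> by (intro mult_left_mono) auto
          ultimately show False using c norm_triangle_sub[of y x] by auto
        qed
        have "\<psi> y = 0" by (simp only: \<psi>_def Z) simp
        with that show False ..
      qed
      have \<psi>m: "\<psi> \<in> borel_measurable borel" unfolding \<psi>_def by measurable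
      have i\<psi>: "integrable lebesgue (\<lambda>y. (\<phi> y - \<psi> y) *\<^sub>R u y)"
      proof (rule locally_integrable_mult[OF u])
        show "(\<lambda>y. \<phi> y - \<psi> y) \<in> borel_measurable lebesgue" using \<psi>m by (intro measurable_completion) simp
        show "\<bar>\<phi> y - \<psi> y\<bar> \<le> L * (DIM('a) * \<delta> n)" for y using \<psi>\<phi>[of y] by simp
        show "norm y \<le> ?R" if "\<phi> y - \<psi> y \<noteq> 0" for y using that R(2)[of y] \<psi>supp[of y] by (cases "\<phi> y = 0") auto
      qed
      have e1: "norm (LINT y|lebesgue. (\<phi> y - \<psi> y) *\<^sub>R u y) \<le> (LINT y|lebesgue. L * (DIM('a) * \<delta> n) * norm (indicator (cball 0 ?R) y *\<^sub>R u y))"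
      proof (rule Bochner_Integration.integral_norm_bound_integral[OF i\<psi>])
        fix y
        show "norm ((\<phi> y - \<psi> y) *\<^sub>R u y) \<le> L * (DIM('a) * \<delta> n) * norm (indicator (cball 0 ?R) y *\<^sub>R u y)"
        proof (cases "norm y \<le> ?R")
          case True
          then show ?thesis using \<psi>\<phi>[of y] by (auto intro!: mult_right_mono)
        next
          case False
          then have "\<phi> y = 0" "\<psi> y = 0" using R(2)[of y] \<psi>supp[of y] by auto
          then show ?thesis using L(1) \<delta>(1)[of n] by (auto intro!: mult_nonneg_nonneg less_imp_le)
        qed
      qed (use iA in auto)
      have "(LINT x|lborel. \<phi> x *\<^sub>R w n x) = (1 / I n) *\<^sub>R (LINT x|lborel. \<phi> x *\<^sub>R U n x)"
        unfolding w_def by (subst integral_scaleR_right[symmetric]) (simp add: mult.commute)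
      also have "\<dots> = (LINT y|lebesgue. \<psi> y *\<^sub>R u y)"
        unfolding U_def mollify_Fubini[OF \<phi> cube_bump_test_function[OF \<delta>(1)] u] \<psi>_def
        by (subst integral_scaleR_right[symmetric]) simp
      finally have eq: "(LINT x|lborel. \<phi> x *\<^sub>R w n x) = (LINT y|lebesgue. \<psi> y *\<^sub>R u y)" .
      have iw: "integrable lebesgue (\<lambda>x. \<phi> x *\<^sub>R w n x)"
        by (rule integrable_test_function_scaleR[OF \<phi> continuous_locally_integrable[OF wcont]])
      have [measurable]: "w n \<in> borel_measurable borel" "v \<in> borel_measurable borel"
        by (intro borel_measurable_continuous_onI wcont vcont)+
      have e2: "norm (LINT x|lebesgue. \<phi> x *\<^sub>R w n x - \<phi> x *\<^sub>R v x) \<le> (LINT x|lebesgue. K * DIM('a) * \<delta> n * \<bar>\<phi> x\<bar>)"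
      proof (rule Bochner_Integration.integral_norm_bound_integral)
        show "norm (\<phi> x *\<^sub>R w n x - \<phi> x *\<^sub>R v x) \<le> K * DIM('a) * \<delta> n * \<bar>\<phi> x\<bar>" for x
          using mult_left_mono[OF wv[of n x], of "\<bar>\<phi> x\<bar>"] by (simp add: mult_ac flip: scaleR_diff_right)
        show "integrable lebesgue (\<lambda>x. K * DIM('a) * \<delta> n * \<bar>\<phi> x\<bar>)"
          using integrable_test_function[OF \<phi>] by (subst integrable_completion) auto
      qed (use iw iv in auto)
      have "(LINT x|lebesgue. \<phi> x *\<^sub>R (u x - v x)) = (LINT x|lebesgue. \<phi> x *\<^sub>R u x) - (LINT x|lebesgue. \<phi> x *\<^sub>R v x)"
        using iu iv by (simp add: scaleR_diff_right)
      also have "\<dots> = (LINT y|lebesgue. (\<phi> y - \<psi> y) *\<^sub>R u y) + (LINT x|lebesgue. \<phi> x *\<^sub>R w n x - \<phi> x *\<^sub>R v x)"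
      proof -
        have "integrable lebesgue (\<lambda>y. \<psi> y *\<^sub>R u y)"
          using Bochner_Integration.integrable_diff[OF iu i\<psi>] by (simp add: scaleR_diff_left)
        moreover have "(LINT x|lebesgue. \<phi> x *\<^sub>R w n x) = (LINT x|lborel. \<phi> x *\<^sub>R w n x)"
          by (intro integral_completion) simp
        ultimately show ?thesis using iw iv iu eq by (simp add: scaleR_diff_left)
      qed
      finally have E: "(LINT x|lebesgue. \<phi> x *\<^sub>R (u x - v x)) = (LINT y|lebesgue. (\<phi> y - \<psi> y) *\<^sub>R u y) + (LINT x|lebesgue. \<phi> x *\<^sub>R w n x - \<phi> x *\<^sub>R v x)" .
      have "norm (LINT x|lebesgue. \<phi> x *\<^sub>R (u x - v x)) \<le> (LINT y|lebesgue. L * (DIM('a) * \<delta> n) * norm (indicator (cball 0 ?R) y *\<^sub>R u y)) + (LINT x|lebesgue. K * DIM('a) * \<delta> n * \<bar>\<phi> x\<bar>)"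
        unfolding E by (rule norm_triangle_le[OF add_mono[OF e1 e2]])
      also have "\<dots> = \<delta> n * (L * DIM('a) * A + K * DIM('a) * P)"
      proof -
        have "(LINT x|lebesgue. K * DIM('a) * \<delta> n * \<bar>\<phi> x\<bar>) = (LINT x|lborel. K * DIM('a) * \<delta> n * \<bar>\<phi> x\<bar>)"
          by (intro integral_completion) simp
        then show ?thesis by (simp add: A_def P_def algebra_simps)
      qed
      finally show ?thesis .
    qed
    have "(\<lambda>n. \<delta> n * (L * DIM('a) * A + K * DIM('a) * P)) \<longlonglongrightarrow> 0 * (L * DIM('a) * A + K * DIM('a) * P)"
      by (intro tendsto_intros \<delta>lim)
    then have "norm (LINT x|lebesgue. \<phi> x *\<^sub>R (u x - v x)) \<le> 0 * (L * DIM('a) * A + K * DIM('a) * P)"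
      by (rule tendsto_lowerbound) (use bound in auto)
    then show "(LINT x|lebesgue. \<phi> x *\<^sub>R (u x - v x)) = 0" by simp
  qed
  then have "AE x in lebesgue. u x = v x" by eventually_elim simp
  with vlip show ?thesis using that by (simp add: K_def)
qed

text \<open>An infimum strictly below c is undercut by some actual weak derivative. For this reason
  the assumed bounds are doubled later on, which turns them into strict ones.\<close>

lemma weak_derivative_norm_lessE:
  assumes "weak_derivative_norm N m u < c"
  obtains g where "has_weak_derivative m u g" "N (\<lambda>x. ennreal (norm (g x))) < c"
  using assms unfolding weak_derivative_norm_def by (auto simp: INF_less_iff)

lemma Linf_lessD:
  assumes "Linf M (\<lambda>x. ennreal (norm (g x))) < ennreal c" "0 \<le> c"
  shows "AE x in M. norm (g x) \<le> c"
proof -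
  have "AE x in M. ennreal (norm (g x)) \<le> Linf M (\<lambda>x. ennreal (norm (g x)))"
    unfolding Linf_def by (rule esssup_AE)
  then show ?thesis
  proof eventually_elim
    case (elim x)
    then have "ennreal (norm (g x)) \<le> ennreal c" using assms(1) by order
    then show ?case using assms(2) by (simp add: ennreal_le_iff)
  qed
qed

lemma sobolev_norm_1:
  fixes u :: "'a::euclidean_space \<Rightarrow> 'b::euclidean_space"
  shows "weak_derivative_norm N {#} u \<le> sobolev_norm N 1 u"
    "b \<in> Basis \<Longrightarrow> weak_derivative_norm N {#b#} u \<le> sobolev_norm N 1 u"
  unfolding sobolev_norm_def
  by (intro member_le_sum finite_multi_indices; simp add: multi_indices_def)+

lemma sobolev_Linf_lipschitz:
  fixes u :: "'a::euclidean_space \<Rightarrow> 'b::euclidean_space" and c :: real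
  assumes "sobolev_norm (Linf lebesgue) 1 u < ennreal c"
  obtains w where "AE x in lebesgue. u x = w x" "\<And>x. norm (w x) \<le> c"
    "\<And>x y. norm (w x - w y) \<le> DIM('a) * c * norm (x - y)"
proof -
  have c: "c \<ge> 0" using assms by (metis ennreal_neg linorder_not_le not_less_zero order_less_imp_le)
  have "weak_derivative_norm (Linf lebesgue) {#} u < ennreal c"
    using sobolev_norm_1(1) assms by (rule order.strict_trans1)
  then obtain g0 where g0: "has_weak_derivative {#} u g0" "Linf lebesgue (\<lambda>x. ennreal (norm (g0 x))) < ennreal c"
    by (rule weak_derivative_norm_lessE)
  have "\<exists>g. has_weak_derivative {#b#} u g \<and> Linf lebesgue (\<lambda>x. ennreal (norm (g x))) < ennreal c" if "b \<in> Basis" for b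
  proof -
    have "weak_derivative_norm (Linf lebesgue) {#b#} u < ennreal c"
      using sobolev_norm_1(2)[OF that] assms by (rule order.strict_trans1)
    then show ?thesis by (rule weak_derivative_norm_lessE) blast
  qed
  then obtain g where g: "\<And>b. b \<in> Basis \<Longrightarrow> has_weak_derivative {#b#} u (g b)"
    "\<And>b. b \<in> Basis \<Longrightarrow> Linf lebesgue (\<lambda>x. ennreal (norm (g b x))) < ennreal c" by metis
  have u: "locally_integrable u" using g0 by (simp add: has_weak_derivative_def)
  obtain w where w: "AE x in lebesgue. u x = w x" "\<And>x y. norm (w x - w y) \<le> DIM('a) * c * norm (x - y)"
    by (rule weak_derivative_lipschitz[OF u c g(1) Linf_lessD[OF g(2) c]]) auto
  have "continuous_on UNIV w"
  proof (rule lipschitz_on_continuous_on[of "DIM('a) * c"])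
    show "(DIM('a) * c)-lipschitz_on UNIV w" using w(2) c by (auto simp: lipschitz_on_def dist_norm)
  qed
  moreover have "AE x in lebesgue. norm (w x) \<le> c"
    using weak_derivative_empty_AE[OF g0(1)] Linf_lessD[OF g0(2) c] w(1) by eventually_elim simp
  ultimately have "norm (w x) \<le> c" for x by (rule AE_continuous_le[rotated])
  with w that show ?thesis by blast
qed

section \<open>The Riesz kernel\<close>

text \<open>Away from the origin this is the gradient of the potential without its factor -(lam
  \<alpha>). At the origin it is 0, which makes it a total Borel function.\<close>

definition riesz_kernel :: "real \<Rightarrow> 'a::euclidean_space \<Rightarrow> 'a" where
  "riesz_kernel \<alpha> x = norm x powr (- (\<alpha> + 2)) *\<^sub>R x"

lemma norm_riesz_kernel: "norm (riesz_kernel \<alpha> x) = norm x powr (- (\<alpha> + 1))"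
proof (cases "x = 0")
  case False
  have "norm x powr (- (\<alpha> + 2)) * norm x powr 1 = norm x powr (- (\<alpha> + 1))"
    by (subst powr_add[symmetric], rule arg_cong2[where f = "(powr)"]) simp_all
  then show ?thesis using False by (simp add: riesz_kernel_def)
qed (simp add: riesz_kernel_def)

lemma riesz_kernel_measurable [measurable]: "riesz_kernel \<alpha> \<in> borel_measurable borel"
  unfolding riesz_kernel_def by measurable

lemma riesz_kernel_scale: "t > 0 \<Longrightarrow> riesz_kernel \<alpha> (t *\<^sub>R x) = t powr (- (\<alpha> + 1)) *\<^sub>R riesz_kernel \<alpha> x"
proof -
  assume t: "t > 0"
  have "t powr (- (\<alpha> + 2)) * t powr 1 = t powr (- (\<alpha> + 1))"
    by (subst powr_add[symmetric], rule arg_cong2[where f = "(powr)"]) simp_all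
  then show ?thesis using t by (simp add: riesz_kernel_def powr_mult mult_ac)
qed

text \<open>Write the difference as |a|^(-\<beta>) (a - b) plus (|a|^(-\<beta>) - |b|^(-\<beta>)) b
  with \<beta> = \<alpha> + 2. The first part contributes 1, and the mean value theorem for the
  power, evaluated at the smaller radius |b|, contributes \<beta>; together \<alpha> + 3.\<close>

lemma riesz_kernel_diff_aux:
  fixes a b :: "'a::euclidean_space"
  assumes "\<alpha> > 0" "a \<noteq> 0" "b \<noteq> 0" "norm b \<le> norm a"
  shows "norm (riesz_kernel \<alpha> a - riesz_kernel \<alpha> b) \<le> (\<alpha> + 3) * norm (a - b) * norm b powr (- (\<alpha> + 2))"
proof -
  let ?\<beta> = "\<alpha> + 2"
  have b: "norm b > 0" using assms by simp
  have 1: "\<bar>norm a powr (- ?\<beta>) - norm b powr (- ?\<beta>)\<bar> \<le> ?\<beta> * norm b powr (- ?\<beta> - 1) * \<bar>norm a - norm b\<bar>"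
  proof -
    have "norm (norm a powr (- ?\<beta>) - norm b powr (- ?\<beta>)) \<le> (?\<beta> * norm b powr (- ?\<beta> - 1)) * norm (norm a - norm b)"
    proof (rule field_differentiable_bound[of "{norm b..}" "\<lambda>r. r powr (- ?\<beta>)" "\<lambda>r. - ?\<beta> * r powr (- ?\<beta> - 1)"])
      show "((\<lambda>r. r powr (- ?\<beta>)) has_field_derivative - ?\<beta> * r powr (- ?\<beta> - 1)) (at r within {norm b..})" if "r \<in> {norm b..}" for r
      proof -
        have "r > 0" using that b by (metis atLeast_iff order_less_le_trans)
        then show ?thesis by (intro DERIV_subset[OF has_real_derivative_powr]) auto
      qed
      show "norm (- ?\<beta> * r powr (- ?\<beta> - 1)) \<le> ?\<beta> * norm b powr (- ?\<beta> - 1)" if "r \<in> {norm b..}" for r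
      proof -
        have "r powr (- ?\<beta> - 1) \<le> norm b powr (- ?\<beta> - 1)" by (rule powr_mono2') (use that b assms(1) in auto)
        then have "?\<beta> * r powr (- ?\<beta> - 1) \<le> ?\<beta> * norm b powr (- ?\<beta> - 1)" using assms(1) by (intro mult_left_mono) auto
        moreover have "\<bar>- ?\<beta>\<bar> = ?\<beta>" using assms(1) by simp
        then have "norm (- ?\<beta> * r powr (- ?\<beta> - 1)) = ?\<beta> * r powr (- ?\<beta> - 1)"
          by (simp only: abs_mult real_norm_def abs_of_nonneg[OF powr_ge_zero])
        ultimately show ?thesis by (simp only:)
      qed
    qed (use assms in auto)
    then show ?thesis by simp
  qed
  have p: "norm b powr (- ?\<beta> - 1) * norm b = norm b powr (- ?\<beta>)"
  proof -
    have "norm b powr (- ?\<beta> - 1) * norm b powr 1 = norm b powr (- ?\<beta>)" by (subst powr_add[symmetric], rule arg_cong2[where f = "(powr)"]) simp_all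
    then show ?thesis using b by simp
  qed
  have "riesz_kernel \<alpha> a - riesz_kernel \<alpha> b = norm a powr (- ?\<beta>) *\<^sub>R (a - b) + (norm a powr (- ?\<beta>) - norm b powr (- ?\<beta>)) *\<^sub>R b"
    by (simp add: riesz_kernel_def algebra_simps)
  also have "norm \<dots> \<le> norm a powr (- ?\<beta>) * norm (a - b) + \<bar>norm a powr (- ?\<beta>) - norm b powr (- ?\<beta>)\<bar> * norm b"
    by (rule norm_triangle_le) simp
  also have "\<dots> \<le> norm b powr (- ?\<beta>) * norm (a - b) + (?\<beta> * norm b powr (- ?\<beta> - 1) * norm (a - b)) * norm b"
  proof (intro add_mono mult_right_mono order_trans[OF 1])
    show "norm a powr (- ?\<beta>) \<le> norm b powr (- ?\<beta>)" using assms b by (intro powr_mono2') auto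
    show "?\<beta> * norm b powr (- ?\<beta> - 1) * \<bar>norm a - norm b\<bar> \<le> ?\<beta> * norm b powr (- ?\<beta> - 1) * norm (a - b)"
      using assms(1) by (intro mult_left_mono norm_triangle_ineq3) auto
  qed auto
  also have "(?\<beta> * norm b powr (- ?\<beta> - 1) * norm (a - b)) * norm b = ?\<beta> * norm (a - b) * (norm b powr (- ?\<beta> - 1) * norm b)"
    by (simp only: mult_ac)
  also have "norm b powr (- ?\<beta>) * norm (a - b) + ?\<beta> * norm (a - b) * (norm b powr (- ?\<beta> - 1) * norm b) = (\<alpha> + 3) * norm (a - b) * norm b powr (- ?\<beta>)"
    unfolding p by (simp add: algebra_simps)
  finally show ?thesis .
qed

lemma riesz_kernel_diff:
  fixes a b :: "'a::euclidean_space"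
  assumes "\<alpha> > 0" "a \<noteq> 0" "b \<noteq> 0"
  shows "norm (riesz_kernel \<alpha> a - riesz_kernel \<alpha> b)
    \<le> (\<alpha> + 3) * norm (a - b) * (norm a powr (- (\<alpha> + 2)) + norm b powr (- (\<alpha> + 2)))"
proof (cases "norm b \<le> norm a")
  case True
  have "(\<alpha> + 3) * norm (a - b) * norm b powr (- (\<alpha> + 2)) \<le> (\<alpha> + 3) * norm (a - b) * (norm a powr (- (\<alpha> + 2)) + norm b powr (- (\<alpha> + 2)))"
    using assms(1) by (intro mult_left_mono) auto
  with riesz_kernel_diff_aux[OF assms True] show ?thesis by simp
next
  case False
  have "(\<alpha> + 3) * norm (a - b) * norm a powr (- (\<alpha> + 2)) \<le> (\<alpha> + 3) * norm (a - b) * (norm a powr (- (\<alpha> + 2)) + norm b powr (- (\<alpha> + 2)))"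
    using assms(1) by (intro mult_left_mono) auto
  with riesz_kernel_diff_aux[OF assms(1,3,2)] False show ?thesis by (simp add: norm_minus_commute)
qed

lemma grad_riesz_potential:
  fixes x :: "real^3"
  assumes "x \<noteq> 0"
  shows "grad (riesz_potential lam \<alpha>) x = - (lam * \<alpha>) *\<^sub>R riesz_kernel \<alpha> x"
proof -
  have nx: "norm x > 0" using assms by simp
  have "((\<lambda>x. lam * norm x powr (- \<alpha>)) has_derivative (\<lambda>h. lam * ((h \<bullet> sgn x) * (- \<alpha> * norm x powr (- \<alpha> - 1))))) (at x)"
  proof (intro has_derivative_mult_right)
    have "((\<lambda>r. r powr (- \<alpha>)) has_derivative (\<lambda>h. h * (- \<alpha> * norm x powr (- \<alpha> - 1)))) (at (norm x))"
      using has_real_derivative_powr[OF nx, of "- \<alpha>"] unfolding has_field_derivative_def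
      by (rule has_derivative_eq_rhs) (auto simp: fun_eq_iff)
    from has_derivative_compose[OF has_derivative_norm[OF assms] this]
    show "((\<lambda>x. norm x powr - \<alpha>) has_derivative (\<lambda>h. h \<bullet> sgn x * (- \<alpha> * norm x powr (- \<alpha> - 1)))) (at x)"
      by (simp add: inner_commute)
  qed
  then have "frechet_derivative (riesz_potential lam \<alpha>) (at x) = (\<lambda>h. lam * ((h \<bullet> sgn x) * (- \<alpha> * norm x powr (- \<alpha> - 1))))"
    unfolding riesz_potential_def[abs_def] by (rule frechet_derivative_at[symmetric])
  then have "grad (riesz_potential lam \<alpha>) x = (\<Sum>b\<in>Basis. (lam * (- \<alpha> * norm x powr (- \<alpha> - 1))) *\<^sub>R ((sgn x \<bullet> b) *\<^sub>R b))"
    by (simp add: grad_def inner_commute mult_ac)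
  also have "\<dots> = (lam * (- \<alpha> * norm x powr (- \<alpha> - 1))) *\<^sub>R sgn x"
    unfolding scaleR_sum_right[symmetric] euclidean_representation ..
  also have "\<dots> = - (lam * \<alpha>) *\<^sub>R riesz_kernel \<alpha> x"
  proof -
    have "norm x powr (- \<alpha> - 1) * inverse (norm x) = norm x powr (- (\<alpha> + 2))"
    proof -
      have "norm x powr (- \<alpha> - 1) * norm x powr (- 1) = norm x powr (- (\<alpha> + 2))"
        by (subst powr_add[symmetric], rule arg_cong2[where f = "(powr)"]) simp_all
      then show ?thesis using nx by (simp only: powr_minus powr_one norm_ge_zero)
    qed
    then show ?thesis by (simp add: riesz_kernel_def sgn_div_norm mult_ac)
  qed
  finally show ?thesis .
qed

text \<open>For r below s take the shell s/2^(k+1) \<le> r < s/2^k: the inner radius determines the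
  power, hence \<open>Suc k\<close> in the coefficient, and the outer radius the indicator, hence
  \<open>k\<close>. At r = 0 the left side is 0 by the convention for \<open>powr\<close>.\<close>

lemma dyadic_bound:
  fixes r s q :: real
  assumes "s > 0" "q > 0" "r \<ge> 0"
  shows "ennreal (r powr (- q)) \<le> ennreal (s powr (- q)) *
    (1 + (\<Sum>k. ennreal (2 powr (real (Suc k) * q)) * indicator {..<s / 2 ^ k} r))"
proof (cases "r \<ge> s")
  case True
  then have "ennreal (r powr (- q)) \<le> ennreal (s powr (- q)) * 1"
    using assms by (auto intro!: ennreal_leI powr_mono2')
  also have "\<dots> \<le> ennreal (s powr (- q)) * (1 + (\<Sum>k. ennreal (2 powr (real (Suc k) * q)) * indicator {..<s / 2 ^ k} r))"
    by (intro mult_left_mono) auto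
  finally show ?thesis .
next
  case rs: False
  show ?thesis
  proof (cases "r = 0")
    case False
    with assms have r: "r > 0" by simp
    have "\<exists>n. s / 2 ^ n \<le> r"
    proof -
      obtain n where "s / r < 2 ^ n" using real_arch_pow[of 2 "s / r"] by auto
      then show ?thesis using r by (intro exI[of _ n]) (simp add: field_simps)
    qed
    then obtain k where k: "s / 2 ^ Suc k \<le> r" "\<not> s / 2 ^ k \<le> r"
      using ex_least_nat_less[of "\<lambda>n. s / 2 ^ n \<le> r"] rs by auto
    have "r powr (- q) \<le> (s / 2 ^ Suc k) powr (- q)"
      using k assms by (intro powr_mono2') auto
    also have "\<dots> = s powr (- q) * 2 powr (real (Suc k) * q)"
    proof -
      have "(2 ^ Suc k) powr (- q) = 2 powr (- (real (Suc k) * q))"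
        by (subst powr_realpow[symmetric]) (auto simp: powr_powr simp del: of_nat_Suc power_Suc)
      then show ?thesis using assms by (simp add: powr_divide powr_minus field_simps del: power_Suc of_nat_Suc)
    qed
    finally have "ennreal (r powr (- q)) \<le> ennreal (s powr (- q)) * (ennreal (2 powr (real (Suc k) * q)) * indicator {..<s / 2 ^ k} r)"
      using k by (simp add: ennreal_mult[symmetric] ennreal_leI del: of_nat_Suc)
    also have "\<dots> \<le> ennreal (s powr (- q)) * (1 + (\<Sum>k. ennreal (2 powr (real (Suc k) * q)) * indicator {..<s / 2 ^ k} r))"
    proof (intro mult_left_mono)
      let ?f = "\<lambda>k. ennreal (2 powr (real (Suc k) * q)) * indicator {..<s / 2 ^ k} r"
      have "?f k \<le> sum ?f {..k}" by (rule member_le_sum) auto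
      also have "\<dots> \<le> suminf ?f" by (rule sum_le_suminf) auto
      also have "\<dots> \<le> 1 + suminf ?f" by simp
      finally show "?f k \<le> 1 + suminf ?f" .
    qed auto
    finally show ?thesis .
  qed simp
qed

text \<open>The kernel is integrable against the image of a bounded density under any expanding map: the
  sublevel set \<open>\<bar>p - Y v\<bar> < s 2\<^sup>-\<^sup>k\<close> has diameter at most \<open>2 s 2\<^sup>-\<^sup>k / c\<close>, and the dyadic
  series converges for \<open>q\<close> below the dimension.\<close>

lemma expanding_density_bound:
  fixes q :: real
  assumes q: "0 < q" "q < DIM('a::euclidean_space)"
  obtains C :: real where "C > 0"
    "\<And>(Y :: 'a \<Rightarrow> 'a) g m p s c. \<lbrakk>Y \<in> borel_measurable borel; g \<in> borel_measurable borel; 0 < s; 0 < c; 0 \<le> m;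
       \<And>v v'. c * norm (v - v') \<le> norm (Y v - Y v'); \<And>v. g v \<le> ennreal m\<rbrakk> \<Longrightarrow>
     (\<integral>\<^sup>+ v. g v * ennreal (norm (p - Y v) powr (- q)) \<partial>lborel)
       \<le> ennreal (s powr (- q)) * ((\<integral>\<^sup>+ v. g v \<partial>lborel) + ennreal (C * m * (s / c) ^ DIM('a)))"
proof -
  let ?d = "DIM('a)"
  define \<omega> where "\<omega> = unit_ball_vol (real ?d)"
  have \<omega>: "\<omega> > 0" by (simp add: \<omega>_def)
  \<comment> \<open>The ratio of consecutive dyadic terms: the power grows by 2^q, the volume
    shrinks by 2^(-d), and q < d makes the series converge.\<close>
  define \<theta> where "\<theta> = 2 powr (q - ?d)"
  have \<theta>: "0 < \<theta>" "\<theta> < 1" using q by (auto simp: \<theta>_def powr_less_one)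
  \<comment> \<open>The unit ball volume and 2^d come from a ball of radius 2 s 2^(-k) / c, the
    factor 2^q from the inner radius of the shells, and 1 / (1 - \<theta>) is the geometric
    sum.\<close>
  define C where "C = \<omega> * 2 ^ ?d * 2 powr q / (1 - \<theta>)"
  have C: "C > 0" using \<omega> \<theta> by (simp add: C_def)
  have "(\<integral>\<^sup>+ v. g v * ennreal (norm (p - Y v) powr (- q)) \<partial>lborel)
       \<le> ennreal (s powr (- q)) * ((\<integral>\<^sup>+ v. g v \<partial>lborel) + ennreal (C * m * (s / c) ^ ?d))"
    if Y[measurable]: "Y \<in> borel_measurable borel" and g[measurable]: "g \<in> borel_measurable borel"
      and s: "0 < s" and c: "0 < c" and m: "0 \<le> m"
      and exp: "\<And>v v'. c * norm (v - v') \<le> norm (Y v - Y v')" and gm: "\<And>v. g v \<le> ennreal m"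
    for Y :: "'a \<Rightarrow> 'a" and g m p s c
  proof -
    let ?S = "\<lambda>k. {v. norm (p - Y v) < s / 2 ^ k}"
    have meas_S [measurable]: "?S k \<in> sets borel" for k by measurable
    have S: "emeasure lborel (?S k) \<le> ennreal (\<omega> * (2 * (s / 2 ^ k) / c) ^ ?d)" for k
    proof (cases "?S k = {}")
      case False
      then obtain v0 where v0: "norm (p - Y v0) < s / 2 ^ k" by auto
      have "?S k \<subseteq> cball v0 (2 * (s / 2 ^ k) / c)"
      proof
        fix v assume "v \<in> ?S k"
        then have "norm (p - Y v) < s / 2 ^ k" by simp
        moreover have "norm (Y v0 - Y v) \<le> norm (p - Y v) + norm (p - Y v0)"
          using norm_triangle_ineq4[of "p - Y v" "p - Y v0"] by simp
        ultimately have "norm (Y v0 - Y v) \<le> 2 * (s / 2 ^ k)" using v0 by linarith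
        then have "c * norm (v0 - v) \<le> 2 * (s / 2 ^ k)" using exp[of v0 v] by simp
        then show "v \<in> cball v0 (2 * (s / 2 ^ k) / c)" using c by (simp add: dist_norm field_simps)
      qed
      then have "emeasure lborel (?S k) \<le> emeasure lborel (cball v0 (2 * (s / 2 ^ k) / c))"
        by (intro emeasure_mono) auto
      also have "\<dots> = ennreal (\<omega> * (2 * (s / 2 ^ k) / c) ^ ?d)"
        using s c by (subst emeasure_cball) (auto simp: \<omega>_def)
      finally show ?thesis .
    qed simp
    have trm: "ennreal (2 powr (real (Suc k) * q)) * (ennreal m * emeasure lborel (?S k))
        \<le> ennreal (\<omega> * 2 ^ ?d * 2 powr q * m * (s / c) ^ ?d * \<theta> ^ k)" for k
    proof -
      have "ennreal (2 powr (real (Suc k) * q)) * (ennreal m * emeasure lborel (?S k))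
        \<le> ennreal (2 powr (real (Suc k) * q)) * (ennreal m * ennreal (\<omega> * (2 * (s / 2 ^ k) / c) ^ ?d))"
        by (intro mult_left_mono S) auto
      also have "\<dots> = ennreal (2 powr (real (Suc k) * q) * (m * (\<omega> * (2 * (s / 2 ^ k) / c) ^ ?d)))"
        using m \<omega> s c by (simp add: ennreal_mult[symmetric] del: of_nat_Suc)
      also have "2 powr (real (Suc k) * q) * (m * (\<omega> * (2 * (s / 2 ^ k) / c) ^ ?d))
        = \<omega> * 2 ^ ?d * 2 powr q * m * (s / c) ^ ?d * \<theta> ^ k"
      proof -
        have 1: "2 powr (real (Suc k) * q) = 2 powr q * 2 powr (q * k)"
          by (simp add: powr_add[symmetric] algebra_simps)
        have 2: "(2 * (s / 2 ^ k) / c) ^ ?d = 2 ^ ?d * (s / c) ^ ?d * inverse ((2 ^ k) ^ ?d)"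
          by (simp add: power_mult_distrib power_divide field_simps)
        have "\<theta> ^ k = 2 powr ((q - ?d) * k)"
          by (simp add: \<theta>_def powr_power mult.commute)
        also have "\<dots> = 2 powr (q * k) * inverse ((2 ^ k) ^ ?d)"
          by (simp add: left_diff_distrib powr_diff powr_realpow[symmetric] powr_powr field_simps)
        finally have 3: "\<theta> ^ k = 2 powr (q * k) * inverse ((2 ^ k) ^ ?d)" .
        show ?thesis unfolding 1 2 3 by (simp only: mult_ac)
      qed
      finally show ?thesis .
    qed
    have "(\<integral>\<^sup>+ v. g v * ennreal (norm (p - Y v) powr (- q)) \<partial>lborel)
      \<le> (\<integral>\<^sup>+ v. ennreal (s powr (- q)) * (g v + (\<Sum>k. ennreal (2 powr (real (Suc k) * q)) * (ennreal m * indicator (?S k) v))) \<partial>lborel)"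
    proof (intro nn_integral_mono)
      fix v
      have "g v * ennreal (norm (p - Y v) powr (- q)) \<le> g v * (ennreal (s powr (- q)) *
          (1 + (\<Sum>k. ennreal (2 powr (real (Suc k) * q)) * indicator {..<s / 2 ^ k} (norm (p - Y v)))))"
        by (intro mult_left_mono dyadic_bound s q) auto
      also have "\<dots> = ennreal (s powr (- q)) * (g v + (\<Sum>k. g v * (ennreal (2 powr (real (Suc k) * q)) * indicator {..<s / 2 ^ k} (norm (p - Y v)))))"
        by (subst ennreal_suminf_cmult) (simp only: distrib_left mult_1_right mult_1_left mult_ac)
      also have "\<dots> \<le> ennreal (s powr (- q)) * (g v + (\<Sum>k. ennreal (2 powr (real (Suc k) * q)) * (ennreal m * indicator (?S k) v)))"
      proof (intro mult_left_mono add_left_mono suminf_le)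
        fix k
        have "g v * (ennreal (2 powr (real (Suc k) * q)) * indicator {..<s / 2 ^ k} (norm (p - Y v)))
          = ennreal (2 powr (real (Suc k) * q)) * (g v * indicator (?S k) v)"
          by (simp add: indicator_def mult_ac)
        also have "\<dots> \<le> ennreal (2 powr (real (Suc k) * q)) * (ennreal m * indicator (?S k) v)"
          using gm by (intro mult_left_mono mult_right_mono) auto
        finally show "g v * (ennreal (2 powr (real (Suc k) * q)) * indicator {..<s / 2 ^ k} (norm (p - Y v))) \<le> \<dots>" .
      qed auto
      finally show "g v * ennreal (norm (p - Y v) powr (- q)) \<le> \<dots>" .
    qed
    also have "\<dots> = ennreal (s powr (- q)) * ((\<integral>\<^sup>+ v. g v \<partial>lborel) +
        (\<Sum>k. ennreal (2 powr (real (Suc k) * q)) * (ennreal m * emeasure lborel (?S k))))"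
      by (simp add: nn_integral_cmult nn_integral_add nn_integral_suminf del: of_nat_Suc)
    also have "\<dots> \<le> ennreal (s powr (- q)) * ((\<integral>\<^sup>+ v. g v \<partial>lborel) +
        (\<Sum>k. ennreal (\<omega> * 2 ^ ?d * 2 powr q * m * (s / c) ^ ?d * \<theta> ^ k)))"
      using trm by (intro mult_left_mono add_left_mono suminf_le) auto
    also have "(\<Sum>k. ennreal (\<omega> * 2 ^ ?d * 2 powr q * m * (s / c) ^ ?d * \<theta> ^ k)) = ennreal (C * m * (s / c) ^ ?d)"
    proof -
      have "(\<lambda>k. \<omega> * 2 ^ ?d * 2 powr q * m * (s / c) ^ ?d * \<theta> ^ k) sums (\<omega> * 2 ^ ?d * 2 powr q * m * (s / c) ^ ?d * (1 / (1 - \<theta>)))"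
        using \<theta> by (intro sums_mult geometric_sums) auto
      then have "(\<Sum>k. ennreal (\<omega> * 2 ^ ?d * 2 powr q * m * (s / c) ^ ?d * \<theta> ^ k))
          = ennreal (\<omega> * 2 ^ ?d * 2 powr q * m * (s / c) ^ ?d * (1 / (1 - \<theta>)))"
        using \<omega> m s c \<theta> by (intro suminf_ennreal_eq) auto
      then show ?thesis by (simp add: C_def mult_ac)
    qed
    finally show ?thesis .
  qed
  with C that show ?thesis by blast
qed

section \<open>Density bounds from the force gradient\<close>

text \<open>Translation invariance gives every difference quotient integral zero. The quotients are
  bounded by \<open>B\<close> and supported in a common ball, so dominated convergence
  applies.\<close>

lemma integral_directional_derivative_eq_0:
  fixes h :: "'a::euclidean_space \<Rightarrow> real"
  assumes der: "\<And>x. (h has_derivative H x) (at x)"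
    and B: "\<And>x. \<bar>H x b\<bar> \<le> B" and R: "\<And>x. h x \<noteq> 0 \<Longrightarrow> norm x \<le> R"
    and b: "norm b \<le> 1" and meas: "(\<lambda>x. H x b) \<in> borel_measurable borel"
  shows "(LINT x|lborel. H x b) = 0"
proof -
  have hc: "continuous_on UNIV h" by (intro continuous_at_imp_continuous_on ballI has_derivative_continuous[OF der])
  note [measurable] = borel_measurable_continuous_onI[OF hc]
  define t where "t n = 1 / real (Suc n)" for n
  have t: "0 < t n" "t n \<le> 1" for n by (auto simp: t_def)
  have tlim: "t \<longlonglongrightarrow> 0" unfolding t_def using LIMSEQ_inverse_real_of_nat by (simp add: inverse_eq_divide)
  have line: "((\<lambda>r. h (x + r *\<^sub>R b)) has_real_derivative H (x + r *\<^sub>R b) b) (at r)" for x r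
  proof -
    have "((\<lambda>r. x + r *\<^sub>R b) has_derivative (\<lambda>r. r *\<^sub>R b)) (at r)" by (auto intro!: derivative_eq_intros)
    from has_derivative_compose[OF this der]
    have "((\<lambda>r. h (x + r *\<^sub>R b)) has_derivative (\<lambda>k. H (x + r *\<^sub>R b) (k *\<^sub>R b))) (at r)" .
    moreover have "H y (k *\<^sub>R b) = H y b * k" for y k
      using linear_scale[OF has_derivative_linear[OF der[of y]]] by (simp add: mult.commute)
    ultimately show ?thesis by (simp add: has_field_derivative_def)
  qed
  let ?q = "\<lambda>n x. (h (x + t n *\<^sub>R b) - h x) / t n"
  have supp: "norm x \<le> R + 1" if "?q n x \<noteq> 0" for n x
  proof -
    have "norm (t n *\<^sub>R b) \<le> 1 * 1" unfolding norm_scaleR using t[of n] b by (intro mult_mono) auto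
    moreover have "h (x + t n *\<^sub>R b) \<noteq> 0 \<or> h x \<noteq> 0" using that by auto
    then have "norm (x + t n *\<^sub>R b) \<le> R \<or> norm x \<le> R" using R by blast
    ultimately show ?thesis using norm_triangle_ineq4[of "x + t n *\<^sub>R b" "t n *\<^sub>R b"] by auto
  qed
  have ih: "integrable lborel (\<lambda>x. h (x + a))" for a
  proof -
    have "integrable lborel h"
    proof -
      have c: "continuous_on (cball 0 R) h" using hc continuous_on_subset by blast
      have "integrable lborel (\<lambda>x. indicator (cball 0 R) x *\<^sub>R h x)"
        by (rule borel_integrable_compact[OF compact_cball c])
      moreover have "(\<lambda>x. indicator (cball 0 R) x *\<^sub>R h x) = h" using R by (auto simp: indicator_def fun_eq_iff)
      ultimately show ?thesis by simp
    qed
    then show ?thesis by (rule integrable_lborel_shift)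
  qed
  have Z: "(LINT x|lborel. ?q n x) = 0" for n
    using ih[of "t n *\<^sub>R b"] ih[of 0] integral_lborel_shift[of h "t n *\<^sub>R b"] by simp
  have "(\<lambda>n. LINT x|lborel. ?q n x) \<longlonglongrightarrow> (LINT x|lborel. H x b)"
  proof (rule integral_dominated_convergence[where w = "\<lambda>x. B * indicator (cball 0 (R + 1)) x"])
    show "(\<lambda>x. H x b) \<in> borel_measurable lborel" using meas by simp
    show "?q n \<in> borel_measurable lborel" for n by simp
    show "integrable lborel (\<lambda>x. B * indicator (cball (0::'a) (R + 1)) x)"
      using emeasure_lborel_cball_finite[of "0::'a" "R + 1"] by (intro integrable_mult_right integrable_real_indicator) auto
    show "AE x in lborel. (\<lambda>n. ?q n x) \<longlonglongrightarrow> H x b"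
    proof (intro AE_I2)
      fix x
      have "(\<lambda>r. (h (x + (0 + r) *\<^sub>R b) - h (x + 0 *\<^sub>R b)) / r) \<midarrow>0\<rightarrow> H x b"
        using line[of x 0] by (simp add: DERIV_def)
      moreover have "filterlim t (at 0) sequentially"
        using tlim t by (auto simp: filterlim_at intro!: always_eventually) (metis less_irrefl)
      ultimately have "(\<lambda>n. (h (x + (0 + t n) *\<^sub>R b) - h (x + 0 *\<^sub>R b)) / t n) \<longlonglongrightarrow> H x b"
        by (rule filterlim_compose)
      then show "(\<lambda>n. ?q n x) \<longlonglongrightarrow> H x b" by simp
    qed
    show "AE x in lborel. norm (?q n x) \<le> B * indicator (cball 0 (R + 1)) x" for n
    proof (intro AE_I2)
      fix x
      have "norm (h (x + t n *\<^sub>R b) - h (x + 0 *\<^sub>R b)) \<le> B * norm (t n - 0)"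
        by (rule field_differentiable_bound[of UNIV "\<lambda>r. h (x + r *\<^sub>R b)"]) (use line B in auto)
      then have "norm (?q n x) \<le> B" using t[of n] by (simp add: field_simps)
      then show "norm (?q n x) \<le> B * indicator (cball 0 (R + 1)) x"
        using supp[where n = n and x = x] by (cases "?q n x = 0") (auto simp: indicator_def)
    qed
  qed
  then have "(\<lambda>n::nat. 0) \<longlonglongrightarrow> (LINT x|lborel. H x b)" by (simp only: Z)
  then show ?thesis by (simp add: LIMSEQ_const_iff)
qed

text \<open>\<open>expanding_density_bound\<close> for the identity map and the indicator of the
  ball, with all scales equal to 1; hence the bound is uniform in the pole p.\<close>

lemma kernel_ball_bound:
  fixes q :: real
  assumes "0 < q" "q < 3"
  obtains C :: real where "C > 0"
    "\<And>p::real^3. (\<integral>\<^sup>+ x. indicator (cball 0 R) x * ennreal (norm (p - x) powr (- q)) \<partial>lborel) \<le> ennreal C"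
proof -
  have q: "0 < q" "q < DIM(real^3)" using assms by auto
  obtain C where C: "C > 0"
    "\<And>(Y :: real^3 \<Rightarrow> real^3) g m p s c. \<lbrakk>Y \<in> borel_measurable borel; g \<in> borel_measurable borel; 0 < s; 0 < c; 0 \<le> m;
       \<And>v v'. c * norm (v - v') \<le> norm (Y v - Y v'); \<And>v. g v \<le> ennreal m\<rbrakk> \<Longrightarrow>
     (\<integral>\<^sup>+ v. g v * ennreal (norm (p - Y v) powr (- q)) \<partial>lborel)
       \<le> ennreal (s powr (- q)) * ((\<integral>\<^sup>+ v. g v \<partial>lborel) + ennreal (C * m * (s / c) ^ DIM(real^3)))"
    using expanding_density_bound[OF q] by blast
  have ind: "indicator (cball (0::real^3) R) \<in> borel_measurable (borel :: (real^3) measure)"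
    by (intro borel_measurable_indicator borel_closed closed_cball)
  define V where "V = measure lborel (cball (0::real^3) R)"
  have V: "emeasure lborel (cball (0::real^3) R) = ennreal V" "V \<ge> 0"
    using emeasure_lborel_cball_finite[of "0::real^3" R] by (auto simp: V_def emeasure_eq_ennreal_measure)
  have "(\<integral>\<^sup>+ x. indicator (cball 0 R) x * ennreal (norm (p - x) powr (- q)) \<partial>lborel) \<le> ennreal (V + C)" for p :: "real^3"
  proof -
    have "(\<integral>\<^sup>+ x. indicator (cball 0 R) x * ennreal (norm (p - x) powr (- q)) \<partial>lborel)
      \<le> ennreal (1 powr (- q)) * ((\<integral>\<^sup>+ x. indicator (cball (0::real^3) R) x \<partial>lborel) + ennreal (C * 1 * (1 / 1) ^ DIM(real^3)))"
      by (rule C(2)) (use ind in \<open>auto simp: indicator_def\<close>)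
    also have "\<dots> = ennreal (V + C)" using V C(1) by (simp add: ennreal_plus[symmetric] del: ennreal_plus)
    finally show ?thesis .
  qed
  with C(1) V(2) show ?thesis using that[of "V + C"] by auto
qed

text \<open>The regularised kernel \<open>(\<kappa> + \<bar>z\<bar>\<^sup>2)\<^sup>-\<^sup>s z\<close> with \<open>2 s = \<alpha> + 2\<close> has divergence at least
  \<open>(1 - \<alpha>) (\<kappa> + \<bar>z\<bar>\<^sup>2)\<^sup>-\<^sup>s\<close>; this positivity is what turns a bound on \<open>\<nabla>E\<close> into a bound on the density.\<close>

lemma regularised_kernel_divergence:
  fixes \<phi> :: "real^3 \<Rightarrow> real"
  assumes \<phi>: "\<phi> \<in> test_functions \<Omega>" and pos: "\<And>x. 0 \<le> \<phi> x" and \<kappa>: "\<kappa> > 0" and \<alpha>: "0 < \<alpha>" "\<alpha> < 1"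
  shows "(LINT x|lborel. (\<Sum>b\<in>Basis. frechet_derivative \<phi> (at x) b * ((\<kappa> + (norm (x - y))\<^sup>2) powr (- (\<alpha> / 2 + 1)) * ((x - y) \<bullet> b))))
    \<le> - (1 - \<alpha>) * (LINT x|lborel. \<phi> x * (\<kappa> + (norm (x - y))\<^sup>2) powr (- (\<alpha> / 2 + 1)))"
proof -
  let ?s = "\<alpha> / 2 + 1"
  let ?w = "\<lambda>x::real^3. \<kappa> + (norm (x - y))\<^sup>2"
  have w: "?w x > 0" for x using \<kappa> by (simp add: add_pos_nonneg)
  have w': "\<kappa> + (x - y) \<bullet> (x - y) > 0" for x using w[of x] by (simp add: power2_norm_eq_inner)
  let ?k = "\<lambda>b x. ?w x powr (- ?s) * ((x - y) \<bullet> b)"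
  let ?Dk = "\<lambda>b x v. (- ?s * ?w x powr (- ?s - 1) * (2 * ((x - y) \<bullet> v))) * ((x - y) \<bullet> b) + ?w x powr (- ?s) * (v \<bullet> b)"
  have Dk: "(?k b has_derivative ?Dk b x) (at x)" for b x
  proof -
    have "((\<lambda>r. r powr (- ?s)) has_derivative (\<lambda>h. - ?s * ?w x powr (- ?s - 1) * h)) (at (?w x))"
      using has_real_derivative_powr[OF w, of "- ?s"] by (simp add: has_field_derivative_def)
    moreover have "(?w has_derivative (\<lambda>v. 2 * ((x - y) \<bullet> v))) (at x)"
      unfolding power2_norm_eq_inner by (auto intro!: derivative_eq_intros simp: inner_commute)
    ultimately have 1: "((\<lambda>x. ?w x powr (- ?s)) has_derivative (\<lambda>v. - ?s * ?w x powr (- ?s - 1) * (2 * ((x - y) \<bullet> v)))) (at x)"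
      using has_derivative_compose[of ?w _ x UNIV "\<lambda>r. r powr (- ?s)"] by blast
    have 2: "((\<lambda>x. (x - y) \<bullet> b) has_derivative (\<lambda>v. v \<bullet> b)) (at x)"
      by (auto intro!: derivative_eq_intros)
    show ?thesis by (rule has_derivative_eq_rhs[OF has_derivative_mult[OF 1 2]]) (auto simp: fun_eq_iff)
  qed
  have sm: "smooth \<phi>" using \<phi> by (simp add: test_functions_def)
  obtain R where R: "R > 0" "\<And>x. \<phi> x \<noteq> 0 \<Longrightarrow> norm x \<le> R" "\<And>x h. frechet_derivative \<phi> (at x) h \<noteq> 0 \<Longrightarrow> norm x \<le> R"
    by (rule frechet_derivative_support[OF \<phi>]) blast
  have cD\<phi>: "continuous_on UNIV (\<lambda>x. frechet_derivative \<phi> (at x) b)" if "b \<in> Basis" for b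
    using smooth_continuous[OF smooth_partials[OF sm, of "[b]"]] that by simp
  have c\<phi>: "continuous_on UNIV \<phi>" by (rule smooth_continuous[OF sm])
  have cw: "continuous_on UNIV (\<lambda>x. ?w x powr e)" for e
    by (intro continuous_on_powr' continuous_intros) (use w in \<open>auto simp: less_imp_neq[symmetric]\<close>)
  have ck: "continuous_on UNIV (?k b)" for b by (intro continuous_intros cw)
  have cDk: "continuous_on UNIV (\<lambda>x. ?Dk b x v)" for b v by (intro continuous_intros cw)
  have int: "integrable lborel F" if "continuous_on UNIV F" "\<And>x. F x \<noteq> 0 \<Longrightarrow> norm x \<le> R" for F :: "real^3 \<Rightarrow> real"
  proof -
    have "integrable lborel (\<lambda>x. indicator (cball 0 R) x *\<^sub>R F x)"
      by (rule borel_integrable_compact[OF compact_cball continuous_on_subset[OF that(1)]]) simp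
    moreover have "(\<lambda>x. indicator (cball 0 R) x *\<^sub>R F x) = F" using that(2) by (auto simp: indicator_def fun_eq_iff)
    ultimately show ?thesis by simp
  qed
  have i1: "integrable lborel (\<lambda>x. frechet_derivative \<phi> (at x) b * ?k b x)" if "b \<in> Basis" for b
    by (rule int[OF continuous_on_mult[OF cD\<phi>[OF that] ck]]) (use R(3) in auto)
  have i2: "integrable lborel (\<lambda>x. \<phi> x * ?Dk b x b)" for b
    by (rule int[OF continuous_on_mult[OF c\<phi> cDk]]) (use R(2) in auto)
  \<comment> \<open>Integration by parts without boundary term: the derivative of the product \<phi>
    \<open>?k b\<close> along b has integral zero.\<close>
  have parts: "(LINT x|lborel. frechet_derivative \<phi> (at x) b * ?k b x) = - (LINT x|lborel. \<phi> x * ?Dk b x b)" if b: "b \<in> Basis" for b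
  proof -
    let ?H = "\<lambda>x v. \<phi> x * ?Dk b x v + frechet_derivative \<phi> (at x) v * ?k b x"
    have Hc: "continuous_on UNIV (\<lambda>x. ?H x b)"
      by (intro continuous_on_add continuous_on_mult[OF c\<phi>] continuous_on_mult[OF cD\<phi>[OF b]] cDk ck)
    have "compact ((\<lambda>x. ?H x b) ` cball 0 R)"
      by (intro compact_continuous_image continuous_on_subset[OF Hc]) auto
    then obtain B where B: "B > 0" "\<And>x. x \<in> cball 0 R \<Longrightarrow> norm (?H x b) \<le> B"
      using compact_imp_bounded bounded_pos by (metis (no_types, lifting) imageI)
    have "(LINT x|lborel. ?H x b) = 0"
    proof (rule integral_directional_derivative_eq_0[of "\<lambda>x. \<phi> x * ?k b x" ?H b B R])
      show "((\<lambda>x. \<phi> x * ?k b x) has_derivative ?H x) (at x)" for x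
        by (rule has_derivative_mult[OF smooth_has_derivative[OF sm] Dk])
      show "\<bar>?H x b\<bar> \<le> B" for x
      proof (cases "norm x \<le> R")
        case False
        then have "\<phi> x = 0" "frechet_derivative \<phi> (at x) b = 0" using R by force+
        then show ?thesis using B(1) by simp
      qed (use B(2)[of x] in simp)
      show "norm x \<le> R" if "\<phi> x * ?k b x \<noteq> 0" for x using that R(2) by auto
      show "norm b \<le> 1" using b by simp
      show "(\<lambda>x. ?H x b) \<in> borel_measurable borel" by (rule borel_measurable_continuous_onI[OF Hc])
    qed
    then show ?thesis using i1[OF b] i2[of b] by (subst (asm) Bochner_Integration.integral_add) auto
  qed
  \<comment> \<open>The divergence is 3 w^(-s) - (\<alpha> + 2) w^(-s-1) |x - y|^2. Since |x - y|^2
    \<le> w, it is at least (3 - (\<alpha> + 2)) w^(-s).\<close>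
  have div: "(1 - \<alpha>) * ?w x powr (- ?s) \<le> (\<Sum>b\<in>Basis. ?Dk b x b)" for x
  proof -
    let ?r2 = "(norm (x - y))\<^sup>2"
    have p: "?w x powr (- ?s - 1) * ?w x = ?w x powr (- ?s)"
    proof -
      have "?w x powr (- ?s - 1) * ?w x powr 1 = ?w x powr (- ?s)"
        by (subst powr_add[symmetric], rule arg_cong2[where f = "(powr)"]) simp_all
      then show ?thesis using w[of x] by simp
    qed
    have "(\<Sum>b\<in>Basis. ?Dk b x b) = (\<Sum>b\<in>(Basis :: (real^3) set). ?w x powr (- ?s) - (\<alpha> + 2) * ?w x powr (- ?s - 1) * (((x - y) \<bullet> b) * ((x - y) \<bullet> b)))"
      by (intro sum.cong refl) (simp add: inner_same_Basis field_simps)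
    also have "\<dots> = 3 * ?w x powr (- ?s) - (\<alpha> + 2) * ?w x powr (- ?s - 1) * ?r2"
      by (simp only: sum_subtractf sum_distrib_left[symmetric] euclidean_inner[symmetric] power2_norm_eq_inner) simp
    also have "\<dots> \<ge> 3 * ?w x powr (- ?s) - (\<alpha> + 2) * (?w x powr (- ?s - 1) * ?w x)"
      using \<kappa> \<alpha> by (simp add: mult_left_mono)
    finally show ?thesis unfolding p by (simp add: algebra_simps)
  qed
  have e1: "(LINT x|lborel. (\<Sum>b\<in>Basis. frechet_derivative \<phi> (at x) b * ?k b x)) = - (LINT x|lborel. (\<Sum>b\<in>Basis. \<phi> x * ?Dk b x b))"
  proof -
    have "(LINT x|lborel. (\<Sum>b\<in>Basis. frechet_derivative \<phi> (at x) b * ?k b x)) = (\<Sum>b\<in>Basis. LINT x|lborel. frechet_derivative \<phi> (at x) b * ?k b x)"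
      by (rule Bochner_Integration.integral_sum) (rule i1)
    also have "\<dots> = (\<Sum>b\<in>Basis. - (LINT x|lborel. \<phi> x * ?Dk b x b))"
      by (intro sum.cong refl parts)
    also have "\<dots> = - (LINT x|lborel. (\<Sum>b\<in>Basis. \<phi> x * ?Dk b x b))"
      unfolding sum_negf neg_equal_iff_equal by (rule Bochner_Integration.integral_sum[symmetric]) (rule i2)
    finally show ?thesis .
  qed
  have e2: "(LINT x|lborel. (1 - \<alpha>) * (\<phi> x * ?w x powr (- ?s))) \<le> (LINT x|lborel. (\<Sum>b\<in>Basis. \<phi> x * ?Dk b x b))"
  proof (rule integral_mono)
    show "integrable lborel (\<lambda>x. (1 - \<alpha>) * (\<phi> x * ?w x powr (- ?s)))"
      by (rule int[OF continuous_on_mult[OF continuous_on_const continuous_on_mult[OF c\<phi> cw]]]) (use R(2) in auto)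
    show "integrable lborel (\<lambda>x. \<Sum>b\<in>Basis. \<phi> x * ?Dk b x b)" by (rule Bochner_Integration.integrable_sum) (rule i2)
    show "(1 - \<alpha>) * (\<phi> x * ?w x powr (- ?s)) \<le> (\<Sum>b\<in>Basis. \<phi> x * ?Dk b x b)" for x
      using mult_left_mono[OF div[of x] pos[of x]] by (simp only: sum_distrib_left[symmetric] mult_ac)
  qed
  have e3: "(LINT x|lborel. (1 - \<alpha>) * (\<phi> x * ?w x powr (- ?s))) = (1 - \<alpha>) * (LINT x|lborel. \<phi> x * ?w x powr (- ?s))"
    by (rule integral_mult_right_zero)
  show ?thesis using le_imp_neg_le[OF e2[unfolded e3]] unfolding e1 by (simp only: mult_minus_left[of "1 - \<alpha>"])
qed

lemma norm_square_powr: "((norm z)\<^sup>2) powr (- (\<alpha> / 2 + 1)) = norm z powr (- (\<alpha> + 2))"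
proof (cases "z = 0")
  case False
  then have "((norm z)\<^sup>2) powr (- (\<alpha> / 2 + 1)) = (norm z powr 2) powr (- (\<alpha> / 2 + 1))" by simp
  also have "\<dots> = norm z powr (- (\<alpha> + 2))"
    unfolding powr_powr by (rule arg_cong2[where f = "(powr)"]) (simp_all add: field_simps)
  finally show ?thesis .
qed simp

text \<open>The divergence of E is tested against a bump \<phi> concentrated at x0. The weak
  derivatives bound the result by 3 M times the mass of \<phi>; by Fubini it is also c times the
  integral of \<rho> against a function of one sign, at least of the order of the singular kernel.
  As this sign does not change, nothing cancels and the sign of c is irrelevant. Fatou's lemma
  removes the width of the bump.\<close>

lemma density_from_gradient_bound:
  fixes \<rho> :: "real^3 \<Rightarrow> real" and E :: "real^3 \<Rightarrow> real^3" and M :: real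
  assumes \<alpha>: "0 < \<alpha>" "\<alpha> < 1" and \<rho>m[measurable]: "\<rho> \<in> borel_measurable borel" and \<rho>0: "\<And>y. 0 \<le> \<rho> y"
    and \<rho>i: "integrable lborel \<rho>" and c: "c \<noteq> 0"
    and E: "\<And>x. E x = c *\<^sub>R (LINT y|lborel. \<rho> y *\<^sub>R riesz_kernel \<alpha> (x - y))"
    and g: "\<And>b. b \<in> Basis \<Longrightarrow> has_weak_derivative {#b#} E (g b)"
    and M: "\<And>b. b \<in> Basis \<Longrightarrow> AE x in lebesgue. norm (g b x) \<le> M" and M0: "0 \<le> M"
  shows "(\<integral>\<^sup>+ y. ennreal (\<rho> y * norm (x0 - y) powr (- (\<alpha> + 2))) \<partial>lborel) \<le> ennreal (12 * M / ((1 - \<alpha>) * \<bar>c\<bar>))"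
proof -
  let ?s = "\<alpha> / 2 + 1"
  let ?K = "riesz_kernel \<alpha> :: real^3 \<Rightarrow> real^3"
  \<comment> \<open>The estimate at bump width \<delta>, with the singularity blunted at that
    scale.\<close>
  have stepA: "(1 - \<alpha>) * \<bar>c\<bar> * (LINT y|lborel. \<rho> y * (19 * \<delta>\<^sup>2 + 2 * (norm (x0 - y))\<^sup>2) powr (- ?s)) \<le> 3 * M"
    if \<delta>: "\<delta> > 0" for \<delta>
  proof -
    define \<phi> where "\<phi> = (\<lambda>x. cube_bump \<delta> (x - x0))"
    have \<phi>: "\<phi> \<in> test_functions UNIV" unfolding \<phi>_def by (rule cube_bump_shift_test_function[OF \<delta>])
    have \<phi>0: "0 \<le> \<phi> x" for x by (simp add: \<phi>_def bump_nonneg)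
    define I where "I = bump_mass TYPE(real^3) \<delta>"
    have I: "I > 0" unfolding I_def by (rule bump_mass_pos[OF \<delta>])
    have I\<phi>: "(LINT x|lborel. \<phi> x) = I"
      using integral_lborel_shift[of "cube_bump \<delta> :: real^3 \<Rightarrow> real" "- x0"] \<delta> by (simp add: I_def \<phi>_def)
    have \<phi>supp: "norm (x - x0) \<le> 3 * \<delta>" if "\<phi> x \<noteq> 0" for x
      using cube_bump_support[OF \<delta> that[unfolded \<phi>_def]] by simp
    let ?D = "\<lambda>x b. frechet_derivative \<phi> (at x) b"
    note [measurable] = frechet_derivative_test_function_measurable[OF \<phi>] test_function_measurable[OF \<phi>]
    obtain R where R: "R > 0" "\<And>x. \<phi> x \<noteq> 0 \<Longrightarrow> norm x \<le> R" "\<And>x h. ?D x h \<noteq> 0 \<Longrightarrow> norm x \<le> R"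
      by (rule frechet_derivative_support[OF \<phi>]) blast
    obtain L where L: "L > 0" "\<And>x h. \<bar>?D x h\<bar> \<le> L * norm h"
      by (rule test_function_derivative_bounded[OF \<phi>]) blast
    obtain C where C: "C > 0" "\<And>p::real^3. (\<integral>\<^sup>+ x. indicator (cball 0 R) x * ennreal (norm (p - x) powr (- (\<alpha> + 1))) \<partial>lborel) \<le> ennreal C"
      by (rule kernel_ball_bound[of "\<alpha> + 1" R]) (use \<alpha> in auto)
    have [measurable]: "cball (0::real^3) R \<in> sets borel" by (intro borel_closed closed_cball)
    have Eli: "locally_integrable E"
    proof -
      obtain b :: "real^3" where "b \<in> Basis" using nonempty_Basis by blast
      from g[OF this] show ?thesis by (simp add: has_weak_derivative_def)
    qed
    have iDE: "integrable lebesgue (\<lambda>x. ?D x b *\<^sub>R E x)" if "b \<in> Basis" for b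
    proof (rule locally_integrable_mult[OF Eli _ L(2)])
      show "(\<lambda>x. ?D x b) \<in> borel_measurable lebesgue" by (rule measurable_completion) simp
    qed (rule R(3))
    \<comment> \<open>Minus the divergence of E, tested against \<phi> and computed by shifting the
      derivatives onto \<phi>.\<close>
    define T where "T = (\<Sum>b\<in>Basis. (LINT x|lebesgue. ?D x b *\<^sub>R E x) \<bullet> b)"
    have T1: "\<bar>T\<bar> \<le> 3 * M * I"
    proof -
      have "\<bar>(LINT x|lebesgue. ?D x b *\<^sub>R E x) \<bullet> b\<bar> \<le> M * I" if b: "b \<in> Basis" for b
      proof -
        have "\<bar>(LINT x|lebesgue. ?D x b *\<^sub>R E x) \<bullet> b\<bar> \<le> norm (LINT x|lebesgue. ?D x b *\<^sub>R E x)"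
          by (rule Basis_le_norm[OF b])
        also have "\<dots> = norm (LINT x|lebesgue. \<phi> x *\<^sub>R g b x)"
          by (simp only: has_weak_derivative_singleton[OF g[OF b] \<phi>] norm_minus_cancel)
        also have "\<dots> \<le> (LINT x|lebesgue. \<phi> x * M)"
        proof (rule integral_norm_bound_integral_AE)
          have lg: "locally_integrable (g b)" using g[OF b] by (simp add: has_weak_derivative_def)
          show "integrable lebesgue (\<lambda>y. \<phi> y *\<^sub>R g b y)" by (rule integrable_test_function_scaleR[OF \<phi> lg])
          show "integrable lebesgue (\<lambda>y. \<phi> y * M)"
            using integrable_test_function[OF \<phi>] by (subst integrable_completion) auto
          show "AE y in lebesgue. norm (\<phi> y *\<^sub>R g b y) \<le> \<phi> y * M"
            using M[OF b] by eventually_elim (auto simp: \<phi>0 intro!: mult_left_mono)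
        qed
        also have "\<dots> = (LINT x|lborel. \<phi> x * M)" by (rule integral_completion) simp
        also have "\<dots> = M * I" using I\<phi> by simp
        finally show ?thesis .
      qed
      then have bd: "(\<Sum>b\<in>Basis. \<bar>(LINT x|lebesgue. ?D x b *\<^sub>R E x) \<bullet> b\<bar>) \<le> (\<Sum>b\<in>(Basis::(real^3) set). M * I)"
        by (intro sum_mono)
      have "\<bar>T\<bar> \<le> (\<Sum>b\<in>Basis. \<bar>(LINT x|lebesgue. ?D x b *\<^sub>R E x) \<bullet> b\<bar>)" unfolding T_def by (rule sum_abs)
      with bd show ?thesis by simp
    qed
    let ?G = "\<lambda>x y. (\<Sum>b\<in>Basis. ?D x b * (?K (x - y) \<bullet> b))"
    let ?H = "\<lambda>x y. indicator (cball 0 R) x * (\<rho> y * norm (x - y) powr (- (\<alpha> + 1)))"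
    have Gbound: "\<bar>?D x b * (k \<bullet> b)\<bar> \<le> indicator (cball 0 R) x * L * norm k" if "b \<in> Basis" for x b and k :: "real^3"
    proof (cases "?D x b = 0")
      case False
      have "\<bar>?D x b\<bar> \<le> L" using L(2)[of x b] that by simp
      then show ?thesis using R(3)[OF False] Basis_le_norm[OF that, of k] L(1) by (auto simp: abs_mult intro!: mult_mono)
    qed (use L(1) in auto)
    have Gsum: "\<bar>\<Sum>b\<in>Basis. ?D x b * (k \<bullet> b)\<bar> \<le> indicator (cball 0 R) x * (3 * L) * norm k" for x and k :: "real^3"
    proof -
      have "\<bar>\<Sum>b\<in>Basis. ?D x b * (k \<bullet> b)\<bar> \<le> (\<Sum>b\<in>Basis. \<bar>?D x b * (k \<bullet> b)\<bar>)" by (rule sum_abs)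
      also have "\<dots> \<le> (\<Sum>b\<in>(Basis::(real^3) set). indicator (cball 0 R) x * L * norm k)" by (intro sum_mono Gbound)
      finally show ?thesis by simp
    qed
    have iH: "integrable (lborel \<Otimes>\<^sub>M lborel) (\<lambda>(x, y). ?H x y)"
    proof (rule integrableI_bounded)
      show "(\<lambda>(x, y). ?H x y) \<in> borel_measurable (lborel \<Otimes>\<^sub>M lborel)" by measurable
      have "(\<integral>\<^sup>+ p. ennreal (norm ((\<lambda>(x, y). ?H x y) p)) \<partial>(lborel \<Otimes>\<^sub>M lborel))
        = (\<integral>\<^sup>+ y. \<integral>\<^sup>+ x. ennreal (norm (?H x y)) \<partial>lborel \<partial>lborel)"
        by (subst lborel_pair.nn_integral_snd[symmetric]) auto
      also have "\<dots> = (\<integral>\<^sup>+ y. ennreal (\<rho> y) * (\<integral>\<^sup>+ x. indicator (cball 0 R) x * ennreal (norm (y - x) powr (- (\<alpha> + 1))) \<partial>lborel) \<partial>lborel)"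
      proof (intro nn_integral_cong)
        fix y
        have "(\<integral>\<^sup>+ x. ennreal (norm (?H x y)) \<partial>lborel) = (\<integral>\<^sup>+ x. ennreal (\<rho> y) * (indicator (cball 0 R) x * ennreal (norm (y - x) powr (- (\<alpha> + 1)))) \<partial>lborel)"
          using \<rho>0[of y] by (intro nn_integral_cong) (auto simp: indicator_def ennreal_mult norm_minus_commute abs_mult)
        then show "(\<integral>\<^sup>+ x. ennreal (norm (?H x y)) \<partial>lborel) = ennreal (\<rho> y) * (\<integral>\<^sup>+ x. indicator (cball 0 R) x * ennreal (norm (y - x) powr (- (\<alpha> + 1))) \<partial>lborel)"
          by (subst nn_integral_cmult[symmetric]) auto
      qed
      also have "\<dots> \<le> (\<integral>\<^sup>+ y. ennreal (\<rho> y) * ennreal C \<partial>lborel)"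
        by (intro nn_integral_mono mult_left_mono C(2)) auto
      also have "\<dots> = (\<integral>\<^sup>+ y. ennreal (\<rho> y) \<partial>lborel) * ennreal C"
        by (rule nn_integral_multc) simp
      also have "\<dots> < \<infinity>"
        using \<rho>i \<rho>0 by (simp add: integrable_iff_bounded ennreal_mult_less_top)
      finally show "(\<integral>\<^sup>+ p. ennreal (norm ((\<lambda>(x, y). ?H x y) p)) \<partial>(lborel \<Otimes>\<^sub>M lborel)) < \<infinity>" .
    qed
    have i\<rho>G: "integrable (lborel \<Otimes>\<^sub>M lborel) (\<lambda>(x, y). \<rho> y * ?G x y)"
    proof (rule Bochner_Integration.integrable_bound[OF integrable_mult_right[OF iH, of "3 * L"]])
      show "(\<lambda>(x, y). \<rho> y * ?G x y) \<in> borel_measurable (lborel \<Otimes>\<^sub>M lborel)" by measurable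
      have "norm (\<rho> y * ?G x y) \<le> norm (3 * L * ?H x y)" for x y
      proof -
        have "norm (\<rho> y * ?G x y) \<le> \<rho> y * (indicator (cball 0 R) x * (3 * L) * norm (?K (x - y)))"
          using Gsum[of x "?K (x - y)"] \<rho>0[of y] by (simp add: abs_mult mult_left_mono)
        also have "\<dots> = 3 * L * ?H x y" by (simp add: norm_riesz_kernel)
        finally show ?thesis by simp
      qed
      then show "AE p in lborel \<Otimes>\<^sub>M lborel. norm (case p of (x, y) \<Rightarrow> \<rho> y * ?G x y) \<le> norm (3 * L * (case p of (x, y) \<Rightarrow> ?H x y))"
        by (intro AE_I2) (auto split: prod.split)
    qed
    define J where "J y = (LINT x|lborel. ?G x y)" for y
    have T2: "T = c * (LINT y|lborel. \<rho> y * J y)"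
    proof -
      have "AE x in lborel. integrable lborel (\<lambda>y. ?H x y)"
        using lborel_pair.AE_integrable_fst'[OF iH] by simp
      then have ae: "AE x in lborel. (\<Sum>b\<in>Basis. (?D x b *\<^sub>R E x) \<bullet> b) = c * (LINT y|lborel. \<rho> y * ?G x y)"
      proof eventually_elim
        case (elim x)
        show ?case
        proof (cases "x \<in> cball 0 R")
          case False
          then have "?D x b = 0" for b using R(3)[of x b] by auto
          then show ?thesis by simp
        next
          case True
          have i: "integrable lborel (\<lambda>y. \<rho> y *\<^sub>R ?K (x - y))"
          proof (rule Bochner_Integration.integrable_bound[OF elim])
            show "AE y in lborel. norm (\<rho> y *\<^sub>R ?K (x - y)) \<le> norm (?H x y)"
              using True \<rho>0 by (intro AE_I2) (simp add: norm_riesz_kernel)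
          qed simp
          then have ib: "integrable lborel (\<lambda>y. \<rho> y * (?K (x - y) \<bullet> b))" for b
            using integrable_inner_left[of b lborel "\<lambda>y. \<rho> y *\<^sub>R ?K (x - y)"] by simp
          have EB: "E x \<bullet> b = c * (LINT y|lborel. \<rho> y * (?K (x - y) \<bullet> b))" for b
            using integral_inner_left[of b lborel "\<lambda>y. \<rho> y *\<^sub>R ?K (x - y)"] i by (simp add: E)
          have "(\<Sum>b\<in>Basis. (?D x b *\<^sub>R E x) \<bullet> b) = (\<Sum>b\<in>Basis. c * (LINT y|lborel. ?D x b * (\<rho> y * (?K (x - y) \<bullet> b))))"
          proof (intro sum.cong refl)
            fix b
            have "(LINT y|lborel. ?D x b * (\<rho> y * (?K (x - y) \<bullet> b))) = ?D x b * (LINT y|lborel. \<rho> y * (?K (x - y) \<bullet> b))"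
              by (rule integral_mult_right_zero)
            then show "(?D x b *\<^sub>R E x) \<bullet> b = c * (LINT y|lborel. ?D x b * (\<rho> y * (?K (x - y) \<bullet> b)))"
              by (simp only: inner_scaleR_left EB) (simp only: mult_ac)
          qed
          also have "\<dots> = c * (LINT y|lborel. (\<Sum>b\<in>Basis. ?D x b * (\<rho> y * (?K (x - y) \<bullet> b))))"
            using ib by (simp add: Bochner_Integration.integral_sum sum_distrib_left)
          also have "(\<lambda>y. \<Sum>b\<in>Basis. ?D x b * (\<rho> y * (?K (x - y) \<bullet> b))) = (\<lambda>y. \<rho> y * ?G x y)"
            by (simp add: sum_distrib_left mult_ac)
          finally show ?thesis .
        qed
      qed
      have "T = (LINT x|lebesgue. (\<Sum>b\<in>Basis. (?D x b *\<^sub>R E x) \<bullet> b))"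
      proof -
        have "(LINT x|lebesgue. (\<Sum>b\<in>Basis. (?D x b *\<^sub>R E x) \<bullet> b)) = (\<Sum>b\<in>Basis. LINT x|lebesgue. (?D x b *\<^sub>R E x) \<bullet> b)"
          by (rule Bochner_Integration.integral_sum) (intro integrable_inner_left iDE)
        also have "\<dots> = T" unfolding T_def by (intro sum.cong refl integral_inner_left iDE)
        finally show ?thesis ..
      qed
      also have "\<dots> = (LINT x|lborel. c * (LINT y|lborel. \<rho> y * ?G x y))"
        by (rule integral_lebesgue_borel_version[OF _ ae]) measurable
      also have "\<dots> = c * (LINT x|lborel. LINT y|lborel. \<rho> y * ?G x y)" by simp
      also have "(LINT x|lborel. LINT y|lborel. \<rho> y * ?G x y) = (LINT y|lborel. LINT x|lborel. \<rho> y * ?G x y)"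
        using lborel_pair.Fubini_integral[OF i\<rho>G] by simp
      finally show ?thesis by (simp add: J_def)
    qed
    \<comment> \<open>On the support of \<phi> one has |x - y| \<le> |x0 - y| + 3 \<delta>, whose
      square is at most 2 |x0 - y|^2 + 18 \<delta>^2; one more \<delta>^2 leaves room for the
      regularisation parameter. So \<open>w y\<close> is a lower bound for the regularised kernel
      over the whole support.\<close>
    define w where "w y = (19 * \<delta>\<^sup>2 + 2 * (norm (x0 - y))\<^sup>2) powr (- ?s)" for y
    have J: "J y \<le> - (1 - \<alpha>) * (I * w y)" for y
    proof -
      \<comment> \<open>Regularisation parameters tending to 0 and never exceeding
        \<delta>^2.\<close>
      let ?kap = "\<lambda>n. \<delta>\<^sup>2 / real (Suc n)"
      have kap: "?kap n > 0" "?kap n \<le> \<delta>\<^sup>2" for n using \<delta> by (auto simp: field_simps)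
      have klim: "?kap \<longlonglongrightarrow> 0"
        using tendsto_mult[OF tendsto_const[of "\<delta>\<^sup>2"] LIMSEQ_inverse_real_of_nat] by (simp add: divide_inverse)
      let ?Gn = "\<lambda>n x. (\<Sum>b\<in>Basis. ?D x b * ((?kap n + (norm (x - y))\<^sup>2) powr (- ?s) * ((x - y) \<bullet> b)))"
      have "(LINT x|lborel. ?Gn n x) \<le> - (1 - \<alpha>) * (I * w y)" for n
      proof -
        have "(LINT x|lborel. ?Gn n x) \<le> - (1 - \<alpha>) * (LINT x|lborel. \<phi> x * (?kap n + (norm (x - y))\<^sup>2) powr (- ?s))"
          by (rule regularised_kernel_divergence[OF \<phi> \<phi>0 kap(1) \<alpha>])
        also have "\<dots> \<le> - (1 - \<alpha>) * (LINT x|lborel. \<phi> x * w y)"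
        proof (rule mult_left_mono_neg)
          show "(LINT x|lborel. \<phi> x * w y) \<le> (LINT x|lborel. \<phi> x * (?kap n + (norm (x - y))\<^sup>2) powr (- ?s))"
          proof (rule integral_mono)
            show "integrable lborel (\<lambda>x. \<phi> x * w y)" using integrable_test_function[OF \<phi>] by simp
            show "integrable lborel (\<lambda>x. \<phi> x * (?kap n + (norm (x - y))\<^sup>2) powr (- ?s))"
            proof (rule Bochner_Integration.integrable_bound[OF integrable_mult_right[OF integrable_test_function[OF \<phi>], of "?kap n powr (- ?s)"]])
              have "(?kap n + (norm (x - y))\<^sup>2) powr (- ?s) \<le> ?kap n powr (- ?s)" for x
                by (rule powr_mono2') (use kap[of n] \<alpha> in auto)
              then show "AE x in lborel. norm (\<phi> x * (?kap n + (norm (x - y))\<^sup>2) powr (- ?s)) \<le> norm (?kap n powr (- ?s) * \<phi> x)"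
                using \<phi>0 by (intro AE_I2) (simp add: abs_mult mult.commute mult_left_mono del: of_nat_Suc)
            qed simp
            fix x
            show "\<phi> x * w y \<le> \<phi> x * (?kap n + (norm (x - y))\<^sup>2) powr (- ?s)"
            proof (cases "\<phi> x = 0")
              case False
              have "norm (x - y) \<le> norm (x0 - y) + 3 * \<delta>"
                using \<phi>supp[OF False] norm_triangle_ineq[of "x - x0" "x0 - y"] by simp
              then have "(norm (x - y))\<^sup>2 \<le> (norm (x0 - y) + 3 * \<delta>)\<^sup>2" by (intro power_mono) auto
              also have "\<dots> \<le> 2 * (norm (x0 - y))\<^sup>2 + 18 * \<delta>\<^sup>2"
                using zero_le_power2[of "norm (x0 - y) - 3 * \<delta>"] by (simp add: power2_eq_square algebra_simps)
              finally have "w y \<le> (?kap n + (norm (x - y))\<^sup>2) powr (- ?s)"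
                unfolding w_def using kap[of n] \<alpha> by (intro powr_mono2') (auto simp del: of_nat_Suc intro: add_pos_nonneg)
              then show ?thesis using \<phi>0 by (intro mult_left_mono)
            qed simp
          qed
        qed (use \<alpha> in auto)
        also have "\<dots> = - (1 - \<alpha>) * (I * w y)" using I\<phi> by simp
        finally show ?thesis .
      qed
      moreover have "(\<lambda>n. LINT x|lborel. ?Gn n x) \<longlonglongrightarrow> J y"
        unfolding J_def
      proof (rule integral_dominated_convergence[where w = "\<lambda>x. 3 * L * (indicator (cball 0 R) x * norm (y - x) powr (- (\<alpha> + 1)))"])
        show "(\<lambda>x. ?G x y) \<in> borel_measurable lborel" by measurable
        show "?Gn n \<in> borel_measurable lborel" for n by measurable
        show "integrable lborel (\<lambda>x. 3 * L * (indicator (cball 0 R) x * norm (y - x) powr (- (\<alpha> + 1))))"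
        proof (intro integrable_mult_right integrableI_bounded)
          have "(\<integral>\<^sup>+ x. ennreal (norm (indicator (cball 0 R) x * norm (y - x) powr (- (\<alpha> + 1)))) \<partial>lborel)
            = (\<integral>\<^sup>+ x. indicator (cball 0 R) x * ennreal (norm (y - x) powr (- (\<alpha> + 1))) \<partial>lborel)"
            by (intro nn_integral_cong) (auto simp: indicator_def)
          also have "\<dots> \<le> ennreal C" by (rule C(2))
          also have "\<dots> < \<infinity>" by simp
          finally show "(\<integral>\<^sup>+ x. ennreal (norm (indicator (cball 0 R) x * norm (y - x) powr (- (\<alpha> + 1)))) \<partial>lborel) < \<infinity>" .
        qed simp
        show "AE x in lborel. (\<lambda>n. ?Gn n x) \<longlonglongrightarrow> ?G x y"
        proof (intro AE_I2 tendsto_sum tendsto_mult[OF tendsto_const])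
          fix x b
          show "(\<lambda>n. (?kap n + (norm (x - y))\<^sup>2) powr (- ?s) * ((x - y) \<bullet> b)) \<longlonglongrightarrow> ?K (x - y) \<bullet> b"
          proof (cases "x = y")
            case False
            then have nz: "norm (x - y) > 0" by simp
            have "(\<lambda>n. (?kap n + (norm (x - y))\<^sup>2) powr (- ?s) * ((x - y) \<bullet> b)) \<longlonglongrightarrow> (0 + (norm (x - y))\<^sup>2) powr (- ?s) * ((x - y) \<bullet> b)"
              using nz by (intro tendsto_intros klim) auto
            moreover have "((norm (x - y))\<^sup>2) powr (- ?s) = norm (x - y) powr (- (\<alpha> + 2))"
            by (rule norm_square_powr)
            ultimately show ?thesis by (simp add: riesz_kernel_def)
          qed (simp add: riesz_kernel_def)
        qed
        show "AE x in lborel. norm (?Gn n x) \<le> 3 * L * (indicator (cball 0 R) x * norm (y - x) powr (- (\<alpha> + 1)))" for n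
        proof (rule AE_I2)
          fix x
          let ?k = "(?kap n + (norm (x - y))\<^sup>2) powr (- ?s) *\<^sub>R (x - y)"
          have "norm ?k \<le> norm (y - x) powr (- (\<alpha> + 1))"
          proof (cases "x = y")
            case False
            then have nz: "norm (x - y) > 0" by simp
            have "(?kap n + (norm (x - y))\<^sup>2) powr (- ?s) \<le> ((norm (x - y))\<^sup>2) powr (- ?s)"
              using nz kap[of n] \<alpha> by (intro powr_mono2') (auto simp del: of_nat_Suc)
            also have "\<dots> = norm (x - y) powr (- (\<alpha> + 2))"
            by (rule norm_square_powr)
            finally have "norm ?k \<le> norm (x - y) powr (- (\<alpha> + 2)) * norm (x - y)"
              by (simp add: mult_right_mono del: of_nat_Suc)
            also have "\<dots> = norm (?K (x - y))" by (simp add: riesz_kernel_def)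
            finally show ?thesis by (simp add: norm_riesz_kernel norm_minus_commute del: of_nat_Suc)
          qed simp
          then have "indicator (cball 0 R) x * (3 * L) * norm ?k \<le> indicator (cball 0 R) x * (3 * L) * norm (y - x) powr (- (\<alpha> + 1))"
            using L(1) by (intro mult_left_mono) auto
          also have "\<dots> = 3 * L * (indicator (cball 0 R) x * norm (y - x) powr (- (\<alpha> + 1)))" by (simp only: mult_ac)
          finally show "norm (?Gn n x) \<le> 3 * L * (indicator (cball 0 R) x * norm (y - x) powr (- (\<alpha> + 1)))"
            using order_trans[OF Gsum[of x ?k]] unfolding inner_scaleR_left real_norm_def by blast
        qed
      qed
      ultimately show ?thesis by (intro tendsto_upperbound) auto
    qed
    have i\<rho>J: "integrable lborel (\<lambda>y. \<rho> y * J y)"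
      using lborel_pair.integrable_snd[OF i\<rho>G] by (simp add: J_def)
    have i\<rho>w: "integrable lborel (\<lambda>y. \<rho> y * w y)"
    proof (rule Bochner_Integration.integrable_bound[OF integrable_mult_right[OF \<rho>i, of "(19 * \<delta>\<^sup>2) powr (- ?s)"]])
      show "(\<lambda>y. \<rho> y * w y) \<in> borel_measurable lborel" unfolding w_def by measurable
      have "w y \<le> (19 * \<delta>\<^sup>2) powr (- ?s)" for y
        unfolding w_def using \<delta> \<alpha> by (intro powr_mono2') auto
      moreover have "0 \<le> w y" for y by (simp add: w_def)
      ultimately show "AE y in lborel. norm (\<rho> y * w y) \<le> norm ((19 * \<delta>\<^sup>2) powr (- ?s) * \<rho> y)"
        using \<rho>0 by (intro AE_I2) (simp add: abs_mult mult.commute mult_left_mono)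
    qed
    have "(1 - \<alpha>) * I * (LINT y|lborel. \<rho> y * w y) \<le> - (LINT y|lborel. \<rho> y * J y)"
    proof -
      have "(LINT y|lborel. (1 - \<alpha>) * I * (\<rho> y * w y)) \<le> (LINT y|lborel. - (\<rho> y * J y))"
      proof (rule integral_mono)
        show "(1 - \<alpha>) * I * (\<rho> y * w y) \<le> - (\<rho> y * J y)" for y
          using mult_left_mono[OF J[of y] \<rho>0[of y]] by (simp add: algebra_simps)
      qed (use i\<rho>J i\<rho>w in auto)
      then show ?thesis by simp
    qed
    also have "\<dots> \<le> \<bar>LINT y|lborel. \<rho> y * J y\<bar>" by simp
    finally have "\<bar>c\<bar> * ((1 - \<alpha>) * I * (LINT y|lborel. \<rho> y * w y)) \<le> \<bar>T\<bar>"
      unfolding T2 abs_mult by (rule mult_left_mono) simp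
    also note T1
    finally have "I * ((1 - \<alpha>) * \<bar>c\<bar> * (LINT y|lborel. \<rho> y * w y)) \<le> I * (3 * M)" by (simp only: mult_ac)
    then show ?thesis using I by (simp add: w_def)
  qed
  define \<delta> where "\<delta> n = 1 / real (Suc n)" for n
  have \<delta>: "\<delta> n > 0" for n by (simp add: \<delta>_def)
  have \<delta>lim: "\<delta> \<longlonglongrightarrow> 0" unfolding \<delta>_def using LIMSEQ_inverse_real_of_nat by (simp add: inverse_eq_divide)
  let ?w = "\<lambda>n y. (19 * (\<delta> n)\<^sup>2 + 2 * (norm (x0 - y))\<^sup>2) powr (- ?s)"
  \<comment> \<open>In the limit the factor 2 in front of |x0 - y|^2 costs 2^(-s) with s =
    \<alpha>/2 + 1 \<le> 2, hence at most a factor 4; together with the 3 of the fixed-width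
    estimate this gives 12.\<close>
  have ptw: "ennreal (1 / 4 * (\<rho> y * norm (x0 - y) powr (- (\<alpha> + 2)))) \<le> liminf (\<lambda>n. ennreal (\<rho> y * ?w n y))" for y
  proof (cases "x0 = y")
    case False
    then have nz: "norm (x0 - y) > 0" by simp
    have "(\<lambda>n. ennreal (\<rho> y * ?w n y)) \<longlonglongrightarrow> ennreal (\<rho> y * (19 * 0\<^sup>2 + 2 * (norm (x0 - y))\<^sup>2) powr (- ?s))"
      using nz by (intro tendsto_intros tendsto_ennrealI \<delta>lim) auto
    then have "liminf (\<lambda>n. ennreal (\<rho> y * ?w n y)) = ennreal (\<rho> y * (19 * 0\<^sup>2 + 2 * (norm (x0 - y))\<^sup>2) powr (- ?s))"
      by (rule lim_imp_Liminf[OF sequentially_bot])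
    moreover have "1 / 4 * norm (x0 - y) powr (- (\<alpha> + 2)) \<le> (19 * 0\<^sup>2 + 2 * (norm (x0 - y))\<^sup>2) powr (- ?s)"
    proof -
      have "((norm (x0 - y))\<^sup>2) powr (- ?s) = norm (x0 - y) powr (- (\<alpha> + 2))" by (rule norm_square_powr)
      moreover have "(2::real) powr (- 2) \<le> 2 powr (- ?s)" using \<alpha> by (intro powr_mono) auto
      then have "1 / 4 \<le> (2::real) powr (- ?s)" by (simp add: powr_minus)
      then have "1 / 4 * norm (x0 - y) powr (- (\<alpha> + 2)) \<le> 2 powr (- ?s) * norm (x0 - y) powr (- (\<alpha> + 2))"
        by (rule mult_right_mono) simp
      ultimately show ?thesis by (simp add: powr_mult)
    qed
    then have "1 / 4 * (\<rho> y * norm (x0 - y) powr (- (\<alpha> + 2))) \<le> \<rho> y * (19 * 0\<^sup>2 + 2 * (norm (x0 - y))\<^sup>2) powr (- ?s)"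
      using mult_left_mono[OF _ \<rho>0[of y]] by (metis mult.left_commute)
    ultimately show ?thesis by (simp add: ennreal_leI)
  qed simp
  have ibd: "(\<integral>\<^sup>+ y. ennreal (\<rho> y * ?w n y) \<partial>lborel) \<le> ennreal (3 * M / ((1 - \<alpha>) * \<bar>c\<bar>))" for n
  proof -
    have "integrable lborel (\<lambda>y. \<rho> y * ?w n y)"
    proof (rule Bochner_Integration.integrable_bound[OF integrable_mult_right[OF \<rho>i, of "(19 * (\<delta> n)\<^sup>2) powr (- ?s)"]])
      have "?w n y \<le> (19 * (\<delta> n)\<^sup>2) powr (- ?s)" for y
        using \<delta>[of n] \<alpha> by (intro powr_mono2') auto
      then show "AE y in lborel. norm (\<rho> y * ?w n y) \<le> norm ((19 * (\<delta> n)\<^sup>2) powr (- ?s) * \<rho> y)"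
        using \<rho>0 by (intro AE_I2) (simp add: abs_mult mult.commute mult_left_mono)
    qed simp
    then have "(\<integral>\<^sup>+ y. ennreal (\<rho> y * ?w n y) \<partial>lborel) = ennreal (LINT y|lborel. \<rho> y * ?w n y)"
      by (intro nn_integral_eq_integral) (use \<rho>0 in auto)
    also have "\<dots> \<le> ennreal (3 * M / ((1 - \<alpha>) * \<bar>c\<bar>))"
      using stepA[OF \<delta>[of n]] \<alpha> c by (intro ennreal_leI) (simp add: field_simps)
    finally show ?thesis .
  qed
  have "(\<integral>\<^sup>+ y. ennreal (1 / 4 * (\<rho> y * norm (x0 - y) powr (- (\<alpha> + 2)))) \<partial>lborel) \<le> (\<integral>\<^sup>+ y. liminf (\<lambda>n. ennreal (\<rho> y * ?w n y)) \<partial>lborel)"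
    by (intro nn_integral_mono ptw)
  also have "\<dots> \<le> liminf (\<lambda>n. \<integral>\<^sup>+ y. ennreal (\<rho> y * ?w n y) \<partial>lborel)"
    by (rule nn_integral_liminf) simp
  also have "\<dots> \<le> limsup (\<lambda>n. \<integral>\<^sup>+ y. ennreal (\<rho> y * ?w n y) \<partial>lborel)"
    by (rule Liminf_le_Limsup) simp
  also have "\<dots> \<le> ennreal (3 * M / ((1 - \<alpha>) * \<bar>c\<bar>))"
    by (rule Limsup_bounded) (use ibd in auto)
  finally have A: "(\<integral>\<^sup>+ y. ennreal (1 / 4 * (\<rho> y * norm (x0 - y) powr (- (\<alpha> + 2)))) \<partial>lborel) \<le> ennreal (3 * M / ((1 - \<alpha>) * \<bar>c\<bar>))" .
  have "(\<integral>\<^sup>+ y. ennreal (\<rho> y * norm (x0 - y) powr (- (\<alpha> + 2))) \<partial>lborel)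
    = (\<integral>\<^sup>+ y. 4 * ennreal (1 / 4 * (\<rho> y * norm (x0 - y) powr (- (\<alpha> + 2)))) \<partial>lborel)"
  proof (intro nn_integral_cong)
    fix y
    have "4 * ennreal (1 / 4 * (\<rho> y * norm (x0 - y) powr (- (\<alpha> + 2)))) = ennreal 4 * ennreal (1 / 4 * (\<rho> y * norm (x0 - y) powr (- (\<alpha> + 2))))" by simp
    also have "\<dots> = ennreal (4 * (1 / 4 * (\<rho> y * norm (x0 - y) powr (- (\<alpha> + 2)))))"
      using \<rho>0[of y] by (intro ennreal_mult[symmetric]) auto
    finally show "ennreal (\<rho> y * norm (x0 - y) powr (- (\<alpha> + 2))) = 4 * ennreal (1 / 4 * (\<rho> y * norm (x0 - y) powr (- (\<alpha> + 2))))" by simp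
  qed
  also have "\<dots> = 4 * (\<integral>\<^sup>+ y. ennreal (1 / 4 * (\<rho> y * norm (x0 - y) powr (- (\<alpha> + 2)))) \<partial>lborel)"
    by (rule nn_integral_cmult) simp
  also have "\<dots> \<le> ennreal 4 * ennreal (3 * M / ((1 - \<alpha>) * \<bar>c\<bar>))"
    using A by (simp add: mult_left_mono)
  also have "\<dots> = ennreal (12 * M / ((1 - \<alpha>) * \<bar>c\<bar>))"
    using M0 \<alpha> by (subst ennreal_mult[symmetric]) auto
  finally show ?thesis .
qed

section \<open>The characteristic flow\<close>

lemma distr_shear_fst:
  fixes a :: "'b::euclidean_space \<Rightarrow> 'a::euclidean_space"
  assumes [measurable]: "a \<in> borel_measurable borel"
  shows "distr lborel borel (\<lambda>(x, v). (x + a v, v)) = (lborel :: ('a \<times> 'b) measure)"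
proof (rule measure_eqI)
  fix A :: "('a \<times> 'b) set" assume "A \<in> sets (distr lborel borel (\<lambda>(x, v). (x + a v, v)))"
  then have Ab [measurable]: "A \<in> sets borel" by simp
  then have A': "A \<in> sets (borel \<Otimes>\<^sub>M borel)" by (simp only: borel_prod)
  have m: "(\<lambda>(x, v). (x + a v, v)) \<in> borel_measurable borel" by (simp flip: borel_prod)
  have "emeasure (distr lborel borel (\<lambda>(x, v). (x + a v, v))) A = (\<integral>\<^sup>+ p. indicator A ((\<lambda>(x, v). (x + a v, v)) p) \<partial>lborel)"
    using m by (subst nn_integral_indicator[symmetric], simp, subst nn_integral_distr) auto
  also have "\<dots> = (\<integral>\<^sup>+ p. indicator A ((\<lambda>(x, v). (x + a v, v)) p) \<partial>(lborel \<Otimes>\<^sub>M lborel))"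
    by (simp add: lborel_prod)
  also have "\<dots> = (\<integral>\<^sup>+ v. \<integral>\<^sup>+ x. indicator A (x + a v, v) \<partial>lborel \<partial>lborel)"
    using m by (subst lborel_pair.nn_integral_snd[symmetric]) (auto simp: lborel_prod)
  also have "\<dots> = (\<integral>\<^sup>+ v. \<integral>\<^sup>+ x. indicator A (x, v) \<partial>lborel \<partial>lborel)"
  proof (rule nn_integral_cong)
    fix v
    have "(\<integral>\<^sup>+ x. indicator A (x, v) \<partial>lborel) = (\<integral>\<^sup>+ x. indicator A (x, v) \<partial>distr lborel borel ((+) (a v)))"
      by (simp only: lborel_distr_plus)
    also have "\<dots> = (\<integral>\<^sup>+ x. indicator A (x + a v, v) \<partial>lborel)"
      using A' by (subst nn_integral_distr) (auto simp: add.commute)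
    finally show "(\<integral>\<^sup>+ x. indicator A (x + a v, v) \<partial>lborel) = (\<integral>\<^sup>+ x. indicator A (x, v) \<partial>lborel)" ..
  qed
  also have "\<dots> = (\<integral>\<^sup>+ p. indicator A p \<partial>(lborel \<Otimes>\<^sub>M lborel))"
    by (subst lborel_pair.nn_integral_snd) (auto simp: lborel_prod)
  also have "\<dots> = emeasure lborel A" by (simp add: lborel_prod)
  finally show "emeasure (distr lborel borel (\<lambda>(x, v). (x + a v, v))) A = emeasure lborel A" .
qed simp

lemma distr_shear_snd:
  fixes a :: "'a::euclidean_space \<Rightarrow> 'b::euclidean_space"
  assumes [measurable]: "a \<in> borel_measurable borel"
  shows "distr lborel borel (\<lambda>(x, v). (x, v + a x)) = (lborel :: ('a \<times> 'b) measure)"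
proof (rule measure_eqI)
  fix A :: "('a \<times> 'b) set" assume "A \<in> sets (distr lborel borel (\<lambda>(x, v). (x, v + a x)))"
  then have Ab [measurable]: "A \<in> sets borel" by simp
  then have A': "A \<in> sets (borel \<Otimes>\<^sub>M borel)" by (simp only: borel_prod)
  have m: "(\<lambda>(x, v). (x, v + a x)) \<in> borel_measurable borel" by (simp flip: borel_prod)
  have "emeasure (distr lborel borel (\<lambda>(x, v). (x, v + a x))) A = (\<integral>\<^sup>+ p. indicator A ((\<lambda>(x, v). (x, v + a x)) p) \<partial>lborel)"
    using m by (subst nn_integral_indicator[symmetric], simp, subst nn_integral_distr) auto
  also have "\<dots> = (\<integral>\<^sup>+ p. indicator A ((\<lambda>(x, v). (x, v + a x)) p) \<partial>(lborel \<Otimes>\<^sub>M lborel))"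
    by (simp add: lborel_prod)
  also have "\<dots> = (\<integral>\<^sup>+ x. \<integral>\<^sup>+ v. indicator A (x, v + a x) \<partial>lborel \<partial>lborel)"
    using m by (subst lborel.nn_integral_fst[symmetric]) (auto simp: lborel_prod)
  also have "\<dots> = (\<integral>\<^sup>+ x. \<integral>\<^sup>+ v. indicator A (x, v) \<partial>lborel \<partial>lborel)"
  proof (rule nn_integral_cong)
    fix x
    have "(\<integral>\<^sup>+ v. indicator A (x, v) \<partial>lborel) = (\<integral>\<^sup>+ v. indicator A (x, v) \<partial>distr lborel borel ((+) (a x)))"
      by (simp only: lborel_distr_plus)
    also have "\<dots> = (\<integral>\<^sup>+ v. indicator A (x, v + a x) \<partial>lborel)"
      using A' by (subst nn_integral_distr) (auto simp: add.commute)
    finally show "(\<integral>\<^sup>+ v. indicator A (x, v + a x) \<partial>lborel) = (\<integral>\<^sup>+ v. indicator A (x, v) \<partial>lborel)" ..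
  qed
  also have "\<dots> = (\<integral>\<^sup>+ p. indicator A p \<partial>(lborel \<Otimes>\<^sub>M lborel))"
    by (subst lborel.nn_integral_fst) (auto simp: lborel_prod)
  also have "\<dots> = emeasure lborel A" by (simp add: lborel_prod)
  finally show "emeasure (distr lborel borel (\<lambda>(x, v). (x, v + a x))) A = emeasure lborel A" .
qed simp

lemma norm_fst_snd_le: "norm (fst w) \<le> norm w" "norm (snd w) \<le> norm w"
  by (metis norm_fst_le prod.collapse, metis norm_snd_le prod.collapse)

text \<open>The flow is part of the data; only its properties are derived. The force is continuous
  in time and Lipschitz in space, so a Jacobian of the flow is never available and measure
  preservation needs a different argument.\<close>

locale char_flow =
  fixes E :: "real \<Rightarrow> real^3 \<Rightarrow> real^3" and \<Phi> :: "real \<Rightarrow> phase \<Rightarrow> phase" and l m :: real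
  assumes E_cont: "continuous_on ({0..} \<times> UNIV) (\<lambda>(t, x). E t x)"
    and E_lip: "\<And>t x y. 0 \<le> t \<Longrightarrow> norm (E t x - E t y) \<le> l * norm (x - y)"
    and E_bdd: "\<And>t x. 0 \<le> t \<Longrightarrow> norm (E t x) \<le> m"
    and l_nonneg: "0 \<le> l"
    and flow: "characteristic_flow E \<Phi>"
begin

abbreviation "X t z \<equiv> fst (\<Phi> t z)"
abbreviation "V t z \<equiv> snd (\<Phi> t z)"

lemma m_nonneg: "0 \<le> m"
  using E_bdd[of 0 0] norm_ge_zero[of "E 0 0"] by linarith

lemma flow_0 [simp]: "\<Phi> 0 z = z"
  using flow unfolding characteristic_flow_def by blast

lemma flow_derivative:
  "0 \<le> t \<Longrightarrow> ((\<lambda>s. \<Phi> s z) has_vector_derivative (V t z, E t (X t z))) (at t within {0..})"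
  using flow unfolding characteristic_flow_def by blast

lemma X_derivative: "0 \<le> t \<Longrightarrow> ((\<lambda>s. X s z) has_vector_derivative V t z) (at t within {0..})"
  using bounded_linear.has_vector_derivative[OF bounded_linear_fst flow_derivative] by simp

lemma V_derivative: "0 \<le> t \<Longrightarrow> ((\<lambda>s. V s z) has_vector_derivative E t (X t z)) (at t within {0..})"
  using bounded_linear.has_vector_derivative[OF bounded_linear_snd flow_derivative] by simp

lemma flow_continuous: "continuous_on {0..} (\<lambda>t. \<Phi> t z)"
  by (rule continuous_on_vector_derivative[OF flow_derivative]) auto

lemma X_continuous: "continuous_on {0..} (\<lambda>t. X t z)" by (intro continuous_on_fst flow_continuous)
lemma V_continuous: "continuous_on {0..} (\<lambda>t. V t z)" by (intro continuous_on_snd flow_continuous)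

lemma E_along_continuous: "continuous_on {0..} (\<lambda>t. E t (X t z))"
proof -
  have "continuous_on {0..} ((\<lambda>(t, x). E t x) \<circ> (\<lambda>t. (t, X t z)))"
    by (intro continuous_on_compose continuous_intros X_continuous continuous_on_subset[OF E_cont]) auto
  then show ?thesis by (simp add: o_def)
qed

lemma at_within_pos: "0 < t \<Longrightarrow> at t within {0..} = at (t::real)"
  by (rule at_within_interior) auto

lemma flow_diff_derivative:
  assumes "0 < t"
  shows "((\<lambda>s. (norm (\<Phi> s z - \<Phi> s z'))\<^sup>2) has_real_derivative
    2 * ((\<Phi> t z - \<Phi> t z') \<bullet> (V t z - V t z', E t (X t z) - E t (X t z')))) (at t)"
proof -
  have d: "((\<lambda>s. \<Phi> s z - \<Phi> s z') has_vector_derivative (V t z - V t z', E t (X t z) - E t (X t z'))) (at t)"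
    using has_vector_derivative_diff[OF flow_derivative[of t z] flow_derivative[of t z']] assms by (simp add: at_within_pos)
  have "((\<lambda>s. (\<Phi> s z - \<Phi> s z') \<bullet> (\<Phi> s z - \<Phi> s z')) has_real_derivative
    2 * ((\<Phi> t z - \<Phi> t z') \<bullet> (V t z - V t z', E t (X t z) - E t (X t z')))) (at t)"
    using has_derivative_inner[OF d[unfolded has_vector_derivative_def] d[unfolded has_vector_derivative_def]]
    unfolding has_field_derivative_def
    by (rule has_derivative_eq_rhs) (auto simp: fun_eq_iff inner_commute simp del: scaleR_Pair)
  then show ?thesis by (simp add: power2_norm_eq_inner)
qed

lemma flow_diff_rate:
  assumes "0 \<le> t"
  shows "\<bar>2 * ((\<Phi> t z - \<Phi> t z') \<bullet> (V t z - V t z', E t (X t z) - E t (X t z')))\<bar> \<le> 2 * (1 + l) * (norm (\<Phi> t z - \<Phi> t z'))\<^sup>2"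
proof -
  let ?d = "\<Phi> t z - \<Phi> t z'"
  have "norm (V t z - V t z', E t (X t z) - E t (X t z')) \<le> norm (V t z - V t z') + norm (E t (X t z) - E t (X t z'))"
    by (rule norm_Pair_le)
  also have "\<dots> \<le> norm ?d + l * norm ?d"
  proof (intro add_mono order_trans[OF E_lip[OF assms]] mult_left_mono l_nonneg)
    show "norm (V t z - V t z') \<le> norm ?d" using norm_fst_snd_le(2)[of ?d] by simp
    show "norm (X t z - X t z') \<le> norm ?d" using norm_fst_snd_le(1)[of ?d] by simp
  qed
  finally have "norm (V t z - V t z', E t (X t z) - E t (X t z')) \<le> (1 + l) * norm ?d" by (simp add: algebra_simps)
  then have "norm ?d * norm (V t z - V t z', E t (X t z) - E t (X t z')) \<le> norm ?d * ((1 + l) * norm ?d)"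
    by (intro mult_left_mono) auto
  with Cauchy_Schwarz_ineq2[of ?d "(V t z - V t z', E t (X t z) - E t (X t z'))"]
  have "\<bar>?d \<bullet> (V t z - V t z', E t (X t z) - E t (X t z'))\<bar> \<le> norm ?d * ((1 + l) * norm ?d)" by linarith
  then have "2 * \<bar>?d \<bullet> (V t z - V t z', E t (X t z) - E t (X t z'))\<bar> \<le> 2 * (norm ?d * ((1 + l) * norm ?d))" by linarith
  also have "\<dots> = 2 * (1 + l) * (norm ?d)\<^sup>2" by (simp add: power2_eq_square)
  finally show ?thesis by (simp only: abs_mult abs_numeral)
qed

text \<open>Gronwall in both directions at once. The squared distance q of two trajectories
  satisfies |q'| \<le> 2 (1 + l) q; multiplied by the matching exponential it is nonincreasing for s
  = 1 and nondecreasing for s = -1.\<close>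

lemma flow_lipschitz_aux:
  assumes "0 \<le> t" "s = 1 \<or> s = - 1"
  shows "s * ((norm (\<Phi> t z - \<Phi> t z'))\<^sup>2 * exp (- s * (2 * (1 + l)) * t)) \<le> s * (norm (z - z'))\<^sup>2"
proof -
  let ?q = "\<lambda>t. (norm (\<Phi> t z - \<Phi> t z'))\<^sup>2"
  let ?c = "2 * (1 + l)"
  let ?g = "\<lambda>t. s * (?q t * exp (- s * ?c * t))"
  have "?g t \<le> ?g 0"
  proof (rule DERIV_nonpos_imp_decreasing_open[OF assms(1)])
    fix r assume r: "0 < r" "r < t"
    let ?q' = "2 * ((\<Phi> r z - \<Phi> r z') \<bullet> (V r z - V r z', E r (X r z) - E r (X r z')))"
    have "((\<lambda>t. exp (- s * ?c * t)) has_real_derivative exp (- s * ?c * r) * (- s * ?c)) (at r)"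
      by (auto intro!: derivative_eq_intros)
    from DERIV_mult[OF flow_diff_derivative[OF r(1)] this]
    have "((\<lambda>t. ?q t * exp (- s * ?c * t)) has_real_derivative (?q' * exp (- s * ?c * r) + ?q r * (exp (- s * ?c * r) * (- s * ?c)))) (at r)"
      by (rule DERIV_cong) (simp only: mult.commute)
    then have "(?g has_real_derivative s * (?q' * exp (- s * ?c * r) + ?q r * (exp (- s * ?c * r) * (- s * ?c)))) (at r)"
      by (rule DERIV_cmult)
    moreover have "s * (?q' * exp (- s * ?c * r) + ?q r * (exp (- s * ?c * r) * (- s * ?c)))
        = exp (- s * ?c * r) * (s * ?q' - ?c * ?q r)"
      using assms(2) by (auto simp: algebra_simps)
    moreover have "s * ?q' \<le> ?c * ?q r"
      using flow_diff_rate[of r z z'] r assms(2) by (auto simp: abs_le_iff)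
    then have "exp (- s * ?c * r) * (s * ?q' - ?c * ?q r) \<le> 0" by (simp add: mult_nonneg_nonpos)
    ultimately show "\<exists>y. (?g has_real_derivative y) (at r) \<and> y \<le> 0" by auto
  next
    show "continuous_on {0..t} ?g"
      by (intro continuous_intros continuous_on_subset[OF flow_continuous]) auto
  qed
  then show ?thesis by simp
qed

lemma flow_lipschitz:
  assumes "0 \<le> t"
  shows "norm (\<Phi> t z - \<Phi> t z') \<le> exp ((1 + l) * t) * norm (z - z')"
proof (rule power2_le_imp_le)
  define q r e where "q = (norm (\<Phi> t z - \<Phi> t z'))\<^sup>2" and "r = (norm (z - z'))\<^sup>2" and "e = 2 * (1 + l) * t"
  have "- 1 * (2 * (1 + l)) * t = - e" by (simp add: e_def algebra_simps)
  then have "q * exp (- e) \<le> r"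
    using flow_lipschitz_aux[OF assms, of 1 z z'] by (simp only: q_def r_def mult_1) blast
  then have "q * exp (- e) * exp e \<le> r * exp e" by (intro mult_right_mono) auto
  then have "q \<le> exp e * r" by (simp add: mult.assoc mult_exp_exp) (simp add: mult.commute)
  then have "(norm (\<Phi> t z - \<Phi> t z'))\<^sup>2 \<le> exp (2 * (1 + l) * t) * (norm (z - z'))\<^sup>2"
    by (simp only: q_def r_def e_def)
  also have "exp (2 * (1 + l) * t) = (exp ((1 + l) * t))\<^sup>2" by (simp add: exp_double[symmetric] mult.assoc)
  finally show "(norm (\<Phi> t z - \<Phi> t z'))\<^sup>2 \<le> (exp ((1 + l) * t) * norm (z - z'))\<^sup>2" by (simp add: power_mult_distrib)
qed simp

lemma flow_expanding:
  assumes "0 \<le> t"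
  shows "norm (z - z') \<le> exp ((1 + l) * t) * norm (\<Phi> t z - \<Phi> t z')"
proof (rule power2_le_imp_le)
  have "(norm (z - z'))\<^sup>2 \<le> (norm (\<Phi> t z - \<Phi> t z'))\<^sup>2 * exp (2 * (1 + l) * t)"
    using flow_lipschitz_aux[OF assms, of "-1" z z'] by simp
  also have "exp (2 * (1 + l) * t) = (exp ((1 + l) * t))\<^sup>2" by (simp add: exp_double[symmetric] mult.assoc)
  finally show "(norm (z - z'))\<^sup>2 \<le> (exp ((1 + l) * t) * norm (\<Phi> t z - \<Phi> t z'))\<^sup>2" by (simp add: power_mult_distrib mult.commute)
qed simp

lemma flow_continuous_space: "0 \<le> t \<Longrightarrow> continuous_on S (\<Phi> t)"
  by (rule lipschitz_on_continuous_on[of "exp ((1 + l) * t)"])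
    (auto simp: lipschitz_on_def dist_norm flow_lipschitz)

lemma flow_inj: "0 \<le> t \<Longrightarrow> inj (\<Phi> t)"
proof (rule injI)
  fix z z' assume "0 \<le> t" "\<Phi> t z = \<Phi> t z'"
  with flow_expanding[of t z z'] show "z = z'" by simp
qed

text \<open>The range is open by invariance of domain and closed because the flow expands distances
  up to a factor; phase space is connected.\<close>

lemma flow_surj:
  assumes t: "0 \<le> t" shows "surj (\<Phi> t)"
proof -
  have "open (range (\<Phi> t))"
    by (rule invariance_of_domain_gen) (use t in \<open>auto intro: flow_continuous_space flow_inj\<close>)
  moreover have "closed (range (\<Phi> t))"
    unfolding closed_sequential_limits
  proof (intro allI impI, elim conjE)
    fix w y assume w: "\<forall>n. w n \<in> range (\<Phi> t)" "w \<longlonglongrightarrow> y"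
    from w(1) have "\<forall>n. \<exists>z. w n = \<Phi> t z" unfolding image_def by blast
    then obtain z where z: "\<And>n. w n = \<Phi> t (z n)" by metis
    have "Cauchy w" by (rule LIMSEQ_imp_Cauchy[OF w(2)])
    have "Cauchy z"
    proof (rule metric_CauchyI)
      fix e :: real assume "e > 0"
      then have "e / exp ((1 + l) * t) > 0" by simp
      then obtain N where N: "\<And>m n. m \<ge> N \<Longrightarrow> n \<ge> N \<Longrightarrow> dist (w m) (w n) < e / exp ((1 + l) * t)"
        using metric_CauchyD[OF \<open>Cauchy w\<close>] by metis
      have "dist (z m) (z n) < e" if "m \<ge> N" "n \<ge> N" for m n
      proof -
        have "dist (z m) (z n) \<le> exp ((1 + l) * t) * dist (w m) (w n)"
          using flow_expanding[OF t, of "z m" "z n"] by (simp add: dist_norm z)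
        also have "\<dots> < e" using N[OF that] by (simp add: field_simps)
        finally show ?thesis .
      qed
      then show "\<exists>M. \<forall>m\<ge>M. \<forall>n\<ge>M. dist (z m) (z n) < e" by blast
    qed
    then obtain z' where "z \<longlonglongrightarrow> z'" using Cauchy_convergent convergent_def by blast
    then have "(\<lambda>n. \<Phi> t (z n)) \<longlonglongrightarrow> \<Phi> t z'"
      by (rule continuous_on_tendsto_compose[OF flow_continuous_space[OF t, of UNIV]]) auto
    moreover have "w = (\<lambda>n. \<Phi> t (z n))" using z by auto
    ultimately have "w \<longlonglongrightarrow> \<Phi> t z'" by (simp only:)
    then have "y = \<Phi> t z'" by (rule LIMSEQ_unique[OF w(2)])
    then show "y \<in> range (\<Phi> t)" by simp
  qed
  ultimately show ?thesis
    using clopen[of "range (\<Phi> t)"] by auto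
qed

section \<open>Growth of trajectories and approximation by Euler steps\<close>

lemma increment_bound:
  fixes y :: "real \<Rightarrow> 'b::real_normed_vector"
  assumes "a \<le> b" "0 \<le> a"
    and "\<And>s. a \<le> s \<Longrightarrow> s \<le> b \<Longrightarrow> (y has_vector_derivative y' s) (at s within {0..})"
    and "\<And>s. a \<le> s \<Longrightarrow> s \<le> b \<Longrightarrow> norm (y' s) \<le> B"
  shows "norm (y b - y a) \<le> B * (b - a)"
proof -
  have "norm (y b - y a) \<le> B * norm (b - a)"
  proof (rule differentiable_bound[of "{a..b}" y "\<lambda>s h. h *\<^sub>R y' s"])
    show "(y has_derivative (\<lambda>h. h *\<^sub>R y' s)) (at s within {a..b})" if "s \<in> {a..b}" for s
      using assms(3)[of s] that has_derivative_subset[of y _ s "{0..}" "{a..b}"] assms(2)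
      by (auto simp: has_vector_derivative_def)
    show "onorm (\<lambda>h. h *\<^sub>R y' s) \<le> B" if "s \<in> {a..b}" for s
      by (rule onorm_le) (use assms(4)[of s] that in \<open>simp add: mult.commute[of B] mult_left_mono\<close>)
  qed (use assms in auto)
  with assms(1) show ?thesis by simp
qed

lemma V_bound: "0 \<le> t \<Longrightarrow> norm (V t z - snd z) \<le> m * t"
  using increment_bound[of 0 t "\<lambda>s. V s z" "\<lambda>s. E s (X s z)" m] V_derivative E_bdd by simp

lemma X_bound: "0 \<le> t \<Longrightarrow> norm (X t z - fst z) \<le> (norm (snd z) + m * t) * t"
proof -
  assume t: "0 \<le> t"
  have "norm (V s z) \<le> norm (snd z) + m * t" if "0 \<le> s" "s \<le> t" for s
  proof -
    have "norm (V s z) \<le> norm (snd z) + norm (V s z - snd z)" by (rule norm_triangle_sub)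
    also have "norm (V s z - snd z) \<le> m * s" by (rule V_bound[OF that(1)])
    also have "m * s \<le> m * t" using that m_nonneg by (intro mult_left_mono)
    finally show ?thesis by simp
  qed
  then show ?thesis
    using increment_bound[of 0 t "\<lambda>s. X s z" "\<lambda>s. V s z" "norm (snd z) + m * t"] X_derivative t by simp
qed

text \<open>The symplectic Euler scheme: the force is evaluated at the already updated position.
  Each step is then a composition of two shears and preserves volume exactly, although E need not be
  differentiable.\<close>

primrec euler :: "real \<Rightarrow> nat \<Rightarrow> phase \<Rightarrow> phase" where
  "euler h 0 z = z"
| "euler h (Suc k) z = (\<lambda>(x, v). (x, v + h *\<^sub>R E (real k * h) x)) ((\<lambda>(x, v). (x + h *\<^sub>R v, v)) (euler h k z))"

lemma E_continuous_space: "0 \<le> t \<Longrightarrow> continuous_on S (E t)"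
  by (rule lipschitz_on_continuous_on[of l]) (auto simp: lipschitz_on_def dist_norm E_lip l_nonneg)

lemma E_measurable: "0 \<le> t \<Longrightarrow> E t \<in> borel_measurable borel"
  by (rule borel_measurable_continuous_onI) (rule E_continuous_space)

lemma euler_measure_preserving:
  assumes "0 \<le> h"
  shows "euler h k \<in> borel_measurable borel \<and> distr lborel borel (euler h k) = lborel"
proof (induction k)
  case 0
  have "euler h 0 = (\<lambda>z. z)" by auto
  then show ?case by (simp add: distr_id2)
next
  case (Suc k)
  let ?S1 = "\<lambda>(x::real^3, v). (x + h *\<^sub>R v, v)"
  let ?S2 = "\<lambda>(x, v). (x, v + h *\<^sub>R E (real k * h) x)"
  have Em: "E (real k * h) \<in> borel_measurable borel" using assms by (intro E_measurable) simp
  have m1: "?S1 \<in> borel_measurable borel" by (simp flip: borel_prod)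
  have m2: "?S2 \<in> borel_measurable borel" using Em by (simp flip: borel_prod)
  have 1: "distr lborel borel ?S1 = lborel" by (rule distr_shear_fst) simp
  have 2: "distr lborel borel ?S2 = lborel" by (rule distr_shear_snd) (use Em in simp)
  have eq: "euler h (Suc k) = ?S2 \<circ> (?S1 \<circ> euler h k)" by (auto simp: fun_eq_iff)
  have m: "euler h k \<in> borel_measurable borel" using Suc by simp
  have "distr lborel borel (euler h (Suc k)) = distr (distr (distr lborel borel (euler h k)) borel ?S1) borel ?S2"
    unfolding eq using m m1 m2 by (subst distr_distr, simp_all add: distr_distr)
  also have "\<dots> = lborel" using Suc 1 2 by simp
  finally have "distr lborel borel (euler h (Suc k)) = lborel" .
  moreover have "euler h (Suc k) \<in> borel_measurable borel"
    unfolding eq by (rule measurable_comp[OF measurable_comp[OF m m1] m2])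
  ultimately show ?case by blast
qed

lemma euler_step_lipschitz:
  assumes "0 \<le> h" "h \<le> 1" "0 \<le> t"
  shows "norm ((x + h *\<^sub>R v, v + h *\<^sub>R E t (x + h *\<^sub>R v)) - (x' + h *\<^sub>R v', v' + h *\<^sub>R E t (x' + h *\<^sub>R v')))
    \<le> (1 + h * (1 + 2 * l)) * norm ((x, v) - (x', v'))"
proof -
  let ?d = "(x, v) - (x', v')"
  have d: "norm (x - x') \<le> norm ?d" "norm (v - v') \<le> norm ?d" using norm_fst_le[of "x - x'" "v - v'"] norm_snd_le[of "v - v'" "x - x'"] by auto
  have "norm (E t (x + h *\<^sub>R v) - E t (x' + h *\<^sub>R v')) \<le> l * norm ((x + h *\<^sub>R v) - (x' + h *\<^sub>R v'))" by (rule E_lip[OF assms(3)])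
  also have "(x + h *\<^sub>R v) - (x' + h *\<^sub>R v') = (x - x') + h *\<^sub>R (v - v')" by (simp add: algebra_simps)
  also have "norm \<dots> \<le> norm (x - x') + h * norm (v - v')" using assms(1) by (intro norm_triangle_le) simp
  also have "\<dots> \<le> norm ?d + 1 * norm ?d" using d assms by (intro add_mono mult_mono) auto
  finally have e: "norm (E t (x + h *\<^sub>R v) - E t (x' + h *\<^sub>R v')) \<le> 2 * l * norm ?d" using l_nonneg by (simp add: mult_left_mono)
  have "(x + h *\<^sub>R v, v + h *\<^sub>R E t (x + h *\<^sub>R v)) - (x' + h *\<^sub>R v', v' + h *\<^sub>R E t (x' + h *\<^sub>R v'))
    = ?d + h *\<^sub>R (v - v', E t (x + h *\<^sub>R v) - E t (x' + h *\<^sub>R v'))"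
    by (simp add: algebra_simps)
  also have "norm \<dots> \<le> norm ?d + h * norm (v - v', E t (x + h *\<^sub>R v) - E t (x' + h *\<^sub>R v'))"
    using assms(1) by (intro norm_triangle_le) (simp del: scaleR_Pair)
  also have "\<dots> \<le> norm ?d + h * (norm ?d + 2 * l * norm ?d)"
    using norm_Pair_le[of "v - v'" "E t (x + h *\<^sub>R v) - E t (x' + h *\<^sub>R v')"] d e assms(1)
    by (intro add_left_mono mult_left_mono) linarith+
  also have "\<dots> = (1 + h * (1 + 2 * l)) * norm ?d" by (simp add: distrib_right distrib_left mult.assoc)
  finally show ?thesis .
qed

text \<open>Consistency plus stability. Uniform continuity of the force along the trajectory on
  [0, T] makes the local error at most h \<epsilon> for small h, and the Lipschitz constant of a
  step turns this into a global error of order \<epsilon>.\<close>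

lemma euler_converges:
  assumes T: "0 < T"
  shows "(\<lambda>n. euler (T / real (Suc n)) (Suc n) z) \<longlonglongrightarrow> \<Phi> T z"
proof (rule metric_LIMSEQ_I)
  fix e :: real assume e: "e > 0"
  define c where "c = 1 + 2 * l"
  have c: "c \<ge> 1" using l_nonneg by (simp add: c_def)
  \<comment> \<open>Accumulated over time T the local error is amplified by at most exp(c T), which
    leaves e/2.\<close>
  define \<epsilon> where "\<epsilon> = e / (2 * exp (c * T))"
  have \<epsilon>: "\<epsilon> > 0" using e by (simp add: \<epsilon>_def)
  define W where "W = norm (snd z) + m * T"
  have W: "W \<ge> 0" using m_nonneg T by (simp add: W_def)
  have VW: "norm (V s z) \<le> W" if "0 \<le> s" "s \<le> T" for s
  proof -
    have "norm (V s z) \<le> norm (snd z) + norm (V s z - snd z)" by (rule norm_triangle_sub)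
    also have "norm (V s z - snd z) \<le> m * s" by (rule V_bound[OF that(1)])
    also have "m * s \<le> m * T" using that m_nonneg by (intro mult_left_mono)
    finally show ?thesis by (simp add: W_def)
  qed
  have "uniformly_continuous_on {0..T} (\<lambda>t. E t (X t z))"
    by (intro compact_uniformly_continuous continuous_on_subset[OF E_along_continuous]) auto
  moreover have "\<epsilon> / 4 > 0" using \<epsilon> by simp
  ultimately obtain d where d: "d > 0" "\<And>s t. s \<in> {0..T} \<Longrightarrow> t \<in> {0..T} \<Longrightarrow> dist s t < d \<Longrightarrow> dist (E s (X s z)) (E t (X t z)) < \<epsilon> / 4"
    unfolding uniformly_continuous_on_def by metis
  obtain h0 where h0: "h0 > 0" "h0 \<le> 1" "h0 < d" "m * h0 \<le> \<epsilon> / 4" "l * W * h0 \<le> \<epsilon> / 4"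
  proof -
    let ?h = "min (min 1 (d / 2)) (min (\<epsilon> / 4 / (m + 1)) (\<epsilon> / 4 / (l * W + 1)))"
    have lW: "0 \<le> l * W" using l_nonneg W by simp
    have m1: "m + 1 > 0" "l * W + 1 > 0" using m_nonneg lW by linarith+
    have h: "?h > 0" using d(1) \<epsilon> m1 by (auto intro!: divide_pos_pos)
    have "m * ?h \<le> (m + 1) * (\<epsilon> / 4 / (m + 1))"
      using m_nonneg h by (intro mult_mono) auto
    also have "\<dots> = \<epsilon> / 4" by (metis m1(1) less_irrefl nonzero_mult_div_cancel_left times_divide_eq_right)
    finally have 1: "m * ?h \<le> \<epsilon> / 4" .
    have "l * W * ?h \<le> (l * W + 1) * (\<epsilon> / 4 / (l * W + 1))"
      using lW h by (intro mult_mono) auto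
    also have "\<dots> = \<epsilon> / 4" by (metis m1(2) less_irrefl nonzero_mult_div_cancel_left times_divide_eq_right)
    finally have 2: "l * W * ?h \<le> \<epsilon> / 4" .
    have 3: "?h \<le> 1" "?h < d" using d(1) by auto
    show ?thesis by (rule that[OF h 3 1 2])
  qed
  obtain N :: nat where N: "T / h0 < real N" using reals_Archimedean2 by blast
  have "dist (euler (T / real (Suc n)) (Suc n) z) (\<Phi> T z) < e" if n: "n \<ge> N" for n
  proof -
    define h where "h = T / real (Suc n)"
    have hpos: "h > 0" using T by (simp add: h_def)
    have "T < real N * h0" using N h0(1) by (simp add: field_simps)
    also have "\<dots> \<le> real (Suc n) * h0" using n h0(1) by (intro mult_right_mono) auto
    finally have hh0: "h < h0" by (simp add: h_def field_simps)
    have hT: "real (Suc n) * h = T" by (simp add: h_def)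
    \<comment> \<open>One step started on the exact trajectory. Subtracting from position and
      velocity a linear function of time with the numerical slope reduces the error to the
      oscillation of V and of the force within the step.\<close>
    have loc: "norm (\<Phi> (real k * h + h) z - (X (real k * h) z + h *\<^sub>R V (real k * h) z,
        V (real k * h) z + h *\<^sub>R E (real k * h) (X (real k * h) z + h *\<^sub>R V (real k * h) z))) \<le> h * \<epsilon>" if k: "k < Suc n" for k
    proof -
      let ?t = "real k * h"
      have t: "0 \<le> ?t" using hpos by simp
      have "real (Suc k) * h \<le> real (Suc n) * h" using k hpos by (intro mult_right_mono) auto
      then have tT: "?t + h \<le> T" using hT by (simp add: algebra_simps)
      have 1: "norm ((X (?t + h) z - (?t + h) *\<^sub>R V ?t z) - (X ?t z - ?t *\<^sub>R V ?t z)) \<le> (\<epsilon> / 4) * (?t + h - ?t)"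
      proof (rule increment_bound[of ?t "?t + h" "\<lambda>s. X s z - s *\<^sub>R V ?t z" "\<lambda>s. V s z - V ?t z"])
        fix s assume s: "?t \<le> s" "s \<le> ?t + h"
        then have s0: "0 \<le> s" using t by linarith
        show "((\<lambda>s. X s z - s *\<^sub>R V ?t z) has_vector_derivative V s z - V ?t z) (at s within {0..})"
          by (auto intro!: derivative_eq_intros X_derivative s0)
        have "norm (V s z - V ?t z) \<le> m * (s - ?t)"
          by (rule increment_bound[where y = "\<lambda>s. V s z" and y' = "\<lambda>s. E s (X s z)"]) (use s t in \<open>auto intro!: V_derivative E_bdd intro: order_trans[OF t]\<close>)
        also have "\<dots> \<le> m * h0" using s hh0 m_nonneg by (intro mult_left_mono) auto
        finally show "norm (V s z - V ?t z) \<le> \<epsilon> / 4" using h0 by linarith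
      qed (use hpos t in auto)
      let ?x' = "X ?t z + h *\<^sub>R V ?t z"
      have 2: "norm ((V (?t + h) z - (?t + h) *\<^sub>R E ?t ?x') - (V ?t z - ?t *\<^sub>R E ?t ?x')) \<le> (\<epsilon> / 2) * (?t + h - ?t)"
      proof (rule increment_bound[of ?t "?t + h" "\<lambda>s. V s z - s *\<^sub>R E ?t ?x'" "\<lambda>s. E s (X s z) - E ?t ?x'"])
        fix s assume s: "?t \<le> s" "s \<le> ?t + h"
        then have s0: "0 \<le> s" using t by linarith
        show "((\<lambda>s. V s z - s *\<^sub>R E ?t ?x') has_vector_derivative E s (X s z) - E ?t ?x') (at s within {0..})"
          by (auto intro!: derivative_eq_intros V_derivative s0)
        have "dist (E s (X s z)) (E ?t (X ?t z)) < \<epsilon> / 4"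
          proof (rule d(2))
          show "s \<in> {0..T}" using s(2) s0 tT unfolding atLeastAtMost_iff by linarith
          show "?t \<in> {0..T}" using t tT hpos unfolding atLeastAtMost_iff by linarith
          show "dist s ?t < d" using s hh0 h0(3) unfolding dist_norm real_norm_def by linarith
        qed
        moreover have "norm (E ?t (X ?t z) - E ?t ?x') \<le> l * norm (X ?t z - ?x')" by (rule E_lip[OF t])
        moreover have "l * norm (X ?t z - ?x') \<le> l * (h0 * W)"
          using VW[of ?t] t tT hpos hh0 by (intro mult_left_mono l_nonneg) (auto intro!: mult_mono)
        ultimately show "norm (E s (X s z) - E ?t ?x') \<le> \<epsilon> / 2"
          using norm_triangle_ineq[of "E s (X s z) - E ?t (X ?t z)" "E ?t (X ?t z) - E ?t ?x'"] h0 by (simp add: dist_norm mult_ac)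
      qed (use hpos t in auto)
      have e1: "(X (?t + h) z - (?t + h) *\<^sub>R V ?t z) - (X ?t z - ?t *\<^sub>R V ?t z) = X (?t + h) z - ?x'"
        by (simp add: algebra_simps)
      have e2: "(V (?t + h) z - (?t + h) *\<^sub>R E ?t ?x') - (V ?t z - ?t *\<^sub>R E ?t ?x') = V (?t + h) z - (V ?t z + h *\<^sub>R E ?t ?x')"
        by (simp add: algebra_simps)
      have e3: "\<Phi> (?t + h) z - (?x', V ?t z + h *\<^sub>R E ?t ?x') = (X (?t + h) z - ?x', V (?t + h) z - (V ?t z + h *\<^sub>R E ?t ?x'))"
        by (simp add: prod_eq_iff)
      have a1: "norm (X (?t + h) z - ?x') \<le> (\<epsilon> / 4) * h" using 1 unfolding e1 by simp
      have a2: "norm (V (?t + h) z - (V ?t z + h *\<^sub>R E ?t ?x')) \<le> (\<epsilon> / 2) * h" using 2 unfolding e2 by simp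
      have "(\<epsilon> / 4) * h + (\<epsilon> / 2) * h \<le> h * \<epsilon>" using hpos \<epsilon> by (simp add: field_simps)
      then show ?thesis unfolding e3
        using norm_Pair_le[of "X (?t + h) z - ?x'" "V (?t + h) z - (V ?t z + h *\<^sub>R E ?t ?x')"] a1 a2 by linarith
    qed
    \<comment> \<open>The bound solves the recursion e(k+1) = (1 + h c) e(k) + h c \<epsilon> with
      e(0) = 0; the local error h \<epsilon> fits because c \<ge> 1.\<close>
    have err: "norm (\<Phi> (real k * h) z - euler h k z) \<le> \<epsilon> * ((1 + h * c) ^ k - 1)" if "k \<le> Suc n" for k
      using that
    proof (induction k)
      case (Suc k)
      let ?t = "real k * h"
      define S where "S p = (fst p + h *\<^sub>R snd p, snd p + h *\<^sub>R E ?t (fst p + h *\<^sub>R snd p))" for p :: phase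
      have eu: "euler h (Suc k) z = S (euler h k z)" by (simp add: S_def case_prod_unfold)
      have "norm (S (\<Phi> ?t z) - S (euler h k z)) \<le> (1 + h * c) * norm (\<Phi> ?t z - euler h k z)"
        using euler_step_lipschitz[of h ?t "X ?t z" "V ?t z" "fst (euler h k z)" "snd (euler h k z)"] hpos hh0 h0(2)
        by (simp add: c_def S_def)
      also have "\<dots> \<le> (1 + h * c) * (\<epsilon> * ((1 + h * c) ^ k - 1))"
        using Suc hpos c by (intro mult_left_mono) auto
      finally have b: "norm (S (\<Phi> ?t z) - S (euler h k z)) \<le> (1 + h * c) * (\<epsilon> * ((1 + h * c) ^ k - 1))" .
      have "norm (\<Phi> (?t + h) z - S (\<Phi> ?t z)) \<le> h * \<epsilon>" using loc[of k] Suc.prems by (simp add: S_def)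
      from norm_diff_triangle_le[OF this b]
      have "norm (\<Phi> (?t + h) z - S (euler h k z)) \<le> h * \<epsilon> + (1 + h * c) * (\<epsilon> * ((1 + h * c) ^ k - 1))" .
      also have "\<dots> \<le> h * (c * \<epsilon>) + (1 + h * c) * (\<epsilon> * ((1 + h * c) ^ k - 1))"
        using hpos c \<epsilon> by (intro add_right_mono mult_left_mono) auto
      also have "\<dots> = \<epsilon> * ((1 + h * c) ^ Suc k - 1)" by (simp add: algebra_simps)
      finally show ?case unfolding eu by (simp add: algebra_simps)
    qed simp
    have "(1 + h * c) ^ Suc n \<le> exp (h * c) ^ Suc n" using hpos c by (intro power_mono) (auto simp: exp_ge_add_one_self add_nonneg_nonneg)
    also have "\<dots> = exp (c * T)" using hT by (metis exp_of_nat_mult mult.commute mult.left_commute)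
    finally have "\<epsilon> * ((1 + h * c) ^ Suc n - 1) \<le> \<epsilon> * exp (c * T)" using \<epsilon> by (intro mult_left_mono) auto
    also have "\<dots> = e / 2" by (simp add: \<epsilon>_def)
    finally have "norm (\<Phi> T z - euler h (Suc n) z) \<le> e / 2" using err[of "Suc n"] hT by simp
    then show ?thesis using e by (simp add: dist_norm norm_minus_commute h_def)
  qed
  then show "\<exists>no. \<forall>n\<ge>no. dist (euler (T / real (Suc n)) (Suc n) z) (\<Phi> T z) < e" by blast
qed

lemma euler_bound:
  assumes "0 \<le> h"
  shows "norm (snd (euler h k z) - snd z) \<le> m * (real k * h) \<and>
    norm (fst (euler h k z) - fst z) \<le> (norm (snd z) + m * (real k * h)) * (real k * h)"
proof (induction k)
  case (Suc k)
  obtain x v where xv: "euler h k z = (x, v)" by (cases "euler h k z")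
  let ?t = "real k * h"
  have t: "0 \<le> ?t" using assms by simp
  have v: "norm (v - snd z) \<le> m * ?t" and x: "norm (x - fst z) \<le> (norm (snd z) + m * ?t) * ?t" using Suc xv by auto
  let ?v' = "v + h *\<^sub>R E ?t (x + h *\<^sub>R v)"
  have "norm (h *\<^sub>R E ?t (x + h *\<^sub>R v)) \<le> h * m" using E_bdd[OF t] assms by (simp add: mult_left_mono)
  then have v': "norm (?v' - snd z) \<le> m * (real (Suc k) * h)"
    using v norm_triangle_ineq[of "v - snd z" "h *\<^sub>R E ?t (x + h *\<^sub>R v)"] by (simp add: algebra_simps)
  have "norm v \<le> norm (snd z) + m * ?t" using v norm_triangle_sub[of v "snd z"] by linarith
  then have "norm (h *\<^sub>R v) \<le> (norm (snd z) + m * ?t) * h" using assms by (simp add: mult_left_mono mult.commute)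
  then have "norm (x + h *\<^sub>R v - fst z) \<le> (norm (snd z) + m * ?t) * (?t + h)"
    using x norm_triangle_ineq[of "x - fst z" "h *\<^sub>R v"] by (simp add: algebra_simps)
  also have "\<dots> \<le> (norm (snd z) + m * (real (Suc k) * h)) * (real (Suc k) * h)"
    using m_nonneg assms t by (intro mult_mono add_mono mult_left_mono) (auto simp: algebra_simps)
  finally show ?case using v' xv by simp
qed simp

text \<open>Exact flow and Euler scheme obey the same growth bounds, so points that they send into a
  fixed ball come from one larger ball that does not depend on the step size. This is the integrable
  majorant for the limits below.\<close>

lemma preimage_bound:
  fixes w :: phase
  assumes "0 \<le> T" "norm (snd w - snd z) \<le> m * T" "norm (fst w - fst z) \<le> (norm (snd z) + m * T) * T" "norm w \<le> R"
  shows "norm z \<le> 2 * (R + m * T) + (R + 2 * m * T) * T"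
proof -
  have mT: "0 \<le> m * T" using assms(1) m_nonneg by simp
  have "norm (snd z) \<le> norm (snd w) + m * T" using assms(2) norm_triangle_sub[of "snd z" "snd w"] by (simp add: norm_minus_commute)
  then have 1: "norm (snd z) \<le> R + m * T" using norm_fst_snd_le(2)[of w] assms(4) by linarith
  have "2 * m * T = 2 * (m * T)" by simp
  then have "norm (snd z) + m * T \<le> R + 2 * m * T" using 1 by linarith
  then have "(norm (snd z) + m * T) * T \<le> (R + 2 * m * T) * T" using assms(1) by (rule mult_right_mono)
  then have "norm (fst z) \<le> R + (R + 2 * m * T) * T"
    using assms(3,4) norm_fst_snd_le(1)[of w] norm_triangle_sub[of "fst z" "fst w"] by (simp add: norm_minus_commute)
  with 1 show ?thesis using norm_Pair_le[of "fst z" "snd z"] mT by simp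
qed

lemma flow_measurable: "0 \<le> t \<Longrightarrow> \<Phi> t \<in> borel_measurable borel"
  by (rule borel_measurable_continuous_onI) (rule flow_continuous_space)

text \<open>Integrals of bumps are invariant under the Euler maps, hence under the flow by dominated
  convergence. Letting the bumps approach indicators yields the measure of preimages of boxes, which
  characterises \<open>lborel\<close>.\<close>

lemma flow_measure_preserving:
  assumes t: "0 \<le> T"
  shows "distr lborel borel (\<Phi> T) = lborel"
proof (cases "T = 0")
  case True
  have "\<Phi> 0 = (\<lambda>z. z)" by auto
  with True show ?thesis by (simp add: distr_id2)
next
  case False
  with t have T: "0 < T" by simp
  note [measurable] = flow_measurable[OF t]
  have bump_eq: "(LINT z|lborel. bump n a c (\<Phi> T z)) = (LINT z|lborel. bump n a c z)" if n: "n > 0" for n and a c :: phase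
  proof -
    have \<phi>: "bump n a c \<in> test_functions UNIV" using n by (intro bump_test_function) auto
    note [measurable] = test_function_measurable[OF \<phi>]
    obtain R where R: "R > 0" "\<And>x. bump n a c x \<noteq> 0 \<Longrightarrow> norm x \<le> R" by (rule frechet_derivative_support[OF \<phi>]) blast
    let ?R = "2 * (R + m * T) + (R + 2 * m * T) * T"
    let ?Z = "\<lambda>n. euler (T / real (Suc n)) (Suc n)"
    have Zm: "?Z k \<in> borel_measurable borel" "distr lborel borel (?Z k) = lborel" for k
      using euler_measure_preserving[of "T / real (Suc k)" "Suc k"] T by auto
    have "(\<lambda>k. LINT z|lborel. bump n a c (?Z k z)) \<longlonglongrightarrow> (LINT z|lborel. bump n a c (\<Phi> T z))"
    proof (rule integral_dominated_convergence[where w = "indicator (cball 0 ?R)"])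
      show "(\<lambda>z. bump n a c (\<Phi> T z)) \<in> borel_measurable lborel" by simp
      show "(\<lambda>z. bump n a c (?Z k z)) \<in> borel_measurable lborel" for k
        using measurable_comp[OF Zm(1)[of k] test_function_measurable[OF \<phi>]] by (simp add: o_def)
      show "integrable lborel (indicator (cball (0::phase) ?R) :: phase \<Rightarrow> real)"
        using emeasure_lborel_cball_finite[of "0::phase" ?R] by (intro integrable_real_indicator) auto
      have "isCont (bump n a c) w" for w
        using has_derivative_continuous[OF smooth_has_derivative[OF smooth_bump]] .
      then show "AE z in lborel. (\<lambda>k. bump n a c (?Z k z)) \<longlonglongrightarrow> bump n a c (\<Phi> T z)"
        by (intro AE_I2 isCont_tendsto_compose[OF _ euler_converges[OF T]])
      show "AE z in lborel. norm (bump n a c (?Z k z)) \<le> indicator (cball 0 ?R) z" for k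
      proof (intro AE_I2)
        fix z
        show "norm (bump n a c (?Z k z)) \<le> indicator (cball 0 ?R) z"
        proof (cases "bump n a c (?Z k z) = 0")
          case False
          have "real (Suc k) * (T / real (Suc k)) = T" by simp
          then have "norm z \<le> ?R"
            using euler_bound[of "T / real (Suc k)" "Suc k" z] T R(2)[OF False] by (intro preimage_bound[of T "?Z k z"]) (auto simp del: of_nat_Suc euler.simps)
          then show ?thesis by (simp add: bump_nonneg bump_le_1 del: euler.simps)
        qed simp
      qed
    qed
    moreover have "(LINT z|lborel. bump n a c (?Z k z)) = (LINT z|lborel. bump n a c z)" for k
      using integral_distr[of "?Z k" lborel borel "bump n a c"] Zm[of k] by simp
    ultimately show ?thesis by (simp add: LIMSEQ_const_iff)
  qed
  show ?thesis
  proof (rule lborel_eqI[symmetric])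
    fix a c :: phase assume ac: "\<And>b. b \<in> Basis \<Longrightarrow> a \<bullet> b \<le> c \<bullet> b"
    obtain R where R: "\<And>x. x \<in> box a c \<Longrightarrow> norm x \<le> R" using bounded_box[of a c] unfolding bounded_iff by auto
    let ?R = "2 * (R + m * T) + (R + 2 * m * T) * T"
    have sub: "{z. \<Phi> T z \<in> box a c} \<subseteq> cball 0 ?R"
      using preimage_bound[OF t V_bound[OF t] X_bound[OF t] R] by auto
    have ms [measurable]: "{z. \<Phi> T z \<in> box a c} \<in> sets borel" by measurable
    have bm [measurable]: "bump (real (Suc n)) a c \<in> borel_measurable borel" for n
      by (rule test_function_measurable[OF bump_test_function]) auto
    have 1: "(\<lambda>n. LINT z|lborel. bump (real (Suc n)) a c (\<Phi> T z)) \<longlonglongrightarrow> (LINT z|lborel. indicator {z. \<Phi> T z \<in> box a c} z)"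
    proof (rule integral_dominated_convergence[where w = "indicator (cball 0 ?R)"])
      show "integrable lborel (indicator (cball (0::phase) ?R) :: phase \<Rightarrow> real)"
        using emeasure_lborel_cball_finite[of "0::phase" ?R] by (intro integrable_real_indicator) auto
      have "indicator {z. \<Phi> T z \<in> box a c} z = (indicator (box a c) (\<Phi> T z) :: real)" for z by (simp add: indicator_def)
      then show "AE z in lborel. (\<lambda>n. bump (real (Suc n)) a c (\<Phi> T z)) \<longlonglongrightarrow> indicator {z. \<Phi> T z \<in> box a c} z"
        by (intro AE_I2) (simp only: bump_tendsto)
      show "AE z in lborel. norm (bump (real (Suc n)) a c (\<Phi> T z)) \<le> indicator (cball 0 ?R) z" for n
      proof (intro AE_I2)
        fix z show "norm (bump (real (Suc n)) a c (\<Phi> T z)) \<le> indicator (cball 0 ?R) z"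
        proof (cases "\<Phi> T z \<in> box a c")
          case True
          then have "z \<in> cball 0 ?R" using sub by blast
          then show ?thesis
            using bump_le_1[of "real (Suc n)" a c "\<Phi> T z"] bump_nonneg[of "real (Suc n)" a c "\<Phi> T z"]
            by (simp only: indicator_simps real_norm_def abs_of_nonneg)
        next
          case False
          then show ?thesis using bump_eq_0_iff[of "real (Suc n)" a c "\<Phi> T z"] by simp
        qed
      qed
    qed (use measurable_compose[OF flow_measurable[OF t] bm] ms in auto)
    have 2: "(\<lambda>n. LINT z|lborel. bump (real (Suc n)) a c z) \<longlonglongrightarrow> (LINT z|lborel. indicator (box a c) z)"
    proof (rule integral_dominated_convergence[where w = "indicator (box a c)"])
      show "integrable lborel (indicator (box a c) :: phase \<Rightarrow> real)"
        by (intro integrable_real_indicator emeasure_lborel_box_finite[unfolded infinity_ennreal_def[symmetric]]) auto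
      show "AE z in lborel. (\<lambda>n. bump (real (Suc n)) a c z) \<longlonglongrightarrow> indicator (box a c) z"
        by (intro AE_I2 bump_tendsto)
      show "AE z in lborel. norm (bump (real (Suc n)) a c z) \<le> indicator (box a c) z" for n
      proof (intro AE_I2)
        fix z show "norm (bump (real (Suc n)) a c z) \<le> indicator (box a c) z"
          using bump_eq_0_iff[of "real (Suc n)" a c z] bump_le_1[of "real (Suc n)" a c z] bump_nonneg[of "real (Suc n)" a c z]
          by (cases "z \<in> box a c") auto
      qed
    qed (use bm in \<open>simp_all del: of_nat_Suc\<close>)
    have "(\<lambda>n. LINT z|lborel. bump (real (Suc n)) a c z) \<longlonglongrightarrow> (LINT z|lborel. indicator {z. \<Phi> T z \<in> box a c} z)"
      using 1 bump_eq by simp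
    then have "(LINT z|lborel. indicat_real {z. \<Phi> T z \<in> box a c} z) = (LINT z|lborel. indicat_real (box a c) z)"
      using 2 by (rule LIMSEQ_unique)
    then have "measure lborel {z. \<Phi> T z \<in> box a c} = measure lborel (box a c)" by simp
    moreover have "emeasure lborel {z. \<Phi> T z \<in> box a c} < \<infinity>"
      using emeasure_mono[OF sub, of lborel] emeasure_lborel_cball_finite[of "0::phase" ?R] by (auto intro: order.strict_trans1)
    ultimately have "emeasure lborel {z. \<Phi> T z \<in> box a c} = emeasure lborel (box a c)"
      using emeasure_lborel_box_finite[of a c] by (metis emeasure_eq_ennreal_measure infinity_ennreal_def less_irrefl)
    moreover have "emeasure (distr lborel borel (\<Phi> T)) (box a c) = emeasure lborel {z. \<Phi> T z \<in> box a c}"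
      by (subst emeasure_distr) (auto simp: vimage_def)
    ultimately show "emeasure (distr lborel borel (\<Phi> T)) (box a c) = ennreal (\<Prod>b\<in>Basis. (c - a) \<bullet> b)"
      using ac by (simp add: emeasure_lborel_box)
  qed simp
qed

end

section \<open>Transport along the flow\<close>

text \<open>Exact scaling is what makes a derivative of the mollifier cost 1/\<delta> and its mass
  equal a fixed multiple of \<delta>^d, with constants independent of \<delta>.\<close>

lemma cube_bump_scale:
  fixes y :: "'a::euclidean_space"
  assumes "\<delta> > 0" shows "cube_bump \<delta> y = cube_bump 1 ((1 / \<delta>) *\<^sub>R y)"
  using assms by (auto simp: bump_def field_simps intro!: prod.cong arg_cong2[where f = "(*)"] arg_cong[where f = "exp_cutoff 1"])

lemma bump_mass_scale:
  assumes "\<delta> > 0" shows "bump_mass TYPE('a::euclidean_space) \<delta> = \<delta> ^ DIM('a) * bump_mass TYPE('a) 1"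
proof -
  have [measurable]: "(cube_bump \<delta> :: 'a \<Rightarrow> real) \<in> borel_measurable borel" "(cube_bump 1 :: 'a \<Rightarrow> real) \<in> borel_measurable borel"
    using assms by (intro cube_bump_measurable; simp)+
  have "bump_mass TYPE('a) \<delta> = (LINT x|density (distr lborel borel (\<lambda>x::'a. 0 + \<delta> *\<^sub>R x)) (\<lambda>_. ennreal (\<bar>\<delta>\<bar> ^ DIM('a))). cube_bump \<delta> x)"
    using assms by (subst lborel_affine[of \<delta> 0]) auto
  also have "\<dots> = (LINT x|lborel. \<delta> ^ DIM('a) * cube_bump \<delta> (\<delta> *\<^sub>R x :: 'a))"
    using assms by (subst integral_density) (auto simp: integral_distr)
  also have "\<dots> = \<delta> ^ DIM('a) * bump_mass TYPE('a) 1"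
    using assms by (simp add: cube_bump_scale[OF assms])
  finally show ?thesis .
qed

lemma frechet_derivative_scale:
  fixes \<phi> :: "'a::euclidean_space \<Rightarrow> real"
  assumes "smooth \<phi>"
  shows "frechet_derivative (\<lambda>y. \<phi> (c *\<^sub>R y)) (at y) h = c * frechet_derivative \<phi> (at (c *\<^sub>R y)) h"
proof -
  have "((\<lambda>y. c *\<^sub>R y) has_derivative (\<lambda>h. c *\<^sub>R h)) (at y)" by (auto intro!: derivative_eq_intros)
  from has_derivative_compose[OF this smooth_has_derivative[OF assms]]
  have "frechet_derivative (\<lambda>y. \<phi> (c *\<^sub>R y)) (at y) = (\<lambda>h. frechet_derivative \<phi> (at (c *\<^sub>R y)) (c *\<^sub>R h))"
    by (rule frechet_derivative_at[symmetric])
  then show ?thesis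
    using linear_scale[OF has_derivative_linear[OF smooth_has_derivative[OF assms, of "c *\<^sub>R y"]], of c h] by simp
qed

lemma frechet_derivative_continuous:
  fixes \<phi> :: "'a::euclidean_space \<Rightarrow> real"
  assumes "smooth \<phi>" "continuous_on UNIV h" "continuous_on UNIV g"
  shows "continuous_on UNIV (\<lambda>y. frechet_derivative \<phi> (at (g y)) (h y))"
proof -
  have *: "continuous_on UNIV (\<lambda>y. partials [b] \<phi> (g y))" if "b \<in> Basis" for b
    using smooth_continuous[OF smooth_partials[OF assms(1), of "[b]"], of UNIV] that
    by (intro continuous_on_compose2[OF _ assms(3)]) auto
  show ?thesis
    unfolding smooth_frechet_derivative_eq[OF assms(1)]
    by (intro continuous_on_sum continuous_on_mult[OF continuous_on_inner[OF assms(2) continuous_on_const] *])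
qed

text \<open>If a is invariant under translation along b, so is its mollification; the derivative of
  the latter along b therefore vanishes, and that derivative is the integral in question up to
  sign.\<close>

lemma mollify_invariant:
  fixes a :: "'a::euclidean_space \<Rightarrow> real"
  assumes \<phi>: "\<phi> \<in> test_functions \<Omega>" and a: "continuous_on UNIV a" and inv: "\<And>s y. a (y + s *\<^sub>R b) = a y"
  shows "(LINT y|lebesgue. frechet_derivative \<phi> (at (y - p)) b * a y) = 0"
proof -
  let ?U = "\<lambda>x. LINT y|lebesgue. \<phi> (y - x) *\<^sub>R a y"
  let ?D = "\<lambda>h. - (LINT y|lebesgue. frechet_derivative \<phi> (at (y - p)) h *\<^sub>R a y)"
  have am [measurable]: "a \<in> borel_measurable borel" by (rule borel_measurable_continuous_onI[OF a])
  note [measurable] = test_function_measurable[OF \<phi>]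
  have der: "(?U has_derivative ?D) (at p)"
    by (rule mollification_has_derivative[OF \<phi> continuous_locally_integrable[OF a]])
  have lb: "?U x = (LINT y|lborel. \<phi> (y - x) * a y)" for x
    by (subst integral_completion) auto
  have const: "?U (p + s *\<^sub>R b) = ?U p" for s
  proof -
    have "?U (p + s *\<^sub>R b) = (LINT y|lborel. \<phi> ((y + s *\<^sub>R b) - (p + s *\<^sub>R b)) * a (y + s *\<^sub>R b))"
      unfolding lb by (rule integral_lborel_shift[symmetric]) measurable
    also have "\<dots> = ?U p" unfolding lb by (simp add: inv)
    finally show ?thesis .
  qed
  have "((\<lambda>s::real. p + s *\<^sub>R b) has_derivative (\<lambda>s. s *\<^sub>R b)) (at 0)" by (auto intro!: derivative_eq_intros)
  from has_derivative_compose[OF this, of ?U ?D] der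
  have "((\<lambda>s::real. ?U (p + s *\<^sub>R b)) has_derivative (\<lambda>s. ?D (s *\<^sub>R b))) (at 0)" by simp
  then have "((\<lambda>s::real. ?U p) has_derivative (\<lambda>s. ?D (s *\<^sub>R b))) (at 0)" by (simp only: const)
  moreover have "((\<lambda>s::real. ?U p) has_derivative (\<lambda>s. 0)) (at 0)" by simp
  ultimately have "(\<lambda>s::real. ?D (s *\<^sub>R b)) = (\<lambda>s. 0)" by (rule has_derivative_unique)
  from fun_cong[OF this, of 1] show ?thesis by simp
qed

lemma integrable_continuous_support:
  fixes F :: "'a::euclidean_space \<Rightarrow> real"
  assumes "continuous_on UNIV F" "\<And>x. F x \<noteq> 0 \<Longrightarrow> norm x \<le> R"
  shows "integrable lborel F"
proof -
  have "integrable lborel (\<lambda>x. indicator (cball 0 R) x *\<^sub>R F x)"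
    by (rule borel_integrable_compact[OF compact_cball continuous_on_subset[OF assms(1)]]) simp
  moreover have "(\<lambda>x. indicator (cball 0 R) x *\<^sub>R F x) = F" using assms(2) by (auto simp: indicator_def fun_eq_iff)
  ultimately show ?thesis by simp
qed

text \<open>DiPerna--Lions commutator estimate: mollify in time and space. Each coefficient of the
  vector field is constant in the direction in which it differentiates, so subtracting the value of
  \<open>F\<close> on the characteristic costs nothing, and Lipschitz continuity of \<open>F\<close> absorbs the derivative of
  the mollifier.\<close>

lemma (in char_flow) transport:
  fixes F :: "real \<Rightarrow> phase \<Rightarrow> real"
  assumes Fc: "continuous_on ({0..} \<times> UNIV) (\<lambda>(t, z). F t z)"
    and Flip: "\<And>T. 0 \<le> T \<Longrightarrow> \<exists>M\<ge>0. \<forall>t\<in>{0..T}. \<forall>z z'. \<bar>F t z - F t z'\<bar> \<le> M * norm (z - z')"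
    and weak: "\<And>\<phi>. \<phi> \<in> test_functions ({0<..} \<times> UNIV) \<Longrightarrow>
       (LINT t|lborel. LINT z|lborel. F t z * frechet_derivative \<phi> (at (t, z)) (1, snd z, E t (fst z))) = 0"
    and t: "0 \<le> t"
  shows "F t (\<Phi> t z) = F 0 z"
proof -
  \<comment> \<open>Freezing the values at time 0 for negative times gives functions continuous on
    the whole of space-time, so that mollification in time causes no boundary trouble.\<close>
  define Fe where "Fe y = F (max 0 (fst y)) (snd y)" for y :: "real \<times> phase"
  define Ee where "Ee y = E (max 0 (fst y)) (fst (snd y))" for y :: "real \<times> phase"
  have Fec: "continuous_on UNIV Fe"
  proof -
    have "continuous_on UNIV ((\<lambda>(t, z). F t z) \<circ> (\<lambda>y. (max 0 (fst y), snd y)))"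
      by (intro continuous_on_compose continuous_intros continuous_on_subset[OF Fc]) auto
    then show ?thesis by (simp add: o_def Fe_def[abs_def])
  qed
  have Eec: "continuous_on UNIV Ee"
  proof -
    have "continuous_on UNIV ((\<lambda>(t, x). E t x) \<circ> (\<lambda>y. (max 0 (fst y), fst (snd y))))"
      by (intro continuous_on_compose continuous_intros continuous_on_subset[OF E_cont]) auto
    then show ?thesis by (simp add: o_def Ee_def[abs_def])
  qed
  let ?d = "DIM(real \<times> phase)"
  have d7: "?d = 7" by simp
  let ?k = "\<lambda>\<delta>. cube_bump \<delta> :: real \<times> phase \<Rightarrow> real"
  define I where "I \<delta> = bump_mass TYPE(real \<times> phase) \<delta>" for \<delta>
  obtain L where L: "L > 0" "\<And>y h. \<bar>frechet_derivative (?k 1) (at y) h\<bar> \<le> L * norm h"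
    by (rule test_function_derivative_bounded[OF cube_bump_test_function[of 1, where 'a = "real \<times> phase"]]) auto
  have L\<delta>: "\<bar>frechet_derivative (?k \<delta>) (at y) h\<bar> \<le> L / \<delta> * norm h" if "\<delta> > 0" for \<delta> y h
  proof -
    have eq: "?k \<delta> = (\<lambda>y. ?k 1 ((1 / \<delta>) *\<^sub>R y))" by (rule ext) (rule cube_bump_scale[OF that])
    have "frechet_derivative (?k \<delta>) (at y) h = 1 / \<delta> * frechet_derivative (?k 1) (at ((1 / \<delta>) *\<^sub>R y)) h"
      unfolding eq by (rule frechet_derivative_scale[OF smooth_bump])
    then show ?thesis using L(2)[of "(1 / \<delta>) *\<^sub>R y" h] that by (simp add: abs_mult divide_right_mono)
  qed
  have ksupp: "norm y \<le> 7 * \<delta>" if "\<delta> > 0" "?k \<delta> y \<noteq> 0" for \<delta> y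
    using cube_bump_support[OF that] d7 by simp
  have Dsupp: "norm y \<le> 7 * \<delta>" if d: "\<delta> > 0" and nz: "frechet_derivative (?k \<delta>) (at y) h \<noteq> 0" for \<delta> y h
  proof (rule ccontr)
    assume n: "\<not> norm y \<le> 7 * \<delta>"
    have "closure {x. ?k \<delta> x \<noteq> 0} \<subseteq> cball 0 (7 * \<delta>)"
      by (rule closure_minimal) (use ksupp[OF d] in auto)
    then have "y \<notin> closure {x. ?k \<delta> x \<noteq> 0}" using n by auto
    then have "partials [b] (?k \<delta>) y = 0" for b by (rule partials_support)
    then have "frechet_derivative (?k \<delta>) (at y) h = 0"
      unfolding smooth_frechet_derivative_eq[OF smooth_bump] by (simp del: partials.simps)
    with nz show False ..
  qed
  \<comment> \<open>The start \<open>s0\<close> is positive so that mollifiers of small width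
    centred on the trajectory are supported in positive times and are admissible in the weak
    formulation.\<close>
  have inter: "Fe (T, \<Phi> T z) = Fe (s0, \<Phi> s0 z)" if s0: "0 < s0" "s0 \<le> T" for s0 T
  proof -
    have T0: "0 \<le> T + 7" using s0 by simp
    obtain M where M: "M \<ge> 0" "\<And>t z z'. t \<in> {0..T + 7} \<Longrightarrow> \<bar>F t z - F t z'\<bar> \<le> M * norm (z - z')"
      using Flip[OF T0] by blast
    have "compact ((\<lambda>t. (t, \<Phi> t z)) ` {s0..T})"
      by (intro compact_continuous_image continuous_intros continuous_on_subset[OF flow_continuous]) (use s0 in auto)
    then obtain R where R: "\<And>t. t \<in> {s0..T} \<Longrightarrow> norm (t, \<Phi> t z) \<le> R"
      using compact_imp_bounded bounded_iff by (metis (no_types, lifting) imageI)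
    have ucE: "uniformly_continuous_on (cball 0 (R + 7)) Ee" and ucF: "uniformly_continuous_on (cball 0 (R + 7)) Fe"
      by (intro compact_uniformly_continuous continuous_on_subset[OF Eec] continuous_on_subset[OF Fec]; simp)+
    \<comment> \<open>Collected from the commutator bound: the volume of a ball of radius 7 \<delta>
      in dimension 7, the bound L / \<delta> on the mollifier's derivative, and the oscillation 7 M
      \<delta> of F in phase space, divided by the mass \<delta>^7 \<open>I 1\<close>. All powers of
      \<delta> cancel.\<close>
    define C where "C = unit_ball_vol 7 * 7 ^ 7 * L * 7 * M / I 1"
    have I1: "I 1 > 0" unfolding I_def by (rule bump_mass_pos) simp
    have C0: "C \<ge> 0" using L(1) M(1) I1 by (simp add: C_def)
    have main: "\<bar>Fe (T, \<Phi> T z) - Fe (s0, \<Phi> s0 z)\<bar> \<le> 2 * e + C * (8 * e) * (T - s0)" if e: "e > 0" for e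
    proof -
      obtain dE where dE: "dE > 0" "\<And>y y'. y \<in> cball 0 (R + 7) \<Longrightarrow> y' \<in> cball 0 (R + 7) \<Longrightarrow> dist y y' < dE \<Longrightarrow> dist (Ee y) (Ee y') < e"
        using ucE e unfolding uniformly_continuous_on_def by metis
      obtain dF where dF: "dF > 0" "\<And>y y'. y \<in> cball 0 (R + 7) \<Longrightarrow> y' \<in> cball 0 (R + 7) \<Longrightarrow> dist y y' < dF \<Longrightarrow> dist (Fe y) (Fe y') < e"
        using ucF e unfolding uniformly_continuous_on_def by metis
      \<comment> \<open>The support of the mollifier has radius at most 7 \<delta>; dividing by 8
        keeps it strictly within the moduli of continuity and within positive times.\<close>
      define \<delta> where "\<delta> = min (min (dE / 8) (dF / 8)) (min (min 1 e) (s0 / 8))"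
      have \<delta>: "\<delta> > 0" "\<delta> \<le> 1" "\<delta> \<le> e" "7 * \<delta> < dE" "7 * \<delta> < dF" "7 * \<delta> < s0"
        using dE(1) dF(1) e s0 by (auto simp: \<delta>_def min_def)
      let ?\<kappa> = "?k \<delta>"
      let ?p = "\<lambda>t. (t, \<Phi> t z)"
      let ?U = "\<lambda>x. LINT y|lebesgue. ?\<kappa> (y - x) *\<^sub>R Fe y"
      note \<kappa> = cube_bump_test_function[OF \<delta>(1), where 'a = "real \<times> phase"]
      have sm: "smooth ?\<kappa>" by (rule smooth_bump)
      have I\<delta>: "I \<delta> > 0" unfolding I_def by (rule bump_mass_pos[OF \<delta>(1)])
      have I\<delta>eq: "I \<delta> = \<delta> ^ 7 * I 1" unfolding I_def using bump_mass_scale[OF \<delta>(1), where 'a = "real \<times> phase"] d7 by simp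
      have in_ball: "y \<in> cball 0 (R + 7)" if "r \<in> {s0..T}" "norm (y - ?p r) \<le> 7 * \<delta>" for r y
      proof -
        have "norm y \<le> norm (?p r) + norm (y - ?p r)" by (rule norm_triangle_sub)
        also have "\<dots> \<le> R + 7" using R[OF that(1)] that(2) \<delta>(2) by linarith
        finally show ?thesis by simp
      qed
      have close: "\<bar>?U (?p r) - I \<delta> * Fe (?p r)\<bar> \<le> I \<delta> * e" if r: "r \<in> {s0..T}" for r
      proof -
        have tf: "(\<lambda>y. ?\<kappa> (y - ?p r)) \<in> test_functions UNIV" by (rule cube_bump_shift_test_function[OF \<delta>(1)])
        note [measurable] = test_function_measurable[OF tf] borel_measurable_continuous_onI[OF Fec]
        have i1: "integrable lborel (\<lambda>y. ?\<kappa> (y - ?p r) * Fe y)"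
          using integrable_test_function_scaleR[OF tf continuous_locally_integrable[OF Fec]]
          by (subst (asm) integrable_completion) auto
        have i2: "integrable lborel (\<lambda>y. ?\<kappa> (y - ?p r) * Fe (?p r))" using integrable_test_function[OF tf] by simp
        have mass: "(LINT y|lborel. ?\<kappa> (y - ?p r)) = I \<delta>"
          using integral_lborel_shift[of ?\<kappa> "- ?p r"] cube_bump_measurable[OF \<delta>(1), where 'a = "real \<times> phase"]
          unfolding I_def diff_conv_add_uminus by blast
        have "?U (?p r) - I \<delta> * Fe (?p r) = (LINT y|lborel. ?\<kappa> (y - ?p r) * Fe y) - (LINT y|lborel. ?\<kappa> (y - ?p r) * Fe (?p r))"
          using mass by (subst integral_completion) auto
        moreover have "\<dots> = (LINT y|lborel. ?\<kappa> (y - ?p r) * Fe y - ?\<kappa> (y - ?p r) * Fe (?p r))"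
          by (rule Bochner_Integration.integral_diff[OF i1 i2, symmetric])
        ultimately have eq: "?U (?p r) - I \<delta> * Fe (?p r) = (LINT y|lborel. ?\<kappa> (y - ?p r) * Fe y - ?\<kappa> (y - ?p r) * Fe (?p r))" by simp
        have "norm (LINT y|lborel. ?\<kappa> (y - ?p r) * Fe y - ?\<kappa> (y - ?p r) * Fe (?p r)) \<le> (LINT y|lborel. ?\<kappa> (y - ?p r) * e)"
        proof (rule Bochner_Integration.integral_norm_bound_integral)
          fix y
          show "norm (?\<kappa> (y - ?p r) * Fe y - ?\<kappa> (y - ?p r) * Fe (?p r)) \<le> ?\<kappa> (y - ?p r) * e"
          proof (cases "?\<kappa> (y - ?p r) = 0")
            case False
            have n: "norm (y - ?p r) \<le> 7 * \<delta>" by (rule ksupp[OF \<delta>(1) False])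
            have "dist (Fe y) (Fe (?p r)) < e"
            proof (rule dF(2))
              show "y \<in> cball 0 (R + 7)" by (rule in_ball[OF r n])
              show "?p r \<in> cball 0 (R + 7)" using R[OF r] by simp
              show "dist y (?p r) < dF" using n \<delta>(5) by (simp only: dist_norm)
            qed
            then have "\<bar>Fe y - Fe (?p r)\<bar> \<le> e" by (simp add: dist_real_def)
            then have "?\<kappa> (y - ?p r) * \<bar>Fe y - Fe (?p r)\<bar> \<le> ?\<kappa> (y - ?p r) * e" by (rule mult_left_mono[OF _ bump_nonneg])
            then show ?thesis by (simp only: right_diff_distrib[symmetric] real_norm_def abs_mult abs_of_nonneg[OF bump_nonneg])
          qed (simp only: mult_zero_left diff_self norm_zero order_refl)
        qed (use i1 i2 integrable_test_function[OF tf] in auto)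
        then show ?thesis unfolding eq using mass by simp
      qed
      \<comment> \<open>The commutator: the mollifier differentiated along the field on the
        characteristic minus the field at y. Both have time component 1, which cancels.\<close>
      define G where "G r y = frechet_derivative ?\<kappa> (at (y - ?p r)) (0, V r z - snd (snd y), E r (X r z) - Ee y)" for r y
      have lin: "frechet_derivative ?\<kappa> (at w) (h - k) = frechet_derivative ?\<kappa> (at w) h - frechet_derivative ?\<kappa> (at w) k" for w h k
        unfolding smooth_frechet_derivative_eq[OF sm] by (simp add: inner_diff_left left_diff_distrib sum_subtractf)
      have Gc: "continuous_on UNIV (G r)" for r
        unfolding G_def by (intro frechet_derivative_continuous[OF sm] continuous_intros Eec)
      have supp_bound: "norm y \<le> R + 7" if "frechet_derivative ?\<kappa> (at (y - ?p r)) h \<noteq> 0" "r \<in> {s0..T}" for r y h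
        using in_ball[OF that(2) Dsupp[OF \<delta>(1) that(1)]] by simp
      \<comment> \<open>The weak formulation removes the term with the field at y; what remains is
        the commutator. The subtracted value keeps the time of y and replaces only the phase point,
        so that Lipschitz continuity in phase space alone suffices.\<close>
      have dU: "(LINT y|lebesgue. frechet_derivative ?\<kappa> (at (y - ?p r)) (1, V r z, E r (X r z)) * Fe y) = (LINT y|lborel. G r y * (Fe y - Fe (fst y, \<Phi> r z)))"
        if r: "r \<in> {s0..T}" for r
      proof -
        let ?h1 = "\<lambda>y. frechet_derivative ?\<kappa> (at (y - ?p r)) (1, V r z, E r (X r z))"
        let ?h2 = "\<lambda>y. frechet_derivative ?\<kappa> (at (y - ?p r)) (1, snd (snd y), Ee y)"
        have c1: "continuous_on UNIV ?h1" and c2: "continuous_on UNIV ?h2"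
          by (intro frechet_derivative_continuous[OF sm] continuous_intros Eec)+
        have i1: "integrable lborel (\<lambda>y. ?h1 y * Fe y)"
          by (rule integrable_continuous_support[OF continuous_on_mult[OF c1 Fec], of "R + 7"]) (use supp_bound[OF _ r] in auto)
        have i2: "integrable lborel (\<lambda>y. ?h2 y * Fe y)"
          by (rule integrable_continuous_support[OF continuous_on_mult[OF c2 Fec], of "R + 7"]) (use supp_bound[OF _ r] in auto)
        have cFr: "continuous_on UNIV (\<lambda>y::real \<times> phase. Fe (fst y, \<Phi> r z))"
          by (rule continuous_on_compose2[OF Fec]) (auto intro!: continuous_intros)
        have iG: "integrable lborel (\<lambda>y. G r y * Fe y)" "integrable lborel (\<lambda>y. G r y * Fe (fst y, \<Phi> r z))"
          by (rule integrable_continuous_support[OF continuous_on_mult[OF Gc Fec], of r "R + 7"]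
              integrable_continuous_support[OF continuous_on_mult[OF Gc cFr], of r "R + 7"]; use supp_bound[OF _ r] in \<open>auto simp: G_def\<close>)+
        have w0: "(LINT y|lborel. ?h2 y * Fe y) = 0"
        proof -
          let ?\<phi> = "\<lambda>y. ?\<kappa> (y - ?p r)"
          have tf: "?\<phi> \<in> test_functions ({0<..} \<times> UNIV)"
            unfolding bump_translate
          proof (rule bump_test_function)
            show "cbox (- (\<delta> *\<^sub>R One) + ?p r) (\<delta> *\<^sub>R One + ?p r) \<subseteq> {0<..} \<times> (UNIV :: phase set)"
            proof
              fix y :: "real \<times> phase" assume y: "y \<in> cbox (- (\<delta> *\<^sub>R One) + ?p r) (\<delta> *\<^sub>R One + ?p r)"
              have b: "(1, 0) \<in> (Basis :: (real \<times> phase) set)" by (simp add: Basis_prod_def)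
              have "(- (\<delta> *\<^sub>R One) + ?p r) \<bullet> (1, 0) \<le> y \<bullet> (1, 0)" using y b unfolding mem_box by blast
              moreover have "(One :: real \<times> phase) \<bullet> (1, 0) = 1" by (rule inner_sum_Basis[OF b])
              ultimately have "r - \<delta> \<le> fst y" by (simp add: inner_add_left inner_prod_def)
              then have "0 < fst y" using r \<delta> by auto
              then show "y \<in> {0<..} \<times> UNIV" by (cases y) auto
            qed
          qed (use \<delta> in auto)
          have fd: "frechet_derivative ?\<phi> (at y) h = frechet_derivative ?\<kappa> (at (y - ?p r)) h" for y h
            by (simp only: frechet_derivative_shift[OF sm])
          have "0 = (LINT t|lborel. LINT z'|lborel. F t z' * frechet_derivative ?\<phi> (at (t, z')) (1, snd z', E t (fst z')))"
            using weak[OF tf] by simp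
          also have "\<dots> = (LINT t|lborel. LINT z'|lborel. ?h2 (t, z') * Fe (t, z'))"
          proof (intro Bochner_Integration.integral_cong refl)
            fix t z'
            show "F t z' * frechet_derivative ?\<phi> (at (t, z')) (1, snd z', E t (fst z')) = ?h2 (t, z') * Fe (t, z')"
            proof (cases "0 \<le> t")
              case True
              then show ?thesis unfolding fd by (simp add: Fe_def Ee_def mult.commute)
            next
              case False
              have "\<not> norm ((t, z') - ?p r) \<le> 7 * \<delta>"
                using norm_fst_snd_le(1)[of "(t, z') - ?p r"] False r \<delta> by auto
              then have "frechet_derivative ?\<kappa> (at ((t, z') - ?p r)) h = 0" for h using Dsupp[OF \<delta>(1)] by blast
              then show ?thesis unfolding fd by simp
            qed
          qed
          also have "\<dots> = (LINT y|(lborel \<Otimes>\<^sub>M lborel). ?h2 y * Fe y)"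
            using i2 by (subst lborel_pair.integral_fst'[symmetric]) (auto simp: lborel_prod)
          also have "\<dots> = (LINT y|lborel. ?h2 y * Fe y)" by (simp only: lborel_prod)
          finally show ?thesis ..
        qed
        \<comment> \<open>Each component of the field difference is constant in its own direction:
          the position component depends on the velocity of y only, the velocity component on its
          time and position, and the time component is 0. The factor
          \<open>Fe (fst y, \<Phi> r z)\<close> depends on time only.\<close>
        have z0: "(LINT y|lborel. G r y * Fe (fst y, \<Phi> r z)) = 0"
        proof -
          let ?\<beta> = "\<lambda>y. (0, V r z - snd (snd y), E r (X r z) - Ee y)"
          let ?a = "\<lambda>b y. (?\<beta> y \<bullet> b) * Fe (fst y, \<Phi> r z)"
          have ac: "continuous_on UNIV (?a b)" for b
            by (intro continuous_on_mult cFr continuous_intros Eec)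
          have each: "(LINT y|lebesgue. frechet_derivative ?\<kappa> (at (y - ?p r)) b * ?a b y) = 0" if b: "b \<in> Basis" for b
          proof (rule mollify_invariant[OF \<kappa> ac])
            fix s :: real and y :: "real \<times> phase"
            from b consider "b = (1, 0)" | e where "b = (0, (e, 0))" | e where "b = (0, (0, e))"
              unfolding Basis_prod_def by auto
            then show "?a b (y + s *\<^sub>R b) = ?a b y" by cases (auto simp: inner_prod_def Ee_def)
          qed
          have ib: "integrable lborel (\<lambda>y. frechet_derivative ?\<kappa> (at (y - ?p r)) b * ?a b y)" for b
          proof (rule integrable_continuous_support[where R = "R + 7"])
            show "continuous_on UNIV (\<lambda>y. frechet_derivative ?\<kappa> (at (y - ?p r)) b * ?a b y)"
              by (intro continuous_on_mult[OF _ ac] frechet_derivative_continuous[OF sm] continuous_intros)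
            show "norm y \<le> R + 7" if "frechet_derivative ?\<kappa> (at (y - ?p r)) b * ?a b y \<noteq> 0" for y
              by (rule supp_bound[OF _ r, of y b]) (use that in \<open>rule contrapos_nn, simp\<close>)
          qed
          have "(LINT y|lborel. G r y * Fe (fst y, \<Phi> r z)) = (LINT y|lborel. (\<Sum>b\<in>Basis. frechet_derivative ?\<kappa> (at (y - ?p r)) b * ?a b y))"
          proof (rule Bochner_Integration.integral_cong[OF refl])
            fix y
            have "frechet_derivative ?\<kappa> (at w) b = partials [b] ?\<kappa> w" for w b by simp
            then show "G r y * Fe (fst y, \<Phi> r z) = (\<Sum>b\<in>Basis. frechet_derivative ?\<kappa> (at (y - ?p r)) b * ?a b y)"
              unfolding G_def smooth_frechet_derivative_eq[OF sm, of _ "?\<beta> y"] sum_distrib_right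
              by (intro sum.cong refl) (simp only: mult_ac)
          qed
          also have "\<dots> = (\<Sum>b\<in>Basis. LINT y|lborel. frechet_derivative ?\<kappa> (at (y - ?p r)) b * ?a b y)"
            by (rule Bochner_Integration.integral_sum) (rule ib)
          also have "\<dots> = (\<Sum>b\<in>Basis. LINT y|lebesgue. frechet_derivative ?\<kappa> (at (y - ?p r)) b * ?a b y)"
            using borel_measurable_integrable[OF ib] by (intro sum.cong refl integral_completion[symmetric]) simp
          also have "\<dots> = 0" by (intro sum.neutral ballI each)
          finally show ?thesis .
        qed
        have "(LINT y|lebesgue. ?h1 y * Fe y) = (LINT y|lborel. ?h1 y * Fe y)"
          using borel_measurable_integrable[OF i1] by (intro integral_completion) simp
        also have "\<dots> = (LINT y|lborel. ?h1 y * Fe y) - (LINT y|lborel. ?h2 y * Fe y)" unfolding w0 by simp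
        also have "\<dots> = (LINT y|lborel. ?h1 y * Fe y - ?h2 y * Fe y)"
          by (rule Bochner_Integration.integral_diff[OF i1 i2, symmetric])
        also have "\<dots> = (LINT y|lborel. G r y * Fe y)"
          by (rule Bochner_Integration.integral_cong[OF refl]) (simp add: G_def left_diff_distrib[symmetric] lin[symmetric])
        also have "\<dots> = (LINT y|lborel. G r y * Fe y) - (LINT y|lborel. G r y * Fe (fst y, \<Phi> r z))" unfolding z0 by simp
        also have "\<dots> = (LINT y|lborel. G r y * Fe y - G r y * Fe (fst y, \<Phi> r z))"
          by (rule Bochner_Integration.integral_diff[OF iG, symmetric])
        finally show ?thesis by (simp only: right_diff_distrib)
      qed
      \<comment> \<open>On the support the two fields differ by at most 7 \<delta> + e \<le> 8 e,
        while the factor 1/\<delta> of the mollifier is compensated by the Lipschitz bound 7 M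
        \<delta>.\<close>
      have dU_bound: "\<bar>LINT y|lborel. G r y * (Fe y - Fe (fst y, \<Phi> r z))\<bar> \<le> I \<delta> * (C * (8 * e))" if r: "r \<in> {s0..T}" for r
      proof -
        let ?B = "L / \<delta> * (8 * e) * (M * (7 * \<delta>))"
        have B0: "?B \<ge> 0" using L(1) M(1) \<delta>(1) e by simp
        have ptw: "\<bar>G r y * (Fe y - Fe (fst y, \<Phi> r z))\<bar> \<le> ?B * indicator (cball (?p r) (7 * \<delta>)) y" for y
        proof (cases "G r y = 0")
          case False
          then have n: "norm (y - ?p r) \<le> 7 * \<delta>" unfolding G_def by (rule Dsupp[OF \<delta>(1)])
          then have yin: "y \<in> cball (?p r) (7 * \<delta>)" by (simp add: dist_norm norm_minus_commute)
          have f: "\<bar>fst y - r\<bar> \<le> 7 * \<delta>" using norm_fst_snd_le(1)[of "y - ?p r"] n by simp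
          have sn: "norm (snd y - \<Phi> r z) \<le> 7 * \<delta>" using norm_fst_snd_le(2)[of "y - ?p r"] n by simp
          have fy: "0 \<le> fst y" "fst y \<le> T + 7" using f r \<delta> s0 by auto
          have "norm (V r z - snd (snd y)) \<le> 7 * \<delta>"
            using norm_fst_snd_le(2)[of "snd y - \<Phi> r z"] sn by (simp add: norm_minus_commute)
          moreover have "norm (E r (X r z) - Ee y) \<le> e"
          proof -
            have "dist (Ee (?p r)) (Ee y) < e"
            proof (rule dE(2))
              show "y \<in> cball 0 (R + 7)" by (rule in_ball[OF r n])
              show "?p r \<in> cball 0 (R + 7)" using R[OF r] by simp
              show "dist (?p r) y < dE" using n \<delta>(4) by (simp only: dist_norm norm_minus_commute)
            qed
            moreover have "Ee (?p r) = E r (X r z)" using r s0 by (simp add: Ee_def)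
            ultimately show ?thesis by (simp add: dist_norm)
          qed
          ultimately have "norm (V r z - snd (snd y), E r (X r z) - Ee y) \<le> 8 * e"
            using norm_Pair_le[of "V r z - snd (snd y)" "E r (X r z) - Ee y"] \<delta>(3) by linarith
          then have "norm (0::real, V r z - snd (snd y), E r (X r z) - Ee y) \<le> 8 * e" by (simp add: norm_Pair)
          then have "L / \<delta> * norm (0::real, V r z - snd (snd y), E r (X r z) - Ee y) \<le> L / \<delta> * (8 * e)"
            using L(1) \<delta>(1) by (intro mult_left_mono) auto
          then have g: "\<bar>G r y\<bar> \<le> L / \<delta> * (8 * e)"
            using L\<delta>[OF \<delta>(1), of "y - ?p r" "(0, V r z - snd (snd y), E r (X r z) - Ee y)"] unfolding G_def by linarith
          have "\<bar>F (fst y) (snd y) - F (fst y) (\<Phi> r z)\<bar> \<le> M * norm (snd y - \<Phi> r z)" by (rule M(2)) (use fy in auto)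
          also have "\<dots> \<le> M * (7 * \<delta>)" using sn M(1) by (intro mult_left_mono)
          finally have "\<bar>Fe y - Fe (fst y, \<Phi> r z)\<bar> \<le> M * (7 * \<delta>)" using fy by (simp add: Fe_def)
          then have "\<bar>G r y\<bar> * \<bar>Fe y - Fe (fst y, \<Phi> r z)\<bar> \<le> ?B"
            using g L(1) \<delta>(1) e by (intro mult_mono) auto
          then show ?thesis using yin by (simp only: abs_mult indicator_simps mult_1_right)
        qed (use B0 in simp)
        have cFr: "continuous_on UNIV (\<lambda>y::real \<times> phase. Fe (fst y, \<Phi> r z))"
          by (rule continuous_on_compose2[OF Fec]) (auto intro!: continuous_intros)
        have "norm (LINT y|lborel. G r y * (Fe y - Fe (fst y, \<Phi> r z))) \<le> (LINT y|lborel. ?B * indicator (cball (?p r) (7 * \<delta>)) y)"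
        proof (rule Bochner_Integration.integral_norm_bound_integral)
          show "integrable lborel (\<lambda>y. G r y * (Fe y - Fe (fst y, \<Phi> r z)))"
            by (rule integrable_continuous_support[of _ "R + 7"])
              (use supp_bound[OF _ r] in \<open>auto simp: G_def intro!: continuous_on_mult continuous_on_diff Gc[unfolded G_def] Fec cFr\<close>)
          show "integrable lborel (\<lambda>y. ?B * indicator (cball (?p r) (7 * \<delta>)) y)"
            using emeasure_lborel_cball_finite[of "?p r" "7 * \<delta>"] by (intro integrable_mult_right integrable_real_indicator) auto
          show "norm (G r y * (Fe y - Fe (fst y, \<Phi> r z))) \<le> ?B * indicator (cball (?p r) (7 * \<delta>)) y" for y
            using ptw[of y] by (simp only: real_norm_def)
        qed
        also have "\<dots> = ?B * (unit_ball_vol 7 * (7 * \<delta>) ^ 7)"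
          using \<delta>(1) d7 content_cball[of "7 * \<delta>" "?p r"] by simp
        also have "\<dots> = I \<delta> * (C * (8 * e))"
          unfolding I\<delta>eq C_def using \<delta>(1) I1 by (simp add: field_simps)
        finally show ?thesis by (simp only: real_norm_def)
      qed
      let ?g = "\<lambda>r. ?U (?p r)"
      have der: "(?g has_vector_derivative - (LINT y|lborel. G r y * (Fe y - Fe (fst y, \<Phi> r z)))) (at r within {0..})" if r: "r \<in> {s0..T}" for r
      proof -
        have r0: "0 \<le> r" using r s0 by auto
        have "((\<lambda>r. ?p r) has_derivative (\<lambda>h. (h, h *\<^sub>R (V r z, E r (X r z))))) (at r within {0..})"
          using flow_derivative[OF r0, of z] unfolding has_vector_derivative_def by (intro has_derivative_Pair has_derivative_ident)
        moreover have "(?U has_derivative (\<lambda>h. - (LINT y|lebesgue. frechet_derivative ?\<kappa> (at (y - ?p r)) h *\<^sub>R Fe y))) (at (?p r))"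
          by (rule mollification_has_derivative[OF \<kappa> continuous_locally_integrable[OF Fec]])
        ultimately have 1: "(?g has_derivative (\<lambda>h. - (LINT y|lebesgue. frechet_derivative ?\<kappa> (at (y - ?p r)) (h, h *\<^sub>R (V r z, E r (X r z))) *\<^sub>R Fe y))) (at r within {0..})"
          by (rule has_derivative_compose)
        have "frechet_derivative ?\<kappa> (at w) (h, h *\<^sub>R (V r z, E r (X r z))) = h * frechet_derivative ?\<kappa> (at w) (1, V r z, E r (X r z))" for w and h :: real
          using linear_scale[OF has_derivative_linear[OF smooth_has_derivative[OF sm, of w]], of h "(1, V r z, E r (X r z))"] by simp
        then have "(\<lambda>h::real. - (LINT y|lebesgue. frechet_derivative ?\<kappa> (at (y - ?p r)) (h, h *\<^sub>R (V r z, E r (X r z))) *\<^sub>R Fe y))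
          = (\<lambda>h. h *\<^sub>R (- (LINT y|lborel. G r y * (Fe y - Fe (fst y, \<Phi> r z)))))"
          using dU[OF r] by (simp add: mult.assoc)
        with 1 show ?thesis unfolding has_vector_derivative_def by simp
      qed
      have gb: "norm (?g T - ?g s0) \<le> (I \<delta> * (C * (8 * e))) * (T - s0)"
        by (rule increment_bound[where y = ?g and y' = "\<lambda>r. - (LINT y|lborel. G r y * (Fe y - Fe (fst y, \<Phi> r z)))"])
          (use s0 der dU_bound in auto)
      have tri: "\<bar>x - y\<bar> \<le> e + e + g" if "norm (a - b) \<le> g" "\<bar>a - x\<bar> \<le> e" "\<bar>b - y\<bar> \<le> e" for a b x y e g :: real
        using that unfolding real_norm_def by linarith
      have "\<bar>I \<delta> * Fe (?p T) - I \<delta> * Fe (?p s0)\<bar> \<le> I \<delta> * e + I \<delta> * e + I \<delta> * (C * (8 * e)) * (T - s0)"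
        by (rule tri[OF gb close close]) (use s0 in auto)
      also have "\<dots> = I \<delta> * (2 * e + C * (8 * e) * (T - s0))" by (simp add: algebra_simps)
      finally have "I \<delta> * \<bar>Fe (?p T) - Fe (?p s0)\<bar> \<le> I \<delta> * (2 * e + C * (8 * e) * (T - s0))"
        using I\<delta> by (simp add: abs_mult right_diff_distrib[symmetric])
      then show ?thesis using I\<delta> by simp
    qed
    have "\<bar>Fe (T, \<Phi> T z) - Fe (s0, \<Phi> s0 z)\<bar> \<le> 0"
    proof (rule field_le_epsilon)
      fix e :: real assume e: "e > 0"
      define c where "c = 2 + C * 8 * (T - s0)"
      have c: "c > 0" using C0 s0 by (simp add: c_def add_pos_nonneg)
      define k where "k = e / c"
      have k: "k > 0" "k * c = e" using c e by (auto simp: k_def)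
      have "2 * k + C * (8 * k) * (T - s0) = k * c" by (simp add: c_def algebra_simps)
      then show "\<bar>Fe (T, \<Phi> T z) - Fe (s0, \<Phi> s0 z)\<bar> \<le> 0 + e"
        using main[OF k(1)] k(2) by simp
    qed
    then show ?thesis by simp
  qed
  show ?thesis
  proof (cases "t = 0")
    case False
    then have tp: "t > 0" using t by simp
    \<comment> \<open>Time 0 is reached as a limit of positive starting times, by continuity of
      \<open>Fe\<close>.\<close>
    define s where "s n = t / real (Suc n)" for n
    have s: "0 < s n" "s n \<le> t" for n using tp by (auto simp: s_def field_simps)
    have slim: "s \<longlonglongrightarrow> 0"
      unfolding s_def using tendsto_mult[OF tendsto_const[of t] LIMSEQ_inverse_real_of_nat] by (simp add: divide_inverse)
    have "(\<lambda>n. \<Phi> (s n) z) \<longlonglongrightarrow> \<Phi> 0 z"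
      by (rule continuous_on_tendsto_compose[OF flow_continuous slim]) (use s in \<open>auto intro!: always_eventually less_imp_le\<close>)
    then have "(\<lambda>n. (s n, \<Phi> (s n) z)) \<longlonglongrightarrow> (0, z)" using slim by (intro tendsto_Pair) auto
    then have "(\<lambda>n. Fe (s n, \<Phi> (s n) z)) \<longlonglongrightarrow> Fe (0, z)"
      by (rule continuous_on_tendsto_compose[OF Fec]) auto
    moreover have "Fe (s n, \<Phi> (s n) z) = Fe (t, \<Phi> t z)" for n using inter[OF s] by simp
    ultimately have "Fe (t, \<Phi> t z) = Fe (0, z)" by (simp add: LIMSEQ_const_iff)
    then show ?thesis using t by (simp add: Fe_def)
  qed simp
qed

section \<open>Asymptotics of the flow and the force\<close>

lemma japanese_bracket_ge: "1 \<le> japanese_bracket y" "norm y \<le> japanese_bracket y"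
  unfolding japanese_bracket_def by (auto intro: real_le_rsqrt)

lemma japanese_bracket_lipschitz: "\<bar>japanese_bracket x - japanese_bracket y\<bar> \<le> norm (x - y)"
proof -
  have *: "japanese_bracket x = norm (1::real, x)" for x :: 'a
    by (simp add: japanese_bracket_def norm_Pair)
  have "\<bar>norm (1::real, x) - norm (1::real, y)\<bar> \<le> norm ((1::real, x) - (1, y))" by (rule norm_triangle_ineq3)
  also have "\<dots> = norm (x - y)" by (simp add: norm_Pair)
  finally show ?thesis by (simp only: *)
qed

lemma japanese_bracket_continuous: "continuous_on S japanese_bracket"
  unfolding japanese_bracket_def[abs_def] by (intro continuous_intros)

text \<open>No integrability has to be checked at the point of use, since a non-integrable function
  has integral 0.\<close>

lemma norm_integral_le_nn_integral:
  assumes "(\<integral>\<^sup>+ x. ennreal (norm (f x)) \<partial>M) \<le> ennreal c" "0 \<le> c"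
  shows "norm (LINT x|M. f x) \<le> c"
proof (cases "integrable M f")
  case True
  then have "ennreal (norm (LINT x|M. f x)) \<le> ennreal c"
    using integral_norm_bound_ennreal assms(1) order_trans by blast
  then show ?thesis using assms(2) by (simp add: ennreal_le_iff)
qed (simp add: assms not_integrable_integral_eq)

lemma nn_integral_linear2:
  fixes f h :: "'a \<Rightarrow> ennreal"
  assumes [measurable]: "f \<in> borel_measurable M" "h \<in> borel_measurable M"
  shows "(\<integral>\<^sup>+ x. c * f x + d * h x \<partial>M) = c * (\<integral>\<^sup>+ x. f x \<partial>M) + d * (\<integral>\<^sup>+ x. h x \<partial>M)"
  by (simp add: nn_integral_add nn_integral_cmult)

lemma increment_bound_fn:
  fixes y :: "real \<Rightarrow> 'b::real_normed_vector"
  assumes ab: "0 \<le> a" "a \<le> b"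
    and y: "\<And>s. a \<le> s \<Longrightarrow> s \<le> b \<Longrightarrow> (y has_vector_derivative y' s) (at s within {0..})"
    and \<phi>: "\<And>s. a \<le> s \<Longrightarrow> s \<le> b \<Longrightarrow> (\<phi> has_real_derivative \<phi>' s) (at s)"
    and le: "\<And>s. a \<le> s \<Longrightarrow> s \<le> b \<Longrightarrow> norm (y' s) \<le> \<phi>' s"
  shows "norm (y b - y a) \<le> \<phi> b - \<phi> a"
proof (cases "a = b")
  case False
  with ab have "a < b" by simp
  then show ?thesis
  proof (rule differentiable_bound_general)
    show "continuous_on {a..b} y"
      by (rule continuous_on_vector_derivative[of _ _ y'])
        (use ab in \<open>auto intro!: has_vector_derivative_within_subset[OF y]\<close>)
    show "continuous_on {a..b} \<phi>"
      by (rule DERIV_continuous_on[of _ _ \<phi>']) (use \<phi> in \<open>auto intro: has_field_derivative_at_within\<close>)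
    show "(y has_vector_derivative y' s) (at s)" if "a < s" "s < b" for s
    proof -
      have "at s within {0..} = at s" by (rule at_within_interior) (use that ab in auto)
      then show ?thesis using y[of s] that by simp
    qed
    show "(\<phi> has_vector_derivative \<phi>' s) (at s)" if "a < s" "s < b" for s
      using \<phi>[of s] that by (simp add: has_real_derivative_iff_has_vector_derivative)
  qed (use le in auto)
qed simp

text \<open>A choice of the constant in \<open>expanding_density_bound\<close> that depends on the
  exponent only. Fixing it globally makes visible that the constants of the final rate depend on
  nothing but \<alpha>.\<close>

definition density_const :: "real \<Rightarrow> real" where
  "density_const q = (SOME C. C > 0 \<and> (\<forall>(Y :: real^3 \<Rightarrow> real^3) g m p s c. Y \<in> borel_measurable borel \<longrightarrow>
     g \<in> borel_measurable borel \<longrightarrow> 0 < s \<longrightarrow> 0 < c \<longrightarrow> 0 \<le> m \<longrightarrow>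
     (\<forall>v v'. c * norm (v - v') \<le> norm (Y v - Y v')) \<longrightarrow> (\<forall>v. g v \<le> ennreal m) \<longrightarrow>
     (\<integral>\<^sup>+ v. g v * ennreal (norm (p - Y v) powr (- q)) \<partial>lborel)
       \<le> ennreal (s powr (- q)) * ((\<integral>\<^sup>+ v. g v \<partial>lborel) + ennreal (C * m * (s / c) ^ 3))))"

lemma density_const:
  assumes "0 < q" "q < 3"
  shows "density_const q > 0"
    "\<And>(Y :: real^3 \<Rightarrow> real^3) g m p s c. \<lbrakk>Y \<in> borel_measurable borel; g \<in> borel_measurable borel; 0 < s; 0 < c; 0 \<le> m;
       \<And>v v'. c * norm (v - v') \<le> norm (Y v - Y v'); \<And>v. g v \<le> ennreal m\<rbrakk> \<Longrightarrow>
     (\<integral>\<^sup>+ v. g v * ennreal (norm (p - Y v) powr (- q)) \<partial>lborel)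
       \<le> ennreal (s powr (- q)) * ((\<integral>\<^sup>+ v. g v \<partial>lborel) + ennreal (density_const q * m * (s / c) ^ 3))"
proof -
  have q: "0 < q" "q < DIM(real^3)" using assms by auto
  have D3: "DIM(real^3) = 3" by simp
  obtain C where C: "C > 0"
    "\<And>(Y :: real^3 \<Rightarrow> real^3) g m p s c. \<lbrakk>Y \<in> borel_measurable borel; g \<in> borel_measurable borel; 0 < s; 0 < c; 0 \<le> m;
       \<And>v v'. c * norm (v - v') \<le> norm (Y v - Y v'); \<And>v. g v \<le> ennreal m\<rbrakk> \<Longrightarrow>
     (\<integral>\<^sup>+ v. g v * ennreal (norm (p - Y v) powr (- q)) \<partial>lborel)
       \<le> ennreal (s powr (- q)) * ((\<integral>\<^sup>+ v. g v \<partial>lborel) + ennreal (C * m * (s / c) ^ 3))"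
    using expanding_density_bound[OF q, unfolded D3] by blast
  have "\<exists>C. C > 0 \<and> (\<forall>(Y :: real^3 \<Rightarrow> real^3) g m p s c. Y \<in> borel_measurable borel \<longrightarrow>
     g \<in> borel_measurable borel \<longrightarrow> 0 < s \<longrightarrow> 0 < c \<longrightarrow> 0 \<le> m \<longrightarrow>
     (\<forall>v v'. c * norm (v - v') \<le> norm (Y v - Y v')) \<longrightarrow> (\<forall>v. g v \<le> ennreal m) \<longrightarrow>
     (\<integral>\<^sup>+ v. g v * ennreal (norm (p - Y v) powr (- q)) \<partial>lborel)
       \<le> ennreal (s powr (- q)) * ((\<integral>\<^sup>+ v. g v \<partial>lborel) + ennreal (C * m * (s / c) ^ 3)))"
    by (intro exI[of _ C] conjI allI impI C) (simp_all only:)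
  from someI_ex[OF this, folded density_const_def]
  show "density_const q > 0"
    "\<And>(Y :: real^3 \<Rightarrow> real^3) g m p s c. \<lbrakk>Y \<in> borel_measurable borel; g \<in> borel_measurable borel; 0 < s; 0 < c; 0 \<le> m;
       \<And>v v'. c * norm (v - v') \<le> norm (Y v - Y v'); \<And>v. g v \<le> ennreal m\<rbrakk> \<Longrightarrow>
     (\<integral>\<^sup>+ v. g v * ennreal (norm (p - Y v) powr (- q)) \<partial>lborel)
       \<le> ennreal (s powr (- q)) * ((\<integral>\<^sup>+ v. g v \<partial>lborel) + ennreal (density_const q * m * (s / c) ^ 3))"
    by blast+
qed

text \<open>The 1 accounts for the integral of the density. The 8 is (s / (s/2))^3, since the maps
  to which the bound is applied expand by the factor s/2.\<close>

definition kernel_const :: "real \<Rightarrow> real" where "kernel_const q = 1 + 8 * density_const q"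

lemma kernel_const_pos: "0 < q \<Longrightarrow> q < 3 \<Longrightarrow> 0 < kernel_const q"
  using density_const(1)[of q] by (simp add: kernel_const_def)

text \<open>\<open>g\<close> is the continuous representative of the weighted initial density.
  \<open>\<epsilon>\<close> measures the assumed decay of the force and only controls the flow,
  while the bounds that enter the rate are proportional to \<open>\<eta>\<close>. The number 5 + 2 /
  (1 - \<alpha>) is the loss in the backward stability estimate. The last assumption writes the
  force in initial coordinates, the form in which the density no longer moves.\<close>

locale vlasov_decay = char_flow +
  fixes \<alpha> \<epsilon> \<eta> lam :: real and g :: "phase \<Rightarrow> real"
  assumes alpha: "1 / 2 < \<alpha>" "\<alpha> < 1"
    and eps: "0 \<le> \<epsilon>" "\<epsilon> * (5 + 2 / (1 - \<alpha>)) \<le> 1 / 2"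
    and E_decay: "\<And>t x. 0 \<le> t \<Longrightarrow> norm (E t x) \<le> \<epsilon> * (1 + t) powr (- (1 + \<alpha>))"
    and E_lip_decay: "\<And>t x y. 0 \<le> t \<Longrightarrow> norm (E t x - E t y) \<le> \<epsilon> * (1 + t) powr (- (2 + \<alpha>)) * norm (x - y)"
    and eta: "0 < \<eta>" and lam: "\<bar>lam\<bar> = 1"
    and g_nonneg: "\<And>z. 0 \<le> g z" and g_le: "\<And>z. g z \<le> \<eta>"
    and g_lip: "\<And>z z'. \<bar>g z - g z'\<bar> \<le> \<eta> * norm (z - z')"
    and g_L1: "(\<integral>\<^sup>+ z. ennreal (g z) \<partial>lborel) \<le> ennreal \<eta>"
    and g_mixed: "(\<integral>\<^sup>+ x. (SUP v. ennreal (g (x, v))) \<partial>lborel) \<le> ennreal \<eta>"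
    and E_eq: "\<And>t x. 0 \<le> t \<Longrightarrow> E t x = (lam * \<alpha>) *\<^sub>R (LINT z|lborel. (g z / japanese_bracket (fst z)) *\<^sub>R riesz_kernel \<alpha> (x - fst (\<Phi> t z)))"
begin

abbreviation "Vp z \<equiv> momentum_limit \<Phi> z"
abbreviation "f0 z \<equiv> g z / japanese_bracket (fst z)"

text \<open>The velocity correction expressed through the kernel and the continuous representative.
  The minus sign of the force and that of the gradient cancel.\<close>

definition A_inf :: "real^3 \<Rightarrow> real^3" where
  "A_inf u = (lam * \<alpha>) *\<^sub>R (LINT z|lborel. f0 z *\<^sub>R riesz_kernel \<alpha> (u - Vp z))"

lemma eps_bounds: "\<epsilon> \<le> 1 / 14" "2 * \<epsilon> / (1 - \<alpha>) + 5 * \<epsilon> \<le> 1 / 2"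
proof -
  have e: "\<epsilon> * (5 + 2 / (1 - \<alpha>)) = 2 * \<epsilon> / (1 - \<alpha>) + 5 * \<epsilon>" by (simp add: algebra_simps)
  then show "2 * \<epsilon> / (1 - \<alpha>) + 5 * \<epsilon> \<le> 1 / 2" using eps(2) by simp
  have "2 \<le> 2 / (1 - \<alpha>)" using alpha by (simp add: field_simps)
  then have "\<epsilon> * (5 + 2) \<le> \<epsilon> * (5 + 2 / (1 - \<alpha>))" using eps(1) by (intro mult_left_mono) auto
  from order_trans[OF this eps(2)] show "\<epsilon> \<le> 1 / 14" by simp
qed

section \<open>The momentum limit and the distance to free motion\<close>

lemma V_tail:
  assumes "0 \<le> s" "s \<le> t"
  shows "norm (V t z - V s z) \<le> 2 * \<epsilon> * (1 + s) powr (- \<alpha>)"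
proof -
  have "norm (V t z - V s z) \<le> - (\<epsilon> / \<alpha>) * (1 + t) powr (- \<alpha>) - (- (\<epsilon> / \<alpha>) * (1 + s) powr (- \<alpha>))"
  proof (rule increment_bound_fn[where y = "\<lambda>s. V s z" and y' = "\<lambda>s. E s (X s z)" and \<phi>' = "\<lambda>s. \<epsilon> * (1 + s) powr (- (1 + \<alpha>))" and \<phi> = "\<lambda>t. - (\<epsilon> / \<alpha>) * (1 + t) powr (- \<alpha>)"])
    fix r assume r: "s \<le> r" "r \<le> t"
    then have r0: "0 \<le> r" using assms by linarith
    show "((\<lambda>s. V s z) has_vector_derivative E r (X r z)) (at r within {0..})" by (rule V_derivative[OF r0])
    show "norm (E r (X r z)) \<le> \<epsilon> * (1 + r) powr (- (1 + \<alpha>))" by (rule E_decay[OF r0])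
    have e: "- (1 + \<alpha>) = - \<alpha> - 1" by simp
    show "((\<lambda>t. - (\<epsilon> / \<alpha>) * (1 + t) powr (- \<alpha>)) has_real_derivative \<epsilon> * (1 + r) powr (- (1 + \<alpha>))) (at r)"
      unfolding e using r0 alpha by (auto intro!: derivative_eq_intros)
  qed (use assms in auto)
  also have "\<dots> \<le> (\<epsilon> / \<alpha>) * (1 + s) powr (- \<alpha>)" using eps alpha by simp
  also have "\<dots> \<le> 2 * \<epsilon> * (1 + s) powr (- \<alpha>)"
  proof (rule mult_right_mono)
    have "\<epsilon> * 1 \<le> \<epsilon> * (2 * \<alpha>)" using eps alpha by (intro mult_left_mono) auto
    then show "\<epsilon> / \<alpha> \<le> 2 * \<epsilon>" using alpha by (simp add: field_simps)
  qed simp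
  finally show ?thesis .
qed

lemma Vp_dist_tendsto: "((\<lambda>t. 2 * \<epsilon> * (1 + t) powr (- \<alpha>)) \<longlongrightarrow> 0) at_top"
proof -
  have "filterlim (\<lambda>t::real. 1 + t) at_top at_top"
    by (rule filterlim_tendsto_add_at_top[OF tendsto_const filterlim_ident])
  then have "((\<lambda>t. (1 + t) powr (- \<alpha>)) \<longlongrightarrow> 0) at_top"
    using alpha by (intro tendsto_neg_powr) auto
  from tendsto_mult[OF tendsto_const[of "2 * \<epsilon>"] this] show ?thesis by simp
qed

lemma Vp_tendsto_dist: "((\<lambda>t. V t z) \<longlongrightarrow> Vp z) at_top \<and> (\<forall>t\<ge>0. norm (Vp z - V t z) \<le> 2 * \<epsilon> * (1 + t) powr (- \<alpha>))"
proof -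
  have "Cauchy (\<lambda>n. V (real n) z)"
  proof (rule metric_CauchyI)
    fix e :: real assume e: "e > 0"
    have "\<forall>\<^sub>F t in at_top. 2 * \<epsilon> * (1 + t) powr (- \<alpha>) < e / 2"
      using order_tendstoD(2)[OF Vp_dist_tendsto, of "e / 2"] e by simp
    then obtain T where T: "\<And>t. t \<ge> T \<Longrightarrow> 2 * \<epsilon> * (1 + t) powr (- \<alpha>) < e / 2"
      unfolding eventually_at_top_linorder by blast
    obtain N :: nat where N: "T \<le> real N" using real_arch_simple by blast
    have *: "norm (V (real n) z - V (real N) z) < e / 2" if "n \<ge> N" for n
      using V_tail[of "real N" "real n" z] T[OF N] that by simp
    have "dist (V (real m) z) (V (real n) z) < e" if "m \<ge> N" "n \<ge> N" for m n
      using *[OF that(1)] *[OF that(2)] norm_triangle_ineq4[of "V (real m) z - V (real N) z" "V (real n) z - V (real N) z"]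
      by (simp add: dist_norm)
    then show "\<exists>M. \<forall>m\<ge>M. \<forall>n\<ge>M. dist (V (real m) z) (V (real n) z) < e" by blast
  qed
  then obtain v where v: "(\<lambda>n. V (real n) z) \<longlonglongrightarrow> v" using Cauchy_convergent convergent_def by blast
  have d: "norm (v - V t z) \<le> 2 * \<epsilon> * (1 + t) powr (- \<alpha>)" if t: "0 \<le> t" for t
  proof (rule tendsto_upperbound[OF tendsto_norm[OF tendsto_diff[OF v tendsto_const]]])
    obtain N :: nat where "t \<le> real N" using real_arch_simple by blast
    then have "norm (V (real n) z - V t z) \<le> 2 * \<epsilon> * (1 + t) powr (- \<alpha>)" if "n \<ge> N" for n
      using V_tail[OF t, of "real n" z] that by simp
    then show "\<forall>\<^sub>F n in sequentially. norm (V (real n) z - V t z) \<le> 2 * \<epsilon> * (1 + t) powr (- \<alpha>)"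
      unfolding eventually_sequentially by blast
  qed simp
  have "((\<lambda>t. V t z) \<longlongrightarrow> v) at_top"
  proof (rule LIM_zero_cancel, rule Lim_null_comparison[OF _ Vp_dist_tendsto])
    show "\<forall>\<^sub>F t in at_top. norm (V t z - v) \<le> 2 * \<epsilon> * (1 + t) powr (- \<alpha>)"
      using eventually_ge_at_top[of "0::real"] by eventually_elim (use d in \<open>simp add: norm_minus_commute\<close>)
  qed
  moreover from this have "Vp z = v" unfolding momentum_limit_def by (intro tendsto_Lim) auto
  ultimately show ?thesis using d by blast
qed

lemmas Vp_tendsto = Vp_tendsto_dist[THEN conjunct1]

lemma Vp_dist: "0 \<le> t \<Longrightarrow> norm (Vp z - V t z) \<le> 2 * \<epsilon> * (1 + t) powr (- \<alpha>)"
  using Vp_tendsto_dist by blast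

lemma X_measurable [measurable]: "0 \<le> t \<Longrightarrow> (\<lambda>z. X t z) \<in> borel_measurable borel"
  by (rule borel_measurable_continuous_onI) (intro continuous_on_fst flow_continuous_space)

lemma V_measurable: "0 \<le> t \<Longrightarrow> (\<lambda>z. V t z) \<in> borel_measurable borel"
  by (rule borel_measurable_continuous_onI) (intro continuous_on_snd flow_continuous_space)

lemma Vp_measurable [measurable]: "(\<lambda>z. Vp z) \<in> borel_measurable borel"
proof (rule borel_measurable_LIMSEQ_metric)
  show "(\<lambda>z. V (real n) z) \<in> borel_measurable borel" for n by (rule V_measurable) simp
  show "(\<lambda>n. V (real n) z) \<longlonglongrightarrow> Vp z" for z
    by (rule filterlim_compose[OF Vp_tendsto filterlim_real_sequentially])
qed

text \<open>X - s V is the position with free streaming removed: the velocity terms cancel and the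
  rate of change is of size s^(-\<alpha>) only. Hence its growth is s^(1-\<alpha>), the order of the
  correction in the reference flow.\<close>

lemma XV_derivative:
  assumes "0 \<le> s"
  shows "((\<lambda>s. X s z - s *\<^sub>R V s z) has_vector_derivative - (s *\<^sub>R E s (X s z))) (at s within {0..})"
proof -
  have *: "((\<lambda>s. s *\<^sub>R V s z) has_vector_derivative s *\<^sub>R E s (X s z) + 1 *\<^sub>R V s z) (at s within {0..})"
    by (rule has_vector_derivative_scaleR[OF _ V_derivative[OF assms]]) simp
  show ?thesis
    by (rule has_vector_derivative_eq_rhs[OF has_vector_derivative_diff[OF X_derivative[OF assms] *]]) simp
qed

lemma powr_shift_le: "1 \<le> s \<Longrightarrow> (1 + s) powr (1 - \<alpha>) \<le> 2 * s powr (1 - \<alpha>)"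
proof -
  assume s: "1 \<le> s"
  have "(1 + s) powr (1 - \<alpha>) \<le> (2 * s) powr (1 - \<alpha>)" using s alpha by (intro powr_mono2) auto
  also have "\<dots> = 2 powr (1 - \<alpha>) * s powr (1 - \<alpha>)" using s by (simp add: powr_mult)
  also have "\<dots> \<le> 2 powr 1 * s powr (1 - \<alpha>)" using alpha by (intro mult_right_mono powr_mono) auto
  finally show ?thesis by simp
qed

lemma powr_split: "0 < r \<Longrightarrow> r * r powr e = r powr (1 + e)"
  for r :: real by (simp add: powr_add)

lemma P_bound:
  assumes "1 \<le> s"
  shows "norm (X s z - s *\<^sub>R V s z - fst z) \<le> (2 * \<epsilon> / (1 - \<alpha>)) * s powr (1 - \<alpha>)"
proof -
  let ?\<phi> = "\<lambda>s. (\<epsilon> / (1 - \<alpha>)) * (1 + s) powr (1 - \<alpha>)"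
  have "norm ((X s z - s *\<^sub>R V s z) - (X 0 z - 0 *\<^sub>R V 0 z)) \<le> ?\<phi> s - ?\<phi> 0"
  proof (rule increment_bound_fn[where y = "\<lambda>s. X s z - s *\<^sub>R V s z" and y' = "\<lambda>s. - (s *\<^sub>R E s (X s z))" and \<phi>' = "\<lambda>s. \<epsilon> * (1 + s) powr (- \<alpha>)"])
    fix r :: real assume r: "0 \<le> r" "r \<le> s"
    show "((\<lambda>s. X s z - s *\<^sub>R V s z) has_vector_derivative - (r *\<^sub>R E r (X r z))) (at r within {0..})"
      by (rule XV_derivative[OF r(1)])
    show "(?\<phi> has_real_derivative \<epsilon> * (1 + r) powr (- \<alpha>)) (at r)"
      using r alpha by (auto intro!: derivative_eq_intros)
    have "norm (- (r *\<^sub>R E r (X r z))) \<le> (1 + r) * (\<epsilon> * (1 + r) powr (- (1 + \<alpha>)))"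
      using r E_decay[OF r(1), of "X r z"] by (auto intro!: mult_mono)
    also have "\<dots> = \<epsilon> * ((1 + r) * (1 + r) powr (- (1 + \<alpha>)))" by simp
    also have "(1 + r) * (1 + r) powr (- (1 + \<alpha>)) = (1 + r) powr (- \<alpha>)" using r by (subst powr_split) auto
    finally show "norm (- (r *\<^sub>R E r (X r z))) \<le> \<epsilon> * (1 + r) powr (- \<alpha>)" .
  qed (use assms in auto)
  also have "\<dots> \<le> (\<epsilon> / (1 - \<alpha>)) * (1 + s) powr (1 - \<alpha>)" using eps alpha by simp
  also have "\<dots> \<le> (\<epsilon> / (1 - \<alpha>)) * (2 * s powr (1 - \<alpha>))"
    using eps alpha by (intro mult_left_mono powr_shift_le assms) auto
  finally show ?thesis by (simp add: mult_ac)
qed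

lemma tail_times:
  assumes "1 \<le> s"
  shows "s * (2 * \<epsilon> * (1 + s) powr (- \<alpha>)) \<le> 2 * \<epsilon> * s powr (1 - \<alpha>)"
proof -
  have "(1 + s) powr (- \<alpha>) \<le> s powr (- \<alpha>)" using assms alpha by (intro powr_mono2') auto
  then have "s * (2 * \<epsilon> * (1 + s) powr (- \<alpha>)) \<le> s * (2 * \<epsilon> * s powr (- \<alpha>))"
    using assms eps by (intro mult_left_mono) auto
  also have "\<dots> = 2 * \<epsilon> * (s * s powr (- \<alpha>))" by simp
  also have "s * s powr (- \<alpha>) = s powr (1 - \<alpha>)" using assms by (subst powr_split) auto
  finally show ?thesis .
qed

text \<open>The velocity u is left open because two choices are needed: the momentum limit of the
  particles that create the field, and the velocity at a later finite time along the trajectory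
  under study.\<close>

lemma X_near:
  assumes "1 \<le> s" "norm (u - V s z) \<le> 2 * \<epsilon> * (1 + s) powr (- \<alpha>)"
  shows "norm (X s z - s *\<^sub>R u) \<le> norm (fst z) + s powr (1 - \<alpha>)"
proof -
  have "X s z - s *\<^sub>R u = (X s z - s *\<^sub>R V s z - fst z) + (fst z - s *\<^sub>R (u - V s z))" by (simp add: algebra_simps)
  also have "norm \<dots> \<le> norm (X s z - s *\<^sub>R V s z - fst z) + (norm (fst z) + norm (s *\<^sub>R (u - V s z)))"
    by (intro norm_triangle_le add_left_mono norm_triangle_ineq4)
  also have "norm (s *\<^sub>R (u - V s z)) \<le> 2 * \<epsilon> * s powr (1 - \<alpha>)"
    using order_trans[OF mult_left_mono[OF assms(2), of s] tail_times[OF assms(1)]] assms(1) by simp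
  also have "norm (X s z - s *\<^sub>R V s z - fst z) \<le> (2 * \<epsilon> / (1 - \<alpha>)) * s powr (1 - \<alpha>)" by (rule P_bound[OF assms(1)])
  finally have "norm (X s z - s *\<^sub>R u) \<le> norm (fst z) + (2 * \<epsilon> / (1 - \<alpha>) + 2 * \<epsilon>) * s powr (1 - \<alpha>)"
    by (simp add: algebra_simps)
  also have "(2 * \<epsilon> / (1 - \<alpha>) + 2 * \<epsilon>) * s powr (1 - \<alpha>) \<le> 1 * s powr (1 - \<alpha>)"
    using eps_bounds eps by (intro mult_right_mono) auto
  finally show ?thesis by simp
qed

text \<open>A bootstrap on the largest velocity difference N over [0, t]. Equal starting positions
  give a position difference of at most N s, the decay of the force gradient makes the change of
  velocity difference at most 2 \<epsilon> N, and \<epsilon> \<le> 1/14 absorbs it.\<close>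

lemma V_diff:
  assumes t: "0 \<le> t"
  shows "norm ((V t (x, v) - V t (x, v')) - (v - v')) \<le> norm (v - v') / 2"
proof -
  let ?dV = "\<lambda>s. V s (x, v) - V s (x, v')"
  have "continuous_on {0..t} (\<lambda>s. norm (?dV s))"
    by (intro continuous_intros continuous_on_subset[OF V_continuous]) auto
  then obtain s0 where s0: "s0 \<in> {0..t}" "\<And>s. s \<in> {0..t} \<Longrightarrow> norm (?dV s) \<le> norm (?dV s0)"
    using continuous_attains_sup[of "{0..t}" "\<lambda>s. norm (?dV s)"] t by auto
  define N where "N = norm (?dV s0)"
  have N: "norm (?dV s) \<le> N" if "0 \<le> s" "s \<le> t" for s using s0(2)[of s] that by (simp add: N_def)
  have N0: "0 \<le> N" by (simp add: N_def)
  have dX: "norm (X s (x, v) - X s (x, v')) \<le> N * s" if s: "0 \<le> s" "s \<le> t" for s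
  proof -
    have "norm ((X s (x, v) - X s (x, v')) - (X 0 (x, v) - X 0 (x, v'))) \<le> N * (s - 0)"
      by (rule increment_bound[where y = "\<lambda>s. X s (x, v) - X s (x, v')" and y' = ?dV])
        (use N s in \<open>auto intro!: has_vector_derivative_diff X_derivative\<close>)
    then show ?thesis by simp
  qed
  have dV: "norm (?dV s - (v - v')) \<le> 2 * \<epsilon> * N" if s: "0 \<le> s" "s \<le> t" for s
  proof -
    let ?\<phi> = "\<lambda>s. - (\<epsilon> * N / \<alpha>) * (1 + s) powr (- \<alpha>)"
    have "norm (?dV s - ?dV 0) \<le> ?\<phi> s - ?\<phi> 0"
    proof (rule increment_bound_fn[where y = ?dV and y' = "\<lambda>s. E s (X s (x, v)) - E s (X s (x, v'))" and \<phi>' = "\<lambda>s. \<epsilon> * N * (1 + s) powr (- (1 + \<alpha>))"])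
      fix r :: real assume r: "0 \<le> r" "r \<le> s"
      show "(?dV has_vector_derivative E r (X r (x, v)) - E r (X r (x, v'))) (at r within {0..})"
        by (intro has_vector_derivative_diff V_derivative r)
      have e: "- (1 + \<alpha>) = - \<alpha> - 1" by simp
      show "(?\<phi> has_real_derivative \<epsilon> * N * (1 + r) powr (- (1 + \<alpha>))) (at r)"
        unfolding e using r alpha by (auto intro!: derivative_eq_intros)
      have "norm (E r (X r (x, v)) - E r (X r (x, v'))) \<le> \<epsilon> * (1 + r) powr (- (2 + \<alpha>)) * (N * r)"
        by (intro order_trans[OF E_lip_decay[OF r(1)]] mult_left_mono dX) (use r s eps in auto)
      also have "\<dots> \<le> \<epsilon> * (1 + r) powr (- (2 + \<alpha>)) * (N * (1 + r))"
        using eps N0 by (intro mult_left_mono) auto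
      also have "\<dots> = \<epsilon> * N * ((1 + r) * (1 + r) powr (- (2 + \<alpha>)))" by simp
      also have "(1 + r) * (1 + r) powr (- (2 + \<alpha>)) = (1 + r) powr (- (1 + \<alpha>))" using r by (subst powr_split) auto
      finally show "norm (E r (X r (x, v)) - E r (X r (x, v'))) \<le> \<epsilon> * N * (1 + r) powr (- (1 + \<alpha>))" .
    qed (use s in auto)
    also have "\<dots> \<le> \<epsilon> * N / \<alpha>" using eps N0 alpha by simp
    also have "\<dots> \<le> 2 * \<epsilon> * N"
    proof -
      have "\<epsilon> * N * 1 \<le> \<epsilon> * N * (2 * \<alpha>)" using eps N0 alpha by (intro mult_left_mono) auto
      then show ?thesis using alpha by (simp add: field_simps)
    qed
    finally show ?thesis by simp
  qed
  have "2 * \<epsilon> * N \<le> 1 / 7 * N" using eps_bounds N0 by (intro mult_right_mono) auto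
  moreover have "N \<le> norm (v - v') + 2 * \<epsilon> * N"
    using dV[of s0] s0(1) norm_triangle_sub[of "?dV s0" "v - v'"] by (simp add: N_def)
  ultimately have "2 * \<epsilon> * N \<le> norm (v - v') / 2" using N0 by linarith
  with dV[of t] t show ?thesis by simp
qed

text \<open>The velocity difference stays within half of its initial value of that value, so the
  position difference deviates from t (v - v') by at most half of its length.\<close>

lemma X_expanding:
  assumes t: "0 \<le> t"
  shows "t / 2 * norm (v - v') \<le> norm (X t (x, v) - X t (x, v'))"
proof -
  have "norm ((X t (x, v) - X t (x, v') - t *\<^sub>R (v - v')) - (X 0 (x, v) - X 0 (x, v') - 0 *\<^sub>R (v - v'))) \<le> norm (v - v') / 2 * (t - 0)"
  proof (rule increment_bound[where y = "\<lambda>t. X t (x, v) - X t (x, v') - t *\<^sub>R (v - v')" and y' = "\<lambda>s. V s (x, v) - V s (x, v') - (v - v')"])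
    fix s assume "0 \<le> s" "s \<le> t"
    then show "((\<lambda>t. X t (x, v) - X t (x, v') - t *\<^sub>R (v - v')) has_vector_derivative V s (x, v) - V s (x, v') - (v - v')) (at s within {0..})"
      by (auto intro!: derivative_eq_intros X_derivative)
    show "norm (V s (x, v) - V s (x, v') - (v - v')) \<le> norm (v - v') / 2" by (rule V_diff) fact
  qed (use t in auto)
  then have "norm (X t (x, v) - X t (x, v') - t *\<^sub>R (v - v')) \<le> t / 2 * norm (v - v')" by (simp add: algebra_simps)
  moreover have "norm (t *\<^sub>R (v - v')) = t * norm (v - v')" using t by simp
  ultimately show ?thesis
    using norm_triangle_sub[of "t *\<^sub>R (v - v')" "X t (x, v) - X t (x, v')"]
      norm_minus_commute[of "t *\<^sub>R (v - v')" "X t (x, v) - X t (x, v')"] by linarith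
qed

lemma Vp_expanding: "1 / 2 * norm (v - v') \<le> norm (Vp (x, v) - Vp (x, v'))"
proof (rule tendsto_lowerbound[OF tendsto_norm[OF tendsto_diff[OF Vp_tendsto Vp_tendsto]]])
  have "1 / 2 * norm (v - v') \<le> norm (V t (x, v) - V t (x, v'))" if "0 \<le> t" for t
    using V_diff[OF that, of x v v'] norm_triangle_sub[of "v - v'" "V t (x, v) - V t (x, v')"] by (simp add: norm_minus_commute)
  then show "\<forall>\<^sub>F t in at_top. 1 / 2 * norm (v - v') \<le> norm (V t (x, v) - V t (x, v'))"
    unfolding eventually_at_top_linorder by blast
qed simp

section \<open>The initial density and weighted kernel integrals\<close>

lemma g_continuous: "continuous_on S g"
  by (rule lipschitz_on_continuous_on[of \<eta>]) (use g_lip eta in \<open>auto simp: lipschitz_on_def dist_norm\<close>)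

lemma g_measurable [measurable]: "g \<in> borel_measurable borel"
  by (rule borel_measurable_continuous_onI[OF g_continuous])

lemma f0_continuous: "continuous_on S (\<lambda>z. f0 z)"
proof (intro continuous_on_divide g_continuous ballI)
  show "continuous_on S (\<lambda>z. japanese_bracket (fst z))"
    by (intro continuous_on_compose2[OF japanese_bracket_continuous] continuous_intros) auto
  show "japanese_bracket (fst z) \<noteq> 0" for z :: phase using japanese_bracket_ge(1)[of "fst z"] by linarith
qed

lemma f0_measurable [measurable]: "(\<lambda>z. f0 z) \<in> borel_measurable borel"
  by (rule borel_measurable_continuous_onI[OF f0_continuous])

lemma f0_bounds: "0 \<le> f0 z" "f0 z \<le> g z" "f0 z * japanese_bracket (fst z) = g z"
proof -
  have j: "1 \<le> japanese_bracket (fst z)" by (rule japanese_bracket_ge)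
  show "0 \<le> f0 z" using g_nonneg[of z] j by simp
  show "f0 z * japanese_bracket (fst z) = g z" using j by simp
  then show "f0 z \<le> g z" using j \<open>0 \<le> f0 z\<close> mult_left_mono[of 1 "japanese_bracket (fst z)" "f0 z"] by simp
qed

text \<open>The supremum is uncountable, but it is lower semicontinuous: its strict superlevel sets
  are unions of open sets.\<close>

lemma sup_measurable: "(\<lambda>x. SUP v. ennreal (g (x, v))) \<in> borel_measurable borel"
proof (rule borel_measurableI_greater)
  fix c :: ennreal
  have "{x \<in> space borel. c < (SUP v. ennreal (g (x, v)))} = (\<Union>v. {x. c < ennreal (g (x, v))})"
    by (auto simp: less_SUP_iff)
  moreover have op: "open {x. c < ennreal (g (x, v))}" for v
  proof -
    have "continuous_on UNIV (\<lambda>x. ennreal (g (x, v)))"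
      by (intro continuous_on_ennreal continuous_on_compose2[OF g_continuous[of UNIV]] continuous_intros) auto
    then show ?thesis by (intro open_Collect_less continuous_on_const)
  qed
  have "open (\<Union>v. {x. c < ennreal (g (x, v))})" by (intro open_UN ballI op)
  ultimately show "{x \<in> space borel. c < (SUP v. ennreal (g (x, v)))} \<in> sets borel" by simp
qed

text \<open>For fixed x the map Y expands in v, so the kernel integral over v is controlled by the
  integral and the supremum of g over v. Integrating over x leads exactly to the norms in
  \<open>g_L1\<close> and \<open>g_mixed\<close>.\<close>

lemma weighted_density:
  fixes Y :: "phase \<Rightarrow> real^3"
  assumes Y[measurable]: "Y \<in> borel_measurable borel" and s: "0 < s" and q: "0 < q" "q < 3"
    and exp: "\<And>x v v'. s / 2 * norm (v - v') \<le> norm (Y (x, v) - Y (x, v'))"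
  shows "(\<integral>\<^sup>+ z. ennreal (g z * norm (p - Y z) powr (- q)) \<partial>lborel) \<le> ennreal (s powr (- q) * (kernel_const q * \<eta>))"
proof -
  let ?M = "\<lambda>x. SUP v. ennreal (g (x, v))"
  have Mm: "?M \<in> borel_measurable borel" by (rule sup_measurable)
  have Y': "(\<lambda>z. ennreal (g z * norm (p - Y z) powr (- q))) \<in> borel_measurable (lborel \<Otimes>\<^sub>M lborel)"
    by (subst lborel_prod) measurable
  have g': "(\<lambda>z. ennreal (g z)) \<in> borel_measurable (lborel \<Otimes>\<^sub>M lborel)" by (simp add: lborel_prod)
  have gx: "(\<lambda>v. g (x, v)) \<in> borel_measurable borel" for x
    by (intro borel_measurable_continuous_onI continuous_on_compose2[OF g_continuous[of UNIV]] continuous_intros) auto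
  have "(\<integral>\<^sup>+ z. ennreal (g z * norm (p - Y z) powr (- q)) \<partial>lborel)
    = (\<integral>\<^sup>+ x. \<integral>\<^sup>+ v. ennreal (g (x, v) * norm (p - Y (x, v)) powr (- q)) \<partial>lborel \<partial>lborel)"
    using lborel.nn_integral_fst[OF Y'] by (simp add: lborel_prod)
  also have "\<dots> \<le> (\<integral>\<^sup>+ x. ennreal (s powr (- q)) * ((\<integral>\<^sup>+ v. ennreal (g (x, v)) \<partial>lborel) + ennreal (8 * density_const q) * ?M x) \<partial>lborel)"
  proof (intro nn_integral_mono)
    fix x
    show "(\<integral>\<^sup>+ v. ennreal (g (x, v) * norm (p - Y (x, v)) powr (- q)) \<partial>lborel)
      \<le> ennreal (s powr (- q)) * ((\<integral>\<^sup>+ v. ennreal (g (x, v)) \<partial>lborel) + ennreal (8 * density_const q) * ?M x)"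
    proof (cases "?M x")
      case (real m)
      have Yx: "(\<lambda>v. Y (x, v)) \<in> borel_measurable borel" by simp
      have "(\<integral>\<^sup>+ v. ennreal (g (x, v) * norm (p - Y (x, v)) powr (- q)) \<partial>lborel)
        = (\<integral>\<^sup>+ v. ennreal (g (x, v)) * ennreal (norm (p - Y (x, v)) powr (- q)) \<partial>lborel)"
        by (intro nn_integral_cong) (simp add: ennreal_mult g_nonneg)
      also have "\<dots> \<le> ennreal (s powr (- q)) * ((\<integral>\<^sup>+ v. ennreal (g (x, v)) \<partial>lborel) + ennreal (density_const q * m * (s / (s / 2)) ^ 3))"
      proof (rule density_const(2)[OF q Yx])
        show "ennreal (g (x, v)) \<le> ennreal m" for v
          using SUP_upper[of v UNIV "\<lambda>v. ennreal (g (x, v))"] real(2) by simp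
        show "(\<lambda>v. ennreal (g (x, v))) \<in> borel_measurable borel" using gx by simp
      qed (use s exp real in auto)
      also have "density_const q * m * (s / (s / 2)) ^ 3 = 8 * density_const q * m" using s by simp
      also have "ennreal (8 * density_const q * m) = ennreal (8 * density_const q) * ?M x"
        unfolding real(2) using density_const(1)[OF q] real(1) by (intro ennreal_mult) auto
      finally show ?thesis .
    next
      \<comment> \<open>On fibres where the supremum is infinite the right side is infinite
        too.\<close>
      case top
      have 1: "ennreal (8 * density_const q) * ?M x = top"
        unfolding top using density_const(1)[OF q] by (simp add: ennreal_mult_top)
      show ?thesis unfolding 1 using s by (simp add: ennreal_mult_top)
    qed
  qed
  also have "\<dots> = ennreal (s powr (- q)) * ((\<integral>\<^sup>+ x. \<integral>\<^sup>+ v. ennreal (g (x, v)) \<partial>lborel \<partial>lborel) + ennreal (8 * density_const q) * (\<integral>\<^sup>+ x. ?M x \<partial>lborel))"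
    using Mm lborel.borel_measurable_nn_integral_fst[OF g']
    by (subst nn_integral_cmult, simp, subst nn_integral_add, simp, simp, subst nn_integral_cmult) auto
  also have "(\<integral>\<^sup>+ x. \<integral>\<^sup>+ v. ennreal (g (x, v)) \<partial>lborel \<partial>lborel) = (\<integral>\<^sup>+ z. ennreal (g z) \<partial>lborel)"
    using lborel.nn_integral_fst[OF g'] by (simp add: lborel_prod)
  also have "ennreal (s powr (- q)) * ((\<integral>\<^sup>+ z. ennreal (g z) \<partial>lborel) + ennreal (8 * density_const q) * (\<integral>\<^sup>+ x. ?M x \<partial>lborel))
     \<le> ennreal (s powr (- q)) * (ennreal \<eta> + ennreal (8 * density_const q) * ennreal \<eta>)"
    by (intro mult_left_mono add_mono g_L1 g_mixed) auto
  also have "\<dots> = ennreal (s powr (- q) * (kernel_const q * \<eta>))"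
  proof -
    have "ennreal \<eta> + ennreal (8 * density_const q) * ennreal \<eta> = ennreal (\<eta> + 8 * density_const q * \<eta>)"
      using density_const(1)[OF q] eta by (simp add: ennreal_mult[symmetric])
    also have "\<eta> + 8 * density_const q * \<eta> = kernel_const q * \<eta>" by (simp add: kernel_const_def algebra_simps)
    finally show ?thesis using kernel_const_pos[OF q] eta by (simp add: ennreal_mult[symmetric])
  qed
  finally show ?thesis .
qed

lemma density_X:
  assumes "0 < t" "0 < q" "q < 3"
  shows "(\<integral>\<^sup>+ z. ennreal (g z * norm (p - X t z) powr (- q)) \<partial>lborel) \<le> ennreal (t powr (- q) * (kernel_const q * \<eta>))"
  using assms X_expanding[of t] by (intro weighted_density X_measurable) auto

lemma density_Vp:
  assumes "0 < q" "q < 3"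
  shows "(\<integral>\<^sup>+ z. ennreal (g z * norm (u - Vp z) powr (- q)) \<partial>lborel) \<le> ennreal (kernel_const q * \<eta>)"
  using weighted_density[OF Vp_measurable _ assms, of 1 u] Vp_expanding by simp

text \<open>Here the force is bounded by the initial data instead of the assumed decay: the constant
  depends on \<alpha> only, since \<epsilon> entered solely through the expansion of X.\<close>

lemma E_decay_eta:
  assumes t: "0 < t"
  shows "norm (E t x) \<le> kernel_const (\<alpha> + 1) * \<eta> * t powr (- (\<alpha> + 1))"
proof -
  have q: "0 < \<alpha> + 1" "\<alpha> + 1 < 3" using alpha by auto
  have "norm (LINT z|lborel. f0 z *\<^sub>R riesz_kernel \<alpha> (x - X t z)) \<le> t powr (- (\<alpha> + 1)) * (kernel_const (\<alpha> + 1) * \<eta>)"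
  proof (rule norm_integral_le_nn_integral)
    have "(\<integral>\<^sup>+ z. ennreal (norm (f0 z *\<^sub>R riesz_kernel \<alpha> (x - X t z))) \<partial>lborel) \<le> (\<integral>\<^sup>+ z. ennreal (g z * norm (x - X t z) powr (- (\<alpha> + 1))) \<partial>lborel)"
      by (intro nn_integral_mono ennreal_leI) (simp only: norm_scaleR norm_riesz_kernel abs_of_nonneg[OF f0_bounds(1)] mult_right_mono[OF f0_bounds(2)] powr_ge_zero)
    also have "\<dots> \<le> ennreal (t powr (- (\<alpha> + 1)) * (kernel_const (\<alpha> + 1) * \<eta>))" by (rule density_X[OF t q])
    finally show "(\<integral>\<^sup>+ z. ennreal (norm (f0 z *\<^sub>R riesz_kernel \<alpha> (x - X t z))) \<partial>lborel) \<le> ennreal (t powr (- (\<alpha> + 1)) * (kernel_const (\<alpha> + 1) * \<eta>))" .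
    show "0 \<le> t powr (- (\<alpha> + 1)) * (kernel_const (\<alpha> + 1) * \<eta>)" using kernel_const_pos[OF q] eta by simp
  qed
  moreover have "norm (E t x) \<le> 1 * norm (LINT z|lborel. f0 z *\<^sub>R riesz_kernel \<alpha> (x - X t z))"
    unfolding E_eq[OF less_imp_le[OF t]] norm_scaleR using alpha lam by (intro mult_right_mono) (auto simp: abs_mult)
  ultimately show ?thesis by (simp add: mult_ac)
qed

lemma kernel_integrable:
  fixes Y :: "phase \<Rightarrow> real^3"
  assumes Y: "Y \<in> borel_measurable borel" and fin: "(\<integral>\<^sup>+ z. ennreal (g z * norm (p - Y z) powr (- (\<alpha> + 1))) \<partial>lborel) < \<infinity>"
  shows "integrable lborel (\<lambda>z. f0 z *\<^sub>R riesz_kernel \<alpha> (p - Y z))"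
proof (rule integrableI_bounded)
  show "(\<lambda>z. f0 z *\<^sub>R riesz_kernel \<alpha> (p - Y z)) \<in> borel_measurable lborel" using Y by simp
  have "(\<integral>\<^sup>+ z. ennreal (norm (f0 z *\<^sub>R riesz_kernel \<alpha> (p - Y z))) \<partial>lborel) \<le> (\<integral>\<^sup>+ z. ennreal (g z * norm (p - Y z) powr (- (\<alpha> + 1))) \<partial>lborel)"
    by (intro nn_integral_mono ennreal_leI) (simp only: norm_scaleR norm_riesz_kernel abs_of_nonneg[OF f0_bounds(1)] mult_right_mono[OF f0_bounds(2)] powr_ge_zero)
  with fin show "(\<integral>\<^sup>+ z. ennreal (norm (f0 z *\<^sub>R riesz_kernel \<alpha> (p - Y z))) \<partial>lborel) < \<infinity>" by order
qed

text \<open>At the origin both the kernel and the power vanish by convention, so the bound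
  degenerates to |b|^(-\<alpha>-1) \<le> (\<alpha> + 3) |b| |b|^(-\<alpha>-2). No null sets of
  coincident points need to be excluded.\<close>

lemma riesz_kernel_diff_le:
  fixes a b :: "real^3"
  shows "norm (riesz_kernel \<alpha> a - riesz_kernel \<alpha> b) \<le> (\<alpha> + 3) * norm (a - b) * (norm a powr (- (\<alpha> + 2)) + norm b powr (- (\<alpha> + 2)))"
proof -
  have zero: "norm (riesz_kernel \<alpha> b) \<le> (\<alpha> + 3) * norm b * norm b powr (- (\<alpha> + 2))" for b :: "real^3"
  proof (cases "b = 0")
    case False
    then have "norm b * norm b powr (- (\<alpha> + 2)) = norm b powr (- (\<alpha> + 1))"
      by (subst powr_split, simp, intro arg_cong2[where f = "(powr)"]) simp_all
    moreover have "1 * (norm b * norm b powr (- (\<alpha> + 2))) \<le> (\<alpha> + 3) * (norm b * norm b powr (- (\<alpha> + 2)))"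
      using alpha by (intro mult_right_mono) auto
    ultimately show ?thesis by (simp add: norm_riesz_kernel mult.assoc)
  qed (simp add: riesz_kernel_def)
  consider "a = 0" | "b = 0" | "a \<noteq> 0" "b \<noteq> 0" by blast
  then show ?thesis
  proof cases
    case 1
    then show ?thesis using zero[of b] by (simp add: riesz_kernel_def)
  next
    case 2
    then show ?thesis using zero[of a] by (simp add: riesz_kernel_def)
  next
    case 3
    then show ?thesis using riesz_kernel_diff[of \<alpha> a b] alpha by simp
  qed
qed

text \<open>By homogeneity \<open>s\<^sup>-\<^sup>1\<^sup>-\<^sup>\<alpha> A\<^sub>\<infinity>(u)\<close> is the field at \<open>s u\<close> of the particles placed at their
  asymptotic positions \<open>s V\<^sup>+\<close>; the displacements are absorbed by the weight \<open>\<langle>x\<rangle>\<close>.\<close>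

lemma E_asymptotics:
  assumes s: "1 \<le> s" and a: "1 \<le> a" "norm (p - s *\<^sub>R u) \<le> a * s powr (1 - \<alpha>)"
  shows "norm (E s p - s powr (- (\<alpha> + 1)) *\<^sub>R A_inf u) \<le> 24 * kernel_const (\<alpha> + 2) * \<eta> * a * s powr (- 1 - 2 * \<alpha>)"
proof -
  have s0: "0 < s" using s by simp
  have q1: "0 < \<alpha> + 1" "\<alpha> + 1 < 3" and q2: "0 < \<alpha> + 2" "\<alpha> + 2 < 3" using alpha by auto
  let ?K = "riesz_kernel \<alpha> :: real^3 \<Rightarrow> real^3"
  let ?C = "kernel_const (\<alpha> + 2)"
  have C: "?C > 0" by (rule kernel_const_pos[OF q2])
  have i1: "integrable lborel (\<lambda>z. f0 z *\<^sub>R ?K (p - X s z))"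
    using s0 density_X[OF s0 q1, of p] by (intro kernel_integrable X_measurable) (auto intro: order.strict_trans1)
  have i2: "integrable lborel (\<lambda>z. f0 z *\<^sub>R ?K (u - Vp z))"
    using density_Vp[OF q1, of u] by (intro kernel_integrable Vp_measurable) (auto intro: order.strict_trans1)
  \<comment> \<open>Homogeneity of degree -(\<alpha> + 1) rewrites the rescaled asymptotic field as
    the field of particles at s V+.\<close>
  have sc: "s powr (- (\<alpha> + 1)) *\<^sub>R (f0 z *\<^sub>R ?K (u - Vp z)) = f0 z *\<^sub>R ?K (s *\<^sub>R u - s *\<^sub>R Vp z)" for z
    using riesz_kernel_scale[OF s0, of \<alpha> "u - Vp z"] by (simp add: scaleR_diff_right[symmetric] scaleR_left_commute)
  have i3: "integrable lborel (\<lambda>z. f0 z *\<^sub>R ?K (s *\<^sub>R u - s *\<^sub>R Vp z))"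
    using integrable_scaleR_right[OF i2, of "s powr (- (\<alpha> + 1))"] unfolding sc .
  have "s powr (- (\<alpha> + 1)) *\<^sub>R A_inf u = (lam * \<alpha>) *\<^sub>R (LINT z|lborel. f0 z *\<^sub>R ?K (s *\<^sub>R u - s *\<^sub>R Vp z))"
    unfolding A_inf_def sc[symmetric] integral_scaleR_right by (rule scaleR_left_commute)
  then have "E s p - s powr (- (\<alpha> + 1)) *\<^sub>R A_inf u
    = (lam * \<alpha>) *\<^sub>R ((LINT z|lborel. f0 z *\<^sub>R ?K (p - X s z)) - (LINT z|lborel. f0 z *\<^sub>R ?K (s *\<^sub>R u - s *\<^sub>R Vp z)))"
    using E_eq[of s p] s0 by (simp add: scaleR_diff_right)
  also have "(LINT z|lborel. f0 z *\<^sub>R ?K (p - X s z)) - (LINT z|lborel. f0 z *\<^sub>R ?K (s *\<^sub>R u - s *\<^sub>R Vp z))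
    = (LINT z|lborel. f0 z *\<^sub>R ?K (p - X s z) - f0 z *\<^sub>R ?K (s *\<^sub>R u - s *\<^sub>R Vp z))"
    by (rule Bochner_Integration.integral_diff[OF i1 i3, symmetric])
  finally have eq: "E s p - s powr (- (\<alpha> + 1)) *\<^sub>R A_inf u
    = (lam * \<alpha>) *\<^sub>R (LINT z|lborel. f0 z *\<^sub>R ?K (p - X s z) - f0 z *\<^sub>R ?K (s *\<^sub>R u - s *\<^sub>R Vp z))" .
  \<comment> \<open>4 bounds \<alpha> + 3, and (a + 2) s^(1-\<alpha>) is the combined displacement
    of field point and particle without the bracket, which is absorbed when f0 is turned into
    g.\<close>
  let ?D = "4 * ((a + 2) * s powr (1 - \<alpha>))"
  have D0: "0 \<le> ?D" using a by simp
  have pw1: "1 \<le> s powr (1 - \<alpha>)" using s alpha by (intro ge_one_powr_ge_zero) auto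
  have ptw: "norm (f0 z *\<^sub>R ?K (p - X s z) - f0 z *\<^sub>R ?K (s *\<^sub>R u - s *\<^sub>R Vp z))
    \<le> ?D * (g z * norm (p - X s z) powr (- (\<alpha> + 2))) + ?D * s powr (- (\<alpha> + 2)) * (g z * norm (u - Vp z) powr (- (\<alpha> + 2)))" for z
  proof -
    let ?N1 = "norm (p - X s z) powr (- (\<alpha> + 2))" and ?N2 = "norm (s *\<^sub>R u - s *\<^sub>R Vp z) powr (- (\<alpha> + 2))"
    let ?j = "japanese_bracket (fst z)"
    have j: "1 \<le> ?j" "norm (fst z) \<le> ?j" by (rule japanese_bracket_ge)+
    have "(p - X s z) - (s *\<^sub>R u - s *\<^sub>R Vp z) = (p - s *\<^sub>R u) - (X s z - s *\<^sub>R Vp z)" by simp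
    then have "norm ((p - X s z) - (s *\<^sub>R u - s *\<^sub>R Vp z)) \<le> norm (p - s *\<^sub>R u) + norm (X s z - s *\<^sub>R Vp z)"
      by (simp only: norm_triangle_ineq4)
    also have "norm (X s z - s *\<^sub>R Vp z) \<le> norm (fst z) + s powr (1 - \<alpha>)"
      using s0 by (intro X_near[OF s] Vp_dist) simp
    also have "norm (p - s *\<^sub>R u) \<le> a * s powr (1 - \<alpha>)" by (rule a(2))
    also have "a * s powr (1 - \<alpha>) + (norm (fst z) + s powr (1 - \<alpha>)) \<le> (a + 2) * s powr (1 - \<alpha>) * ?j"
    proof -
      have "a * s powr (1 - \<alpha>) * 1 \<le> a * s powr (1 - \<alpha>) * ?j" using a j by (intro mult_left_mono) auto
      moreover have "1 * norm (fst z) \<le> s powr (1 - \<alpha>) * ?j" using pw1 j by (intro mult_mono) auto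
      moreover have "s powr (1 - \<alpha>) * 1 \<le> s powr (1 - \<alpha>) * ?j" using j by (intro mult_left_mono) auto
      ultimately show ?thesis by (simp add: algebra_simps)
    qed
    finally have d: "norm ((p - X s z) - (s *\<^sub>R u - s *\<^sub>R Vp z)) \<le> (a + 2) * s powr (1 - \<alpha>) * ?j" by simp
    have "norm (f0 z *\<^sub>R ?K (p - X s z) - f0 z *\<^sub>R ?K (s *\<^sub>R u - s *\<^sub>R Vp z)) = f0 z * norm (?K (p - X s z) - ?K (s *\<^sub>R u - s *\<^sub>R Vp z))"
      unfolding scaleR_diff_right[symmetric] norm_scaleR using f0_bounds(1)[of z] by (simp only: abs_of_nonneg)
    also have "\<dots> \<le> f0 z * ((\<alpha> + 3) * norm ((p - X s z) - (s *\<^sub>R u - s *\<^sub>R Vp z)) * (?N1 + ?N2))"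
      by (intro mult_left_mono riesz_kernel_diff_le f0_bounds)
    also have "\<dots> \<le> f0 z * (4 * ((a + 2) * s powr (1 - \<alpha>) * ?j) * (?N1 + ?N2))"
      using d alpha by (intro mult_left_mono mult_right_mono mult_mono f0_bounds) auto
    also have "\<dots> = ?D * ((f0 z * ?j) * (?N1 + ?N2))" by (simp only: mult_ac)
    also have "\<dots> = ?D * (g z * ?N1) + ?D * (g z * ?N2)" unfolding f0_bounds(3) by (simp only: distrib_left)
    also have "?N2 = s powr (- (\<alpha> + 2)) * norm (u - Vp z) powr (- (\<alpha> + 2))"
      using s0 by (simp add: scaleR_diff_right[symmetric] powr_mult)
    finally show ?thesis by (simp only: mult_ac)
  qed
  have "norm (LINT z|lborel. f0 z *\<^sub>R ?K (p - X s z) - f0 z *\<^sub>R ?K (s *\<^sub>R u - s *\<^sub>R Vp z)) \<le> 2 * (?D * s powr (- (\<alpha> + 2)) * (?C * \<eta>))"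
  proof (rule norm_integral_le_nn_integral)
    have m1: "(\<lambda>z. ennreal (g z * norm (p - X s z) powr (- (\<alpha> + 2)))) \<in> borel_measurable lborel"
      using X_measurable[of s] s0 by simp
    have m2: "(\<lambda>z. ennreal (g z * norm (u - Vp z) powr (- (\<alpha> + 2)))) \<in> borel_measurable lborel" by simp
    have "(\<integral>\<^sup>+ z. ennreal (norm (f0 z *\<^sub>R ?K (p - X s z) - f0 z *\<^sub>R ?K (s *\<^sub>R u - s *\<^sub>R Vp z))) \<partial>lborel)
      \<le> (\<integral>\<^sup>+ z. ennreal ?D * ennreal (g z * norm (p - X s z) powr (- (\<alpha> + 2))) + ennreal (?D * s powr (- (\<alpha> + 2))) * ennreal (g z * norm (u - Vp z) powr (- (\<alpha> + 2))) \<partial>lborel)"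
    proof (intro nn_integral_mono)
      fix z
      have "ennreal (norm (f0 z *\<^sub>R ?K (p - X s z) - f0 z *\<^sub>R ?K (s *\<^sub>R u - s *\<^sub>R Vp z)))
        \<le> ennreal (?D * (g z * norm (p - X s z) powr (- (\<alpha> + 2))) + ?D * s powr (- (\<alpha> + 2)) * (g z * norm (u - Vp z) powr (- (\<alpha> + 2))))"
        by (intro ennreal_leI ptw)
      also have "\<dots> = ennreal ?D * ennreal (g z * norm (p - X s z) powr (- (\<alpha> + 2))) + ennreal (?D * s powr (- (\<alpha> + 2))) * ennreal (g z * norm (u - Vp z) powr (- (\<alpha> + 2)))"
      proof -
        note mult_nonneg_nonneg[OF g_nonneg powr_ge_zero] mult_nonneg_nonneg[OF D0 powr_ge_zero]
        then show ?thesis using D0 by (simp only: ennreal_plus ennreal_mult mult_nonneg_nonneg)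
      qed
      finally show "ennreal (norm (f0 z *\<^sub>R ?K (p - X s z) - f0 z *\<^sub>R ?K (s *\<^sub>R u - s *\<^sub>R Vp z))) \<le> \<dots>" .
    qed
    also have "\<dots> = ennreal ?D * (\<integral>\<^sup>+ z. ennreal (g z * norm (p - X s z) powr (- (\<alpha> + 2))) \<partial>lborel)
        + ennreal (?D * s powr (- (\<alpha> + 2))) * (\<integral>\<^sup>+ z. ennreal (g z * norm (u - Vp z) powr (- (\<alpha> + 2))) \<partial>lborel)"
      by (rule nn_integral_linear2[OF m1 m2])
    also have "\<dots> \<le> ennreal ?D * ennreal (s powr (- (\<alpha> + 2)) * (?C * \<eta>)) + ennreal (?D * s powr (- (\<alpha> + 2))) * ennreal (?C * \<eta>)"
      by (intro add_mono mult_left_mono density_X[OF s0 q2] density_Vp[OF q2]) auto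
    also have "\<dots> = ennreal (2 * (?D * s powr (- (\<alpha> + 2)) * (?C * \<eta>)))"
    proof -
      have n: "0 \<le> ?C * \<eta>" "0 \<le> s powr (- (\<alpha> + 2)) * (?C * \<eta>)" "0 \<le> ?D * s powr (- (\<alpha> + 2))" using C eta D0 by simp_all
      have "ennreal ?D * ennreal (s powr (- (\<alpha> + 2)) * (?C * \<eta>)) = ennreal (?D * s powr (- (\<alpha> + 2)) * (?C * \<eta>))"
        using D0 n by (simp only: ennreal_mult[symmetric] mult.assoc)
      moreover have "ennreal (?D * s powr (- (\<alpha> + 2))) * ennreal (?C * \<eta>) = ennreal (?D * s powr (- (\<alpha> + 2)) * (?C * \<eta>))"
        using n by (simp only: ennreal_mult[symmetric])
      ultimately show ?thesis
        using mult_nonneg_nonneg[OF n(3) n(1)] by (simp only: ennreal_plus[symmetric] mult_2)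
    qed
    finally show "(\<integral>\<^sup>+ z. ennreal (norm (f0 z *\<^sub>R ?K (p - X s z) - f0 z *\<^sub>R ?K (s *\<^sub>R u - s *\<^sub>R Vp z))) \<partial>lborel) \<le> ennreal (2 * (?D * s powr (- (\<alpha> + 2)) * (?C * \<eta>)))" .
    show "0 \<le> 2 * (?D * s powr (- (\<alpha> + 2)) * (?C * \<eta>))"
      by (intro mult_nonneg_nonneg powr_ge_zero) (use C eta a in auto)
  qed
  then have "norm (E s p - s powr (- (\<alpha> + 1)) *\<^sub>R A_inf u) \<le> 1 * (2 * (?D * s powr (- (\<alpha> + 2)) * (?C * \<eta>)))"
    unfolding eq norm_scaleR using alpha lam by (intro mult_mono) (auto simp: abs_mult)
  also have "\<dots> = 8 * ?C * \<eta> * (a + 2) * (s powr (1 - \<alpha>) * s powr (- (\<alpha> + 2)))" by simp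
  also have "s powr (1 - \<alpha>) * s powr (- (\<alpha> + 2)) = s powr (- 1 - 2 * \<alpha>)"
    by (subst powr_add[symmetric], rule arg_cong2[where f = "(powr)"]) simp_all
  \<comment> \<open>a + 2 \<le> 3 a because a \<ge> 1; this gives 24 = 8 * 3.\<close>
  also have "8 * ?C * \<eta> * (a + 2) * s powr (- 1 - 2 * \<alpha>) \<le> 8 * ?C * \<eta> * (3 * a) * s powr (- 1 - 2 * \<alpha>)"
    using C eta a by (intro mult_right_mono mult_left_mono) auto
  finally show ?thesis by (simp add: mult_ac)
qed

end

section \<open>Backward stability and the rate of convergence\<close>

text \<open>A difference of positions growing like \<open>B + s b\<close> reproduces itself under the linearised
  backward flow, because \<open>b T\<^sup>1\<^sup>-\<^sup>\<alpha> \<le> B\<close>; no bound on \<open>\<nabla>\<^sup>2E\<close> is needed.\<close>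

lemma (in vlasov_decay) backward_stability:
  assumes T: "1 \<le> T" and B: "0 < B"
    and P: "norm ((X T z1 - T *\<^sub>R V T z1) - (X T z2 - T *\<^sub>R V T z2)) \<le> B"
    and W: "T powr (1 - \<alpha>) * norm (V T z1 - V T z2) \<le> B"
  shows "norm (z1 - z2) \<le> 5 * B"
proof -
  define b where "b = norm (V T z1 - V T z2)"
  have b0: "0 \<le> b" by (simp add: b_def)
  let ?dX = "\<lambda>s. X s z1 - X s z2"
  let ?dV = "\<lambda>s. V s z1 - V s z2"
  let ?dP = "\<lambda>s. (X s z1 - s *\<^sub>R V s z1) - (X s z2 - s *\<^sub>R V s z2)"
  let ?dE = "\<lambda>s. E s (X s z1) - E s (X s z2)"
  have bB: "b \<le> B"
  proof -
    have "1 * b \<le> T powr (1 - \<alpha>) * b" using T alpha b0 by (intro mult_right_mono ge_one_powr_ge_zero) auto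
    then show ?thesis using W by (simp add: b_def)
  qed
  have w: "0 < B + s * b" if "0 \<le> s" for s using B b0 that by (simp add: add_pos_nonneg)
  \<comment> \<open>The best constant R in |dX| \<le> R (B + s b) is attained by compactness. The
    estimates below bound this ratio by 1 + R/2, hence R \<le> 2.\<close>
  have "continuous_on {0..T} (\<lambda>s. norm (?dX s) / (B + s * b))"
    by (intro continuous_intros continuous_on_subset[OF X_continuous]) (use w in \<open>auto simp: less_imp_neq[symmetric]\<close>)
  then obtain s0 where s0: "s0 \<in> {0..T}" "\<And>s. s \<in> {0..T} \<Longrightarrow> norm (?dX s) / (B + s * b) \<le> norm (?dX s0) / (B + s0 * b)"
    using continuous_attains_sup[of "{0..T}" "\<lambda>s. norm (?dX s) / (B + s * b)"] T by auto
  define R where "R = norm (?dX s0) / (B + s0 * b)"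
  have R0: "0 \<le> R" using w[of s0] s0(1) by (simp add: R_def)
  have dX: "norm (?dX s) \<le> R * (B + s * b)" if "0 \<le> s" "s \<le> T" for s
    using s0(2)[of s] w[of s] that by (simp add: R_def[symmetric] pos_divide_le_eq)
  define k where "k = \<epsilon> * R"
  have k0: "0 \<le> k" using eps R0 by (simp add: k_def)
  have dE: "norm (?dE r) \<le> k * (B * (1 + r) powr (- (2 + \<alpha>)) + b * (1 + r) powr (- (1 + \<alpha>)))" if r: "0 \<le> r" "r \<le> T" for r
  proof -
    have "norm (?dE r) \<le> \<epsilon> * (1 + r) powr (- (2 + \<alpha>)) * norm (?dX r)" by (rule E_lip_decay[OF r(1)])
    also have "\<dots> \<le> \<epsilon> * (1 + r) powr (- (2 + \<alpha>)) * (R * (B + (1 + r) * b))"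
    proof (intro mult_left_mono order_trans[OF dX[OF r]] mult_left_mono R0)
      show "B + r * b \<le> B + (1 + r) * b" using b0 by (simp add: distrib_right)
    qed (use eps in auto)
    also have "\<dots> = k * (B * (1 + r) powr (- (2 + \<alpha>)) + b * ((1 + r) * (1 + r) powr (- (2 + \<alpha>))))"
      by (simp add: k_def algebra_simps)
    also have "(1 + r) * (1 + r) powr (- (2 + \<alpha>)) = (1 + r) powr (- (1 + \<alpha>))" using r by (subst powr_split) auto
    finally show ?thesis .
  qed
  \<comment> \<open>One backward integration of the force gradient along the ansatz B + r b. The
    factor 2 bounds 1/\<alpha>.\<close>
  have dV: "norm (?dV T - ?dV s) \<le> k * (B * (1 + s) powr (- (1 + \<alpha>)) + 2 * b * (1 + s) powr (- \<alpha>))" if s: "0 \<le> s" "s \<le> T" for s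
  proof -
    let ?\<phi> = "\<lambda>r. k * (- (B / (1 + \<alpha>)) * (1 + r) powr (- (1 + \<alpha>)) + - (b / \<alpha>) * (1 + r) powr (- \<alpha>))"
    have "norm (?dV T - ?dV s) \<le> ?\<phi> T - ?\<phi> s"
    proof (rule increment_bound_fn[where y = ?dV and y' = ?dE and \<phi>' = "\<lambda>r. k * (B * (1 + r) powr (- (2 + \<alpha>)) + b * (1 + r) powr (- (1 + \<alpha>)))"])
      fix r assume r: "s \<le> r" "r \<le> T"
      then have r0: "0 \<le> r" using s by simp
      show "(?dV has_vector_derivative ?dE r) (at r within {0..})" by (intro has_vector_derivative_diff V_derivative r0)
      show "norm (?dE r) \<le> k * (B * (1 + r) powr (- (2 + \<alpha>)) + b * (1 + r) powr (- (1 + \<alpha>)))" by (rule dE[OF r0 r(2)])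
      have e: "- (2 + \<alpha>) = - (1 + \<alpha>) - 1" by simp
      have d1: "((\<lambda>r. (1 + r) powr (- (1 + \<alpha>))) has_real_derivative - (1 + \<alpha>) * (1 + r) powr (- (2 + \<alpha>))) (at r)"
        unfolding e using r0 by (auto intro!: derivative_eq_intros)
      have e': "- (1 + \<alpha>) = - \<alpha> - 1" by simp
      have d2: "((\<lambda>r. (1 + r) powr (- \<alpha>)) has_real_derivative - \<alpha> * (1 + r) powr (- (1 + \<alpha>))) (at r)"
        unfolding e' using r0 by (auto intro!: derivative_eq_intros)
      have "(?\<phi> has_real_derivative k * (- (B / (1 + \<alpha>)) * (- (1 + \<alpha>) * (1 + r) powr (- (2 + \<alpha>))) + - (b / \<alpha>) * (- \<alpha> * (1 + r) powr (- (1 + \<alpha>))))) (at r)"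
        by (intro DERIV_cmult DERIV_add d1 d2)
      moreover have "- (B / (1 + \<alpha>)) * (- (1 + \<alpha>) * p) = B * p" "- (b / \<alpha>) * (- \<alpha> * p) = b * p" for p
        using alpha by (simp_all add: field_simps)
      ultimately show "(?\<phi> has_real_derivative k * (B * (1 + r) powr (- (2 + \<alpha>)) + b * (1 + r) powr (- (1 + \<alpha>)))) (at r)"
        by (simp only:)
    qed (use s in auto)
    also have "\<dots> \<le> 0 - ?\<phi> s"
    proof (intro diff_right_mono mult_nonneg_nonpos[OF k0] add_nonpos_nonpos)
      have "0 \<le> B / (1 + \<alpha>) * (1 + T) powr (- (1 + \<alpha>))" "0 \<le> b / \<alpha> * (1 + T) powr (- \<alpha>)"
        using B b0 alpha by simp_all
      then show "- (B / (1 + \<alpha>)) * (1 + T) powr (- (1 + \<alpha>)) \<le> 0" "- (b / \<alpha>) * (1 + T) powr (- \<alpha>) \<le> 0"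
        by simp_all
    qed
    also have "\<dots> = k * (B * (1 / (1 + \<alpha>)) * (1 + s) powr (- (1 + \<alpha>)) + b * (1 / \<alpha>) * (1 + s) powr (- \<alpha>))"
      by (simp add: algebra_simps)
    also have "\<dots> \<le> k * (B * 1 * (1 + s) powr (- (1 + \<alpha>)) + b * 2 * (1 + s) powr (- \<alpha>))"
      using k0 B b0 alpha by (intro mult_left_mono add_mono mult_right_mono) (auto simp: field_simps)
    finally show ?thesis by (simp add: mult_ac)
  qed
  \<comment> \<open>For positions with streaming removed, the contribution of b grows like
    T^(1-\<alpha>) b; hypothesis \<open>W\<close> bounds exactly this quantity by B.\<close>
  have dP: "norm (?dP T - ?dP s) \<le> k * (B * (2 + 2 / (1 - \<alpha>)))" if s: "0 \<le> s" "s \<le> T" for s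
  proof -
    let ?\<phi> = "\<lambda>r. k * (- (B / \<alpha>) * (1 + r) powr (- \<alpha>) + (b / (1 - \<alpha>)) * (1 + r) powr (1 - \<alpha>))"
    have "norm (?dP T - ?dP s) \<le> ?\<phi> T - ?\<phi> s"
    proof (rule increment_bound_fn[where y = ?dP and y' = "\<lambda>r. - (r *\<^sub>R E r (X r z1)) - - (r *\<^sub>R E r (X r z2))" and \<phi>' = "\<lambda>r. k * (B * (1 + r) powr (- (1 + \<alpha>)) + b * (1 + r) powr (- \<alpha>))"])
      fix r assume r: "s \<le> r" "r \<le> T"
      then have r0: "0 \<le> r" using s by simp
      show "(?dP has_vector_derivative - (r *\<^sub>R E r (X r z1)) - - (r *\<^sub>R E r (X r z2))) (at r within {0..})"
        by (intro has_vector_derivative_diff XV_derivative r0)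
      have "- (r *\<^sub>R E r (X r z1)) - - (r *\<^sub>R E r (X r z2)) = - (r *\<^sub>R ?dE r)" by (simp add: algebra_simps)
      then have "norm (- (r *\<^sub>R E r (X r z1)) - - (r *\<^sub>R E r (X r z2))) = r * norm (?dE r)" using r0 by simp
      also have "\<dots> \<le> (1 + r) * (k * (B * (1 + r) powr (- (2 + \<alpha>)) + b * (1 + r) powr (- (1 + \<alpha>))))"
        using r0 by (intro mult_mono dE[OF r0 r(2)]) auto
      also have "\<dots> = k * (B * ((1 + r) * (1 + r) powr (- (2 + \<alpha>))) + b * ((1 + r) * (1 + r) powr (- (1 + \<alpha>))))"
        by (simp add: algebra_simps)
      also have "(1 + r) * (1 + r) powr (- (2 + \<alpha>)) = (1 + r) powr (- (1 + \<alpha>))" using r0 by (subst powr_split) auto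
      also have "(1 + r) * (1 + r) powr (- (1 + \<alpha>)) = (1 + r) powr (- \<alpha>)" using r0 by (subst powr_split) auto
      finally show "norm (- (r *\<^sub>R E r (X r z1)) - - (r *\<^sub>R E r (X r z2))) \<le> k * (B * (1 + r) powr (- (1 + \<alpha>)) + b * (1 + r) powr (- \<alpha>))" .
      have e': "- (1 + \<alpha>) = - \<alpha> - 1" by simp
      have d1: "((\<lambda>r. (1 + r) powr (- \<alpha>)) has_real_derivative - \<alpha> * (1 + r) powr (- (1 + \<alpha>))) (at r)"
        unfolding e' using r0 by (auto intro!: derivative_eq_intros)
      have d2: "((\<lambda>r. (1 + r) powr (1 - \<alpha>)) has_real_derivative (1 - \<alpha>) * (1 + r) powr (- \<alpha>)) (at r)"
        using r0 by (auto intro!: derivative_eq_intros)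
      have "(?\<phi> has_real_derivative k * (- (B / \<alpha>) * (- \<alpha> * (1 + r) powr (- (1 + \<alpha>))) + (b / (1 - \<alpha>)) * ((1 - \<alpha>) * (1 + r) powr (- \<alpha>)))) (at r)"
        by (intro DERIV_cmult DERIV_add d1 d2)
      moreover have "- (B / \<alpha>) * (- \<alpha> * p) = B * p" "(b / (1 - \<alpha>)) * ((1 - \<alpha>) * p) = b * p" for p
        using alpha by (simp_all add: field_simps)
      ultimately show "(?\<phi> has_real_derivative k * (B * (1 + r) powr (- (1 + \<alpha>)) + b * (1 + r) powr (- \<alpha>))) (at r)"
        by (simp only:)
    qed (use s in auto)
    also have "\<dots> = k * ((B / \<alpha>) * ((1 + s) powr (- \<alpha>) - (1 + T) powr (- \<alpha>)) + (b / (1 - \<alpha>)) * ((1 + T) powr (1 - \<alpha>) - (1 + s) powr (1 - \<alpha>)))"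
      by (simp add: algebra_simps)
    also have "\<dots> \<le> k * ((B / \<alpha>) * 1 + (b / (1 - \<alpha>)) * (2 * T powr (1 - \<alpha>)))"
    proof (intro mult_left_mono add_mono k0)
      have "(1 + s) powr (- \<alpha>) \<le> 1 powr (- \<alpha>)" using s alpha by (intro powr_mono2') auto
      then have "(1 + s) powr (- \<alpha>) \<le> 1" by simp
      moreover have "0 \<le> (1 + T) powr (- \<alpha>)" by simp
      ultimately show "(1 + s) powr (- \<alpha>) - (1 + T) powr (- \<alpha>) \<le> 1" by linarith
      have "0 \<le> (1 + s) powr (1 - \<alpha>)" by simp
      then show "(1 + T) powr (1 - \<alpha>) - (1 + s) powr (1 - \<alpha>) \<le> 2 * T powr (1 - \<alpha>)" using powr_shift_le[OF T] by linarith
    qed (use B b0 alpha in auto)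
    also have "(b / (1 - \<alpha>)) * (2 * T powr (1 - \<alpha>)) = (2 / (1 - \<alpha>)) * (T powr (1 - \<alpha>) * b)" by simp
    also have "k * ((B / \<alpha>) * 1 + (2 / (1 - \<alpha>)) * (T powr (1 - \<alpha>) * b)) \<le> k * (2 * B + (2 / (1 - \<alpha>)) * B)"
    proof (intro mult_left_mono add_mono k0)
      show "T powr (1 - \<alpha>) * b \<le> B" using W by (simp add: b_def)
      have "B * 1 \<le> B * (2 * \<alpha>)" using B alpha by (intro mult_left_mono) auto
      then show "B / \<alpha> * 1 \<le> 2 * B" using alpha by (simp add: field_simps)
    qed (use alpha in auto)
    also have "\<dots> = k * (B * (2 + 2 / (1 - \<alpha>)))" by (simp add: algebra_simps)
    finally show ?thesis .
  qed
  \<comment> \<open>The estimates of dP and dV add up to (3 + 2 / (1 - \<alpha>)) B + 2 s b, at most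
    c (B + s b). The smallness assumption on \<epsilon> says precisely \<epsilon> c \<le>
    1/2.\<close>
  define c where "c = 5 + 2 / (1 - \<alpha>)"
  have c0: "5 \<le> c" using alpha by (simp add: c_def)
  have kc: "k * c \<le> R / 2" using mult_right_mono[OF eps(2) R0] by (simp add: k_def c_def mult_ac)
  have dX2: "norm (?dX s) \<le> (1 + R / 2) * (B + s * b)" if s: "0 \<le> s" "s \<le> T" for s
  proof -
    have e: "?dX s = (?dP T - (?dP T - ?dP s)) + s *\<^sub>R (?dV T - (?dV T - ?dV s))" by (simp add: algebra_simps)
    have "norm (?dX s) \<le> (norm (?dP T) + norm (?dP T - ?dP s)) + s * (norm (?dV T) + norm (?dV T - ?dV s))"
    proof (subst e, intro norm_triangle_le add_mono norm_triangle_ineq4)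
      show "norm (s *\<^sub>R (?dV T - (?dV T - ?dV s))) \<le> s * (norm (?dV T) + norm (?dV T - ?dV s))"
        using mult_left_mono[OF norm_triangle_ineq4[of "?dV T" "?dV T - ?dV s"] s(1)] s(1) unfolding norm_scaleR by (simp only: abs_of_nonneg)
    qed
    also have "\<dots> \<le> (B + k * (B * (2 + 2 / (1 - \<alpha>)))) + (s * b + k * (B + 2 * (s * b)))"
    proof (intro add_mono P dP[OF s])
      have p1: "(1 + s) powr (- (1 + \<alpha>)) \<le> (1 + s) powr (- 1)" using s alpha by (intro powr_mono) auto
      have "s * (1 + s) powr (- (1 + \<alpha>)) \<le> (1 + s) * (1 + s) powr (- 1)"
        using s p1 by (intro mult_mono) auto
      also have "\<dots> = 1" using s by (subst powr_split) auto
      finally have q1: "s * (1 + s) powr (- (1 + \<alpha>)) \<le> 1" .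
      have "(1 + s) powr (- \<alpha>) \<le> 1 powr (- \<alpha>)" using s alpha by (intro powr_mono2') auto
      then have q2: "s * (1 + s) powr (- \<alpha>) \<le> s" using s by (simp add: mult_left_le)
      have "s * (norm (?dV T) + norm (?dV T - ?dV s)) \<le> s * (b + k * (B * (1 + s) powr (- (1 + \<alpha>)) + 2 * b * (1 + s) powr (- \<alpha>)))"
        using s(1) by (intro mult_left_mono add_mono dV[OF s]) (auto simp: b_def)
      also have "\<dots> = s * b + k * (B * (s * (1 + s) powr (- (1 + \<alpha>))) + 2 * b * (s * (1 + s) powr (- \<alpha>)))"
        by (simp add: algebra_simps)
      also have "\<dots> \<le> s * b + k * (B * 1 + 2 * b * s)"
        using q1 q2 B b0 k0 by (intro add_left_mono mult_left_mono add_mono) auto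
      finally show "s * (norm (?dV T) + norm (?dV T - ?dV s)) \<le> s * b + k * (B + 2 * (s * b))" by (simp add: mult_ac)
    qed
    also have "\<dots> \<le> B + s * b + k * (c * B + c * (s * b))"
    proof -
      have "B * (2 + 2 / (1 - \<alpha>)) + (B + 2 * (s * b)) \<le> c * B + c * (s * b)"
      proof -
        have "2 * (s * b) \<le> c * (s * b)" using c0 s b0 by (intro mult_right_mono) auto
        moreover have "B * (2 + 2 / (1 - \<alpha>)) + B = (c - 2) * B" by (simp add: c_def algebra_simps)
        moreover have "(c - 2) * B \<le> c * B" using B by (intro mult_right_mono) auto
        ultimately show ?thesis by linarith
      qed
      from mult_left_mono[OF this k0] show ?thesis
        unfolding distrib_left[of k "B * (2 + 2 / (1 - \<alpha>))" "B + 2 * (s * b)"] by linarith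
    qed
    also have "\<dots> = (1 + k * c) * (B + s * b)" by (simp add: algebra_simps)
    also have "\<dots> \<le> (1 + R / 2) * (B + s * b)" using kc w[OF s(1)] by (intro mult_right_mono) auto
    finally show ?thesis .
  qed
  \<comment> \<open>The improved estimate at the maximising time \<open>s0\<close> closes the
    argument. At time 0 it leaves 2 B for the positions, and 3 B suffices for the
    velocities.\<close>
  have "R \<le> 1 + R / 2"
    using dX2[of s0] s0(1) w[of s0] by (simp add: R_def pos_divide_le_eq)
  then have R2: "R \<le> 2" by simp
  have "norm (?dX 0) \<le> R * (B + 0 * b)" by (rule dX) (use T in auto)
  also have "\<dots> \<le> 2 * B" using R2 B by simp
  finally have x: "norm (fst z1 - fst z2) \<le> 2 * B" by simp
  have "\<epsilon> * R \<le> 1 / 14 * 2" using eps_bounds eps R2 R0 by (intro mult_mono) auto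
  then have k1: "k \<le> 1 / 7" by (simp add: k_def)
  have "norm (?dV 0) \<le> norm (?dV T) + norm (?dV T - ?dV 0)"
    using norm_triangle_ineq4[of "?dV T" "?dV T - ?dV 0"] by simp
  also have "norm (?dV T - ?dV 0) \<le> k * (B * (1 + 0) powr (- (1 + \<alpha>)) + 2 * b * (1 + 0) powr (- \<alpha>))" by (rule dV) (use T in auto)
  also have "\<dots> \<le> 1 / 7 * (B + 2 * b)" using k1 B b0 by (simp add: mult_right_mono)
  finally have "norm (?dV 0) \<le> b + 1 / 7 * (B + 2 * b)" by (simp add: b_def)
  then have "norm (snd z1 - snd z2) \<le> b + 1 / 7 * (B + 2 * b)" by simp
  also have "\<dots> \<le> B + 1 / 7 * (B + 2 * B)" using bB by (intro add_mono mult_left_mono) auto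
  also have "\<dots> = (10 / 7) * B" by simp
  also have "\<dots> \<le> 3 * B" using B by (intro mult_right_mono) auto
  finally have v: "norm (snd z1 - snd z2) \<le> 3 * B" .
  have "z1 - z2 = (fst z1 - fst z2, snd z1 - snd z2)" by (simp add: prod_eq_iff)
  then have "norm (z1 - z2) \<le> norm (fst z1 - fst z2) + norm (snd z1 - snd z2)" using norm_Pair_le by metis
  with x v show ?thesis by simp
qed

text \<open>10 is the factor 5 of \<open>backward_stability\<close> times the factor 2 in the
  Lipschitz bound for f0. The first summand is the field error 24 with a = 2 j, integrated over
  s^(-2\<alpha>); the second is the velocity drift, with 2 bounding 1/\<alpha>.\<close>

definition scattering_const :: "real \<Rightarrow> real" where
  "scattering_const \<alpha> = 10 * (48 * kernel_const (\<alpha> + 2) / (2 * \<alpha> - 1) + 2 * kernel_const (\<alpha> + 1))"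

text \<open>\<open>z1\<close> and \<open>z2\<close> are the initial states that reach the reference
  point of the same label at times t1 and t2. Following \<open>z2\<close> back to t1, its state
  nearly agrees with that of \<open>z1\<close>, because the reference flow already contains the
  leading part of the motion in between. Backward stability carries the small difference to time
  0.\<close>

lemma (in vlasov_decay) scattering_rate:
  assumes t: "1 \<le> t1" "t1 \<le> t2"
    and z1: "\<Phi> t1 z1 = reference_flow \<alpha> A_inf t1 (y, v)" and z2: "\<Phi> t2 z2 = reference_flow \<alpha> A_inf t2 (y, v)"
  shows "\<bar>f0 z1 - f0 z2\<bar> \<le> scattering_const \<alpha> * \<eta>\<^sup>2 * t1 powr (1 - 2 * \<alpha>)"
proof -
  define c where "c s = (s powr (1 - \<alpha>) - 1) / (1 - \<alpha>)" for s
  define k1 where "k1 = kernel_const (\<alpha> + 1)"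
  define k2 where "k2 = kernel_const (\<alpha> + 2)"
  have k: "0 < k1" "0 < k2" unfolding k1_def k2_def by (rule kernel_const_pos; use alpha in auto)+
  define j where "j = japanese_bracket (fst z2)"
  have j: "1 \<le> j" "norm (fst z2) \<le> j" unfolding j_def by (rule japanese_bracket_ge)+
  have X1: "X t1 z1 = y + t1 *\<^sub>R v - c t1 *\<^sub>R A_inf v" "V t1 z1 = v"
    and X2: "X t2 z2 = y + t2 *\<^sub>R v - c t2 *\<^sub>R A_inf v" "V t2 z2 = v"
    using z1 z2 by (simp_all add: reference_flow_def c_def algebra_simps)
  \<comment> \<open>\<open>c\<close> has derivative s^(-\<alpha>), so the correction cancels s times
    the leading term s^(-1-\<alpha>) \<open>A_inf v\<close> of the force, and only the remainder
    s^(-2\<alpha>) is integrated.\<close>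
  let ?Q = "\<lambda>s. (X s z2 - s *\<^sub>R V s z2) + c s *\<^sub>R A_inf v"
  let ?d = "48 * k2 * \<eta> * j"
  have d0: "0 \<le> ?d" using k eta j by (intro mult_nonneg_nonneg) auto
  have Q: "norm (?Q t2 - ?Q t1) \<le> ?d / (2 * \<alpha> - 1) * t1 powr (1 - 2 * \<alpha>)"
  proof -
    let ?\<phi> = "\<lambda>s. - (?d / (2 * \<alpha> - 1)) * s powr (1 - 2 * \<alpha>)"
    have "norm (?Q t2 - ?Q t1) \<le> ?\<phi> t2 - ?\<phi> t1"
    proof (rule increment_bound_fn[where y = ?Q and y' = "\<lambda>s. - (s *\<^sub>R E s (X s z2)) + s powr (- \<alpha>) *\<^sub>R A_inf v" and \<phi>' = "\<lambda>s. ?d * s powr (- 2 * \<alpha>)"])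
      fix s assume s: "t1 \<le> s" "s \<le> t2"
      then have s1: "1 \<le> s" using t by simp
      then have s0: "0 < s" by simp
      have "(c has_real_derivative s powr (- \<alpha>)) (at s)"
        unfolding c_def[abs_def] using s0 alpha by (auto intro!: derivative_eq_intros)
      then have "(c has_real_derivative s powr (- \<alpha>)) (at s within {0..})" by (rule has_field_derivative_at_within)
      then have "((\<lambda>s. c s *\<^sub>R A_inf v) has_vector_derivative s powr (- \<alpha>) *\<^sub>R A_inf v) (at s within {0..})"
        using has_vector_derivative_scaleR[of c "s powr (- \<alpha>)" s "{0..}" "\<lambda>_. A_inf v" 0] by simp
      then show "(?Q has_vector_derivative - (s *\<^sub>R E s (X s z2)) + s powr (- \<alpha>) *\<^sub>R A_inf v) (at s within {0..})"
        using s0 by (intro has_vector_derivative_add XV_derivative) auto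
      have "((\<lambda>s. s powr (1 - 2 * \<alpha>)) has_real_derivative (1 - 2 * \<alpha>) * s powr (- 2 * \<alpha>)) (at s)"
        using s0 by (auto intro!: derivative_eq_intros)
      from DERIV_cmult[OF this, of "- (?d / (2 * \<alpha> - 1))"]
      have "(?\<phi> has_real_derivative - (?d / (2 * \<alpha> - 1)) * ((1 - 2 * \<alpha>) * s powr (- 2 * \<alpha>))) (at s)" .
      moreover have "- (e / (2 * \<alpha> - 1)) * ((1 - 2 * \<alpha>) * p) = e * p" for e p using alpha by (simp add: field_simps)
      ultimately show "(?\<phi> has_real_derivative ?d * s powr (- 2 * \<alpha>)) (at s)" by (simp only:)
      have pw1: "1 \<le> s powr (1 - \<alpha>)" using s1 alpha by (intro ge_one_powr_ge_zero) auto
      \<comment> \<open>The final velocity v is V(t2), so the tail of V, not the momentum limit,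
        measures its distance to V(s).\<close>
      have "norm (v - V s z2) \<le> 2 * \<epsilon> * (1 + s) powr (- \<alpha>)"
        using V_tail[of s t2 z2] s s0 X2(2) by simp
      from X_near[OF s1 this] have "norm (X s z2 - s *\<^sub>R v) \<le> norm (fst z2) + s powr (1 - \<alpha>)" .
      also have "\<dots> \<le> (2 * j) * s powr (1 - \<alpha>)"
      proof -
        have "norm (fst z2) * 1 \<le> j * s powr (1 - \<alpha>)" using j pw1 by (intro mult_mono) auto
        moreover have "1 * s powr (1 - \<alpha>) \<le> j * s powr (1 - \<alpha>)" using j by (intro mult_right_mono) auto
        ultimately show ?thesis by simp
      qed
      finally have "norm (E s (X s z2) - s powr (- (\<alpha> + 1)) *\<^sub>R A_inf v) \<le> 24 * k2 * \<eta> * (2 * j) * s powr (- 1 - 2 * \<alpha>)"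
        unfolding k2_def using j by (intro E_asymptotics[OF s1]) auto
      then have "s * norm (E s (X s z2) - s powr (- (\<alpha> + 1)) *\<^sub>R A_inf v) \<le> s * (24 * k2 * \<eta> * (2 * j) * s powr (- 1 - 2 * \<alpha>))"
        using s0 by (intro mult_left_mono) auto
      also have "\<dots> = ?d * (s * s powr (- 1 - 2 * \<alpha>))" by simp
      also have "s * s powr (- 1 - 2 * \<alpha>) = s powr (- 2 * \<alpha>)" using s0 by (subst powr_split) auto
      finally have n: "s * norm (E s (X s z2) - s powr (- (\<alpha> + 1)) *\<^sub>R A_inf v) \<le> ?d * s powr (- 2 * \<alpha>)" .
      have "s * s powr (- (\<alpha> + 1)) = s powr (- \<alpha>)" using s0 by (subst powr_split) auto
      then have "- (s *\<^sub>R E s (X s z2)) + s powr (- \<alpha>) *\<^sub>R A_inf v = - (s *\<^sub>R (E s (X s z2) - s powr (- (\<alpha> + 1)) *\<^sub>R A_inf v))"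
        by (simp add: scaleR_diff_right)
      then have "norm (- (s *\<^sub>R E s (X s z2)) + s powr (- \<alpha>) *\<^sub>R A_inf v) = s * norm (E s (X s z2) - s powr (- (\<alpha> + 1)) *\<^sub>R A_inf v)"
        using s0 by simp
      then show "norm (- (s *\<^sub>R E s (X s z2)) + s powr (- \<alpha>) *\<^sub>R A_inf v) \<le> ?d * s powr (- 2 * \<alpha>)" using n by simp
    qed (use t in auto)
    also have "\<dots> \<le> 0 - ?\<phi> t1"
    proof (intro diff_right_mono)
      have "0 \<le> ?d / (2 * \<alpha> - 1) * t2 powr (1 - 2 * \<alpha>)" using alpha by (intro mult_nonneg_nonneg[OF divide_nonneg_nonneg[OF d0]]) auto
      then show "?\<phi> t2 \<le> 0" by simp
    qed
    finally show ?thesis by simp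
  qed
  have Vd: "norm (V t2 z2 - V t1 z2) \<le> 2 * k1 * \<eta> * t1 powr (- \<alpha>)"
  proof -
    let ?\<phi> = "\<lambda>s. - (k1 * \<eta> / \<alpha>) * s powr (- \<alpha>)"
    have "norm (V t2 z2 - V t1 z2) \<le> ?\<phi> t2 - ?\<phi> t1"
    proof (rule increment_bound_fn[where y = "\<lambda>s. V s z2" and y' = "\<lambda>s. E s (X s z2)" and \<phi>' = "\<lambda>s. k1 * \<eta> * s powr (- (\<alpha> + 1))"])
      fix s assume s: "t1 \<le> s" "s \<le> t2"
      then have s0: "0 < s" using t by simp
      show "((\<lambda>s. V s z2) has_vector_derivative E s (X s z2)) (at s within {0..})" using s0 by (intro V_derivative) simp
      show "norm (E s (X s z2)) \<le> k1 * \<eta> * s powr (- (\<alpha> + 1))" unfolding k1_def by (rule E_decay_eta[OF s0])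
      have e: "- (\<alpha> + 1) = - \<alpha> - 1" by simp
      show "(?\<phi> has_real_derivative k1 * \<eta> * s powr (- (\<alpha> + 1))) (at s)"
        unfolding e using s0 alpha by (auto intro!: derivative_eq_intros)
    qed (use t in auto)
    also have "\<dots> \<le> k1 * \<eta> / \<alpha> * t1 powr (- \<alpha>)" using k eta alpha by simp
    also have "\<dots> \<le> 2 * k1 * \<eta> * t1 powr (- \<alpha>)"
    proof (rule mult_right_mono)
      have "k1 * \<eta> * 1 \<le> k1 * \<eta> * (2 * \<alpha>)" using k eta alpha by (intro mult_left_mono) auto
      then show "k1 * \<eta> / \<alpha> \<le> 2 * k1 * \<eta>" using alpha by (simp add: field_simps)
    qed simp
    finally show ?thesis .
  qed
  define C where "C = 48 * k2 / (2 * \<alpha> - 1) + 2 * k1"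
  have C: "0 < C" using k alpha by (simp add: C_def add_pos_pos)
  define B where "B = C * \<eta> * j * t1 powr (1 - 2 * \<alpha>)"
  have tp: "0 < t1 powr (1 - 2 * \<alpha>)" using t by simp
  have B: "0 < B" using C eta j tp by (simp add: B_def)
  have "norm (z1 - z2) \<le> 5 * B"
  proof (rule backward_stability[OF t(1) B])
    \<comment> \<open>At t2 the corrected position of \<open>z2\<close> is the label y, and at t1
      that of \<open>z1\<close> is y as well. Hence the two states at t1 differ exactly by the
      increment of Q along \<open>z2\<close>.\<close>
    have Q2: "?Q t2 = y" using X2 by simp
    have "(X t1 z1 - t1 *\<^sub>R V t1 z1) - (X t1 z2 - t1 *\<^sub>R V t1 z2) = ?Q t2 - ?Q t1"
      unfolding Q2 using X1 by (simp add: algebra_simps)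
    then have "norm ((X t1 z1 - t1 *\<^sub>R V t1 z1) - (X t1 z2 - t1 *\<^sub>R V t1 z2)) \<le> ?d / (2 * \<alpha> - 1) * t1 powr (1 - 2 * \<alpha>)"
      using Q by (simp only:)
    also have "\<dots> = 48 * k2 / (2 * \<alpha> - 1) * (\<eta> * j * t1 powr (1 - 2 * \<alpha>))" by simp
    also have "\<dots> \<le> C * (\<eta> * j * t1 powr (1 - 2 * \<alpha>))"
      using k eta j by (intro mult_right_mono) (auto simp: C_def)
    finally show "norm ((X t1 z1 - t1 *\<^sub>R V t1 z1) - (X t1 z2 - t1 *\<^sub>R V t1 z2)) \<le> B" by (simp add: B_def mult_ac)
    have "norm (V t1 z1 - V t1 z2) = norm (V t2 z2 - V t1 z2)" using X1 X2 by simp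
    then have "t1 powr (1 - \<alpha>) * norm (V t1 z1 - V t1 z2) \<le> t1 powr (1 - \<alpha>) * (2 * k1 * \<eta> * t1 powr (- \<alpha>))"
      using Vd by (simp add: mult_left_mono)
    also have "\<dots> = 2 * k1 * (\<eta> * 1 * (t1 powr (1 - \<alpha>) * t1 powr (- \<alpha>)))" by simp
    also have "t1 powr (1 - \<alpha>) * t1 powr (- \<alpha>) = t1 powr (1 - 2 * \<alpha>)"
      by (subst powr_add[symmetric], rule arg_cong2[where f = "(powr)"]) simp_all
    also have "2 * k1 * (\<eta> * 1 * t1 powr (1 - 2 * \<alpha>)) \<le> C * (\<eta> * j * t1 powr (1 - 2 * \<alpha>))"
      using k eta j alpha by (intro mult_mono) (auto simp: C_def)
    finally show "t1 powr (1 - \<alpha>) * norm (V t1 z1 - V t1 z2) \<le> B" by (simp add: B_def mult_ac)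
  qed
  \<comment> \<open>Only the bracket at \<open>z2\<close> is divided out; the change of the bracket
    is Lipschitz and f0 is at most \<eta>. The factor 1/j cancels the weight j accumulated in
    B.\<close>
  moreover have f: "\<bar>f0 z1 - f0 z2\<bar> \<le> 2 * \<eta> * norm (z1 - z2) / j"
  proof -
    define i where "i = japanese_bracket (fst z1)"
    have i: "1 \<le> i" unfolding i_def by (rule japanese_bracket_ge)
    have ij: "\<bar>j - i\<bar> \<le> norm (z1 - z2)"
      using japanese_bracket_lipschitz[of "fst z2" "fst z1"] norm_fst_snd_le(1)[of "z1 - z2"]
      by (simp add: i_def j_def norm_minus_commute)
    have "f0 z1 - f0 z2 = ((g z1 - g z2) + (g z1 / i) * (j - i)) / j"
      unfolding i_def[symmetric] j_def[symmetric] using i j by (simp add: field_simps)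
    moreover have ja: "\<bar>j\<bar> = j" using j by simp
    ultimately have "\<bar>f0 z1 - f0 z2\<bar> = \<bar>(g z1 - g z2) + (g z1 / i) * (j - i)\<bar> / j" by (simp only: abs_divide ja)
    also have "\<dots> \<le> (\<eta> * norm (z1 - z2) + \<eta> * norm (z1 - z2)) / j"
    proof (intro divide_right_mono order_trans[OF abs_triangle_ineq] add_mono g_lip)
      have "g z1 / i \<le> \<eta> / 1" using g_nonneg[of z1] g_le[of z1] i by (intro frac_le) auto
      then have "(g z1 / i) * \<bar>j - i\<bar> \<le> \<eta> * norm (z1 - z2)"
        using ij g_nonneg[of z1] i eta by (intro mult_mono) auto
      then show "\<bar>(g z1 / i) * (j - i)\<bar> \<le> \<eta> * norm (z1 - z2)" using g_nonneg[of z1] i by (simp add: abs_mult)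
    qed (use j in auto)
    finally show ?thesis by simp
  qed
  ultimately have "\<bar>f0 z1 - f0 z2\<bar> \<le> 2 * \<eta> * (5 * B) / j"
    using eta j by (intro order_trans[OF f] divide_right_mono mult_left_mono) auto
  also have "\<dots> = 10 * C * \<eta>\<^sup>2 * t1 powr (1 - 2 * \<alpha>)" using j by (simp add: B_def power2_eq_square)
  also have "10 * C = scattering_const \<alpha>" by (simp add: scattering_const_def C_def k1_def k2_def)
  finally show ?thesis .
qed

section \<open>Continuous representatives in time\<close>

lemma nn_integral_lebesgue_AE_eq:
  assumes "AE x in lebesgue. u x = w x"
  shows "(\<integral>\<^sup>+ x. u x \<partial>lebesgue) = (\<integral>\<^sup>+ x. w x \<partial>lborel)"
  using nn_integral_cong_AE[OF assms] by (simp add: nn_integral_completion)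

lemma L1_less_topD:
  assumes "L1 lebesgue g < ennreal c"
  shows "(\<integral>\<^sup>+ x. g x \<partial>lebesgue) < ennreal c"
  using assms by (auto simp: L1_def split: if_splits)

lemma lipschitz_continuous:
  fixes w :: "'a::real_normed_vector \<Rightarrow> 'b::real_normed_vector"
  assumes "\<And>x y. norm (w x - w y) \<le> c * norm (x - y)"
  shows "continuous_on S w"
proof (rule lipschitz_on_continuous_on[of "\<bar>c\<bar>"])
  show "\<bar>c\<bar>-lipschitz_on S w"
  proof (rule lipschitz_onI)
    fix x y :: 'a
    have "c * norm (x - y) \<le> \<bar>c\<bar> * norm (x - y)" by (intro mult_right_mono) auto
    with assms[of x y] show "dist (w x) (w y) \<le> \<bar>c\<bar> * dist x y" by (simp add: dist_norm)
  qed simp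
qed

lemma W11_W1inf_lipschitz:
  fixes u :: "'a::euclidean_space \<Rightarrow> real" and c :: real
  assumes "W11_W1inf_norm u < ennreal c"
  obtains w where "AE x in lebesgue. u x = w x" "\<And>x. \<bar>w x\<bar> \<le> c"
    "\<And>x y. \<bar>w x - w y\<bar> \<le> DIM('a) * c * norm (x - y)" "continuous_on UNIV w"
    "(\<integral>\<^sup>+ x. ennreal \<bar>w x\<bar> \<partial>lborel) \<le> ennreal c"
proof -
  have "sobolev_norm (Linf lebesgue) 1 u \<le> W11_W1inf_norm u" "sobolev_norm (L1 lebesgue) 1 u \<le> W11_W1inf_norm u"
    unfolding W11_W1inf_norm_def by simp_all
  then have s: "sobolev_norm (Linf lebesgue) 1 u < ennreal c" "sobolev_norm (L1 lebesgue) 1 u < ennreal c"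
    using assms by order+
  obtain w where w: "AE x in lebesgue. u x = w x" "\<And>x. norm (w x) \<le> c"
    "\<And>x y. norm (w x - w y) \<le> DIM('a) * c * norm (x - y)"
    by (rule sobolev_Linf_lipschitz[OF s(1)]) blast
  have "weak_derivative_norm (L1 lebesgue) {#} u < ennreal c"
    using sobolev_norm_1(1) s(2) by (rule order.strict_trans1)
  then obtain g where g: "has_weak_derivative {#} u g" "L1 lebesgue (\<lambda>x. ennreal (norm (g x))) < ennreal c"
    by (rule weak_derivative_norm_lessE) blast
  have "AE x in lebesgue. ennreal (norm (g x)) = ennreal \<bar>w x\<bar>"
    using weak_derivative_empty_AE[OF g(1)] w(1) by eventually_elim simp
  then have "(\<integral>\<^sup>+ x. ennreal \<bar>w x\<bar> \<partial>lborel) = (\<integral>\<^sup>+ x. ennreal (norm (g x)) \<partial>lebesgue)"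
    by (rule nn_integral_lebesgue_AE_eq[symmetric])
  then have "(\<integral>\<^sup>+ x. ennreal \<bar>w x\<bar> \<partial>lborel) \<le> ennreal c" using L1_less_topD[OF g(2)] by simp
  with w lipschitz_continuous[OF w(3), of UNIV] that[of w] show ?thesis by (simp only: real_norm_def)
qed

text \<open>For each time separately there is a Lipschitz representative. The representative of a
  difference is continuous and so equals the difference of the representatives everywhere; thus
  continuity in norm becomes uniform continuity in z, and the Lipschitz constants are locally
  bounded in time.\<close>

lemma W11_W1inf_continuous_representative:
  fixes f :: "real \<Rightarrow> 'a::euclidean_space \<Rightarrow> real"
  assumes nonneg: "\<And>t z. 0 \<le> t \<Longrightarrow> 0 \<le> f t z"
    and fin: "\<And>t. 0 \<le> t \<Longrightarrow> W11_W1inf_norm (f t) < \<infinity>"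
    and cont: "\<And>t. 0 \<le> t \<Longrightarrow> ((\<lambda>s. W11_W1inf_norm (\<lambda>z. f s z - f t z)) \<longlongrightarrow> 0) (at t within {0..})"
  obtains F where "\<And>t. 0 \<le> t \<Longrightarrow> AE z in lebesgue. f t z = F t z"
    "continuous_on ({0..} \<times> UNIV) (\<lambda>(t, z). F t z)"
    "\<And>T. 0 \<le> T \<Longrightarrow> \<exists>M\<ge>0. \<forall>t\<in>{0..T}. \<forall>z z'. \<bar>F t z - F t z'\<bar> \<le> M * norm (z - z')"
    "\<And>t z. 0 \<le> t \<Longrightarrow> 0 \<le> F t z"
    "\<And>t. 0 \<le> t \<Longrightarrow> integrable lborel (F t)"
    "\<And>t e. 0 \<le> t \<Longrightarrow> 0 < e \<Longrightarrow> \<exists>d>0. \<forall>s\<ge>0. \<bar>s - t\<bar> < d \<longrightarrow> (LINT z|lborel. \<bar>F s z - F t z\<bar>) \<le> e"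
proof -
  define Q where "Q t w \<longleftrightarrow> (AE z in lebesgue. f t z = w z) \<and> continuous_on UNIV w \<and>
      (\<exists>c\<ge>0. (\<forall>z z'. \<bar>w z - w z'\<bar> \<le> c * norm (z - z')) \<and> (\<integral>\<^sup>+ z. ennreal \<bar>w z\<bar> \<partial>lborel) \<le> ennreal c)" for t w
  have "\<exists>w. Q t w" if t: "0 \<le> t" for t
  proof -
    obtain n :: nat where "W11_W1inf_norm (f t) < of_nat n"
      using fin[OF t] ennreal_Ex_less_of_nat by (auto simp: top.not_eq_extremum)
    then have n: "W11_W1inf_norm (f t) < ennreal (real n)" by (simp add: ennreal_of_nat_eq_real_of_nat)
    obtain w where w: "AE x in lebesgue. f t x = w x" "\<And>x y. \<bar>w x - w y\<bar> \<le> DIM('a) * real n * norm (x - y)"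
      "continuous_on UNIV w" "(\<integral>\<^sup>+ x. ennreal \<bar>w x\<bar> \<partial>lborel) \<le> ennreal (real n)"
      by (rule W11_W1inf_lipschitz[OF n]) blast
    have "1 * real n \<le> DIM('a) * real n" by (intro mult_right_mono) (auto simp: Suc_leI)
    then have "(\<integral>\<^sup>+ x. ennreal \<bar>w x\<bar> \<partial>lborel) \<le> ennreal (DIM('a) * real n)"
      using w(4) by (auto intro: order_trans ennreal_leI)
    with w show ?thesis unfolding Q_def by (intro exI[of _ w] conjI exI[of _ "DIM('a) * real n"]) auto
  qed
  then have "\<forall>t\<in>{0..}. \<exists>w. Q t w" by simp
  from bchoice[OF this] obtain F where "\<And>t. 0 \<le> t \<Longrightarrow> Q t (F t)" by auto
  then have F: "\<And>t. 0 \<le> t \<Longrightarrow> AE z in lebesgue. f t z = F t z" "\<And>t. 0 \<le> t \<Longrightarrow> continuous_on UNIV (F t)"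
    and FL: "\<And>t. 0 \<le> t \<Longrightarrow> \<exists>c\<ge>0. (\<forall>z z'. \<bar>F t z - F t z'\<bar> \<le> c * norm (z - z')) \<and> (\<integral>\<^sup>+ z. ennreal \<bar>F t z\<bar> \<partial>lborel) \<le> ennreal c"
    unfolding Q_def by simp_all
  have Fm: "F t \<in> borel_measurable borel" if "0 \<le> t" for t
    using F(2)[OF that] by (rule borel_measurable_continuous_onI)
  have Fi: "integrable lborel (F t)" if t: "0 \<le> t" for t
  proof (rule integrableI_bounded)
    show "F t \<in> borel_measurable lborel" using Fm[OF t] by simp
    show "(\<integral>\<^sup>+ z. ennreal (norm (F t z)) \<partial>lborel) < \<infinity>" using FL[OF t] by (auto intro: order.strict_trans1)
  qed
  have close: "\<exists>d>0. \<forall>s\<ge>0. \<bar>s - t\<bar> < d \<longrightarrow> (\<forall>z. \<bar>F s z - F t z\<bar> \<le> e) \<and>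
      (\<forall>z z'. \<bar>(F s z - F t z) - (F s z' - F t z')\<bar> \<le> DIM('a) * e * norm (z - z')) \<and> (LINT z|lborel. \<bar>F s z - F t z\<bar>) \<le> e"
    if t: "0 \<le> t" and e: "0 < e" for t e :: real
  proof -
    have "\<forall>\<^sub>F s in at t within {0..}. W11_W1inf_norm (\<lambda>z. f s z - f t z) < ennreal e"
      using order_tendstoD(2)[OF cont[OF t], of "ennreal e"] e by simp
    then obtain d where d: "d > 0" "\<And>s. 0 \<le> s \<Longrightarrow> s \<noteq> t \<Longrightarrow> \<bar>s - t\<bar> < d \<Longrightarrow> W11_W1inf_norm (\<lambda>z. f s z - f t z) < ennreal e"
      unfolding eventually_at by (auto simp: dist_real_def)
    show ?thesis
    proof (intro exI[of _ d] conjI d allI impI)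
      fix s assume s: "0 \<le> s" "\<bar>s - t\<bar> < d"
      have "(\<forall>z. \<bar>F s z - F t z\<bar> \<le> e) \<and>
        (\<forall>z z'. \<bar>(F s z - F t z) - (F s z' - F t z')\<bar> \<le> DIM('a) * e * norm (z - z')) \<and> (LINT z|lborel. \<bar>F s z - F t z\<bar>) \<le> e"
      proof (cases "s = t")
        case False
        obtain w where w: "AE x in lebesgue. f s x - f t x = w x" "\<And>x. \<bar>w x\<bar> \<le> e"
          "\<And>x y. \<bar>w x - w y\<bar> \<le> DIM('a) * e * norm (x - y)" "continuous_on UNIV w"
          "(\<integral>\<^sup>+ x. ennreal \<bar>w x\<bar> \<partial>lborel) \<le> ennreal e"
          by (rule W11_W1inf_lipschitz[OF d(2)[OF s(1) False s(2)]]) blast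
        have "AE z in lebesgue. w z = F s z - F t z"
          using w(1) F(1)[OF s(1)] F(1)[OF t] by eventually_elim simp
        \<comment> \<open>Two continuous functions equal almost everywhere are equal; from here on
          the norm bound on the difference holds pointwise.\<close>
        then have weq: "w = (\<lambda>z. F s z - F t z)"
          by (rule AE_continuous_eq[OF _ w(4)]) (intro continuous_intros F(2) s t)
        have "integrable lborel (\<lambda>z. \<bar>w z\<bar>)" unfolding weq using Fi[OF s(1)] Fi[OF t] by simp
        then have "ennreal (LINT z|lborel. \<bar>w z\<bar>) \<le> ennreal e" using w(5) by (subst nn_integral_eq_integral[symmetric]) auto
        then have "(LINT z|lborel. \<bar>w z\<bar>) \<le> e" using e by (simp add: ennreal_le_iff)
        with w(2,3) show ?thesis unfolding weq by blast
      qed (use e in simp)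
      then show "\<bar>F s z - F t z\<bar> \<le> e" "\<bar>(F s z - F t z) - (F s z' - F t z')\<bar> \<le> DIM('a) * e * norm (z - z')"
        "(LINT z|lborel. \<bar>F s z - F t z\<bar>) \<le> e" for z z' by blast+
    qed
  qed
  show ?thesis
  proof (rule that[of F])
    show "continuous_on ({0..} \<times> UNIV) (\<lambda>(t, z). F t z)"
      unfolding continuous_on_iff
    proof (intro ballI allI impI)
      fix p :: "real \<times> 'a" and e :: real assume p: "p \<in> {0..} \<times> UNIV" and e: "0 < e"
      obtain t z where [simp]: "p = (t, z)" by (metis surj_pair)
      have t: "0 \<le> t" using p by simp
      obtain d1 where d1: "d1 > 0" "\<And>s y. 0 \<le> s \<Longrightarrow> \<bar>s - t\<bar> < d1 \<Longrightarrow> \<bar>F s y - F t y\<bar> \<le> e / 2"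
        using close[OF t, of "e / 2"] e by (metis half_gt_zero)
      obtain d2 where d2: "d2 > 0" "\<And>y. dist y z < d2 \<Longrightarrow> dist (F t y) (F t z) < e / 2"
        using F(2)[OF t] e unfolding continuous_on_iff by (metis UNIV_I half_gt_zero)
      show "\<exists>d>0. \<forall>q\<in>{0..} \<times> UNIV. dist q p < d \<longrightarrow> dist (case q of (t, z) \<Rightarrow> F t z) (case p of (t, z) \<Rightarrow> F t z) < e"
      proof (intro exI[of _ "min d1 d2"] conjI ballI impI)
        fix q :: "real \<times> 'a" assume q: "q \<in> {0..} \<times> UNIV" "dist q p < min d1 d2"
        obtain s y where [simp]: "q = (s, y)" by (metis surj_pair)
        have "dist s t < d1" "dist y z < d2" using q(2) dist_fst_le[of q p] dist_snd_le[of q p] by auto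
        then have "\<bar>F s y - F t y\<bar> \<le> e / 2" "\<bar>F t y - F t z\<bar> < e / 2"
          using d1(2)[of s y] d2(2)[of y] q(1) by (auto simp: dist_real_def)
        then have "\<bar>F s y - F t z\<bar> < e" by linarith
        then show "dist (case q of (t, z) \<Rightarrow> F t z) (case p of (t, z) \<Rightarrow> F t z) < e" by (simp add: dist_real_def)
      qed (use d1 d2 in auto)
    qed
    show "\<exists>M\<ge>0. \<forall>t\<in>{0..T}. \<forall>z z'. \<bar>F t z - F t z'\<bar> \<le> M * norm (z - z')" if T: "0 \<le> T" for T
    proof -
      \<comment> \<open>A common Lipschitz constant exists near every time and passes to unions of
        adjacent intervals, so it exists on the compact interval. Negative times are exempt because
        F is not controlled there.\<close>
      define P where "P a b \<longleftrightarrow> (\<exists>M\<ge>0. \<forall>t\<in>{a..b}. 0 \<le> t \<longrightarrow> (\<forall>z z'. \<bar>F t z - F t z'\<bar> \<le> M * norm (z - z')))" for a b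
      have "P 0 T"
        using T
      proof (induction rule: Bolzano)
        case (trans a b c)
        obtain M where M: "0 \<le> M" "\<And>t z z'. t \<in> {a..b} \<Longrightarrow> 0 \<le> t \<Longrightarrow> \<bar>F t z - F t z'\<bar> \<le> M * norm (z - z')"
          using trans(1) unfolding P_def by blast
        obtain N where N: "0 \<le> N" "\<And>t z z'. t \<in> {b..c} \<Longrightarrow> 0 \<le> t \<Longrightarrow> \<bar>F t z - F t z'\<bar> \<le> N * norm (z - z')"
          using trans(2) unfolding P_def by blast
        show ?case unfolding P_def
        proof (intro exI[of _ "max M N"] conjI ballI allI impI)
          show "0 \<le> max M N" using M(1) by simp
          fix t z z' assume t: "t \<in> {a..c}" "0 \<le> t"
          have "\<bar>F t z - F t z'\<bar> \<le> M * norm (z - z') \<or> \<bar>F t z - F t z'\<bar> \<le> N * norm (z - z')"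
            using M(2)[of t z z'] N(2)[of t z z'] t by (cases "t \<le> b") auto
          moreover have "M * norm (z - z') \<le> max M N * norm (z - z')" "N * norm (z - z') \<le> max M N * norm (z - z')"
            by (intro mult_right_mono; simp)+
          ultimately show "\<bar>F t z - F t z'\<bar> \<le> max M N * norm (z - z')" by linarith
        qed
      next
        case (local x)
        then have x: "0 \<le> x" by simp
        obtain c where c: "c \<ge> 0" "\<And>z z'. \<bar>F x z - F x z'\<bar> \<le> c * norm (z - z')" using FL[OF x] by blast
        obtain d where d: "d > 0" "\<And>s z z'. 0 \<le> s \<Longrightarrow> \<bar>s - x\<bar> < d \<Longrightarrow> \<bar>(F s z - F x z) - (F s z' - F x z')\<bar> \<le> real DIM('a) * 1 * norm (z - z')"
          using close[OF x zero_less_one] by blast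
        show ?case
        proof (intro exI[of _ d] conjI d allI impI)
          fix a b assume ab: "a \<le> x \<and> x \<le> b \<and> b - a < d"
          show "P a b" unfolding P_def
          proof (intro exI[of _ "c + DIM('a)"] conjI ballI allI impI)
            fix t z z' assume t: "t \<in> {a..b}" "0 \<le> t"
            then have "\<bar>t - x\<bar> < d" using ab by auto
            from d(2)[OF t(2) this, of z z'] c(2)[of z z']
            show "\<bar>F t z - F t z'\<bar> \<le> (c + DIM('a)) * norm (z - z')" by (simp add: distrib_right)
          qed (use c in simp)
        qed
      qed
      then show ?thesis unfolding P_def by auto
    qed
    show "0 \<le> F t z" if t: "0 \<le> t" for t z
    proof -
      have "AE z in lebesgue. F t z = \<bar>F t z\<bar>" using F(1)[OF t] by eventually_elim (metis nonneg[OF t] abs_of_nonneg)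
      then have "F t = (\<lambda>z. \<bar>F t z\<bar>)"
        by (rule AE_continuous_eq) (intro continuous_intros F(2) t)+
      then show ?thesis by (metis abs_ge_zero)
    qed
    show "\<exists>d>0. \<forall>s\<ge>0. \<bar>s - t\<bar> < d \<longrightarrow> (LINT z|lborel. \<bar>F s z - F t z\<bar>) \<le> e" if "0 \<le> t" "0 < e" for t e
      using close[OF that] by blast
  qed (use F Fi in auto)
qed

section \<open>Regularity of the force field\<close>

lemma fiber_integral_AE:
  fixes u F :: "'a::euclidean_space \<times> 'b::euclidean_space \<Rightarrow> real"
  assumes ae: "AE z in lebesgue. u z = F z" and F[measurable]: "F \<in> borel_measurable borel"
  shows "AE y in lborel. (LINT v|lebesgue. u (y, v)) = (LINT v|lborel. F (y, v))"
proof -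
  have "AE z in lborel \<Otimes>\<^sub>M lborel. u z = F z" using ae unfolding AE_lebesgue_iff lborel_prod .
  then have "AE y in lborel. AE v in lborel. u (y, v) = F (y, v)" by (rule lborel_pair.AE_pair)
  then show ?thesis
  proof eventually_elim
    case (elim y)
    have "(\<lambda>v. F (y, v)) \<in> borel_measurable borel"
      by (rule measurable_compose[OF _ F]) simp
    from integral_lebesgue_borel_version[OF this elim] show ?case .
  qed
qed

lemma fiber_integral_measurable:
  fixes F :: "'a::euclidean_space \<times> 'b::euclidean_space \<Rightarrow> real"
  assumes F: "F \<in> borel_measurable borel"
  shows "(\<lambda>y. LINT v|lborel. F (y, v)) \<in> borel_measurable borel"
proof -
  have "case_prod (\<lambda>y v. F (y, v)) \<in> borel_measurable (lborel \<Otimes>\<^sub>M lborel)"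
    using F by (simp add: lborel_prod)
  then have "(\<lambda>y. LINT v|lborel. F (y, v)) \<in> borel_measurable lborel"
    by (rule lborel.borel_measurable_lebesgue_integral)
  then show ?thesis by simp
qed

text \<open>The origin of the potential corresponds to the single point y = x, a null set, so the
  gradient may be replaced by the kernel.\<close>

lemma force_field_eq:
  assumes ae: "AE z in lebesgue. f t z = F z" and F: "F \<in> borel_measurable borel"
  shows "force_field lam \<alpha> f t x = (lam * \<alpha>) *\<^sub>R (LINT y|lborel. (LINT v|lborel. F (y, v)) *\<^sub>R riesz_kernel \<alpha> (x - y))"
proof -
  let ?\<rho> = "\<lambda>y. LINT v|lborel. F (y, v)"
  note [measurable] = fiber_integral_measurable[OF F]
  have "AE y in lborel. spatial_density f t y *\<^sub>R grad (riesz_potential lam \<alpha>) (x - y) = (- (lam * \<alpha>)) *\<^sub>R (?\<rho> y *\<^sub>R riesz_kernel \<alpha> (x - y))"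
    using fiber_integral_AE[OF ae F] AE_lborel_singleton[of x]
  proof eventually_elim
    case (elim y)
    then have "grad (riesz_potential lam \<alpha>) (x - y) = (- (lam * \<alpha>)) *\<^sub>R riesz_kernel \<alpha> (x - y)"
      by (intro grad_riesz_potential) simp
    with elim(1) show ?case by (simp only: spatial_density_def scaleR_left_commute)
  qed
  then have "(LINT y|lebesgue. spatial_density f t y *\<^sub>R grad (riesz_potential lam \<alpha>) (x - y))
      = (LINT y|lborel. (- (lam * \<alpha>)) *\<^sub>R (?\<rho> y *\<^sub>R riesz_kernel \<alpha> (x - y)))"
    by (intro integral_lebesgue_borel_version) measurable
  then show ?thesis unfolding force_field_def by (simp only: integral_scaleR_right scaleR_minus_left integral_minus minus_minus)
qed

lemma nabla_Linf_norm_1E: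
  fixes u :: "'a::euclidean_space \<Rightarrow> 'b::euclidean_space" and c :: real
  assumes u: "nabla_Linf_norm 1 u < ennreal c" and c: "0 \<le> c"
  obtains g where "\<And>b. b \<in> Basis \<Longrightarrow> has_weak_derivative {#b#} u (g b)"
    "\<And>b. b \<in> Basis \<Longrightarrow> AE x in lebesgue. norm (g b x) \<le> c"
proof -
  have "\<exists>g. has_weak_derivative {#b#} u g \<and> (AE x in lebesgue. norm (g x) \<le> c)" if b: "b \<in> Basis" for b
  proof -
    have "finite {m :: 'a multiset. set_mset m \<subseteq> Basis \<and> size m = 1}"
      by (rule finite_subset[OF _ finite_multi_indices[of 1]]) (auto simp: multi_indices_def)
    then have "weak_derivative_norm (Linf lebesgue) {#b#} u \<le> nabla_Linf_norm 1 u"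
      unfolding nabla_Linf_norm_def using b by (intro member_le_sum) auto
    then have "weak_derivative_norm (Linf lebesgue) {#b#} u < ennreal c" using u by (rule order.strict_trans1)
    then obtain g where "has_weak_derivative {#b#} u g" "Linf lebesgue (\<lambda>x. ennreal (norm (g x))) < ennreal c"
      by (rule weak_derivative_norm_lessE) blast
    with Linf_lessD[OF _ c] show ?thesis by blast
  qed
  then have "\<forall>b\<in>Basis. \<exists>g. has_weak_derivative {#b#} u g \<and> (AE x in lebesgue. norm (g x) \<le> c)" by blast
  from bchoice[OF this] that show ?thesis by blast
qed

text \<open>Lifts the bound from the spatial density to phase space by integrating out velocities.
  The resulting integral of the stronger singularity is what makes the force integral absolutely
  convergent at every single point x.\<close>

lemma force_density_bound:
  fixes F :: "phase \<Rightarrow> real" and E :: "real^3 \<Rightarrow> real^3" and M :: real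
  assumes \<alpha>: "0 < \<alpha>" "\<alpha> < 1" and c: "c \<noteq> 0"
    and Fi: "integrable lborel F" and F0: "\<And>z. 0 \<le> F z"
    and E: "\<And>x. E x = c *\<^sub>R (LINT y|lborel. (LINT v|lborel. F (y, v)) *\<^sub>R riesz_kernel \<alpha> (x - y))"
    and g: "\<And>b. b \<in> Basis \<Longrightarrow> has_weak_derivative {#b#} E (g b)"
    and M: "\<And>b. b \<in> Basis \<Longrightarrow> AE x in lebesgue. norm (g b x) \<le> M" and M0: "0 \<le> M"
  shows "(\<integral>\<^sup>+ z. ennreal (F z * norm (x - fst z) powr (- (\<alpha> + 2))) \<partial>lborel) \<le> ennreal (12 * M / ((1 - \<alpha>) * \<bar>c\<bar>))"
    and "integrable lborel (\<lambda>z. F z *\<^sub>R riesz_kernel \<alpha> (x - fst z))"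
    and "E x = c *\<^sub>R (LINT z|lborel. F z *\<^sub>R riesz_kernel \<alpha> (x - fst z))"
proof -
  let ?\<rho> = "\<lambda>y. LINT v|lborel. F (y, v)"
  have Fm[measurable]: "F \<in> borel_measurable borel" using Fi by auto
  have fm[measurable]: "(fst :: phase \<Rightarrow> real^3) \<in> borel_measurable borel" by (intro borel_measurable_continuous_onI continuous_intros)
  have Fi': "integrable (lborel \<Otimes>\<^sub>M lborel) F" using Fi by (simp add: lborel_prod)
  have fib: "AE y in lborel. integrable lborel (\<lambda>v. F (y, v))" by (rule lborel_pair.AE_integrable_fst'[OF Fi'])
  have \<rho>: "(\<integral>\<^sup>+ y. ennreal (?\<rho> y * norm (x - y) powr (- (\<alpha> + 2))) \<partial>lborel) \<le> ennreal (12 * M / ((1 - \<alpha>) * \<bar>c\<bar>))"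
  proof (rule density_from_gradient_bound[OF \<alpha> fiber_integral_measurable[OF Fm] _ _ c E g M M0])
    show "0 \<le> ?\<rho> y" for y using F0 by simp
    show "integrable lborel ?\<rho>" using lborel_pair.integrable_fst'[OF Fi'] .
  qed
  let ?r = "\<lambda>z. ennreal (F z * norm (x - fst z) powr (- (\<alpha> + 2)))"
  have "(\<integral>\<^sup>+ z. ?r z \<partial>lborel) = (\<integral>\<^sup>+ z. ?r z \<partial>(lborel \<Otimes>\<^sub>M lborel))" by (simp only: lborel_prod)
  also have "\<dots> = (\<integral>\<^sup>+ y. (\<integral>\<^sup>+ v. ?r (y, v) \<partial>lborel) \<partial>lborel)"
    by (rule lborel.nn_integral_fst[symmetric]) (simp add: lborel_prod)
  also have "\<dots> = (\<integral>\<^sup>+ y. ennreal (?\<rho> y * norm (x - y) powr (- (\<alpha> + 2))) \<partial>lborel)"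
  proof (rule nn_integral_cong_AE)
    show "AE y in lborel. (\<integral>\<^sup>+ v. ?r (y, v) \<partial>lborel) = ennreal (?\<rho> y * norm (x - y) powr (- (\<alpha> + 2)))"
      using fib
    proof eventually_elim
      case (elim y)
      have "(\<integral>\<^sup>+ v. ?r (y, v) \<partial>lborel) = ennreal (LINT v|lborel. F (y, v) * norm (x - y) powr (- (\<alpha> + 2)))"
        using elim F0 by (simp add: nn_integral_eq_integral)
      then show ?case by simp
    qed
  qed
  finally show b: "(\<integral>\<^sup>+ z. ?r z \<partial>lborel) \<le> ennreal (12 * M / ((1 - \<alpha>) * \<bar>c\<bar>))" using \<rho> by simp
  have [measurable]: "(\<lambda>z. F z *\<^sub>R riesz_kernel \<alpha> (x - fst z)) \<in> borel_measurable borel"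
    by (intro borel_measurable_scaleR Fm measurable_compose[OF _ riesz_kernel_measurable] borel_measurable_diff) simp_all
  show i: "integrable lborel (\<lambda>z. F z *\<^sub>R riesz_kernel \<alpha> (x - fst z))"
  proof (rule integrableI_bounded)
    \<comment> \<open>The weaker singularity is at most the stronger one inside the unit ball and at
      most 1 outside.\<close>
    have pw: "r powr (- (\<alpha> + 1)) \<le> 1 + r powr (- (\<alpha> + 2))" if r: "0 \<le> r" for r :: real
    proof (cases "r = 0")
      case False
      then have r0: "0 < r" using r by simp
      show ?thesis
      proof (cases "r \<le> 1")
        case True
        then have "r powr (- (\<alpha> + 1)) \<le> r powr (- (\<alpha> + 2))" using r0 by (intro powr_mono') auto
        then show ?thesis by simp
      next
        case False
        then have "r powr (- (\<alpha> + 1)) \<le> 1 powr (- (\<alpha> + 1))" using \<alpha> by (intro powr_mono2') auto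
        moreover have "0 \<le> r powr (- (\<alpha> + 2))" by simp
        ultimately show ?thesis unfolding powr_one_eq_one by linarith
      qed
    qed simp
    have "(\<integral>\<^sup>+ z. ennreal (norm (F z *\<^sub>R riesz_kernel \<alpha> (x - fst z))) \<partial>lborel) \<le> (\<integral>\<^sup>+ z. ennreal (F z) + ?r z \<partial>lborel)"
    proof (intro nn_integral_mono)
      fix z :: phase
      have "norm (F z *\<^sub>R riesz_kernel \<alpha> (x - fst z)) \<le> F z * (1 + norm (x - fst z) powr (- (\<alpha> + 2)))"
        unfolding norm_scaleR norm_riesz_kernel abs_of_nonneg[OF F0] by (intro mult_left_mono pw F0) simp
      also have "\<dots> = F z + F z * norm (x - fst z) powr (- (\<alpha> + 2))" by (simp add: distrib_left)
      finally have "ennreal (norm (F z *\<^sub>R riesz_kernel \<alpha> (x - fst z))) \<le> ennreal (F z + F z * norm (x - fst z) powr (- (\<alpha> + 2)))"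
        by (rule ennreal_leI)
      also have "\<dots> = ennreal (F z) + ?r z" using F0[of z] by (intro ennreal_plus) auto
      finally show "ennreal (norm (F z *\<^sub>R riesz_kernel \<alpha> (x - fst z))) \<le> ennreal (F z) + ?r z" .
    qed
    also have "\<dots> = (\<integral>\<^sup>+ z. ennreal (F z) \<partial>lborel) + (\<integral>\<^sup>+ z. ?r z \<partial>lborel)" by (rule nn_integral_add) measurable
    also have "\<dots> < \<infinity>" using b Fi F0 by (auto simp: nn_integral_eq_integral intro: order.strict_trans1)
    finally show "(\<integral>\<^sup>+ z. ennreal (norm (F z *\<^sub>R riesz_kernel \<alpha> (x - fst z))) \<partial>lborel) < \<infinity>" .
  qed simp
  have "(LINT z|lborel. F z *\<^sub>R riesz_kernel \<alpha> (x - fst z)) = (LINT z|(lborel \<Otimes>\<^sub>M lborel). F z *\<^sub>R riesz_kernel \<alpha> (x - fst z))"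
    by (simp only: lborel_prod)
  also have "\<dots> = (LINT y|lborel. (LINT v|lborel. F (y, v) *\<^sub>R riesz_kernel \<alpha> (x - fst (y, v))))"
    by (rule lborel_pair.integral_fst'[symmetric]) (use i in \<open>simp add: lborel_prod\<close>)
  also have "\<dots> = (LINT y|lborel. ?\<rho> y *\<^sub>R riesz_kernel \<alpha> (x - y))"
  proof (rule Bochner_Integration.integral_cong[OF refl])
    fix y
    show "(LINT v|lborel. F (y, v) *\<^sub>R riesz_kernel \<alpha> (x - fst (y, v))) = ?\<rho> y *\<^sub>R riesz_kernel \<alpha> (x - y)"
    \<comment> \<open>On a fibre where F is not integrable and the kernel is nonzero, both sides are
      0 by the default value of the integral.\<close>
    proof (cases "integrable lborel (\<lambda>v. F (y, v)) \<or> riesz_kernel \<alpha> (x - y) = 0")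
      case False
      let ?k = "riesz_kernel \<alpha> (x - y)"
      have "\<not> integrable lborel (\<lambda>v. F (y, v) *\<^sub>R ?k)"
      proof
        assume "integrable lborel (\<lambda>v. F (y, v) *\<^sub>R ?k)"
        then have "integrable lborel (\<lambda>v. ((F (y, v) *\<^sub>R ?k) \<bullet> ?k) / (?k \<bullet> ?k))" by (intro integrable_divide_zero integrable_inner_left)
        moreover have "((F (y, v) *\<^sub>R ?k) \<bullet> ?k) / (?k \<bullet> ?k) = F (y, v)" for v using False by simp
        ultimately have "integrable lborel (\<lambda>v. F (y, v))" by (simp only:)
        with False show False by blast
      qed
      with False show ?thesis by (simp add: not_integrable_integral_eq)
    qed auto
  qed
  finally show "E x = c *\<^sub>R (LINT z|lborel. F z *\<^sub>R riesz_kernel \<alpha> (x - fst z))" by (simp add: E)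
qed

text \<open>Only the scalar factor is frozen inside radius \<kappa>; the vector is kept. The result
  is bounded and continuous, and its error is at most \<kappa> times |a|^(-\<alpha>-2), which the
  density bound integrates.\<close>

definition truncated_kernel :: "real \<Rightarrow> real \<Rightarrow> 'a::euclidean_space \<Rightarrow> 'a" where
  "truncated_kernel \<alpha> \<kappa> a = max (norm a) \<kappa> powr (- (\<alpha> + 2)) *\<^sub>R a"

lemma truncated_kernel_continuous:
  assumes "0 < \<kappa>" shows "continuous_on S (truncated_kernel \<alpha> \<kappa>)"
  unfolding truncated_kernel_def[abs_def] using assms by (intro continuous_intros) (auto simp: max_def)

lemma truncated_kernel_bound:
  assumes "0 < \<kappa>" "0 < \<alpha>" shows "norm (truncated_kernel \<alpha> \<kappa> a) \<le> \<kappa> powr (- (\<alpha> + 1))"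
proof -
  let ?m = "max (norm a) \<kappa>"
  have "norm (truncated_kernel \<alpha> \<kappa> a) = ?m powr (- (\<alpha> + 2)) * norm a" by (simp add: truncated_kernel_def)
  also have "\<dots> \<le> ?m powr (- (\<alpha> + 2)) * ?m" by (intro mult_left_mono) auto
  also have "\<dots> = ?m powr (- (\<alpha> + 1))"
  proof -
    have "?m * ?m powr (- (\<alpha> + 2)) = ?m powr (1 + - (\<alpha> + 2))" using assms by (intro powr_mult_base) auto
    also have "1 + - (\<alpha> + 2) = - (\<alpha> + 1)" by simp
    finally show ?thesis by (simp only: mult.commute)
  qed
  also have "\<dots> \<le> \<kappa> powr (- (\<alpha> + 1))" using assms by (intro powr_mono2') auto
  finally show ?thesis .
qed

lemma truncated_kernel_error:
  assumes "0 < \<kappa>" "0 < \<alpha>"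
  shows "norm (truncated_kernel \<alpha> \<kappa> a - riesz_kernel \<alpha> a) \<le> \<kappa> * norm a powr (- (\<alpha> + 2))"
proof (cases "a = 0 \<or> \<kappa> \<le> norm a")
  case True
  then show ?thesis using assms by (auto simp: truncated_kernel_def riesz_kernel_def max_def)
next
  case False
  then have a: "0 < norm a" "norm a < \<kappa>" by auto
  have p: "\<kappa> powr (- (\<alpha> + 2)) \<le> norm a powr (- (\<alpha> + 2))" using a assms by (intro powr_mono2') auto
  have "truncated_kernel \<alpha> \<kappa> a - riesz_kernel \<alpha> a = (\<kappa> powr (- (\<alpha> + 2)) - norm a powr (- (\<alpha> + 2))) *\<^sub>R a"
    using a by (simp add: truncated_kernel_def riesz_kernel_def max_def scaleR_diff_left)
  then have "norm (truncated_kernel \<alpha> \<kappa> a - riesz_kernel \<alpha> a) = (norm a powr (- (\<alpha> + 2)) - \<kappa> powr (- (\<alpha> + 2))) * norm a"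
    using p by (simp only: norm_scaleR) simp
  also have "\<dots> \<le> norm a powr (- (\<alpha> + 2)) * \<kappa>" using a p by (intro mult_mono) auto
  finally show ?thesis by (simp only: mult.commute)
qed

text \<open>The truncated fields are jointly continuous, by continuity of F in L1 with respect to
  time and of the bounded kernel in space. They converge uniformly, with error at most \<kappa> K,
  because the bound \<open>K\<close> is uniform in time and position.\<close>

lemma force_continuous:
  fixes F :: "real \<Rightarrow> phase \<Rightarrow> real" and K :: real
  assumes \<alpha>: "0 < \<alpha>" and F0: "\<And>t z. 0 \<le> t \<Longrightarrow> 0 \<le> F t z"
    and Fi: "\<And>t. 0 \<le> t \<Longrightarrow> integrable lborel (F t)"
    and FL: "\<And>t e. 0 \<le> t \<Longrightarrow> 0 < e \<Longrightarrow> \<exists>d>0. \<forall>s\<ge>0. \<bar>s - t\<bar> < d \<longrightarrow> (LINT z|lborel. \<bar>F s z - F t z\<bar>) \<le> e"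
    and K: "\<And>t x. 0 \<le> t \<Longrightarrow> (\<integral>\<^sup>+ z. ennreal (F t z * norm (x - fst z) powr (- (\<alpha> + 2))) \<partial>lborel) \<le> ennreal K" "0 \<le> K"
    and ki: "\<And>t x. 0 \<le> t \<Longrightarrow> integrable lborel (\<lambda>z. F t z *\<^sub>R riesz_kernel \<alpha> (x - fst z))"
  shows "continuous_on ({0..} \<times> UNIV) (\<lambda>(t, x). LINT z|lborel. F t z *\<^sub>R riesz_kernel \<alpha> (x - fst z))"
proof -
  let ?T = "truncated_kernel \<alpha> :: real \<Rightarrow> real^3 \<Rightarrow> real^3"
  have [measurable]: "F t \<in> borel_measurable borel" if "0 \<le> t" for t using Fi[OF that] by auto
  have fm[measurable]: "(fst :: phase \<Rightarrow> real^3) \<in> borel_measurable borel" by (intro borel_measurable_continuous_onI continuous_intros)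
  have Tm[measurable]: "(\<lambda>z::phase. ?T \<kappa> (x - fst z)) \<in> borel_measurable borel" if "0 < \<kappa>" for \<kappa> x
    by (intro borel_measurable_continuous_onI continuous_on_compose2[OF truncated_kernel_continuous[OF that, of UNIV]] continuous_intros) auto
  have Ti: "integrable lborel (\<lambda>z. h z *\<^sub>R ?T \<kappa> (x - fst z))" if h: "integrable lborel h" and \<kappa>: "0 < \<kappa>" for h :: "phase \<Rightarrow> real" and \<kappa> x
  proof (rule Bochner_Integration.integrable_bound)
    show "integrable lborel (\<lambda>z. h z * \<kappa> powr (- (\<alpha> + 1)))" using h by simp
    show "(\<lambda>z. h z *\<^sub>R ?T \<kappa> (x - fst z)) \<in> borel_measurable lborel" using h Tm[OF \<kappa>] by (intro borel_measurable_scaleR) auto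
    have "norm (h z *\<^sub>R ?T \<kappa> (x - fst z)) \<le> norm (h z * \<kappa> powr (- (\<alpha> + 1)))" for z
      unfolding norm_scaleR real_norm_def abs_mult abs_of_nonneg[OF powr_ge_zero]
      by (intro mult_left_mono truncated_kernel_bound \<kappa> \<alpha>) simp
    then show "AE z in lborel. norm (h z *\<^sub>R ?T \<kappa> (x - fst z)) \<le> norm (h z * \<kappa> powr (- (\<alpha> + 1)))" by simp
  qed
  have cont: "continuous_on ({0..} \<times> UNIV) (\<lambda>(t, x). LINT z|lborel. F t z *\<^sub>R ?T \<kappa> (x - fst z))" if \<kappa>: "0 < \<kappa>" for \<kappa>
  proof (rule continuous_on_sequentiallyI)
    fix u :: "nat \<Rightarrow> real \<times> (real^3)" and a :: "real \<times> (real^3)"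
    assume u: "\<forall>n. u n \<in> {0..} \<times> UNIV" and a: "a \<in> {0..} \<times> UNIV" and ua: "u \<longlonglongrightarrow> a"
    define \<tau> where "\<tau> n = fst (u n)" for n
    define \<xi> where "\<xi> n = snd (u n)" for n
    define t where "t = fst a"
    define x where "x = snd a"
    have \<tau>0: "0 \<le> \<tau> n" for n using u by (metis SigmaE atLeast_iff fst_conv \<tau>_def)
    have t0: "0 \<le> t" using a by (auto simp: t_def)
    have \<tau>: "\<tau> \<longlonglongrightarrow> t" unfolding \<tau>_def[abs_def] t_def by (rule tendsto_fst[OF ua])
    have \<xi>: "\<xi> \<longlonglongrightarrow> x" unfolding \<xi>_def[abs_def] x_def by (rule tendsto_snd[OF ua])
    let ?C = "\<kappa> powr (- (\<alpha> + 1))"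
    have Jlim: "(\<lambda>n. LINT z|lborel. F t z *\<^sub>R ?T \<kappa> (\<xi> n - fst z)) \<longlonglongrightarrow> (LINT z|lborel. F t z *\<^sub>R ?T \<kappa> (x - fst z))"
    proof (rule integral_dominated_convergence[where w = "\<lambda>z. F t z * ?C"])
      show "integrable lborel (\<lambda>z. F t z * ?C)" using Fi[OF t0] by simp
      have *: "(\<lambda>n. ?T \<kappa> (\<xi> n - fst z)) \<longlonglongrightarrow> ?T \<kappa> (x - fst z)" for z :: phase
        by (rule continuous_on_tendsto_compose[OF truncated_kernel_continuous[OF \<kappa>, of UNIV]]) (auto intro!: tendsto_intros \<xi>)
      show "AE z in lborel. (\<lambda>n. F t z *\<^sub>R ?T \<kappa> (\<xi> n - fst z)) \<longlonglongrightarrow> F t z *\<^sub>R ?T \<kappa> (x - fst z)"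
        by (intro AE_I2 tendsto_scaleR tendsto_const *)
      have "norm (F t z *\<^sub>R ?T \<kappa> (\<xi> n - fst z)) \<le> F t z * ?C" for n z
        unfolding norm_scaleR abs_of_nonneg[OF F0[OF t0]] by (intro mult_left_mono truncated_kernel_bound \<kappa> \<alpha> F0 t0)
      then show "AE z in lborel. norm (F t z *\<^sub>R ?T \<kappa> (\<xi> n - fst z)) \<le> F t z * ?C" for n by simp
    qed (use Tm[OF \<kappa>] t0 in \<open>auto intro!: borel_measurable_scaleR\<close>)
    have Llim: "(\<lambda>n. LINT z|lborel. \<bar>F (\<tau> n) z - F t z\<bar>) \<longlonglongrightarrow> 0"
    proof (rule tendstoI)
      fix e :: real assume e: "0 < e"
      obtain d where d: "d > 0" "\<And>s. 0 \<le> s \<Longrightarrow> \<bar>s - t\<bar> < d \<Longrightarrow> (LINT z|lborel. \<bar>F s z - F t z\<bar>) \<le> e / 2"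
        using FL[OF t0, of "e / 2"] e by auto
      from tendstoD[OF \<tau> d(1)] show "\<forall>\<^sub>F n in sequentially. dist (LINT z|lborel. \<bar>F (\<tau> n) z - F t z\<bar>) 0 < e"
      proof eventually_elim
        case (elim n)
        then have "(LINT z|lborel. \<bar>F (\<tau> n) z - F t z\<bar>) \<le> e / 2" using d(2)[OF \<tau>0] by (simp add: dist_real_def)
        moreover have "0 \<le> (LINT z|lborel. \<bar>F (\<tau> n) z - F t z\<bar>)" by (rule integral_nonneg_AE) simp
        ultimately show ?case using e by (simp add: dist_real_def)
      qed
    qed
    have diff: "norm ((LINT z|lborel. F (\<tau> n) z *\<^sub>R ?T \<kappa> (\<xi> n - fst z)) - (LINT z|lborel. F t z *\<^sub>R ?T \<kappa> (\<xi> n - fst z)))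
        \<le> (LINT z|lborel. \<bar>F (\<tau> n) z - F t z\<bar>) * ?C" for n
    proof -
      have "(LINT z|lborel. F (\<tau> n) z *\<^sub>R ?T \<kappa> (\<xi> n - fst z)) - (LINT z|lborel. F t z *\<^sub>R ?T \<kappa> (\<xi> n - fst z))
          = (LINT z|lborel. (F (\<tau> n) z - F t z) *\<^sub>R ?T \<kappa> (\<xi> n - fst z))"
        unfolding scaleR_diff_left by (rule Bochner_Integration.integral_diff[symmetric]; intro Ti Fi \<tau>0 t0 \<kappa>)
      moreover have "norm (LINT z|lborel. (F (\<tau> n) z - F t z) *\<^sub>R ?T \<kappa> (\<xi> n - fst z)) \<le> (LINT z|lborel. \<bar>F (\<tau> n) z - F t z\<bar> * ?C)"
      proof (rule Bochner_Integration.integral_norm_bound_integral)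
        show "integrable lborel (\<lambda>z. (F (\<tau> n) z - F t z) *\<^sub>R ?T \<kappa> (\<xi> n - fst z))"
          by (intro Ti Bochner_Integration.integrable_diff Fi \<tau>0 t0 \<kappa>)
        show "integrable lborel (\<lambda>z. \<bar>F (\<tau> n) z - F t z\<bar> * ?C)"
          by (intro integrable_mult_left integrable_abs Bochner_Integration.integrable_diff Fi \<tau>0 t0)
        show "norm ((F (\<tau> n) z - F t z) *\<^sub>R ?T \<kappa> (\<xi> n - fst z)) \<le> \<bar>F (\<tau> n) z - F t z\<bar> * ?C" for z
          unfolding norm_scaleR by (intro mult_left_mono truncated_kernel_bound \<kappa> \<alpha>) simp
      qed
      ultimately show ?thesis by simp
    qed
    have "(\<lambda>n. (LINT z|lborel. F (\<tau> n) z *\<^sub>R ?T \<kappa> (\<xi> n - fst z)) - (LINT z|lborel. F t z *\<^sub>R ?T \<kappa> (\<xi> n - fst z))) \<longlonglongrightarrow> 0"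
      by (rule Lim_null_comparison[OF always_eventually[OF allI[OF diff]]]) (rule tendsto_mult_left_zero[OF Llim])
    from tendsto_add[OF this Jlim]
    have "(\<lambda>n. LINT z|lborel. F (\<tau> n) z *\<^sub>R ?T \<kappa> (\<xi> n - fst z)) \<longlonglongrightarrow> (LINT z|lborel. F t z *\<^sub>R ?T \<kappa> (x - fst z))" by simp
    then show "(\<lambda>n. case u n of (t, x) \<Rightarrow> LINT z|lborel. F t z *\<^sub>R ?T \<kappa> (x - fst z)) \<longlonglongrightarrow> (case a of (t, x) \<Rightarrow> LINT z|lborel. F t z *\<^sub>R ?T \<kappa> (x - fst z))"
      by (simp add: case_prod_beta \<tau>_def \<xi>_def t_def x_def)
  qed
  let ?\<kappa> = "\<lambda>n. inverse (real (Suc n))"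
  show ?thesis
  proof (rule uniform_limit_theorem[where F = sequentially])
    show "\<forall>\<^sub>F n in sequentially. continuous_on ({0..} \<times> UNIV) (\<lambda>(t, x). LINT z|lborel. F t z *\<^sub>R ?T (?\<kappa> n) (x - fst z))"
      by (intro always_eventually allI cont) simp
    show "uniform_limit ({0..} \<times> UNIV) (\<lambda>n (t, x). LINT z|lborel. F t z *\<^sub>R ?T (?\<kappa> n) (x - fst z))
        (\<lambda>(t, x). LINT z|lborel. F t z *\<^sub>R riesz_kernel \<alpha> (x - fst z)) sequentially"
    proof (rule uniform_limitI)
      fix e :: real assume e: "0 < e"
      have "(\<lambda>n. K * ?\<kappa> n) \<longlonglongrightarrow> 0" by (rule tendsto_mult_right_zero[OF LIMSEQ_inverse_real_of_nat])
      then have "\<forall>\<^sub>F n in sequentially. K * ?\<kappa> n < e" using e by (rule order_tendstoD)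
      then show "\<forall>\<^sub>F n in sequentially. \<forall>p\<in>{0..} \<times> UNIV. dist (case p of (t, x) \<Rightarrow> LINT z|lborel. F t z *\<^sub>R ?T (?\<kappa> n) (x - fst z))
          (case p of (t, x) \<Rightarrow> LINT z|lborel. F t z *\<^sub>R riesz_kernel \<alpha> (x - fst z)) < e"
      proof eventually_elim
        case (elim n)
        show ?case
        proof
          fix p :: "real \<times> (real^3)" assume p: "p \<in> {0..} \<times> UNIV"
          define t where "t = fst p"
          define x where "x = snd p"
          have t: "0 \<le> t" using p by (auto simp: t_def)
          have \<kappa>: "0 < ?\<kappa> n" by simp
          have "norm (LINT z|lborel. F t z *\<^sub>R (?T (?\<kappa> n) (x - fst z) - riesz_kernel \<alpha> (x - fst z))) \<le> ?\<kappa> n * K"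
          proof (rule norm_integral_le_nn_integral)
            have "(\<integral>\<^sup>+ z. ennreal (norm (F t z *\<^sub>R (?T (?\<kappa> n) (x - fst z) - riesz_kernel \<alpha> (x - fst z)))) \<partial>lborel)
                \<le> (\<integral>\<^sup>+ z. ennreal (?\<kappa> n) * ennreal (F t z * norm (x - fst z) powr (- (\<alpha> + 2))) \<partial>lborel)"
            proof (intro nn_integral_mono)
              fix z :: phase
              have "norm (F t z *\<^sub>R (?T (?\<kappa> n) (x - fst z) - riesz_kernel \<alpha> (x - fst z))) \<le> F t z * (?\<kappa> n * norm (x - fst z) powr (- (\<alpha> + 2)))"
                unfolding norm_scaleR abs_of_nonneg[OF F0[OF t]] by (intro mult_left_mono truncated_kernel_error \<kappa> \<alpha> F0 t)
              also have "\<dots> = ?\<kappa> n * (F t z * norm (x - fst z) powr (- (\<alpha> + 2)))" by (rule mult.left_commute)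
              finally show "ennreal (norm (F t z *\<^sub>R (?T (?\<kappa> n) (x - fst z) - riesz_kernel \<alpha> (x - fst z))))
                  \<le> ennreal (?\<kappa> n) * ennreal (F t z * norm (x - fst z) powr (- (\<alpha> + 2)))"
                using F0[OF t, of z] by (subst ennreal_mult[symmetric]) (auto intro: ennreal_leI)
            qed
            also have "\<dots> = ennreal (?\<kappa> n) * (\<integral>\<^sup>+ z. ennreal (F t z * norm (x - fst z) powr (- (\<alpha> + 2))) \<partial>lborel)"
              using t by (intro nn_integral_cmult) measurable
            also have "\<dots> \<le> ennreal (?\<kappa> n) * ennreal K" by (intro mult_left_mono K t) simp
            also have "\<dots> = ennreal (?\<kappa> n * K)" using K(2) by (intro ennreal_mult[symmetric]) auto
            finally show "(\<integral>\<^sup>+ z. ennreal (norm (F t z *\<^sub>R (?T (?\<kappa> n) (x - fst z) - riesz_kernel \<alpha> (x - fst z)))) \<partial>lborel) \<le> ennreal (?\<kappa> n * K)" .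
          qed (use K(2) in simp)
          moreover have "(LINT z|lborel. F t z *\<^sub>R (?T (?\<kappa> n) (x - fst z) - riesz_kernel \<alpha> (x - fst z)))
              = (LINT z|lborel. F t z *\<^sub>R ?T (?\<kappa> n) (x - fst z)) - (LINT z|lborel. F t z *\<^sub>R riesz_kernel \<alpha> (x - fst z))"
            unfolding scaleR_diff_right by (rule Bochner_Integration.integral_diff[OF Ti[OF Fi[OF t] \<kappa>] ki[OF t]])
          ultimately have "norm ((LINT z|lborel. F t z *\<^sub>R ?T (?\<kappa> n) (x - fst z)) - (LINT z|lborel. F t z *\<^sub>R riesz_kernel \<alpha> (x - fst z))) \<le> ?\<kappa> n * K"
            by (simp only:)
          also have "\<dots> < e" using elim by (simp only: mult.commute)
          finally have "norm ((LINT z|lborel. F t z *\<^sub>R ?T (?\<kappa> n) (x - fst z)) - (LINT z|lborel. F t z *\<^sub>R riesz_kernel \<alpha> (x - fst z))) < e" .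
          then show "dist (case p of (t, x) \<Rightarrow> LINT z|lborel. F t z *\<^sub>R ?T (?\<kappa> n) (x - fst z))
              (case p of (t, x) \<Rightarrow> LINT z|lborel. F t z *\<^sub>R riesz_kernel \<alpha> (x - fst z)) < e"
            by (simp only: case_prod_beta dist_norm t_def x_def)
        qed
      qed
    qed
  qed simp
qed

lemma continuous_gradient_bound_lipschitz:
  fixes E :: "'a::euclidean_space \<Rightarrow> 'b::euclidean_space" and M :: real
  assumes E: "continuous_on UNIV E" and M0: "0 \<le> M"
    and g: "\<And>b. b \<in> Basis \<Longrightarrow> has_weak_derivative {#b#} E (g b)"
    and M: "\<And>b. b \<in> Basis \<Longrightarrow> AE x in lebesgue. norm (g b x) \<le> M"
  shows "norm (E x - E y) \<le> DIM('a) * M * norm (x - y)"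
proof -
  obtain w where w: "AE x in lebesgue. E x = w x" "\<And>x y. norm (w x - w y) \<le> DIM('a) * M * norm (x - y)"
    by (rule weak_derivative_lipschitz[OF continuous_locally_integrable[OF E] M0 g M]) auto
  have "E = w" by (rule AE_continuous_eq[OF w(1) E lipschitz_continuous[OF w(2)]])
  with w(2) show ?thesis by simp
qed

lemma ennreal_le_divide:
  fixes y :: ennreal
  assumes "ennreal a * y \<le> ennreal b" "0 < a" "0 \<le> b"
  shows "y \<le> ennreal (b / a)"
proof (cases y)
  case (real r)
  then have "a * r \<le> b" using assms by (simp add: ennreal_mult[symmetric] ennreal_le_iff)
  then show ?thesis using real assms by (simp add: ennreal_leI field_simps)
next
  case top
  then show ?thesis using assms by (simp add: ennreal_mult_top top_unique)
qed

section \<open>The scattering limit\<close>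

lemma weak_formulation_representative:
  fixes f F :: "real \<Rightarrow> phase \<Rightarrow> real" and E :: "real \<Rightarrow> real^3 \<Rightarrow> real^3"
  assumes ae: "\<And>t. 0 \<le> t \<Longrightarrow> AE z in lebesgue. f t z = F t z"
    and Fc: "continuous_on ({0..} \<times> UNIV) (\<lambda>(t, z). F t z)"
    and Ec: "continuous_on ({0..} \<times> UNIV) (\<lambda>(t, x). E t x)"
    and \<phi>: "\<phi> \<in> test_functions ({0<..} \<times> UNIV)"
    and w: "(LINT t|lebesgue. LINT z|lebesgue. f t z * frechet_derivative \<phi> (at (t, z)) (1, snd z, E t (fst z))) = 0"
  shows "(LINT t|lborel. LINT z|lborel. F t z * frechet_derivative \<phi> (at (t, z)) (1, snd z, E t (fst z))) = 0"
proof -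
  have sm: "smooth \<phi>" and supp: "closure {x. \<phi> x \<noteq> 0} \<subseteq> {0<..} \<times> UNIV" using \<phi> by (auto simp: test_functions_def)
  \<comment> \<open>Replacing t by max t 0 makes the integrand continuous on all of space-time. It
    changes nothing, since the derivatives of \<phi> vanish for t \<le> 0.\<close>
  define H where "H t z = F (max t 0) z * frechet_derivative \<phi> (at (t, z)) (1, snd z, E (max t 0) (fst z))" for t z
  have Fc': "continuous_on UNIV (\<lambda>p. F (max (fst p) 0) (snd p))"
  proof -
    have c: "continuous_on UNIV (\<lambda>p::real \<times> phase. (max (fst p) 0, snd p))" by (intro continuous_intros continuous_on_max)
    have sub: "range (\<lambda>p::real \<times> phase. (max (fst p) 0, snd p)) \<subseteq> {0..} \<times> UNIV" by auto
    show ?thesis using continuous_on_compose2[OF Fc c sub] by (simp only: prod.case)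
  qed
  have Ec': "continuous_on UNIV (\<lambda>p::real \<times> phase. E (max (fst p) 0) (fst (snd p)))"
  proof -
    have c: "continuous_on UNIV (\<lambda>p::real \<times> phase. (max (fst p) 0, fst (snd p)))" by (intro continuous_intros continuous_on_max)
    have sub: "range (\<lambda>p::real \<times> phase. (max (fst p) 0, fst (snd p))) \<subseteq> {0..} \<times> UNIV" by auto
    show ?thesis using continuous_on_compose2[OF Ec c sub] by (simp only: prod.case)
  qed
  have Hc: "continuous_on UNIV (\<lambda>p. H (fst p) (snd p))"
    unfolding H_def
    by (intro continuous_on_mult Fc' frechet_derivative_continuous[OF sm] continuous_on_Pair Ec' continuous_on_const continuous_on_snd continuous_on_fst continuous_on_id)
  have z: "frechet_derivative \<phi> (at (t, z)) h = 0" if "t \<le> 0" for t z h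
  proof -
    have "(t, z) \<notin> closure {x. \<phi> x \<noteq> 0}" using supp that by auto
    then have "partials [b] \<phi> (t, z) = 0" for b by (rule partials_support)
    then show ?thesis unfolding smooth_frechet_derivative_eq[OF sm] by (simp del: partials.simps)
  qed
  have H: "F t z * frechet_derivative \<phi> (at (t, z)) (1, snd z, E t (fst z)) = H t z" for t z
    by (cases "0 \<le> t") (simp_all add: H_def z)
  have Hm: "H t \<in> borel_measurable borel" for t
  proof (rule borel_measurable_continuous_onI)
    have "continuous_on UNIV (\<lambda>z. (t, z))" by (intro continuous_intros)
    from continuous_on_compose2[OF Hc this] show "continuous_on UNIV (H t)" by simp
  qed
  have inner: "(LINT z|lebesgue. f t z * frechet_derivative \<phi> (at (t, z)) (1, snd z, E t (fst z))) = (LINT z|lborel. H t z)" for t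
  proof (rule integral_lebesgue_borel_version[OF Hm])
    show "AE y in lborel. f t y * frechet_derivative \<phi> (at (t, y)) (1, snd y, E t (fst y)) = H t y"
    proof (cases "0 \<le> t")
      case True
      from ae[OF this] show ?thesis unfolding AE_lebesgue_iff by eventually_elim (simp only: H)
    qed (simp add: z H[symmetric])
  qed
  have "(\<lambda>p. H (fst p) (snd p)) \<in> borel_measurable (borel \<Otimes>\<^sub>M borel)"
    unfolding borel_prod by (rule borel_measurable_continuous_onI[OF Hc])
  then have "case_prod H \<in> borel_measurable (lborel \<Otimes>\<^sub>M lborel)" by (simp add: case_prod_beta' cong: measurable_cong_sets)
  then have "(\<lambda>t. LINT z|lborel. H t z) \<in> borel_measurable lborel"
    by (rule lborel.borel_measurable_lebesgue_integral)
  from integral_completion[OF this] show ?thesis using w unfolding inner H by simp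
qed

text \<open>The term without derivatives already bounds the L1 norm in x of the essential supremum
  in v; for a continuous function the essential supremum is the supremum, as exceptional sets would
  be open.\<close>

lemma mixed_norm_bound:
  fixes h g :: "'a::euclidean_space \<times> 'b::euclidean_space \<Rightarrow> real"
  assumes h: "mixed_W11_W1inf_norm h < ennreal c" and ae: "AE z in lebesgue. h z = g z"
    and gc: "continuous_on UNIV g" and g0: "\<And>z. 0 \<le> g z"
  shows "(\<integral>\<^sup>+ x. (SUP v. ennreal (g (x, v))) \<partial>lborel) \<le> ennreal c"
proof -
  let ?N = "L1x_Linfv :: ('a \<times> 'b \<Rightarrow> ennreal) \<Rightarrow> ennreal"
  let ?w = "\<lambda>m m'. weak_derivative_norm ?N (image_mset (\<lambda>b. (b, 0)) m + image_mset (\<lambda>b. (0, b)) m') h"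
  have e: "{#} \<in> (multi_indices 1 :: 'a multiset set)" "{#} \<in> (multi_indices 1 :: 'b multiset set)"
    by (simp_all add: multi_indices_def)
  have "weak_derivative_norm ?N {#} h = ?w {#} {#}" by simp
  also have "\<dots> \<le> (\<Sum>m'\<in>multi_indices 1. ?w {#} m')" by (intro member_le_sum e finite_multi_indices) simp
  also have "\<dots> \<le> (\<Sum>m\<in>multi_indices 1. \<Sum>m'\<in>multi_indices 1. ?w m m')"
    by (rule member_le_sum[where f = "\<lambda>m. \<Sum>m'\<in>multi_indices 1. ?w m m'"]) (use e finite_multi_indices in auto)
  also have "\<dots> \<le> mixed_W11_W1inf_norm h" unfolding mixed_W11_W1inf_norm_def mixed_sobolev_norm_def by simp
  also note h
  finally obtain k where k: "has_weak_derivative {#} h k" "L1x_Linfv (\<lambda>z. ennreal (norm (k z))) < ennreal c"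
    by (rule weak_derivative_norm_lessE) blast
  let ?S = "\<lambda>x. Linf lebesgue (\<lambda>v. ennreal (norm (k (x, v))))"
  have "AE z in lebesgue. k z = g z" using weak_derivative_empty_AE[OF k(1)] ae by eventually_elim simp
  then have "AE z in lborel \<Otimes>\<^sub>M lborel. k z = g z" unfolding AE_lebesgue_iff lborel_prod .
  then have "AE x in lborel. AE v in lborel. k (x, v) = g (x, v)" by (rule lborel_pair.AE_pair)
  then have "AE x in lborel. (SUP v. ennreal (g (x, v))) \<le> ?S x"
  proof eventually_elim
    case (elim x)
    have "AE v in lebesgue. ennreal (norm (k (x, v))) \<le> ?S x" unfolding Linf_def by (rule esssup_AE)
    then have "AE v in lebesgue. v \<notin> {v. ?S x < ennreal (g (x, v))}"
      using elim[folded AE_lebesgue_iff] by eventually_elim (use g0 in \<open>simp add: not_less\<close>)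
    moreover have "open {v. ?S x < ennreal (g (x, v))}"
    proof (rule open_Collect_less)
      have "continuous_on UNIV (\<lambda>v. g (x, v))" by (rule continuous_on_compose2[OF gc]) (auto intro!: continuous_intros)
      then show "continuous_on UNIV (\<lambda>v. ennreal (g (x, v)))" by (rule continuous_on_ennreal)
    qed simp
    ultimately have "{v. ?S x < ennreal (g (x, v))} = {}" by (rule AE_open_imp_empty)
    then show ?case by (intro SUP_least) (auto simp: not_less)
  qed
  then have "(\<integral>\<^sup>+ x. (SUP v. ennreal (g (x, v))) \<partial>lborel) \<le> (\<integral>\<^sup>+ x. ?S x \<partial>lborel)" by (rule nn_integral_mono_AE)
  also have "\<dots> = (\<integral>\<^sup>+ x. ?S x \<partial>lebesgue)" by (simp only: nn_integral_completion)
  also have "\<dots> \<le> ennreal c" using L1_less_topD[OF k(2)[unfolded L1x_Linfv_def]] by (rule less_imp_le)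
  finally show ?thesis .
qed

text \<open>The shift of the position depends on the velocity alone, so the map is a shear and
  preserves measure for any measurable A.\<close>

lemma reference_flow_preserving:
  assumes [measurable]: "A \<in> borel_measurable borel"
  shows "reference_flow \<alpha> A t \<in> borel_measurable borel" "distr lborel borel (reference_flow \<alpha> A t) = lborel"
proof -
  let ?a = "\<lambda>v. t *\<^sub>R v - ((t powr (1 - \<alpha>) - 1) / (1 - \<alpha>)) *\<^sub>R A v"
  have R: "reference_flow \<alpha> A t = (\<lambda>(x, v). (x + ?a v, v))" by (auto simp: reference_flow_def fun_eq_iff)
  have a[measurable]: "?a \<in> borel_measurable borel" by measurable
  show "reference_flow \<alpha> A t \<in> borel_measurable borel" unfolding R by (simp flip: borel_prod)
  show "distr lborel borel (reference_flow \<alpha> A t) = lborel" unfolding R by (rule distr_shear_fst[OF a])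
qed

section \<open>The velocity correction and the limit density\<close>

context vlasov_decay
begin

lemma A_inf_measurable: "A_inf \<in> borel_measurable borel"
proof -
  have f0': "(\<lambda>p. f0 (snd p)) \<in> borel_measurable (borel \<Otimes>\<^sub>M borel)" by (rule measurable_compose[OF measurable_snd f0_measurable])
  have V': "(\<lambda>p. Vp (snd p)) \<in> borel_measurable (borel \<Otimes>\<^sub>M borel)" by (rule measurable_compose[OF measurable_snd Vp_measurable])
  have "(\<lambda>p. f0 (snd p) *\<^sub>R riesz_kernel \<alpha> (fst p - Vp (snd p))) \<in> borel_measurable (borel \<Otimes>\<^sub>M borel)"
    by (intro borel_measurable_scaleR f0' measurable_compose[OF _ riesz_kernel_measurable] borel_measurable_diff V' measurable_fst)
  then have "case_prod (\<lambda>u z. f0 z *\<^sub>R riesz_kernel \<alpha> (u - Vp z)) \<in> borel_measurable (borel \<Otimes>\<^sub>M lborel)"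
    by (simp add: case_prod_beta' cong: measurable_cong_sets)
  then have "(\<lambda>u. LINT z|lborel. f0 z *\<^sub>R riesz_kernel \<alpha> (u - Vp z)) \<in> borel_measurable borel"
    by (rule lborel.borel_measurable_lebesgue_integral)
  then show ?thesis unfolding A_inf_def[abs_def] by (intro borel_measurable_scaleR borel_measurable_const)
qed

text \<open>For fixed x the momentum limit is injective in v by expansion, so each fibre contains at
  most one exceptional velocity. This excludes the origin of the potential in the velocity
  correction.\<close>

lemma Vp_avoids: "AE z in lborel. Vp z \<noteq> u"
proof -
  have "AE z in lborel \<Otimes>\<^sub>M lborel. Vp z \<noteq> u"
  proof (rule lborel_pair.AE_pair_measure)
    have "{z. Vp z \<noteq> u} \<in> sets borel" using Vp_measurable by simp
    then show "{z \<in> space (lborel \<Otimes>\<^sub>M lborel). Vp z \<noteq> u} \<in> sets (lborel \<Otimes>\<^sub>M lborel)"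
      unfolding lborel_prod by simp
    have "AE v in lborel. Vp (x, v) \<noteq> u" for x
    proof (cases "\<exists>c. Vp (x, c) = u")
      case True
      then obtain c where c: "Vp (x, c) = u" by blast
      show ?thesis using AE_lborel_singleton[of c]
      proof eventually_elim
        case (elim v)
        then show ?case using Vp_expanding[of v c x] c by auto
      qed
    qed auto
    then show "AE x in lborel. AE v in lborel. Vp (x, v) \<noteq> u" by simp
  qed
  then show ?thesis by (simp only: lborel_prod)
qed

lemma velocity_correction_eq:
  assumes ae: "AE z in lebesgue. f z = f0 z"
  shows "velocity_correction lam \<alpha> f \<Phi> u = A_inf u"
proof -
  have "AE z in lborel. f z *\<^sub>R grad (riesz_potential lam \<alpha>) (u - Vp z) = (- (lam * \<alpha>)) *\<^sub>R (f0 z *\<^sub>R riesz_kernel \<alpha> (u - Vp z))"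
    using ae[unfolded AE_lebesgue_iff] Vp_avoids[of u]
  proof eventually_elim
    case (elim z)
    then have "grad (riesz_potential lam \<alpha>) (u - Vp z) = (- (lam * \<alpha>)) *\<^sub>R riesz_kernel \<alpha> (u - Vp z)"
      by (intro grad_riesz_potential) auto
    then show ?case unfolding elim(1) by (simp only: scaleR_left_commute)
  qed
  moreover have "(\<lambda>z. (- (lam * \<alpha>)) *\<^sub>R (f0 z *\<^sub>R riesz_kernel \<alpha> (u - Vp z))) \<in> borel_measurable borel"
    by (intro borel_measurable_scaleR borel_measurable_const f0_measurable measurable_compose[OF _ riesz_kernel_measurable] borel_measurable_diff Vp_measurable)
  ultimately have "(LINT z|lebesgue. f z *\<^sub>R grad (riesz_potential lam \<alpha>) (u - Vp z))
      = (LINT z|lborel. (- (lam * \<alpha>)) *\<^sub>R (f0 z *\<^sub>R riesz_kernel \<alpha> (u - Vp z)))"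
    by (intro integral_lebesgue_borel_version)
  then show ?thesis unfolding velocity_correction_def A_inf_def
    by (simp only: integral_scaleR_right scaleR_minus_left integral_minus minus_minus)
qed

lemma scattering_const_nonneg: "0 \<le> scattering_const \<alpha>"
  using alpha kernel_const_pos[of "\<alpha> + 2"] kernel_const_pos[of "\<alpha> + 1"] by (simp add: scattering_const_def)

lemma flow_inv_measurable:
  assumes t: "0 \<le> t" shows "inv (\<Phi> t) \<in> borel_measurable borel"
proof (rule borel_measurable_continuous_onI[OF lipschitz_continuous])
  show "norm (inv (\<Phi> t) w - inv (\<Phi> t) w') \<le> exp ((1 + l) * t) * norm (w - w')" for w w'
    using flow_expanding[OF t, of "inv (\<Phi> t) w" "inv (\<Phi> t) w'"] by (simp add: surj_f_inv_f[OF flow_surj[OF t]])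
qed

text \<open>Along the reference flow the density is Cauchy in time for each label, by
  \<open>scattering_rate\<close>. The limit is taken along integers from 1 on, where that estimate
  is valid, and letting the later time tend to infinity in it gives the rate at every earlier
  time.\<close>

lemma scattering_limit:
  obtains f_plus where "f_plus \<in> borel_measurable borel" "\<And>\<zeta>. 0 \<le> f_plus \<zeta>" "\<And>\<zeta>. f_plus \<zeta> \<le> \<eta>"
    "(\<integral>\<^sup>+ \<zeta>. ennreal (f_plus \<zeta>) \<partial>lborel) \<le> ennreal \<eta>"
    "\<And>t z \<zeta>. 1 \<le> t \<Longrightarrow> \<Phi> t z = reference_flow \<alpha> A_inf t \<zeta> \<Longrightarrow>
      \<bar>f0 z - f_plus \<zeta>\<bar> \<le> scattering_const \<alpha> * \<eta>\<^sup>2 * t powr (1 - 2 * \<alpha>)"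
proof -
  define R where "R = reference_flow \<alpha> A_inf"
  define G where "G t \<zeta> = f0 (inv (\<Phi> t) (R t \<zeta>))" for t \<zeta>
  let ?K = "scattering_const \<alpha> * \<eta>\<^sup>2"
  have K0: "0 \<le> ?K" using scattering_const_nonneg by simp
  have inv: "\<Phi> t (inv (\<Phi> t) w) = w" if "0 \<le> t" for t w by (rule surj_f_inv_f[OF flow_surj[OF that]])
  note R = reference_flow_preserving[OF A_inf_measurable, of \<alpha>, folded R_def]
  have G: "\<bar>G s \<zeta> - G t \<zeta>\<bar> \<le> ?K * s powr (1 - 2 * \<alpha>)" if "1 \<le> s" "s \<le> t" for s t \<zeta>
    unfolding G_def R_def using that by (intro scattering_rate[of s t _ "fst \<zeta>" "snd \<zeta>"]) (simp_all add: inv)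
  have Gm: "G t \<in> borel_measurable borel" if "0 \<le> t" for t
    unfolding G_def by (rule measurable_compose[OF measurable_compose[OF R(1) flow_inv_measurable[OF that]] f0_measurable])
  have Gb: "0 \<le> G t \<zeta>" "G t \<zeta> \<le> \<eta>" for t \<zeta> unfolding G_def using f0_bounds g_le order_trans by blast+
  \<comment> \<open>Reference flow and true flow both preserve Lebesgue measure, so the mass is that
    of f0 at all times; Fatou then gives it to the limit.\<close>
  have G1: "(\<integral>\<^sup>+ \<zeta>. ennreal (G t \<zeta>) \<partial>lborel) \<le> ennreal \<eta>" if t: "0 \<le> t" for t
  proof -
    have m: "(\<lambda>w. ennreal (f0 (inv (\<Phi> t) w))) \<in> borel_measurable borel"
      using measurable_compose[OF flow_inv_measurable[OF t] f0_measurable] by simp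
    have "(\<integral>\<^sup>+ \<zeta>. ennreal (G t \<zeta>) \<partial>lborel) = (\<integral>\<^sup>+ w. ennreal (f0 (inv (\<Phi> t) w)) \<partial>distr lborel borel (R t))"
      unfolding G_def using m R(1) by (subst nn_integral_distr) auto
    also have "\<dots> = (\<integral>\<^sup>+ w. ennreal (f0 (inv (\<Phi> t) w)) \<partial>distr lborel borel (\<Phi> t))"
      by (simp only: R(2) flow_measure_preserving[OF t])
    also have "\<dots> = (\<integral>\<^sup>+ z. ennreal (f0 z) \<partial>lborel)"
      using m flow_measurable[OF t] by (subst nn_integral_distr) (auto simp: inv_f_f[OF flow_inj[OF t]])
    also have "\<dots> \<le> (\<integral>\<^sup>+ z. ennreal (g z) \<partial>lborel)" by (intro nn_integral_mono ennreal_leI f0_bounds)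
    also note g_L1
    finally show ?thesis .
  qed
  have tail: "((\<lambda>s. ?K * s powr (1 - 2 * \<alpha>)) \<longlongrightarrow> 0) at_top"
    by (intro tendsto_mult_right_zero tendsto_neg_powr filterlim_ident) (use alpha in simp)
  have conv: "convergent (\<lambda>n. G (real (Suc n)) \<zeta>)" for \<zeta>
  proof (rule Cauchy_convergent, rule metric_CauchyI)
    fix e :: real assume e: "0 < e"
    have "\<forall>\<^sub>F s in at_top. ?K * s powr (1 - 2 * \<alpha>) < e / 2" using order_tendstoD(2)[OF tail, of "e / 2"] e by simp
    then obtain s0 where s0: "\<And>s. s0 \<le> s \<Longrightarrow> ?K * s powr (1 - 2 * \<alpha>) < e / 2" unfolding eventually_at_top_linorder by blast
    obtain N :: nat where N: "s0 \<le> real N" using real_arch_simple by blast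
    have "\<bar>G (real (Suc N)) \<zeta> - G (real (Suc n)) \<zeta>\<bar> < e / 2" if "N \<le> n" for n
      using G[of "real (Suc N)" "real (Suc n)" \<zeta>] s0[of "real (Suc N)"] N that by simp
    then show "\<exists>M. \<forall>m\<ge>M. \<forall>n\<ge>M. dist (G (real (Suc m)) \<zeta>) (G (real (Suc n)) \<zeta>) < e"
      unfolding dist_real_def by (intro exI[of _ N] allI impI) (smt (verit) field_sum_of_halves)
  qed
  define f_plus where "f_plus \<zeta> = lim (\<lambda>n. G (real (Suc n)) \<zeta>)" for \<zeta>
  have lim: "(\<lambda>n. G (real (Suc n)) \<zeta>) \<longlonglongrightarrow> f_plus \<zeta>" for \<zeta>
    using conv unfolding f_plus_def by (simp add: convergent_LIMSEQ_iff)
  show ?thesis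
  proof (rule that[of f_plus])
    show "f_plus \<in> borel_measurable borel"
      by (rule borel_measurable_LIMSEQ_real[OF lim]) (intro Gm, simp)
    show "0 \<le> f_plus \<zeta>" for \<zeta> by (rule LIMSEQ_le_const[OF lim]) (simp add: Gb)
    show "f_plus \<zeta> \<le> \<eta>" for \<zeta> by (rule LIMSEQ_le_const2[OF lim]) (simp add: Gb)
    have "(\<integral>\<^sup>+ \<zeta>. ennreal (f_plus \<zeta>) \<partial>lborel) = (\<integral>\<^sup>+ \<zeta>. liminf (\<lambda>n. ennreal (G (real (Suc n)) \<zeta>)) \<partial>lborel)"
      by (intro nn_integral_cong lim_imp_Liminf[symmetric] tendsto_ennrealI lim) simp
    also have "\<dots> \<le> liminf (\<lambda>n. \<integral>\<^sup>+ \<zeta>. ennreal (G (real (Suc n)) \<zeta>) \<partial>lborel)"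
      by (rule nn_integral_liminf) (use Gm in simp)
    also have "\<dots> \<le> liminf (\<lambda>n. ennreal \<eta>)" by (intro Liminf_mono always_eventually allI G1) simp
    also have "\<dots> = ennreal \<eta>" by (simp add: Liminf_const)
    finally show "(\<integral>\<^sup>+ \<zeta>. ennreal (f_plus \<zeta>) \<partial>lborel) \<le> ennreal \<eta>" .
    show "\<bar>f0 z - f_plus \<zeta>\<bar> \<le> scattering_const \<alpha> * \<eta>\<^sup>2 * t powr (1 - 2 * \<alpha>)"
      if t: "1 \<le> t" and z: "\<Phi> t z = reference_flow \<alpha> A_inf t \<zeta>" for t z \<zeta>
    proof -
      have t0: "0 \<le> t" using t by simp
      have Gz: "G t \<zeta> = f0 z" unfolding G_def R_def z[symmetric] inv_f_f[OF flow_inj[OF t0]] ..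
      have "(\<lambda>n. \<bar>f0 z - G (real (Suc n)) \<zeta>\<bar>) \<longlonglongrightarrow> \<bar>f0 z - f_plus \<zeta>\<bar>" by (intro tendsto_intros lim)
      moreover have "\<exists>N. \<forall>n\<ge>N. \<bar>f0 z - G (real (Suc n)) \<zeta>\<bar> \<le> ?K * t powr (1 - 2 * \<alpha>)"
      proof -
        obtain N :: nat where "t \<le> real N" using real_arch_simple by blast
        then have "\<bar>f0 z - G (real (Suc n)) \<zeta>\<bar> \<le> ?K * t powr (1 - 2 * \<alpha>)" if "N \<le> n" for n
          unfolding Gz[symmetric] using that by (intro G t) simp
        then show ?thesis by blast
      qed
      ultimately show ?thesis by (rule LIMSEQ_le_const2)
    qed
  qed
qed

end

section \<open>Small solutions scatter\<close>

text \<open>1 + t is at most twice the bracket of t, and 2^p \<le> 8 for p \<le> 3.\<close>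

lemma japanese_bracket_decay:
  fixes t p b :: real
  assumes "0 \<le> t" "0 \<le> p" "p \<le> 3" "0 \<le> b"
  shows "b / japanese_bracket t powr p \<le> 8 * b * (1 + t) powr (- p)" "b / japanese_bracket t powr p \<le> b"
proof -
  have J: "1 \<le> japanese_bracket t" "t \<le> japanese_bracket t"
    using japanese_bracket_ge[of t] assms by auto
  have J1: "1 \<le> japanese_bracket t powr p" using J assms by (intro ge_one_powr_ge_zero)
  have "(1 + t) powr p \<le> (2 * japanese_bracket t) powr p" using J assms by (intro powr_mono2) auto
  also have "\<dots> = 2 powr p * japanese_bracket t powr p" using J by (simp add: powr_mult)
  also have "\<dots> \<le> 8 * japanese_bracket t powr p"
  proof (rule mult_right_mono)
    have "(2::real) powr p \<le> 2 powr (real 3)" using assms by (intro powr_mono) auto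
    then show "(2::real) powr p \<le> 8" by (simp only: powr_realpow) simp
  qed simp
  finally have "(1 + t) powr p \<le> 8 * japanese_bracket t powr p" .
  then have "b * (1 + t) powr p \<le> b * (8 * japanese_bracket t powr p)" using assms by (intro mult_left_mono) auto
  moreover have "0 < (1 + t) powr p" "0 < japanese_bracket t powr p" using J assms by auto
  ultimately show "b / japanese_bracket t powr p \<le> 8 * b * (1 + t) powr (- p)"
    by (simp add: powr_minus_divide field_simps)
  have "b / japanese_bracket t powr p \<le> b / 1" using J1 assms by (intro divide_left_mono) auto
  then show "b / japanese_bracket t powr p \<le> b" by simp
qed

text \<open>Translates the almost-everywhere and weak hypotheses into the pointwise ones of
  \<open>vlasov_decay\<close>. The order is forced: density bound, continuity of the force, flow,
  transport, and only then the force in initial coordinates.\<close>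

lemma vlasov_riesz_decay:
  fixes \<alpha> \<eta> C lam :: real and f\<^sub>0 :: "phase \<Rightarrow> real"
  assumes \<alpha>: "1 / 2 < \<alpha>" "\<alpha> < 1" and \<eta>: "0 < \<eta>" and C: "0 < C"
    and small: "48 * C * \<eta> * (5 + 2 / (1 - \<alpha>)) \<le> 1 / 2" and lam: "lam \<in> {1, - 1}" and f0: "\<And>z. 0 \<le> f\<^sub>0 z"
    and init: "W11_W1inf_norm (\<lambda>(x, v). japanese_bracket x * f\<^sub>0 (x, v))
      + mixed_W11_W1inf_norm (\<lambda>(x, v). japanese_bracket x * f\<^sub>0 (x, v)) \<le> ennreal \<eta>"
    and sol: "vlasov_riesz_solution lam \<alpha> f\<^sub>0 f"
    and decay: "(SUP t\<in>{0::real..}.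
        ennreal (japanese_bracket t powr (1 + \<alpha>))
          * Linf lebesgue (\<lambda>x. ennreal (norm (force_field lam \<alpha> f t x)))
      + ennreal (japanese_bracket t powr (2 + \<alpha>)) * nabla_Linf_norm 1 (force_field lam \<alpha> f t)
      + ennreal (japanese_bracket t ^ 3) * nabla_Linf_norm 2 (force_field lam \<alpha> f t))
      \<le> ennreal (C * \<eta>)"
    and flow: "characteristic_flow (force_field lam \<alpha> f) \<Phi>"
  obtains F g where "vlasov_decay (force_field lam \<alpha> f) \<Phi> (48 * C * \<eta>) (48 * C * \<eta>) \<alpha> (48 * C * \<eta>) (12 * \<eta>) lam g"
    "\<And>t. 0 \<le> t \<Longrightarrow> AE z in lebesgue. f t z = F t z"
    "\<And>t z. 0 \<le> t \<Longrightarrow> F t (\<Phi> t z) = g z / japanese_bracket (fst z)"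
    "AE z in lebesgue. f\<^sub>0 z = g z / japanese_bracket (fst z)"
proof -
  define E where "E = force_field lam \<alpha> f"
  define c where "c = lam * \<alpha>"
  have c: "c \<noteq> 0" "\<bar>c\<bar> = \<alpha>" using lam \<alpha> by (auto simp: c_def)
  have \<alpha>0: "0 < \<alpha>" using \<alpha> by simp
  have C\<eta>: "0 < C * \<eta>" using C \<eta> by simp
  \<comment> \<open>Doubled to make the bounds strict. The 48 below is this 2, the 8 from comparing
    the bracket with 1 + t, and the dimension 3 in the Lipschitz bound for E.\<close>
  define D where "D t p = 2 * C * \<eta> / japanese_bracket t powr p" for t p :: real
  have J: "1 \<le> japanese_bracket t" for t :: real by (rule japanese_bracket_ge)
  have D0: "0 \<le> D t p" for t p using C\<eta> J[of t] by (simp add: D_def)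
  have Dle: "D t p \<le> 2 * C * \<eta>" "3 * D t p \<le> 48 * C * \<eta> * (1 + t) powr (- p)" if "0 \<le> t" "0 \<le> p" "p \<le> 3" for t p
    using japanese_bracket_decay[OF that, of "2 * C * \<eta>"] C\<eta> unfolding D_def by simp_all

  have term_le: "ennreal (japanese_bracket t powr (1 + \<alpha>)) * Linf lebesgue (\<lambda>x. ennreal (norm (E t x))) \<le> ennreal (C * \<eta>)"
    "ennreal (japanese_bracket t powr (2 + \<alpha>)) * nabla_Linf_norm 1 (E t) \<le> ennreal (C * \<eta>)" if "0 \<le> t" for t
  proof -
    have "ennreal (japanese_bracket t powr (1 + \<alpha>)) * Linf lebesgue (\<lambda>x. ennreal (norm (E t x)))
      + ennreal (japanese_bracket t powr (2 + \<alpha>)) * nabla_Linf_norm 1 (E t)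
      + ennreal (japanese_bracket t ^ 3) * nabla_Linf_norm 2 (E t) \<le> ennreal (C * \<eta>)"
      by (rule order_trans[OF _ decay[folded E_def]]) (rule SUP_upper, use that in simp)
    moreover have "a \<le> a + b + d" "b \<le> a + b + d" for a b d :: ennreal
      by (simp_all add: add.assoc add.left_commute[of a b])
    ultimately show "ennreal (japanese_bracket t powr (1 + \<alpha>)) * Linf lebesgue (\<lambda>x. ennreal (norm (E t x))) \<le> ennreal (C * \<eta>)"
      "ennreal (japanese_bracket t powr (2 + \<alpha>)) * nabla_Linf_norm 1 (E t) \<le> ennreal (C * \<eta>)"
      by (meson order_trans)+
  qed
  have lt: "y < ennreal (D t p)" if "ennreal (japanese_bracket t powr p) * y \<le> ennreal (C * \<eta>)" for y t p
  proof -
    have p: "0 < japanese_bracket t powr p" using J[of t] by auto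
    have "y \<le> ennreal (C * \<eta> / japanese_bracket t powr p)" using ennreal_le_divide[OF that p] C\<eta> by simp
    also have "\<dots> < ennreal (D t p)" using p C\<eta> unfolding D_def by (intro ennreal_lessI) (auto intro!: divide_strict_right_mono)
    finally show ?thesis .
  qed
  have Linf_E: "AE x in lebesgue. norm (E t x) \<le> D t (1 + \<alpha>)" if t: "0 \<le> t" for t
    by (rule Linf_lessD[OF lt[OF term_le(1)[OF t]] D0])
  have weak_E: "\<exists>g. (\<forall>b\<in>Basis. has_weak_derivative {#b#} (E t) (g b)) \<and> (\<forall>b\<in>Basis. AE x in lebesgue. norm (g b x) \<le> D t (2 + \<alpha>))" if t: "0 \<le> t" for t
    by (rule nabla_Linf_norm_1E[OF lt[OF term_le(2)[OF t]] D0]) blast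

  have nonneg: "0 \<le> f t z" and fin: "W11_W1inf_norm (f t) < \<infinity>"
    and cont: "((\<lambda>s. W11_W1inf_norm (\<lambda>z. f s z - f t z)) \<longlongrightarrow> 0) (at t within {0..})" if "0 \<le> t" for t z
    using sol that unfolding vlasov_riesz_solution_def by blast+
  obtain F where F: "\<And>t. 0 \<le> t \<Longrightarrow> AE z in lebesgue. f t z = F t z"
    "continuous_on ({0..} \<times> UNIV) (\<lambda>(t, z). F t z)"
    "\<And>T. 0 \<le> T \<Longrightarrow> \<exists>M\<ge>0. \<forall>t\<in>{0..T}. \<forall>z z'. \<bar>F t z - F t z'\<bar> \<le> M * norm (z - z')"
    "\<And>t z. 0 \<le> t \<Longrightarrow> 0 \<le> F t z"
    "\<And>t. 0 \<le> t \<Longrightarrow> integrable lborel (F t)"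
    "\<And>t e. 0 \<le> t \<Longrightarrow> 0 < e \<Longrightarrow> \<exists>d>0. \<forall>s\<ge>0. \<bar>s - t\<bar> < d \<longrightarrow> (LINT z|lborel. \<bar>F s z - F t z\<bar>) \<le> e"
    by (rule W11_W1inf_continuous_representative[of f, OF nonneg fin cont]) blast+

  define K where "K = 12 * (2 * C * \<eta>) / ((1 - \<alpha>) * \<alpha>)"
  have K0: "0 \<le> K" using C\<eta> \<alpha> by (simp add: K_def)
  have dens: "(\<integral>\<^sup>+ z. ennreal (F t z * norm (x - fst z) powr (- (\<alpha> + 2))) \<partial>lborel) \<le> ennreal K"
    "integrable lborel (\<lambda>z. F t z *\<^sub>R riesz_kernel \<alpha> (x - fst z))"
    "E t x = c *\<^sub>R (LINT z|lborel. F t z *\<^sub>R riesz_kernel \<alpha> (x - fst z))" if t: "0 \<le> t" for t x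
  proof -
    obtain g where g: "\<And>b. b \<in> Basis \<Longrightarrow> has_weak_derivative {#b#} (E t) (g b)"
      "\<And>b. b \<in> Basis \<Longrightarrow> AE x in lebesgue. norm (g b x) \<le> D t (2 + \<alpha>)" using weak_E[OF t] by blast
    have Et: "E t x = c *\<^sub>R (LINT y|lborel. (LINT v|lborel. F t (y, v)) *\<^sub>R riesz_kernel \<alpha> (x - y))" for x
      unfolding E_def c_def by (rule force_field_eq[where f = f and t = t and F = "F t", OF F(1)[OF t]]) (use F(5)[OF t] in auto)
    note b = force_density_bound[OF \<alpha>0 \<alpha>(2) c(1) F(5)[OF t] F(4)[OF t] Et g D0]
    have "12 * D t (2 + \<alpha>) / ((1 - \<alpha>) * \<bar>c\<bar>) \<le> K"
      unfolding K_def c(2) using Dle(1)[OF t, of "2 + \<alpha>"] \<alpha> by (intro divide_right_mono mult_left_mono) auto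
    with b(1)[of x] show "(\<integral>\<^sup>+ z. ennreal (F t z * norm (x - fst z) powr (- (\<alpha> + 2))) \<partial>lborel) \<le> ennreal K"
      by (meson ennreal_leI order_trans)
    show "integrable lborel (\<lambda>z. F t z *\<^sub>R riesz_kernel \<alpha> (x - fst z))"
      "E t x = c *\<^sub>R (LINT z|lborel. F t z *\<^sub>R riesz_kernel \<alpha> (x - fst z))" using b(2,3)[of x] by blast+
  qed
  have Ec: "continuous_on ({0..} \<times> UNIV) (\<lambda>(t, x). E t x)"
  proof -
    have "continuous_on ({0..} \<times> UNIV) (\<lambda>(t, x). LINT z|lborel. F t z *\<^sub>R riesz_kernel \<alpha> (x - fst z))"
      by (rule force_continuous[OF \<alpha>0 F(4) F(5) F(6) dens(1) K0 dens(2)])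
    then have "continuous_on ({0..} \<times> UNIV) (\<lambda>p. c *\<^sub>R (case p of (t, x) \<Rightarrow> LINT z|lborel. F t z *\<^sub>R riesz_kernel \<alpha> (x - fst z)))"
      by (intro continuous_on_scaleR continuous_on_const)
    then show ?thesis by (rule continuous_on_eq) (auto simp: dens(3))
  qed
  have Ect: "continuous_on UNIV (E t)" if "0 \<le> t" for t
  proof -
    have "continuous_on UNIV (\<lambda>x. (t, x))" by (intro continuous_intros)
    from continuous_on_compose2[OF Ec this] show ?thesis using that by (simp add: image_subset_iff)
  qed
  have E1: "norm (E t x) \<le> D t (1 + \<alpha>)" if "0 \<le> t" for t x by (rule AE_continuous_le[OF Linf_E Ect]) (use that in auto)
  have E2: "norm (E t x - E t y) \<le> 3 * D t (2 + \<alpha>) * norm (x - y)" if t: "0 \<le> t" for t x y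
  proof -
    obtain g where g: "\<And>b. b \<in> Basis \<Longrightarrow> has_weak_derivative {#b#} (E t) (g b)"
      "\<And>b. b \<in> Basis \<Longrightarrow> AE x in lebesgue. norm (g b x) \<le> D t (2 + \<alpha>)" using weak_E[OF t] by blast
    from continuous_gradient_bound_lipschitz[OF Ect[OF t] D0 g] show ?thesis by simp
  qed
  let ?\<epsilon> = "48 * C * \<eta>"
  have d1: "norm (E t x) \<le> ?\<epsilon> * (1 + t) powr (- (1 + \<alpha>))" if t: "0 \<le> t" for t x
    using E1[OF t, of x] Dle(2)[OF t, of "1 + \<alpha>"] D0[of t "1 + \<alpha>"] \<alpha> by simp
  have d2: "norm (E t x - E t y) \<le> ?\<epsilon> * (1 + t) powr (- (2 + \<alpha>)) * norm (x - y)" if t: "0 \<le> t" for t x y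
    using Dle(2)[OF t, of "2 + \<alpha>"] \<alpha> by (intro order_trans[OF E2[OF t]] mult_right_mono) auto
  have le1: "?\<epsilon> * (1 + t) powr (- p) \<le> ?\<epsilon>" if "0 \<le> t" "0 \<le> p" for t p
  proof -
    have "(1 + t) powr (- p) \<le> 1 powr (- p)" using that by (intro powr_mono2') auto
    then show ?thesis using C\<eta> by (simp add: mult_left_le)
  qed
  have cf: "char_flow E \<Phi> ?\<epsilon> ?\<epsilon>"
  proof (rule char_flow.intro[OF Ec])
    show "norm (E t x - E t y) \<le> ?\<epsilon> * norm (x - y)" if t: "0 \<le> t" for t x y
      using le1[OF t, of "2 + \<alpha>"] \<alpha> by (intro order_trans[OF d2[OF t]] mult_right_mono) auto
    show "norm (E t x) \<le> ?\<epsilon>" if t: "0 \<le> t" for t x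
      using le1[OF t, of "1 + \<alpha>"] \<alpha> by (intro order_trans[OF d1[OF t]]) auto
    show "characteristic_flow E \<Phi>" using flow by (simp only: E_def)
  qed (use C\<eta> in simp)
  interpret char_flow E \<Phi> ?\<epsilon> ?\<epsilon> by (rule cf)
  have tr: "F t (\<Phi> t z) = F 0 z" if t: "0 \<le> t" for t z
  proof (rule transport[OF F(2,3) _ t])
    fix \<phi> :: "real \<times> phase \<Rightarrow> real" assume \<phi>: "\<phi> \<in> test_functions ({0<..} \<times> UNIV)"
    show "(LINT t|lborel. LINT z|lborel. F t z * frechet_derivative \<phi> (at (t, z)) (1, snd z, E t (fst z))) = 0"
    proof (rule weak_formulation_representative[OF F(1) F(2) Ec \<phi>])
      show "(LINT t|lebesgue. LINT z|lebesgue. f t z * frechet_derivative \<phi> (at (t, z)) (1, snd z, E t (fst z))) = 0"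
        using sol \<phi> unfolding vlasov_riesz_solution_def E_def by blast
    qed
  qed

  let ?h = "\<lambda>(x, v). japanese_bracket x * f\<^sub>0 (x, v)"
  have \<eta>2: "ennreal \<eta> < ennreal (2 * \<eta>)" using \<eta> by (intro ennreal_lessI) auto
  have "W11_W1inf_norm ?h \<le> ennreal \<eta>" "mixed_W11_W1inf_norm ?h \<le> ennreal \<eta>"
    using init by (auto intro: order_trans[rotated])
  then have h: "W11_W1inf_norm ?h < ennreal (2 * \<eta>)" "mixed_W11_W1inf_norm ?h < ennreal (2 * \<eta>)"
    using \<eta>2 by order+
  obtain w where w: "AE x in lebesgue. ?h x = w x" "\<And>x. \<bar>w x\<bar> \<le> 2 * \<eta>"
    "\<And>x y. \<bar>w x - w y\<bar> \<le> real DIM(phase) * (2 * \<eta>) * norm (x - y)" "continuous_on UNIV w"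
    "(\<integral>\<^sup>+ x. ennreal \<bar>w x\<bar> \<partial>lborel) \<le> ennreal (2 * \<eta>)"
    by (rule W11_W1inf_lipschitz[OF h(1)]) blast
  have hnn: "0 \<le> ?h z" for z using f0 japanese_bracket_ge(1)[of "fst z"] by (auto simp: case_prod_beta)
  have "AE z in lebesgue. w z = \<bar>w z\<bar>" using w(1)
  proof eventually_elim
    case (elim z)
    show ?case using hnn[of z] unfolding elim by simp
  qed
  then have "w = (\<lambda>z. \<bar>w z\<bar>)" by (rule AE_continuous_eq) (intro continuous_intros w(4))+
  then have w0: "0 \<le> w z" for z by (metis abs_ge_zero)
  have f0w: "AE z in lebesgue. f\<^sub>0 z = w z / japanese_bracket (fst z)"
    using w(1)
  proof eventually_elim
    case (elim z)
    have "japanese_bracket (fst z) \<noteq> 0" using japanese_bracket_ge(1)[of "fst z"] by auto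
    then show ?case using elim by (simp add: case_prod_beta elim[symmetric])
  qed
  have jc: "continuous_on UNIV (\<lambda>z::phase. w z / japanese_bracket (fst z))"
  proof (intro continuous_on_divide w(4) ballI)
    show "continuous_on UNIV (\<lambda>z::phase. japanese_bracket (fst z))"
      by (intro continuous_on_compose2[OF japanese_bracket_continuous] continuous_intros) auto
    show "japanese_bracket (fst z) \<noteq> 0" for z :: phase using japanese_bracket_ge(1)[of "fst z"] by linarith
  qed
  \<comment> \<open>Initial data, solution at time 0 and the weighted representative agree only
    almost everywhere; continuity makes them agree at every point, as transport along single
    trajectories requires.\<close>
  have F0: "F 0 = (\<lambda>z. w z / japanese_bracket (fst z))"
  proof (rule AE_continuous_eq[OF _ _ jc])
    have "AE z in lebesgue. f 0 z = f\<^sub>0 z" using sol by (simp add: vlasov_riesz_solution_def)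
    with f0w F(1)[OF order_refl] show "AE z in lebesgue. F 0 z = w z / japanese_bracket (fst z)" by eventually_elim simp
    have "continuous_on UNIV (\<lambda>z::phase. (0::real, z))" by (intro continuous_intros)
    from continuous_on_compose2[OF F(2) this] show "continuous_on UNIV (F 0)" by (simp add: image_subset_iff)
  qed
  have m12: "ennreal (2 * \<eta>) \<le> ennreal (12 * \<eta>)" using \<eta> by (intro ennreal_leI) simp
  \<comment> \<open>12 = 6 * 2: the dimension of phase space in the Lipschitz constant times the
    factor that makes the norm bound strict. The force formula follows by transporting the integral
    with the measure preserving flow.\<close>
  have "vlasov_decay E \<Phi> ?\<epsilon> ?\<epsilon> \<alpha> ?\<epsilon> (12 * \<eta>) lam w"
  proof (rule vlasov_decay.intro[OF cf], rule vlasov_decay_axioms.intro)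
    show "w z \<le> 12 * \<eta>" for z using w(2)[of z] \<eta> by simp
    show "\<bar>w z - w z'\<bar> \<le> 12 * \<eta> * norm (z - z')" for z z' using w(3)[of z z'] by simp
    have "(\<integral>\<^sup>+ z. ennreal (w z) \<partial>lborel) \<le> ennreal (2 * \<eta>)" using w(5) by (simp only: abs_of_nonneg[OF w0])
    then show "(\<integral>\<^sup>+ z. ennreal (w z) \<partial>lborel) \<le> ennreal (12 * \<eta>)" using m12 by (rule order_trans)
    show "(\<integral>\<^sup>+ x. (SUP v. ennreal (w (x, v))) \<partial>lborel) \<le> ennreal (12 * \<eta>)"
      using mixed_norm_bound[OF h(2) w(1) w(4) w0] m12 by (rule order_trans)
    show "E t x = (lam * \<alpha>) *\<^sub>R (LINT z|lborel. (w z / japanese_bracket (fst z)) *\<^sub>R riesz_kernel \<alpha> (x - fst (\<Phi> t z)))"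
      if t: "0 \<le> t" for t x
    proof -
      let ?k = "\<lambda>z. F t z *\<^sub>R riesz_kernel \<alpha> (x - fst z)"
      have k: "?k \<in> borel_measurable borel" using dens(2)[OF t, of x] by auto
      have "(LINT z|lborel. ?k z) = (LINT z|distr lborel borel (\<Phi> t). ?k z)" by (simp only: flow_measure_preserving[OF t])
      also have "\<dots> = (LINT z|lborel. ?k (\<Phi> t z))" using flow_measurable[OF t] k by (intro integral_distr) auto
      finally show ?thesis unfolding dens(3)[OF t] c_def tr[OF t] F0 by simp
    qed
  qed (use \<alpha> C\<eta> small \<eta> lam w0 d1 d2 in auto)
  moreover have "F t (\<Phi> t z) = w z / japanese_bracket (fst z)" if "0 \<le> t" for t z using tr[OF that] by (simp add: F0)
  ultimately show ?thesis using that[of w F] F(1) f0w unfolding E_def by blast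
qed

theorem theorem1p1:
  fixes \<alpha> :: real
  assumes "1/2 < \<alpha>" and "\<alpha> < 1"
  shows "\<exists>\<eta>>0. \<exists>C>0. \<forall>lam\<in>{1, -1}. \<forall>f\<^sub>0 f \<Phi>.
    (\<forall>z. 0 \<le> f\<^sub>0 z) \<longrightarrow>
    W11_W1inf_norm (\<lambda>(x, v). japanese_bracket x * f\<^sub>0 (x, v))
      + mixed_W11_W1inf_norm (\<lambda>(x, v). japanese_bracket x * f\<^sub>0 (x, v)) \<le> ennreal \<eta> \<longrightarrow>
    vlasov_riesz_solution lam \<alpha> f\<^sub>0 f \<longrightarrow>
    (SUP t\<in>{0::real..}.
        ennreal (japanese_bracket t powr (1 + \<alpha>))
          * Linf lebesgue (\<lambda>x. ennreal (norm (force_field lam \<alpha> f t x)))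
      + ennreal (japanese_bracket t powr (2 + \<alpha>)) * nabla_Linf_norm 1 (force_field lam \<alpha> f t)
      + ennreal (japanese_bracket t ^ 3) * nabla_Linf_norm 2 (force_field lam \<alpha> f t))
      \<le> ennreal (C * \<eta>) \<longrightarrow>
    characteristic_flow (force_field lam \<alpha> f) \<Phi> \<longrightarrow>
    (\<exists>f_plus :: phase \<Rightarrow> real.
       f_plus \<in> borel_measurable lebesgue \<and>
       L1 lebesgue (\<lambda>z. ennreal \<bar>f_plus z\<bar>) < \<infinity> \<and>
       Linf lebesgue (\<lambda>z. ennreal \<bar>f_plus z\<bar>) < \<infinity> \<and>
       (\<forall>t\<ge>1. Linf lebesgue (\<lambda>z. ennreal
          \<bar>f t (reference_flow \<alpha> (velocity_correction lam \<alpha> f\<^sub>0 \<Phi>) t z) - f_plus z\<bar>)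
          \<le> ennreal (C * (\<eta>\<^sup>2 / t powr (2 * \<alpha> - 1)))))"
proof -
  \<comment> \<open>144 is the square of the 12 in the bound 12 \<eta> for the weighted density;
    adding 1 keeps \<open>C\<close> positive.\<close>
  define C where "C = 144 * scattering_const \<alpha> + 1"
  have sc: "0 \<le> scattering_const \<alpha>"
    using assms kernel_const_pos[of "\<alpha> + 2"] kernel_const_pos[of "\<alpha> + 1"] by (simp add: scattering_const_def)
  have C: "0 < C" using sc by (simp add: C_def)
  define b where "b = 5 + 2 / (1 - \<alpha>)"
  have b: "0 < b" using assms by (simp add: b_def add_pos_nonneg)
  \<comment> \<open>Chosen after \<open>C\<close> so that 48 C \<eta> b equals 1/2, the smallness
    that the flow estimates need.\<close>
  define \<eta> where "\<eta> = 1 / (96 * C * b)"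
  have \<eta>: "0 < \<eta>" using C b by (simp add: \<eta>_def)
  have small: "48 * C * \<eta> * b \<le> 1 / 2" using C b by (simp add: \<eta>_def)
  show ?thesis
  proof (rule exI[of _ \<eta>], intro conjI \<eta>, rule exI[of _ C], intro conjI C ballI allI impI)
    fix lam :: real and f\<^sub>0 :: "phase \<Rightarrow> real" and f \<Phi>
    assume lam: "lam \<in> {1, - 1}" and f0: "\<forall>z. 0 \<le> f\<^sub>0 z"
      and init: "W11_W1inf_norm (\<lambda>(x, v). japanese_bracket x * f\<^sub>0 (x, v))
        + mixed_W11_W1inf_norm (\<lambda>(x, v). japanese_bracket x * f\<^sub>0 (x, v)) \<le> ennreal \<eta>"
      and sol: "vlasov_riesz_solution lam \<alpha> f\<^sub>0 f"
      and decay: "(SUP t\<in>{0::real..}.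
          ennreal (japanese_bracket t powr (1 + \<alpha>))
            * Linf lebesgue (\<lambda>x. ennreal (norm (force_field lam \<alpha> f t x)))
        + ennreal (japanese_bracket t powr (2 + \<alpha>)) * nabla_Linf_norm 1 (force_field lam \<alpha> f t)
        + ennreal (japanese_bracket t ^ 3) * nabla_Linf_norm 2 (force_field lam \<alpha> f t))
        \<le> ennreal (C * \<eta>)"
      and flow: "characteristic_flow (force_field lam \<alpha> f) \<Phi>"
    obtain F g where vd: "vlasov_decay (force_field lam \<alpha> f) \<Phi> (48 * C * \<eta>) (48 * C * \<eta>) \<alpha> (48 * C * \<eta>) (12 * \<eta>) lam g"
      and F: "\<And>t. 0 \<le> t \<Longrightarrow> AE z in lebesgue. f t z = F t z"
      and tr: "\<And>t z. 0 \<le> t \<Longrightarrow> F t (\<Phi> t z) = g z / japanese_bracket (fst z)"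
      and f0g: "AE z in lebesgue. f\<^sub>0 z = g z / japanese_bracket (fst z)"
      by (rule vlasov_riesz_decay[OF assms \<eta> C small[unfolded b_def] lam _ init sol decay flow]) (use f0 in auto)
    interpret vlasov_decay "force_field lam \<alpha> f" \<Phi> "48 * C * \<eta>" "48 * C * \<eta>" \<alpha> "48 * C * \<eta>" "12 * \<eta>" lam g by (rule vd)
    have A: "velocity_correction lam \<alpha> f\<^sub>0 \<Phi> = A_inf" by (rule ext) (rule velocity_correction_eq[OF f0g])
    note R = reference_flow_preserving[OF A_inf_measurable, of \<alpha>]
    obtain f_plus where fm: "f_plus \<in> borel_measurable borel" and f0': "\<And>\<zeta>. 0 \<le> f_plus \<zeta>" and f1: "\<And>\<zeta>. f_plus \<zeta> \<le> 12 * \<eta>"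
      and fL1: "(\<integral>\<^sup>+ \<zeta>. ennreal (f_plus \<zeta>) \<partial>lborel) \<le> ennreal (12 * \<eta>)"
      and rate: "\<And>t z \<zeta>. 1 \<le> t \<Longrightarrow> \<Phi> t z = reference_flow \<alpha> A_inf t \<zeta> \<Longrightarrow>
        \<bar>f0 z - f_plus \<zeta>\<bar> \<le> scattering_const \<alpha> * (12 * \<eta>)\<^sup>2 * t powr (1 - 2 * \<alpha>)"
      by (rule scattering_limit) blast
    have fml: "f_plus \<in> borel_measurable lebesgue" using fm by (intro measurable_completion) simp
    show "\<exists>f_plus :: phase \<Rightarrow> real. f_plus \<in> borel_measurable lebesgue \<and>
       L1 lebesgue (\<lambda>z. ennreal \<bar>f_plus z\<bar>) < \<infinity> \<and>
       Linf lebesgue (\<lambda>z. ennreal \<bar>f_plus z\<bar>) < \<infinity> \<and>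
       (\<forall>t\<ge>1. Linf lebesgue (\<lambda>z. ennreal
          \<bar>f t (reference_flow \<alpha> (velocity_correction lam \<alpha> f\<^sub>0 \<Phi>) t z) - f_plus z\<bar>)
          \<le> ennreal (C * (\<eta>\<^sup>2 / t powr (2 * \<alpha> - 1))))"
    proof (intro exI[of _ f_plus] conjI fml allI impI)
      show "L1 lebesgue (\<lambda>z. ennreal \<bar>f_plus z\<bar>) < \<infinity>"
        using fL1 fml by (auto simp: L1_def abs_of_nonneg[OF f0'] nn_integral_completion intro: order.strict_trans1)
      have "Linf lebesgue (\<lambda>z. ennreal \<bar>f_plus z\<bar>) \<le> ennreal (12 * \<eta>)"
        unfolding Linf_def using fml f0' f1 by (intro esssup_I) (auto intro!: ennreal_leI)
      then show "Linf lebesgue (\<lambda>z. ennreal \<bar>f_plus z\<bar>) < \<infinity>" by (auto intro: order.strict_trans1)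
      fix t :: real assume t: "1 \<le> t"
      then have t0: "0 \<le> t" by simp
      let ?R = "reference_flow \<alpha> A_inf t"
      \<comment> \<open>The solution equals its representative only off a null set. As the reference
        flow preserves measure, the preimage of this set is null as well, and f may be replaced by F
        along the reference flow.\<close>
      have "AE w in distr lborel borel ?R. f t w = F t w" using F[OF t0] unfolding R(2) AE_lebesgue_iff .
      then have ae: "AE z in lborel. f t (?R z) = F t (?R z)" by (rule AE_distrD[rotated]) (use R(1) in simp)
      have FR: "F t (?R z) = f0 (inv (\<Phi> t) (?R z))" for z
        using tr[OF t0, of "inv (\<Phi> t) (?R z)"] by (simp add: surj_f_inv_f[OF flow_surj[OF t0]])
      have m1: "(\<lambda>z. f0 (inv (\<Phi> t) (?R z))) \<in> borel_measurable borel"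
        by (rule measurable_compose[OF measurable_compose[OF R(1) flow_inv_measurable[OF t0]] f0_measurable])
      have m: "(\<lambda>z. \<bar>f0 (inv (\<Phi> t) (?R z)) - f_plus z\<bar>) \<in> borel_measurable borel"
        by (intro borel_measurable_abs borel_measurable_diff m1 fm)
      have ae': "AE z in lebesgue. \<bar>f0 (inv (\<Phi> t) (?R z)) - f_plus z\<bar> = \<bar>f t (?R z) - f_plus z\<bar>"
        unfolding AE_lebesgue_iff using ae by eventually_elim (simp only: FR)
      have meas: "(\<lambda>z. \<bar>f t (?R z) - f_plus z\<bar>) \<in> borel_measurable lebesgue"
        by (rule borel_measurable_AE[OF _ ae']) (use m in \<open>intro measurable_completion, simp\<close>)
      have le: "\<bar>f0 (inv (\<Phi> t) (?R z)) - f_plus z\<bar> \<le> C * (\<eta>\<^sup>2 / t powr (2 * \<alpha> - 1))" for z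
      proof -
        have "\<bar>f0 (inv (\<Phi> t) (?R z)) - f_plus z\<bar> \<le> scattering_const \<alpha> * (12 * \<eta>)\<^sup>2 * t powr (1 - 2 * \<alpha>)"
          by (rule rate[OF t surj_f_inv_f[OF flow_surj[OF t0]]])
        also have "t powr (1 - 2 * \<alpha>) = 1 / t powr (2 * \<alpha> - 1)" using powr_minus_divide[of t "2 * \<alpha> - 1"] by simp
        also have "scattering_const \<alpha> * (12 * \<eta>)\<^sup>2 * (1 / t powr (2 * \<alpha> - 1)) = (144 * scattering_const \<alpha>) * (\<eta>\<^sup>2 / t powr (2 * \<alpha> - 1))"
          by (simp add: power_mult_distrib)
        also have "\<dots> \<le> C * (\<eta>\<^sup>2 / t powr (2 * \<alpha> - 1))" by (rule mult_right_mono) (simp_all add: C_def)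
        finally show ?thesis .
      qed
      show "Linf lebesgue (\<lambda>z. ennreal \<bar>f t (reference_flow \<alpha> (velocity_correction lam \<alpha> f\<^sub>0 \<Phi>) t z) - f_plus z\<bar>)
          \<le> ennreal (C * (\<eta>\<^sup>2 / t powr (2 * \<alpha> - 1)))"
        unfolding A Linf_def
      proof (rule esssup_I)
        show "(\<lambda>z. ennreal \<bar>f t (?R z) - f_plus z\<bar>) \<in> borel_measurable lebesgue" using meas by simp
        show "AE z in lebesgue. ennreal \<bar>f t (?R z) - f_plus z\<bar> \<le> ennreal (C * (\<eta>\<^sup>2 / t powr (2 * \<alpha> - 1)))"
          using ae'
        proof eventually_elim
          case (elim z)
          show ?case unfolding elim[symmetric] by (rule ennreal_leI[OF le])
        qed
      qed
    qed
  qed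
qed

end
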